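(* Assume that $(X,d,T)$ has the $g$-almost product property and the uniform separation property, and let $\varphi\in C(X,\mathbb{R})$. Fix $S_1\subset\Xi(M(X,T))$ and $S_2\subset Y$. (1) If $S_1=\emptyset$, then $$P(\Delta(S_1,S_2),\varphi)=\sup_{x\in S_2}\Lambda(x,\varphi).$$ (2) If $S_1\ne\emptyset$ and the closed convex hull $\overline{co}(S_1)$ of $S_1$ is contained in a connected component of $S_2$, then $$P(\Delta(S_1,S_2),\varphi)=\inf_{x\in S_1}\Lambda(x,\varphi).$$ (3) If $S_1\ne\emptyset$ and $S_1$ is not contained in a connected component of $S_2$, then $\{x\in X:S_1\subset A(\Xi L_nx)\subset S_2\}=\emptyset$.
   Context: Setting. $(X,d)$ is a compact metric space and $T:X\to X$ is continuous. $M(X)$ is the set of Borel probability measures on $X$ with the weak* topology, $M(X,T)$ the subset of $T$-invariant ones, and $h(T,\mu)$ the metric (measure-theoretic) entropy. Fix a countable dense subset $\{f_1,f_2,\dots\}$ of $C(X,[0,1])$ and metrize $M(X)$ by $\rho(\mu,\nu)=\sum_{k\ge1}2^{-k}|\int f_k\,d\mu-\int f_k\,d\nu|$; the metric on $X$ is taken to be $d(x,y)=\rho(\delta_x,\delta_y)$ (equivalent to the original one). The $n$-th empirical measure is $L_nx=\frac1n\sum_{k=0}^{n-1}\delta_{T^kx}$. $Y$ is a real vector space with a metric $d'$ that is linearly compatible: $d'(x_1+x_2,y_1+y_2)\le d'(x_1,y_1)+d'(x_2,y_2)$ and $d'(\lambda x,\lambda y)\le|\lambda|d'(x,y)$ for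 all vectors in $Y$ and $\lambda\in\mathbb{R}$. $\Xi:M(X)\to Y$ is continuous and affine. $A(x_n)$ denotes the set of accumulation points (limits of subsequences) of a sequence $(x_n)$; $A(\Xi L_nx)$ is that of $(\Xi L_nx)_{n\ge1}$. $\Delta(S_1,S_2)=\{x\in X:S_1\subset A(\Xi L_nx)\subset S_2\}$. For $y\in Y$, $\Lambda(y,\varphi)=\sup\{h(T,\mu)+\int\varphi\,d\mu:\mu\in M(X,T),\ \Xi\mu=y\}$ if $y\in\Xi(M(X,T))$, and $\Lambda(y,\varphi)=-\infty$ otherwise. Conventions: $\sup\emptyset=-\infty$; the definition of pressure below gives $P(\emptyset,\varphi)=-\infty$. $g$-almost product property: A blow-up function is a nondecreasing unbounded map $g:\mathbb{N}\to\mathbb{N}$ with $g(n)<n$ (for $n\ge1$; the value $0$ is allowed) and $g(n)/n\to0$. Let $\Lambda_n=\{0,\dots,n-1\}$ and $B_n(g;x,\epsilon)=\{y\in X:\exists\Lambda\subset\Lambda_n,\ \#(\Lambda_n\setminus\Lambda)\le g(n),\ \max\{d(T^jx,T^jy):j\in\Lambda\}\le\epsilon\}$. $(X,d,T)$ has the $g$-almost product property (with blow-up function $g$) if there is a nonincreasing $m:\mathbb{R}^+\to\mathbb{N}$ such that for all $k\ge1$, $x_1,\dots,x_k\in X$, $\epsilon_1,\dots,\epsilon_k>0$ and integers $n_j\ge m(\epsilon_j)$ ($n_j\geq 1$), $\bigcap_{j=1}^kT^{-M_{j-1}}B_{n_j}(g;x_j,\epsilon_j)\ne\emptyset$, where $M_0=0$,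 $M_i=n_1+\cdots+n_i$. Uniform separation property: Points $x,y$ are $(\delta,n,\epsilon)$-separated if $\#\{0\le j\le n-1:d(T^jx,T^jy)>\epsilon\}\ge\delta n$; a set is $(\delta,n,\epsilon)$-separated if any two distinct points of it are. For $F\subset M(X)$, $X_{n,F}=\{x:L_nx\in F\}$ and $N(F;\delta,n,\epsilon)$ is the maximal cardinality of a $(\delta,n,\epsilon)$-separated subset of $X_{n,F}$. The property holds if for every $\eta>0$ there are $\delta^*>0,\epsilon^*>0$ such that for every ergodic $\mu\in M(X,T)$ and every neighborhood $F\subset M(X)$ of $\mu$ there is $n^*_{F,\mu,\eta}$ with $N(F;\delta^*,n,\epsilon^* )\ge\exp(n(h(T,\mu)-\eta))$ for all $n\ge n^*_{F,\mu,\eta}$. Topological pressure of an arbitrary set $Z\subset X$: $B_n(x,\epsilon)=\{y:\max_{0\le i\le n-1}d(T^ix,T^iy)\le\epsilon\}$, $S_n\varphi=\sum_{i=0}^{n-1}\varphi\circ T^i$, $\Gamma_n(Z,\epsilon)$ is the collection of finite or countable covers of $Z$ by sets $B_m(x,\epsilon)$ with $m\ge n$; $M(Z,t,\varphi,n,\epsilon)=\inf_{\mathcal{C}\in\Gamma_n(Z,\epsilon)}\sum_{B_m(x,\epsilon)\in\mathcal{C}}\exp(-tm+\sup_{y\in B_m(x,\epsilon)}S_m\varphi(y))$, $M(Z,t,\varphi,\epsilon)=\lim_{n\to\infty}M(Z,t,\varphi,n,\epsilon)$, $P(Z,\varphi,\epsilon)=\inf\{t:M(Z,t,\varphi,\epsilon)=0\}=\sup\{t:M(Z,t,\varphi,\epsilon)=\infty\}$,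 $P(Z,\varphi)=\lim_{\epsilon\to0}P(Z,\varphi,\epsilon)$. *)

theory Defs
  imports "HOL-Probability.Probability"
begin

section \<open>Spaces of measures\<close>

text \<open>The compact metric space \<open>X\<close> is a type \<open>'a\<close> of class \<^class>\<open>metric_space\<close>; its class
  metric only supplies the topology (and the Borel sets). All dynamical notions below take an explicit
  metric \<open>d\<close>, to be instantiated with \<open>rho_dist f\<close>.\<close>

definition prob_measures :: "'a::topological_space measure set" where
  "prob_measures = {\<mu>. sets \<mu> = sets borel \<and> prob_space \<mu>}"

text \<open>Coarsest topology on \<^term>\<open>prob_measures\<close> making \<open>\<mu> \<mapsto> \<integral>h d\<mu>\<close> continuous
  for every \<open>h \<in> C(X,\<real>)\<close>.\<close>

definition weak_star :: "'a::topological_space measure topology" where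
  "weak_star = topology_generated_by
     {{\<mu> \<in> prob_measures. (\<integral>x. h x \<partial>\<mu>) \<in> U} | (h :: 'a \<Rightarrow> real) U. continuous_on UNIV h \<and> open U}"

definition weak_star_nhd :: "'a::topological_space measure \<Rightarrow> 'a measure set \<Rightarrow> bool" where
  "weak_star_nhd \<mu> F \<longleftrightarrow> F \<subseteq> prob_measures \<and> (\<exists>U. openin weak_star U \<and> \<mu> \<in> U \<and> U \<subseteq> F)"

definition invariant_measures :: "('a::topological_space \<Rightarrow> 'a) \<Rightarrow> 'a measure set" where
  "invariant_measures T = {\<mu> \<in> prob_measures. distr \<mu> borel T = \<mu>}"

definition ergodic_measures :: "('a::topological_space \<Rightarrow> 'a) \<Rightarrow> 'a measure set" where
  "ergodic_measures T = {\<mu> \<in> invariant_measures T.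
     \<forall>A\<in>sets borel. T -` A = A \<longrightarrow> measure \<mu> A = 0 \<or> measure \<mu> A = 1}"

text \<open>The convex combination \<open>s\<mu> + (1-s)\<nu>\<close>, for \<open>0 \<le> s \<le> 1\<close>.\<close>

definition mix :: "real \<Rightarrow> 'a::topological_space measure \<Rightarrow> 'a measure \<Rightarrow> 'a measure" where
  "mix s \<mu> \<nu> = measure_of UNIV (sets borel)
     (\<lambda>A. ennreal s * emeasure \<mu> A + ennreal (1 - s) * emeasure \<nu> A)"

definition affine_on_measures :: "('a::topological_space measure \<Rightarrow> 'y::real_vector) \<Rightarrow> bool" where
  "affine_on_measures \<Xi> \<longleftrightarrow> (\<forall>\<mu>\<in>prob_measures. \<forall>\<nu>\<in>prob_measures. \<forall>s. 0 \<le> s \<and> s \<le> 1 \<longrightarrow>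
     \<Xi> (mix s \<mu> \<nu>) = s *\<^sub>R \<Xi> \<mu> + (1 - s) *\<^sub>R \<Xi> \<nu>)"

text \<open>The empirical measure \<open>L\<^sub>n x\<close>; a probability measure for \<open>n \<ge> 1\<close>, the zero measure for \<open>n = 0\<close>.\<close>

definition empirical :: "('a::topological_space \<Rightarrow> 'a) \<Rightarrow> nat \<Rightarrow> 'a \<Rightarrow> 'a measure" where
  "empirical T n x = measure_of UNIV (sets borel)
     (\<lambda>A. ennreal (1 / real n) * (\<Sum>k<n. emeasure (return borel ((T ^^ k) x)) A))"

text \<open>The family \<open>f\<^sub>1, f\<^sub>2, \<dots>\<close> of the mathematical text is indexed from \<open>0\<close>.\<close>

definition dense_in_C01 :: "(nat \<Rightarrow> ('a::topological_space \<Rightarrow>\<^sub>C real)) \<Rightarrow> bool" where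
  "dense_in_C01 f \<longleftrightarrow>
     (let C01 = {h. \<forall>x. apply_bcontfun h x \<in> {0..1}} in range f \<subseteq> C01 \<and> C01 \<subseteq> closure (range f))"

definition rho :: "(nat \<Rightarrow> ('a::topological_space \<Rightarrow>\<^sub>C real)) \<Rightarrow> 'a measure \<Rightarrow> 'a measure \<Rightarrow> real" where
  "rho f \<mu> \<nu> = (\<Sum>k. (1/2) ^ Suc k * \<bar>(\<integral>x. f k x \<partial>\<mu>) - (\<integral>x. f k x \<partial>\<nu>)\<bar>)"

definition rho_dist :: "(nat \<Rightarrow> ('a::topological_space \<Rightarrow>\<^sub>C real)) \<Rightarrow> 'a \<Rightarrow> 'a \<Rightarrow> real" where
  "rho_dist f x y = rho f (return borel x) (return borel y)"

section \<open>Measure-theoretic entropy\<close>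

definition partition_entropy :: "'a measure \<Rightarrow> 'a set set \<Rightarrow> real" where
  "partition_entropy \<mu> P = - (\<Sum>A\<in>P. measure \<mu> A * ln (measure \<mu> A))"

definition finite_partition :: "'a::topological_space set set \<Rightarrow> bool" where
  "finite_partition P \<longleftrightarrow> finite P \<and> P \<subseteq> sets borel \<and> partition_on UNIV P"

text \<open>The join \<open>P \<or> T\<^sup>-\<^sup>1P \<or> \<dots> \<or> T\<^sup>-\<^sup>(\<^sup>n\<^sup>-\<^sup>1\<^sup>)P\<close>. It may contain the empty set, which contributes
  \<open>0\<close> to the entropy since \<^term>\<open>ln 0 = (0::real)\<close>.\<close>

definition iterated_join :: "('a \<Rightarrow> 'a) \<Rightarrow> 'a set set \<Rightarrow> nat \<Rightarrow> 'a set set" where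
  "iterated_join T P n = {(\<Inter>i<n. (T ^^ i) -` A i) | A. \<forall>i<n. A i \<in> P}"

definition metric_entropy :: "('a::topological_space \<Rightarrow> 'a) \<Rightarrow> 'a measure \<Rightarrow> ereal" where
  "metric_entropy T \<mu> = (SUP P\<in>{P. finite_partition P}.
     ereal (lim (\<lambda>n. partition_entropy \<mu> (iterated_join T P n) / real n)))"

section \<open>The g-almost product property\<close>

definition blowup_function :: "(nat \<Rightarrow> nat) \<Rightarrow> bool" where
  "blowup_function g \<longleftrightarrow> mono_on {1..} g \<and> \<not> bdd_above (g ` {1..}) \<and> (\<forall>n\<ge>1. g n < n)
     \<and> (\<lambda>n. real (g n) / real n) \<longlonglongrightarrow> 0"

definition blowup_ball ::
    "('a \<Rightarrow> 'a \<Rightarrow> real) \<Rightarrow> ('a \<Rightarrow> 'a) \<Rightarrow> (nat \<Rightarrow> nat) \<Rightarrow> nat \<Rightarrow> 'a \<Rightarrow> real \<Rightarrow> 'a set" where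
  "blowup_ball d T g n x \<epsilon> = {y. \<exists>L. L \<subseteq> {..<n} \<and> card ({..<n} - L) \<le> g n
     \<and> (\<forall>j\<in>L. d ((T ^^ j) x) ((T ^^ j) y) \<le> \<epsilon>)}"

text \<open>The tuples are indexed by \<open>0, \<dots>, k-1\<close> instead of \<open>1, \<dots>, k\<close>, so that the \<open>j\<close>-th shift
  \<open>n\<^sub>1 + \<dots> + n\<^bsub>j-1\<^esub>\<close> of the mathematical text becomes \<open>\<Sum>i<j. n i\<close>.\<close>

definition almost_product_property ::
    "('a \<Rightarrow> 'a \<Rightarrow> real) \<Rightarrow> ('a \<Rightarrow> 'a) \<Rightarrow> (nat \<Rightarrow> nat) \<Rightarrow> bool" where
  "almost_product_property d T g \<longleftrightarrow> (\<exists>m :: real \<Rightarrow> nat. antimono_on {0<..} m \<and>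
     (\<forall>k\<ge>1. \<forall>(x :: nat \<Rightarrow> 'a) (\<epsilon> :: nat \<Rightarrow> real) (n :: nat \<Rightarrow> nat).
        (\<forall>j<k. 0 < \<epsilon> j \<and> 1 \<le> n j \<and> m (\<epsilon> j) \<le> n j) \<longrightarrow>
        (\<Inter>j<k. (T ^^ (\<Sum>i<j. n i)) -` blowup_ball d T g (n j) (x j) (\<epsilon> j)) \<noteq> {}))"

section \<open>The uniform separation property\<close>

definition separated_points ::
    "('a \<Rightarrow> 'a \<Rightarrow> real) \<Rightarrow> ('a \<Rightarrow> 'a) \<Rightarrow> real \<Rightarrow> nat \<Rightarrow> real \<Rightarrow> 'a \<Rightarrow> 'a \<Rightarrow> bool" where
  "separated_points d T \<delta> n \<epsilon> x y \<longleftrightarrow>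
     real (card {j. j < n \<and> d ((T ^^ j) x) ((T ^^ j) y) > \<epsilon>}) \<ge> \<delta> * real n"

definition separated_set ::
    "('a \<Rightarrow> 'a \<Rightarrow> real) \<Rightarrow> ('a \<Rightarrow> 'a) \<Rightarrow> real \<Rightarrow> nat \<Rightarrow> real \<Rightarrow> 'a set \<Rightarrow> bool" where
  "separated_set d T \<delta> n \<epsilon> E \<longleftrightarrow> (\<forall>x\<in>E. \<forall>y\<in>E. x \<noteq> y \<longrightarrow> separated_points d T \<delta> n \<epsilon> x y)"

text \<open>A subset of a separated set is separated, so restricting to finite \<open>E\<close> only avoids the
  convention that infinite sets have \<^const>\<open>card\<close> \<open>0\<close>.\<close>

definition max_separated :: "('a::topological_space \<Rightarrow> 'a \<Rightarrow> real) \<Rightarrow> ('a \<Rightarrow> 'a) \<Rightarrow>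
    'a measure set \<Rightarrow> real \<Rightarrow> nat \<Rightarrow> real \<Rightarrow> enat" where
  "max_separated d T F \<delta> n \<epsilon> = (SUP E\<in>{E. finite E \<and> E \<subseteq> {x. empirical T n x \<in> F}
     \<and> separated_set d T \<delta> n \<epsilon> E}. enat (card E))"

definition ereal_exp :: "ereal \<Rightarrow> ereal" where
  "ereal_exp z = (case z of ereal r \<Rightarrow> ereal (exp r) | PInfty \<Rightarrow> \<infinity> | MInfty \<Rightarrow> 0)"

definition uniform_separation_property ::
    "('a::topological_space \<Rightarrow> 'a \<Rightarrow> real) \<Rightarrow> ('a \<Rightarrow> 'a) \<Rightarrow> bool" where
  "uniform_separation_property d T \<longleftrightarrow> (\<forall>\<eta>>0. \<exists>\<delta>>0. \<exists>\<epsilon>>0.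
     \<forall>\<mu>\<in>ergodic_measures T. \<forall>F. weak_star_nhd \<mu> F \<longrightarrow> (\<exists>n0. \<forall>n\<ge>n0.
       ereal_of_enat (max_separated d T F \<delta> n \<epsilon>)
         \<ge> ereal_exp (ereal (real n) * (metric_entropy T \<mu> - ereal \<eta>))))"

section \<open>Topological pressure of an arbitrary set\<close>

definition bowen_ball ::
    "('a \<Rightarrow> 'a \<Rightarrow> real) \<Rightarrow> ('a \<Rightarrow> 'a) \<Rightarrow> nat \<Rightarrow> 'a \<Rightarrow> real \<Rightarrow> 'a set" where
  "bowen_ball d T n x \<epsilon> = {y. \<forall>i<n. d ((T ^^ i) x) ((T ^^ i) y) \<le> \<epsilon>}"

definition birkhoff_sum :: "('a \<Rightarrow> 'a) \<Rightarrow> nat \<Rightarrow> ('a \<Rightarrow> real) \<Rightarrow> 'a \<Rightarrow> real" where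
  "birkhoff_sum T n \<phi> x = (\<Sum>i<n. \<phi> ((T ^^ i) x))"

text \<open>A cover by balls \<open>B\<^sub>m(x,\<epsilon>)\<close> is represented by the countable set of its index pairs \<open>(m, x)\<close>,
  because the summands of the pressure depend on \<open>m\<close>.\<close>

definition ball_covers :: "('a \<Rightarrow> 'a \<Rightarrow> real) \<Rightarrow> ('a \<Rightarrow> 'a) \<Rightarrow> 'a set \<Rightarrow> nat \<Rightarrow> real \<Rightarrow>
    (nat \<times> 'a) set set" where
  "ball_covers d T Z n \<epsilon> = {C. countable C \<and> (\<forall>(m, x)\<in>C. n \<le> m)
     \<and> Z \<subseteq> (\<Union>(m, x)\<in>C. bowen_ball d T m x \<epsilon>)}"

definition pressure_sum :: "('a \<Rightarrow> 'a \<Rightarrow> real) \<Rightarrow> ('a \<Rightarrow> 'a) \<Rightarrow> 'a set \<Rightarrow> real \<Rightarrow> ('a \<Rightarrow> real) \<Rightarrow>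
    nat \<Rightarrow> real \<Rightarrow> ennreal" where
  "pressure_sum d T Z t \<phi> n \<epsilon> = (INF C\<in>ball_covers d T Z n \<epsilon>. \<Sum>\<^sub>\<infinity>(m, x)\<in>C.
     ennreal (exp (- t * real m + (SUP y\<in>bowen_ball d T m x \<epsilon>. birkhoff_sum T m \<phi> y))))"

definition pressure_lim :: "('a \<Rightarrow> 'a \<Rightarrow> real) \<Rightarrow> ('a \<Rightarrow> 'a) \<Rightarrow> 'a set \<Rightarrow> real \<Rightarrow> ('a \<Rightarrow> real) \<Rightarrow>
    real \<Rightarrow> ennreal" where
  "pressure_lim d T Z t \<phi> \<epsilon> = lim (\<lambda>n. pressure_sum d T Z t \<phi> n \<epsilon>)"

definition pressure_scale :: "('a \<Rightarrow> 'a \<Rightarrow> real) \<Rightarrow> ('a \<Rightarrow> 'a) \<Rightarrow> 'a set \<Rightarrow> ('a \<Rightarrow> real) \<Rightarrow>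
    real \<Rightarrow> ereal" where
  "pressure_scale d T Z \<phi> \<epsilon> = Inf (ereal ` {t. pressure_lim d T Z t \<phi> \<epsilon> = 0})"

definition pressure :: "('a \<Rightarrow> 'a \<Rightarrow> real) \<Rightarrow> ('a \<Rightarrow> 'a) \<Rightarrow> 'a set \<Rightarrow> ('a \<Rightarrow> real) \<Rightarrow> ereal" where
  "pressure d T Z \<phi> = Lim (at_right 0) (\<lambda>\<epsilon>. pressure_scale d T Z \<phi> \<epsilon>)"

section \<open>Accumulation sets and the conditional variational function\<close>

definition linearly_compatible :: "'y::{real_vector, metric_space} itself \<Rightarrow> bool" where
  "linearly_compatible _ \<longleftrightarrow>
     (\<forall>x1 x2 y1 y2 :: 'y. dist (x1 + x2) (y1 + y2) \<le> dist x1 y1 + dist x2 y2) \<and>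
     (\<forall>(c::real) (x::'y) y. dist (c *\<^sub>R x) (c *\<^sub>R y) \<le> \<bar>c\<bar> * dist x y)"

definition accumulation_points :: "(nat \<Rightarrow> 'y::topological_space) \<Rightarrow> 'y set" where
  "accumulation_points s = {y. \<exists>r. strict_mono r \<and> (s \<circ> r) \<longlonglongrightarrow> y}"

text \<open>The sequence of empirical measures starts at \<open>n = 1\<close>, whence \<^term>\<open>Suc n\<close>.\<close>

definition Delta_set :: "('a::topological_space \<Rightarrow> 'a) \<Rightarrow> ('a measure \<Rightarrow> 'y::topological_space) \<Rightarrow>
    'y set \<Rightarrow> 'y set \<Rightarrow> 'a set" where
  "Delta_set T \<Xi> S1 S2 = {x. S1 \<subseteq> accumulation_points (\<lambda>n. \<Xi> (empirical T (Suc n) x))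
     \<and> accumulation_points (\<lambda>n. \<Xi> (empirical T (Suc n) x)) \<subseteq> S2}"

definition Lambda_fun :: "('a::topological_space \<Rightarrow> 'a) \<Rightarrow> ('a measure \<Rightarrow> 'y) \<Rightarrow> ('a \<Rightarrow> real) \<Rightarrow>
    'y \<Rightarrow> ereal" where
  "Lambda_fun T \<Xi> \<phi> y = (if y \<in> \<Xi> ` invariant_measures T
     then (SUP \<mu>\<in>{\<mu> \<in> invariant_measures T. \<Xi> \<mu> = y}. metric_entropy T \<mu> + ereal (\<integral>x. \<phi> x \<partial>\<mu>))
     else -\<infinity>)"

section \<open>Well-definedness\<close>

lemma topspace_weak_star: "topspace weak_star = prob_measures"
proof -
  have "prob_measures \<in> {{\<mu> \<in> prob_measures. (\<integral>x. h x \<partial>\<mu>) \<in> U} |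
      (h :: 'a \<Rightarrow> real) U. continuous_on UNIV h \<and> open U}"
    by (rule CollectI, rule exI[of _ "\<lambda>_. 0"], rule exI[of _ UNIV]) auto
  then show ?thesis
    unfolding weak_star_def topology_generated_by_topspace by blast
qed

lemma emeasure_mix:
  assumes "\<mu> \<in> prob_measures" "\<nu> \<in> prob_measures" "A \<in> sets borel"
  shows "emeasure (mix s \<mu> \<nu>) A = ennreal s * emeasure \<mu> A + ennreal (1 - s) * emeasure \<nu> A"
  unfolding mix_def
proof (rule emeasure_measure_of_sigma)
  show "sigma_algebra UNIV (sets (borel :: 'a measure))"
    using sets.sigma_algebra_axioms[of "borel :: 'a measure"] by simp
  show "countably_additive (sets borel)
      (\<lambda>A. ennreal s * emeasure \<mu> A + ennreal (1 - s) * emeasure \<nu> A)"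
  proof (rule countably_additiveI)
    fix B :: "nat \<Rightarrow> 'a set"
    assume B: "range B \<subseteq> sets borel" "disjoint_family B"
    have "(\<Sum>i. emeasure \<mu> (B i)) = emeasure \<mu> (\<Union>i. B i)"
         "(\<Sum>i. emeasure \<nu> (B i)) = emeasure \<nu> (\<Union>i. B i)"
      using B assms by (auto intro!: suminf_emeasure simp: prob_measures_def)
    then show "(\<Sum>i. ennreal s * emeasure \<mu> (B i) + ennreal (1 - s) * emeasure \<nu> (B i)) =
        ennreal s * emeasure \<mu> (\<Union>i. B i) + ennreal (1 - s) * emeasure \<nu> (\<Union>i. B i)"
      by (simp add: suminf_add[symmetric])
  qed
qed (use assms in \<open>auto simp: positive_def\<close>)

lemma mix_in_prob_measures:
  assumes "\<mu> \<in> prob_measures" "\<nu> \<in> prob_measures" "0 \<le> s" "s \<le> 1"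
  shows "mix s \<mu> \<nu> \<in> prob_measures"
proof -
  have sp: "space \<mu> = UNIV" "space \<nu> = UNIV"
    using assms by (auto simp: prob_measures_def dest!: sets_eq_imp_space_eq)
  have sm: "space (mix s \<mu> \<nu>) = UNIV"
    by (simp add: mix_def)
  have "emeasure \<mu> UNIV = 1" "emeasure \<nu> UNIV = 1"
    using assms sp by (auto simp: prob_measures_def dest!: prob_space.emeasure_space_1)
  then have "emeasure (mix s \<mu> \<nu>) UNIV = 1"
    using assms by (simp add: emeasure_mix ennreal_plus[symmetric] del: ennreal_plus)
  moreover have "sets (mix s \<mu> \<nu>) = sets borel"
    unfolding mix_def using sets.sigma_sets_eq[of "borel :: 'a measure"] by simp
  ultimately show ?thesis
    by (simp add: prob_measures_def prob_space.intro prob_spaceI sm)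
qed

lemma emeasure_empirical:
  assumes "A \<in> sets borel"
  shows "emeasure (empirical T n x) A
    = ennreal (1 / real n) * (\<Sum>k<n. emeasure (return borel ((T ^^ k) x)) A)"
  unfolding empirical_def
proof (rule emeasure_measure_of_sigma)
  show "sigma_algebra UNIV (sets (borel :: 'a measure))"
    using sets.sigma_algebra_axioms[of "borel :: 'a measure"] by simp
  show "countably_additive (sets borel)
      (\<lambda>A. ennreal (1 / real n) * (\<Sum>k<n. emeasure (return borel ((T ^^ k) x)) A))"
  proof (rule countably_additiveI)
    fix B :: "nat \<Rightarrow> 'a set"
    assume B: "range B \<subseteq> sets borel" "disjoint_family B"
    have "(\<Sum>i. emeasure (return borel ((T ^^ k) x)) (B i))
        = emeasure (return borel ((T ^^ k) x)) (\<Union>i. B i)" for k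
      by (rule suminf_emeasure) (use B in auto)
    then show "(\<Sum>i. ennreal (1 / real n) * (\<Sum>k<n. emeasure (return borel ((T ^^ k) x)) (B i)))
        = ennreal (1 / real n) * (\<Sum>k<n. emeasure (return borel ((T ^^ k) x)) (\<Union>i. B i))"
      by (simp add: suminf_sum)
  qed
qed (use assms in \<open>auto simp: positive_def\<close>)

lemma empirical_in_prob_measures:
  assumes "n \<ge> 1"
  shows "empirical T n x \<in> prob_measures"
proof -
  have sm: "space (empirical T n x) = UNIV"
    by (simp add: empirical_def)
  have "emeasure (empirical T n x) UNIV = ennreal (1 / real n) * ennreal (real n)"
    by (simp add: emeasure_empirical ennreal_of_nat_eq_real_of_nat)
  also have "\<dots> = 1"
    using assms by (simp add: ennreal_mult[symmetric])
  finally have "emeasure (empirical T n x) UNIV = 1" .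
  moreover have "sets (empirical T n x) = sets borel"
    unfolding empirical_def using sets.sigma_sets_eq[of "borel :: 'a measure"] by simp
  ultimately show ?thesis
    by (simp add: prob_measures_def prob_spaceI sm)
qed

lemma incseq_pressure_sum: "incseq (\<lambda>n. pressure_sum d T Z t \<phi> n \<epsilon>)"
  unfolding pressure_sum_def
  by (intro incseq_SucI INF_superset_mono) (auto simp: ball_covers_def)

lemma pressure_sum_tendsto:
  "(\<lambda>n. pressure_sum d T Z t \<phi> n \<epsilon>) \<longlonglongrightarrow> pressure_lim d T Z t \<phi> \<epsilon>"
  using LIMSEQ_SUP[OF incseq_pressure_sum] unfolding pressure_lim_def
  by (metis limI)

lemma pressure_empty: "pressure d T {} \<phi> = -\<infinity>"
proof -
  have "pressure_sum d T {} t \<phi> n \<epsilon> = 0" for t n \<epsilon>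
  proof -
    have "{} \<in> ball_covers d T {} n \<epsilon>"
      by (simp add: ball_covers_def)
    then have "pressure_sum d T {} t \<phi> n \<epsilon> \<le> 0"
      unfolding pressure_sum_def by (intro INF_lower2[of "{}"]) auto
    then show ?thesis by simp
  qed
  then have "pressure_lim d T {} t \<phi> \<epsilon> = 0" for t \<epsilon>
    by (simp add: pressure_lim_def limI)
  then have "pressure_scale d T {} \<phi> \<epsilon> = -\<infinity>" for \<epsilon>
  proof -
    have "Inf (range ereal) \<le> ereal r" for r
      by (rule Inf_lower) simp
    then have "Inf (range ereal) = -\<infinity>"
      by (rule ereal_bot)
    then show ?thesis
      using \<open>\<And>t \<epsilon>. pressure_lim d T {} t \<phi> \<epsilon> = 0\<close>
      by (simp only: pressure_scale_def UNIV_def[symmetric] simp_thms)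
  qed
  then have "pressure_scale d T {} \<phi> = (\<lambda>_. -\<infinity>)"
    by (rule ext)
  then show ?thesis
    unfolding pressure_def by (intro tendsto_Lim) simp_all
qed

end

theory Submission
  imports Defs "HOL-Library.Diagonal_Subsequence"
begin

text \<open>Upper bounds: if every point of \<open>Z\<close> has an accumulation measure \<open>\<mu>\<close> of its empirical measures with
  \<open>h(\<mu>) + \<integral>\<phi> d\<mu> \<le> s\<close>, then few Bowen balls cover the orbit segments whose empirical measure is close to
  \<open>\<mu>\<close>, and a countable base of the weak topology reduces \<open>Z\<close> to countably many such pieces.

  Lower bounds: uniform separation provides many separated orbit segments near each ergodic measure, all at
  one scale \<open>\<epsilon>0\<close>. Concatenation makes the set of pairs (measure, growth rate) with this property convex and
  closed, so a separation argument extends it to all invariant measures. For a slowly moving path of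
  measures whose image under \<open>\<Xi>\<close> stays in the convex hull of \<open>S1\<close> and visits a dense subset of \<open>S1\<close>
  infinitely often, the almost product property glues these segments into a Moran set inside
  \<open>\<Delta>(S1, S2)\<close>, and counting its cylinders bounds the pressure from below.

  The third claim holds because the accumulation set of \<open>\<Xi> (L\<^sub>n x)\<close> is connected: consecutive empirical
  measures get arbitrarily close.\<close>

section \<open>Borel probability measures on a compact metric space\<close>

text \<open>Uniform separation speaks of ergodic measures, but a Moran set glues segments of
  infinitely many mixtures, and all of them must be distinguishable at one scale \<epsilon>0. Hence
  the loss \<eta> in the rate is fixed in advance and \<epsilon>0 depends on \<eta> alone.

  Entropy need not be semicontinuous, so it cannot itself be maximized over the invariant measures.
  For a given invariant \<mu> it is replaced by a functional \<open>F\<close> that lies below the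
  entropy, nearly equals it at \<mu>, and is upper semicontinuous and convex. Convexity is cheap:
  entropies of partitions are convex under mixing up to an additive 1, which disappears after
  division by the length. Adding a small strictly convex term to a linear functional plus a multiple
  of \<open>F\<close> forces the maximizer to be extreme, hence ergodic; this takes the place of an
  ergodic decomposition.

  The limit over \<epsilon> in the pressure is obtained from an upper and a lower bound valid for
  all small \<epsilon>, not from monotonicity in \<epsilon>.\<close>

lemma prob_measuresD:
  assumes "\<mu> \<in> prob_measures"
  shows "prob_space \<mu>" "sets \<mu> = sets borel" "space \<mu> = UNIV"
  using assms by (auto simp: prob_measures_def dest: sets_eq_imp_space_eq)

lemma prob_measures_integrable:
  fixes h :: "'a::topological_space \<Rightarrow> real"
  assumes "\<mu> \<in> prob_measures" "h \<in> borel_measurable borel" "\<And>x. \<bar>h x\<bar> \<le> B"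
  shows "integrable \<mu> h"
proof -
  interpret prob_space \<mu> by (rule prob_measuresD[OF assms(1)])
  have "h \<in> borel_measurable \<mu>"
    using assms(2) prob_measuresD(2)[OF assms(1)] by (simp cong: measurable_cong_sets)
  then show ?thesis
    by (rule integrable_const_bound[rotated]) (use assms(3) in auto)
qed

lemma finite_measure_prob_measures: "\<mu> \<in> prob_measures \<Longrightarrow> finite_measure \<mu>"
  using prob_measuresD(1) prob_space.finite_measure by blast

lemma emeasure_prob_measures:
  "\<mu> \<in> prob_measures \<Longrightarrow> emeasure \<mu> A = ennreal (measure \<mu> A)"
  using finite_measure_prob_measures finite_measure.emeasure_eq_measure by blast

lemma measure_prob_measures_UNIV [simp]: "\<mu> \<in> prob_measures \<Longrightarrow> measure \<mu> UNIV = 1"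
  using prob_measuresD prob_space.prob_space by metis

lemma prob_measures_eqI:
  assumes "\<mu> \<in> prob_measures" "\<nu> \<in> prob_measures"
    and "\<And>A. A \<in> sets borel \<Longrightarrow> measure \<mu> A = measure \<nu> A"
  shows "\<mu> = \<nu>"
  using assms by (intro measure_eqI) (auto simp: emeasure_prob_measures prob_measuresD)

lemma measure_mix:
  assumes "\<mu> \<in> prob_measures" "\<nu> \<in> prob_measures" "A \<in> sets borel" "0 \<le> s" "s \<le> 1"
  shows "measure (mix s \<mu> \<nu>) A = s * measure \<mu> A + (1 - s) * measure \<nu> A"
proof -
  have "ennreal (measure (mix s \<mu> \<nu>) A) = emeasure (mix s \<mu> \<nu>) A"
    using emeasure_prob_measures[OF mix_in_prob_measures] assms by metis
  also have "\<dots> = ennreal (s * measure \<mu> A + (1 - s) * measure \<nu> A)"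
    using assms by (simp add: emeasure_mix emeasure_prob_measures ennreal_mult)
  finally show ?thesis
    using assms by (subst (asm) ennreal_inj) auto
qed

lemma nn_integral_mix:
  fixes h :: "'a::topological_space \<Rightarrow> ennreal"
  assumes "\<mu> \<in> prob_measures" "\<nu> \<in> prob_measures" "0 \<le> s" "s \<le> 1" "h \<in> borel_measurable borel"
  shows "(\<integral>\<^sup>+x. h x \<partial>mix s \<mu> \<nu>) = ennreal s * (\<integral>\<^sup>+x. h x \<partial>\<mu>) + ennreal (1 - s) * (\<integral>\<^sup>+x. h x \<partial>\<nu>)"
proof -
  let ?m = "mix s \<mu> \<nu>"
  have m: "?m \<in> prob_measures" by (intro mix_in_prob_measures assms)
  have sets: "sets ?m = sets borel" "sets \<mu> = sets borel" "sets \<nu> = sets borel"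
    using m assms prob_measuresD by auto
  have meas: "g \<in> borel_measurable ?m" "g \<in> borel_measurable \<mu>" "g \<in> borel_measurable \<nu>"
    if "g \<in> borel_measurable borel" for g :: "'a \<Rightarrow> ennreal"
    using that sets by (simp_all cong: measurable_cong_sets)
  show ?thesis
    using assms(5)
  proof (induction rule: borel_measurable_induct)
    case (cong f g)
    then show ?case by simp
  next
    case (set A)
    then show ?case
      using assms sets by (simp add: emeasure_mix)
  next
    case (mult u c)
    note u = meas[OF mult.hyps(2)]
    show ?case
      unfolding nn_integral_cmult[OF u(1)] nn_integral_cmult[OF u(2)] nn_integral_cmult[OF u(3)] mult.IH
      by (simp only: distrib_left mult.left_commute)
  next
    case (add u v)
    note u = meas[OF add.hyps(1)] and v = meas[OF add.hyps(3)]
    show ?case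
      unfolding nn_integral_add[OF v(1) u(1)] nn_integral_add[OF v(2) u(2)] nn_integral_add[OF v(3) u(3)]
        add.IH
      by (simp only: distrib_left ac_simps)
  next
    case (seq U)
    have "(\<integral>\<^sup>+x. (SUP i. U i x) \<partial>?m) = (SUP i. \<integral>\<^sup>+x. U i x \<partial>?m)"
      by (intro nn_integral_monotone_convergence_SUP meas seq.hyps)
    also have "\<dots> = (SUP i. ennreal s * (\<integral>\<^sup>+x. U i x \<partial>\<mu>) + ennreal (1 - s) * (\<integral>\<^sup>+x. U i x \<partial>\<nu>))"
      by (simp only: seq.IH)
    also have "\<dots> = (SUP i. ennreal s * (\<integral>\<^sup>+x. U i x \<partial>\<mu>)) + (SUP i. ennreal (1 - s) * (\<integral>\<^sup>+x. U i x \<partial>\<nu>))"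
      using seq.hyps(3) by (intro ennreal_SUP_add) (auto simp: incseq_def le_fun_def intro!: mult_left_mono nn_integral_mono)
    also have "\<dots> = ennreal s * (\<integral>\<^sup>+x. (SUP i. U i x) \<partial>\<mu>) + ennreal (1 - s) * (\<integral>\<^sup>+x. (SUP i. U i x) \<partial>\<nu>)"
      unfolding nn_integral_monotone_convergence_SUP[OF seq.hyps(3) meas(2)[OF seq.hyps(1)]]
        nn_integral_monotone_convergence_SUP[OF seq.hyps(3) meas(3)[OF seq.hyps(1)]]
      by (simp only: SUP_mult_left_ennreal)
    finally show ?case by (simp add: SUP_apply image_comp)
  qed
qed

lemma integral_mix:
  fixes h :: "'a::topological_space \<Rightarrow> real"
  assumes "\<mu> \<in> prob_measures" "\<nu> \<in> prob_measures" "0 \<le> s" "s \<le> 1"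
    and h: "h \<in> borel_measurable borel" and B: "\<And>x. \<bar>h x\<bar> \<le> B"
  shows "(\<integral>x. h x \<partial>mix s \<mu> \<nu>) = s * (\<integral>x. h x \<partial>\<mu>) + (1 - s) * (\<integral>x. h x \<partial>\<nu>)"
proof -
  have pos: "0 \<le> h x + B" for x
    using B[of x] by linarith
  have shift: "(\<integral>x. h x + B \<partial>\<rho>) = (\<integral>x. h x \<partial>\<rho>) + B" "0 \<le> (\<integral>x. h x + B \<partial>\<rho>)"
    "(\<integral>\<^sup>+x. ennreal (h x + B) \<partial>\<rho>) = ennreal (\<integral>x. h x + B \<partial>\<rho>)"
    if "\<rho> \<in> prob_measures" for \<rho> :: "'a measure"
  proof -
    interpret prob_space \<rho> by (rule prob_measuresD[OF that])
    have i: "integrable \<rho> h" by (rule prob_measures_integrable[OF that h B])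
    then show "(\<integral>x. h x + B \<partial>\<rho>) = (\<integral>x. h x \<partial>\<rho>) + B"
      using prob_space by simp
    show "0 \<le> (\<integral>x. h x + B \<partial>\<rho>)" using pos by simp
    show "(\<integral>\<^sup>+x. ennreal (h x + B) \<partial>\<rho>) = ennreal (\<integral>x. h x + B \<partial>\<rho>)"
      using i pos by (intro nn_integral_eq_integral) auto
  qed
  have m: "mix s \<mu> \<nu> \<in> prob_measures" by (intro mix_in_prob_measures assms)
  have "ennreal (\<integral>x. h x + B \<partial>mix s \<mu> \<nu>)
      = ennreal (s * (\<integral>x. h x + B \<partial>\<mu>) + (1 - s) * (\<integral>x. h x + B \<partial>\<nu>))"
    using assms shift m nn_integral_mix[of \<mu> \<nu> s "\<lambda>x. ennreal (h x + B)"]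
    by (simp add: ennreal_mult)
  then have "(\<integral>x. h x + B \<partial>mix s \<mu> \<nu>) = s * (\<integral>x. h x + B \<partial>\<mu>) + (1 - s) * (\<integral>x. h x + B \<partial>\<nu>)"
    using shift(2)[OF m] shift(2)[OF assms(1)] shift(2)[OF assms(2)] assms(3,4)
    by (subst (asm) ennreal_inj) auto
  then show ?thesis
    unfolding shift(1)[OF m] shift(1)[OF assms(1)] shift(1)[OF assms(2)] by (simp add: algebra_simps)
qed

lemma integral_empirical:
  fixes h :: "'a::topological_space \<Rightarrow> real"
  assumes n: "n \<ge> 1" and h: "h \<in> borel_measurable borel"
  shows "(\<integral>y. h y \<partial>empirical T n x) = birkhoff_sum T n h x / real n"
proof -
  let ?p = "measure_pmf (pmf_of_set {..<n})"
  have fin: "finite {..<n}" "{..<n} \<noteq> {}" using n by (auto simp: lessThan_empty_iff)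
  have eq: "empirical T n x = distr ?p borel (\<lambda>k. (T ^^ k) x)"
  proof (rule measure_eqI)
    show "sets (empirical T n x) = sets (distr ?p borel (\<lambda>k. (T ^^ k) x))"
      using prob_measuresD(2)[OF empirical_in_prob_measures[OF n]] by simp
    fix A assume "A \<in> sets (empirical T n x)"
    then have A: "A \<in> sets borel"
      by (simp only: prob_measuresD(2)[OF empirical_in_prob_measures[OF n]])
    have "emeasure (distr ?p borel (\<lambda>k. (T ^^ k) x)) A = emeasure ?p ((\<lambda>k. (T ^^ k) x) -` A)"
      using A by (subst emeasure_distr) auto
    also have "\<dots> = ennreal (real (card ({..<n} \<inter> (\<lambda>k. (T ^^ k) x) -` A)) / real n)"
      using fin by (simp add: emeasure_pmf_of_set)
    also have "real (card ({..<n} \<inter> (\<lambda>k. (T ^^ k) x) -` A)) = (\<Sum>k<n. indicator A ((T ^^ k) x))"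
      by (simp add: indicator_def sum.If_cases) (rule arg_cong[of _ _ card], auto)
    also have "ennreal ((\<Sum>k<n. indicator A ((T ^^ k) x)) / real n)
      = ennreal (1 / real n) * ennreal (\<Sum>k<n. indicator A ((T ^^ k) x))"
      by (subst ennreal_mult'[symmetric]) auto
    also have "ennreal (\<Sum>k<n. indicator A ((T ^^ k) x)) = (\<Sum>k<n. ennreal (indicator A ((T ^^ k) x)))"
      by (subst sum_ennreal) auto
    also have "\<dots> = (\<Sum>k<n. emeasure (return borel ((T ^^ k) x)) A)"
      using A by (simp add: ennreal_indicator)
    also have "ennreal (1 / real n) * \<dots> = emeasure (empirical T n x) A"
      using emeasure_empirical[OF A] by metis
    finally show "emeasure (empirical T n x) A = emeasure (distr ?p borel (\<lambda>k. (T ^^ k) x)) A" ..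
  qed
  show ?thesis
    unfolding eq using h fin
    by (subst integral_distr) (auto simp: integral_pmf_of_set birkhoff_sum_def)
qed

lemma abs_ramp_le: "\<bar>max 0 (1 - c * t)\<bar> \<le> 1" if "0 \<le> c" "0 \<le> t" for c t :: real
proof -
  have "0 \<le> c * t" using that by simp
  then show ?thesis by (simp add: max_def)
qed

text \<open>The ramps decrease to the indicator of \<open>A\<close>, because \<open>infdist\<close>
  is positive off a closed set; dominated convergence with the constant 1 does the rest.
  Nonemptiness matters since \<open>infdist x {}\<close> is 0.\<close>

lemma measure_closed_approx:
  fixes \<mu> :: "'a::metric_space measure"
  assumes \<mu>: "\<mu> \<in> prob_measures" and A: "closed A" "A \<noteq> {}"
  shows "(\<lambda>k. \<integral>x. max 0 (1 - real k * infdist x A) \<partial>\<mu>) \<longlonglongrightarrow> measure \<mu> A"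
proof -
  interpret prob_space \<mu> by (rule prob_measuresD[OF \<mu>])
  have [measurable]: "A \<in> sets borel" using A by simp
  have [measurable_cong]: "sets \<mu> = sets borel" using \<mu> by (rule prob_measuresD)
  have "(\<lambda>k. \<integral>x. max 0 (1 - real k * infdist x A) \<partial>\<mu>) \<longlonglongrightarrow> (\<integral>x. indicator A x \<partial>\<mu>)"
  proof (rule integral_dominated_convergence[where w = "\<lambda>_. 1"])
    show "AE x in \<mu>. (\<lambda>k. max 0 (1 - real k * infdist x A)) \<longlonglongrightarrow> indicator A x"
    proof (rule AE_I2)
      fix x
      show "(\<lambda>k. max 0 (1 - real k * infdist x A)) \<longlonglongrightarrow> indicator A x"
      proof (cases "x \<in> A")
        case False
        then have pos: "infdist x A > 0"
          using A in_closed_iff_infdist_zero[of A x] infdist_nonneg[of x A] by (metis less_eq_real_def)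
        obtain k0 where k0: "1 / infdist x A < real k0" using reals_Archimedean2 by blast
        have "max 0 (1 - real k * infdist x A) = 0" if "k \<ge> k0" for k
        proof -
          have "1 / infdist x A \<le> real k" using k0 that by (meson less_le_trans less_imp_le of_nat_le_iff order_trans)
          then show ?thesis using pos by (simp add: field_simps)
        qed
        then have "\<forall>\<^sub>F k in sequentially. max 0 (1 - real k * infdist x A) = 0"
          by (auto simp: eventually_sequentially)
        then show ?thesis using False by (simp add: tendsto_eventually)
      qed simp
    qed
    show "AE x in \<mu>. norm (max 0 (1 - real k * infdist x A)) \<le> 1" for k
      by (rule AE_I2) (simp add: abs_ramp_le infdist_nonneg)
  qed (use A in \<open>auto simp: measurable_cong_sets[OF prob_measuresD(2)[OF \<mu>] refl]
        intro!: borel_measurable_continuous_onI continuous_intros\<close>)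
  then show ?thesis using prob_measuresD(3)[OF \<mu>] by (simp)
qed

text \<open>Closed sets form an intersection-stable generator of the Borel sets, and the ramps
  recover the measure of a closed set from integrals of continuous functions into the unit interval,
  the kind of function that the sequence \<open>f\<close> approximates.\<close>

lemma prob_measures_eq_continuousI:
  fixes \<mu> \<nu> :: "'a::metric_space measure"
  assumes \<mu>: "\<mu> \<in> prob_measures" and \<nu>: "\<nu> \<in> prob_measures"
    and eq: "\<And>h :: 'a \<Rightarrow> real. continuous_on UNIV h \<Longrightarrow> (\<And>x. 0 \<le> h x \<and> h x \<le> 1) \<Longrightarrow> (\<integral>x. h x \<partial>\<mu>) = (\<integral>x. h x \<partial>\<nu>)"
  shows "\<mu> = \<nu>"
proof (rule measure_eqI_generator_eq[where E = "Collect closed" and \<Omega> = UNIV and A = "\<lambda>_. UNIV"])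
  fix A :: "'a set" assume "A \<in> Collect closed"
  then have A: "closed A" by simp
  show "emeasure \<mu> A = emeasure \<nu> A"
  proof (cases "A = {}")
    case False
    have "(\<integral>x. max 0 (1 - real k * infdist x A) \<partial>\<mu>) = (\<integral>x. max 0 (1 - real k * infdist x A) \<partial>\<nu>)" for k
      by (rule eq) (auto intro!: continuous_intros simp: infdist_nonneg mult_nonneg_nonneg)
    with measure_closed_approx[OF \<mu> A False] measure_closed_approx[OF \<nu> A False]
    have "measure \<mu> A = measure \<nu> A" by (simp add: LIMSEQ_unique)
    then show ?thesis by (simp add: emeasure_prob_measures[OF \<mu>] emeasure_prob_measures[OF \<nu>])
  qed simp
qed (use prob_measuresD[OF \<mu>] prob_measuresD[OF \<nu>] in
      \<open>auto simp: Int_stable_def borel_eq_closed emeasure_prob_measures[OF \<mu>]\<close>)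

lemma prob_measures_closed_inner:
  fixes \<mu> :: "'a::metric_space measure"
  assumes \<mu>: "\<mu> \<in> prob_measures" and A: "A \<in> sets borel" and e: "0 < e"
  obtains K where "closed K" "K \<subseteq> A" "measure \<mu> (A - K) < e"
proof -
  interpret prob_space \<mu> by (rule prob_measuresD[OF \<mu>])
  have [measurable_cong]: "sets \<mu> = sets borel" using \<mu> by (rule prob_measuresD)
  have sets: "sets \<mu> = sets borel" using \<mu> by (rule prob_measuresD)
  have "A \<in> sigma_sets UNIV (Collect closed)"
    using A by (simp add: borel_eq_closed)
  \<comment> \<open>Regularity is proved from inside and outside at once: complementation exchanges
    the closed and the open set, so the property passes through the induction over the
    \<sigma>-algebra.\<close>
  then have "\<forall>e>0. \<exists>K U. closed K \<and> open U \<and> K \<subseteq> A \<and> A \<subseteq> U \<and> measure \<mu> (U - K) < e"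
  proof induction
    case (Basic A)
    then have cl: "closed A" by simp
    show ?case
    proof (intro allI impI)
      fix e :: real assume e: "0 < e"
      show "\<exists>K U. closed K \<and> open U \<and> K \<subseteq> A \<and> A \<subseteq> U \<and> measure \<mu> (U - K) < e"
      proof (cases "A = {}")
        case True
        then show ?thesis using e by (intro exI[of _ "{}"]) auto
      next
        case False
        let ?U = "\<lambda>n. {x. infdist x A < 1 / real (Suc n)}"
        have op: "open (?U n)" for n by (intro open_Collect_less continuous_intros)
        have "(\<lambda>n. measure \<mu> (?U n)) \<longlonglongrightarrow> measure \<mu> (\<Inter>n. ?U n)"
        proof (rule finite_Lim_measure_decseq)
          show "range ?U \<subseteq> sets \<mu>" using op sets by auto
          show "decseq ?U"
            by (rule decseq_SucI) (auto intro: less_trans simp: frac_less2 elim!: less_trans)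
        qed
        also have "(\<Inter>n. ?U n) = A"
        proof safe
          fix x assume "x \<in> A" then show "infdist x A < 1 / real (Suc n)" for n by simp
        next
          fix x assume x: "x \<in> (\<Inter>n. ?U n)"
          then have "infdist x A < 1 / real (Suc n)" for n by simp
          then have "infdist x A \<le> 0"
            by (metis linorder_not_less nat_approx_posE order_less_asym)
          then show "x \<in> A" using cl False in_closed_iff_infdist_zero[of A x] infdist_nonneg[of x A] by force
        qed
        finally have "\<forall>\<^sub>F n in sequentially. dist (measure \<mu> (?U n)) (measure \<mu> A) < e"
          using e by (rule tendstoD)
        then obtain n where n: "dist (measure \<mu> (?U n)) (measure \<mu> A) < e"
          by (auto simp: eventually_sequentially)
        have "measure \<mu> (?U n - A) = measure \<mu> (?U n) - measure \<mu> A"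
          using op cl sets by (intro finite_measure_Diff) (auto simp: )
        then show ?thesis
          using n cl op by (intro exI[of _ A] exI[of _ "?U n"]) (auto simp: dist_real_def)
      qed
    qed
  next
    case Empty
    show ?case by (rule allI, rule impI, rule exI[of _ "{}"], rule exI[of _ "{}"]) simp
  next
    case (Compl A)
    show ?case
    proof (intro allI impI)
      fix e :: real assume "0 < e"
      then obtain K U where "closed K" "open U" "K \<subseteq> A" "A \<subseteq> U" "measure \<mu> (U - K) < e"
        using Compl.IH[rule_format, of e] by blast
      moreover have "- K - - U = U - K" by auto
      ultimately show "\<exists>K U. closed K \<and> open U \<and> K \<subseteq> UNIV - A \<and> UNIV - A \<subseteq> U \<and> measure \<mu> (U - K) < e"
        by (intro exI[of _ "- U"] exI[of _ "- K"]) (auto simp: Compl_eq_Diff_UNIV[symmetric])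
    qed
  next
    case (Union A)
    show ?case
    proof (intro allI impI)
      fix e :: real assume e: "0 < e"
      \<comment> \<open>The gaps of the single sets share the budget \<open>e / 2\<close>
        geometrically. The other half pays for replacing the countable union of closed sets by a
        finite one, which is closed.\<close>
      have "\<forall>i. \<exists>K U. closed K \<and> open U \<and> K \<subseteq> A i \<and> A i \<subseteq> U \<and> measure \<mu> (U - K) < e / 2 * (1/2) ^ Suc i"
      proof
        fix i
        have "0 < e / 2 * (1/2) ^ Suc i" using e by simp
        with Union.IH[of i] show "\<exists>K U. closed K \<and> open U \<and> K \<subseteq> A i \<and> A i \<subseteq> U \<and> measure \<mu> (U - K) < e / 2 * (1/2) ^ Suc i"
          by (elim allE) (erule (1) mp)
      qed
      then obtain K U where KU: "\<And>i. closed (K i)" "\<And>i. open (U i)" "\<And>i. K i \<subseteq> A i" "\<And>i. A i \<subseteq> U i"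
          "\<And>i. measure \<mu> (U i - K i) < e / 2 * (1/2) ^ Suc i" by metis
      have KUs: "K i \<in> sets \<mu>" "U i \<in> sets \<mu>" for i using KU sets by auto
      have "(\<lambda>n. measure \<mu> (\<Union>i\<le>n. K i)) \<longlonglongrightarrow> measure \<mu> (\<Union>n. \<Union>i\<le>n. K i)"
        by (rule finite_Lim_measure_incseq) (use KUs in \<open>auto simp: incseq_def, force\<close>)
      also have "(\<Union>n. \<Union>i\<le>n. K i) = (\<Union>i. K i)" by auto
      finally have "\<forall>\<^sub>F n in sequentially. dist (measure \<mu> (\<Union>i\<le>n. K i)) (measure \<mu> (\<Union>i. K i)) < e / 2"
        using e by (intro tendstoD) auto
      then obtain n where n: "dist (measure \<mu> (\<Union>i\<le>n. K i)) (measure \<mu> (\<Union>i. K i)) < e / 2"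
        by (auto simp: eventually_sequentially)
      have sm: "summable (\<lambda>i. e / 2 * (1/2) ^ Suc i)" by (intro summable_mult) (auto simp: summable_geometric)
      have "measure \<mu> (\<Union>i. U i - K i) \<le> (\<Sum>i. measure \<mu> (U i - K i))"
      proof (rule finite_measure_subadditive_countably)
        show "range (\<lambda>i. U i - K i) \<subseteq> sets \<mu>" using KUs by auto
        show "summable (\<lambda>i. measure \<mu> (U i - K i))"
          by (rule summable_comparison_test'[OF sm, of 0]) (use KU(5) in \<open>auto intro: less_imp_le\<close>)
      qed
      also have "\<dots> \<le> (\<Sum>i. e / 2 * (1/2) ^ Suc i)"
        by (rule suminf_le[OF _ summable_comparison_test'[OF sm, of 0] sm]) (use KU(5) in \<open>auto intro: less_imp_le\<close>)
      also have "\<dots> = e / 2" using suminf_mult[of "\<lambda>i. (1/2::real) ^ Suc i" "e/2"] power_half_series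
        by (auto simp: sums_iff)
      finally have 1: "measure \<mu> (\<Union>i. U i - K i) \<le> e / 2" .
      have "(\<Union>i. U i) - (\<Union>i\<le>n. K i) \<subseteq> (\<Union>i. U i - K i) \<union> ((\<Union>i. K i) - (\<Union>i\<le>n. K i))" by auto
      then have "measure \<mu> ((\<Union>i. U i) - (\<Union>i\<le>n. K i)) \<le> measure \<mu> ((\<Union>i. U i - K i) \<union> ((\<Union>i. K i) - (\<Union>i\<le>n. K i)))"
        using KUs by (intro finite_measure_mono) auto
      also have "\<dots> \<le> measure \<mu> (\<Union>i. U i - K i) + measure \<mu> ((\<Union>i. K i) - (\<Union>i\<le>n. K i))"
        using KUs by (intro measure_Un_le) auto
      also have "measure \<mu> ((\<Union>i. K i) - (\<Union>i\<le>n. K i)) = measure \<mu> (\<Union>i. K i) - measure \<mu> (\<Union>i\<le>n. K i)"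
        using KUs by (intro finite_measure_Diff) auto
      also have "measure \<mu> (\<Union>i. U i - K i) + (measure \<mu> (\<Union>i. K i) - measure \<mu> (\<Union>i\<le>n. K i)) < e"
        using 1 n unfolding dist_real_def by linarith
      finally show "\<exists>K U. closed K \<and> open U \<and> K \<subseteq> (\<Union>i. A i) \<and> (\<Union>i. A i) \<subseteq> U \<and> measure \<mu> (U - K) < e"
        using KU by (intro exI[of _ "\<Union>i\<le>n. K i"] exI[of _ "\<Union>i. U i"] conjI) (auto intro!: closed_UN, blast+)
    qed
  qed
  from this[rule_format, OF e] obtain K U
    where KU: "closed K" "open U" "K \<subseteq> A" "A \<subseteq> U" "measure \<mu> (U - K) < e" by metis
  then have "measure \<mu> (A - K) \<le> measure \<mu> (U - K)"
    using sets A by (intro finite_measure_mono) auto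
  then show thesis using KU that by force
qed

section \<open>Weak convergence of sequences and the weak-star topology\<close>

definition weak_conv :: "(nat \<Rightarrow> 'a::topological_space measure) \<Rightarrow> 'a measure \<Rightarrow> bool" where
  "weak_conv M \<mu> \<longleftrightarrow> (\<forall>h :: 'a \<Rightarrow> real. continuous_on UNIV h \<longrightarrow> (\<lambda>n. \<integral>x. h x \<partial>M n) \<longlonglongrightarrow> (\<integral>x. h x \<partial>\<mu>))"

text \<open>Finite intersections of subbasic sets; the separation property is applied to
  neighbourhoods of this form.\<close>

lemma openin_weak_star_nbhd:
  fixes \<mu> :: "'a::topological_space measure"
  assumes "finite H" "\<And>h. h \<in> H \<Longrightarrow> continuous_on UNIV (h :: 'a \<Rightarrow> real)"
  shows "openin weak_star {\<nu> \<in> prob_measures. \<forall>h\<in>H. \<bar>(\<integral>x. h x \<partial>\<nu>) - (\<integral>x. h x \<partial>\<mu>)\<bar> < \<theta>}"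
  using assms
proof (induction H rule: finite_induct)
  case empty
  show ?case using openin_topspace[of weak_star] by (simp add: topspace_weak_star)
next
  case (insert h H)
  let ?a = "\<integral>x. h x \<partial>\<mu>"
  have "openin weak_star {\<nu> \<in> prob_measures. (\<integral>x. h x \<partial>\<nu>) \<in> {?a - \<theta><..<?a + \<theta>}}"
    unfolding weak_star_def openin_topology_generated_by_iff
    by (rule generate_topology_on.Basis) (use insert.prems[of h] open_greaterThanLessThan in blast)
  from openin_Int[OF this insert.IH] insert.prems
  have "openin weak_star ({\<nu> \<in> prob_measures. (\<integral>x. h x \<partial>\<nu>) \<in> {?a - \<theta><..<?a + \<theta>}}
      \<inter> {\<nu> \<in> prob_measures. \<forall>h\<in>H. \<bar>(\<integral>x. h x \<partial>\<nu>) - (\<integral>x. h x \<partial>\<mu>)\<bar> < \<theta>})" by auto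
  also have "{\<nu> \<in> prob_measures. (\<integral>x. h x \<partial>\<nu>) \<in> {?a - \<theta><..<?a + \<theta>}}
      \<inter> {\<nu> \<in> prob_measures. \<forall>h\<in>H. \<bar>(\<integral>x. h x \<partial>\<nu>) - (\<integral>x. h x \<partial>\<mu>)\<bar> < \<theta>}
      = {\<nu> \<in> prob_measures. \<forall>h\<in>insert h H. \<bar>(\<integral>x. h x \<partial>\<nu>) - (\<integral>x. h x \<partial>\<mu>)\<bar> < \<theta>}"
    by (auto simp: abs_diff_less_iff)
  finally show ?case .
qed

text \<open>Eventual membership survives finite intersections and arbitrary unions, so only the
  generating sets have to be checked; for these it is the convergence of a single integral.\<close>

lemma weak_conv_limitin:
  assumes "\<And>n. M n \<in> prob_measures" "\<mu> \<in> prob_measures" "weak_conv M \<mu>"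
  shows "limitin weak_star M \<mu> sequentially"
  unfolding limitin_def
proof (intro conjI allI impI)
  show "\<mu> \<in> topspace weak_star" using assms by (simp add: topspace_weak_star)
  fix U assume U: "openin weak_star U \<and> \<mu> \<in> U"
  then have "generate_topology_on
     {{\<mu> \<in> prob_measures. (\<integral>x. h x \<partial>\<mu>) \<in> U} | (h :: 'a \<Rightarrow> real) U. continuous_on UNIV h \<and> open U} U"
    unfolding weak_star_def openin_topology_generated_by_iff by blast
  then have "\<mu> \<in> U \<longrightarrow> (\<forall>\<^sub>F n in sequentially. M n \<in> U)"
  proof induction
    case (Int a b)
    then show ?case by (auto elim: eventually_elim2)
  next
    case (UN K)
    show ?case
    proof
      assume "\<mu> \<in> \<Union> K"
      then obtain k where k: "k \<in> K" "\<mu> \<in> k" by blast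
      then have "\<forall>\<^sub>F n in sequentially. M n \<in> k" using UN.IH by blast
      then show "\<forall>\<^sub>F n in sequentially. M n \<in> \<Union> K" by (rule eventually_mono) (use k in blast)
    qed
  next
    case (Basis s)
    then obtain h :: "'a \<Rightarrow> real" and V where s: "s = {\<mu> \<in> prob_measures. (\<integral>x. h x \<partial>\<mu>) \<in> V}" "continuous_on UNIV h" "open V"
      by blast
    then have "(\<lambda>n. \<integral>x. h x \<partial>M n) \<longlonglongrightarrow> (\<integral>x. h x \<partial>\<mu>)"
      using assms(3) by (auto simp: weak_conv_def)
    then show ?case
      using s assms(1) by (auto dest: topological_tendstoD)
  qed auto
  then show "\<forall>\<^sub>F n in sequentially. M n \<in> U" using U by blast
qed

lemma weak_conv_continuous_map:
  fixes \<Xi> :: "'a::topological_space measure \<Rightarrow> 'y::topological_space"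
  assumes "continuous_map weak_star euclidean \<Xi>" "\<And>n. M n \<in> prob_measures" "\<mu> \<in> prob_measures"
    "weak_conv M \<mu>"
  shows "(\<lambda>n. \<Xi> (M n)) \<longlonglongrightarrow> \<Xi> \<mu>"
  using continuous_map_limit[OF assms(1) weak_conv_limitin[OF assms(2-)]]
  by (simp add: comp_def)

text \<open>Every coordinate stays in a compact interval, and the diagonal sequence is, from some
  index on, a subsequence of each stage of the selection.\<close>

lemma convergent_diagonal:
  fixes u :: "nat \<Rightarrow> nat \<Rightarrow> real"
  assumes bdd: "\<And>n i. \<bar>u n i\<bar> \<le> 1"
  obtains r where "strict_mono r" "\<And>i. convergent (\<lambda>n. u (r n) i)"
proof -
  let ?P = "\<lambda>i s. convergent (\<lambda>k. u (s k) i)"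
  interpret nat: subseqs ?P
  proof (unfold convergent_def, unfold subseqs_def, auto)
    fix i :: nat and s :: "nat \<Rightarrow> nat" assume s: "strict_mono s"
    have "u (s k) i \<in> {-1..1}" for k
      using bdd[of "s k" i] by (auto simp: abs_le_iff)
    then have "\<exists>l s'. strict_mono s' \<and> ((\<lambda>k. u (s k) i) \<circ> s') \<longlonglongrightarrow> l"
      using compact_Icc compact_imp_seq_compact seq_compactE by metis
    thus "\<exists>s'. strict_mono (s'::nat\<Rightarrow>nat) \<and> (\<exists>l. (\<lambda>k. u (s (s' k)) i) \<longlonglongrightarrow> l)"
      by (auto simp: comp_def)
  qed
  define d where "d = nat.diagseq"
  have "?P i d" for i
  proof -
    have 1: "(\<lambda>k. u ((nat.seqseq (Suc i) \<circ> (\<lambda>k. nat.fold_reduce (Suc i) k (Suc i + k))) k) i)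
        = (\<lambda>k. u (nat.seqseq (Suc i) k) i) \<circ> (\<lambda>k. nat.fold_reduce (Suc i) k (Suc i + k))"
      by auto
    have "?P i (d \<circ> ((+) (Suc i)))"
      unfolding d_def nat.diagseq_seqseq 1
      by (intro convergent_subseq_convergent nat.seqseq_holds nat.subseq_diagonal_rest)
    then obtain L where "(\<lambda>k. u (d (k + Suc i)) i) \<longlonglongrightarrow> L"
      by (auto simp: add.commute dest: convergentD)
    then have "(\<lambda>k. u (d k) i) \<longlonglongrightarrow> L"
      by (rule LIMSEQ_offset)
    then show ?thesis
      by (auto simp: convergent_def)
  qed
  then show thesis using that nat.subseq_diagseq d_def by blast
qed

lemma integral_finite_valued:
  fixes X :: "'b \<Rightarrow> 'c" and q :: "'c \<Rightarrow> real"
  assumes "prob_space M" "finite V" "\<And>x. x \<in> space M \<Longrightarrow> X x \<in> V"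
    and meas: "\<And>v. v \<in> V \<Longrightarrow> X -` {v} \<inter> space M \<in> sets M"
  shows "(\<integral>x. q (X x) \<partial>M) = (\<Sum>v\<in>V. q v * measure M (X -` {v} \<inter> space M))"
proof -
  interpret prob_space M by fact
  have "(\<integral>x. q (X x) \<partial>M) = (\<integral>x. (\<Sum>v\<in>V. q v * indicator (X -` {v} \<inter> space M) x) \<partial>M)"
  proof (rule Bochner_Integration.integral_cong[OF refl])
    fix x assume x: "x \<in> space M"
    have "(\<Sum>v\<in>V. q v * indicator (X -` {v} \<inter> space M) x) = (\<Sum>v\<in>V. if v = X x then q v else 0)"
      using x by (intro sum.cong) (auto simp: indicator_def)
    then show "q (X x) = (\<Sum>v\<in>V. q v * indicator (X -` {v} \<inter> space M) x)"
      using assms(2,3) x by simp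
  qed
  also have "\<dots> = (\<Sum>v\<in>V. q v * measure M (X -` {v} \<inter> space M))"
    using meas by (subst Bochner_Integration.integral_sum) (auto simp: emeasure_eq_measure Int_assoc)
  finally show ?thesis .
qed

lemma sum_lessThan_add:
  fixes h :: "nat \<Rightarrow> 'b::comm_monoid_add"
  shows "(\<Sum>i<a + b. h i) = (\<Sum>i<a. h i) + (\<Sum>i<b. h (a + i))"
  by (induction b) (simp_all add: ac_simps)

section \<open>Continuous functions on the compact space and sequential compactness of the
  probability measures\<close>

locale compact_dynamics =
  fixes T :: "'a::metric_space \<Rightarrow> 'a"
    and f :: "nat \<Rightarrow> ('a \<Rightarrow>\<^sub>C real)"
  assumes compact_UNIV: "compact (UNIV :: 'a set)"
    and cont_T: "continuous_on UNIV T"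
    and dense_f: "dense_in_C01 f"
begin

lemma continuous_bounded:
  fixes h :: "'a \<Rightarrow> real"
  assumes "continuous_on UNIV h"
  obtains B where "0 < B" "\<And>x. \<bar>h x\<bar> \<le> B"
proof -
  have "bounded (range h)"
    using compact_continuous_image[OF assms compact_UNIV] by (rule compact_imp_bounded)
  then show thesis
    using that unfolding bounded_pos by auto
qed

lemma uniform_modulus:
  fixes h :: "'a \<Rightarrow> 'b::metric_space"
  assumes "continuous_on UNIV h" "0 < e"
  obtains \<delta> where "0 < \<delta>" "\<And>x y. dist x y < \<delta> \<Longrightarrow> dist (h x) (h y) < e"
  using compact_uniformly_continuous[OF assms(1) compact_UNIV] assms(2)
  unfolding uniformly_continuous_on_def by (metis UNIV_I dist_commute)

lemma continuous_integrable:
  fixes h :: "'a \<Rightarrow> real"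
  assumes "\<mu> \<in> prob_measures" "continuous_on UNIV h"
  shows "integrable \<mu> h"
  using continuous_bounded[OF assms(2)] prob_measures_integrable[OF assms(1)] assms(2)
  by (metis borel_measurable_continuous_onI)

lemma integral_mix_continuous:
  fixes h :: "'a \<Rightarrow> real"
  assumes "\<mu> \<in> prob_measures" "\<nu> \<in> prob_measures" "0 \<le> s" "s \<le> 1" "continuous_on UNIV h"
  shows "(\<integral>x. h x \<partial>mix s \<mu> \<nu>) = s * (\<integral>x. h x \<partial>\<mu>) + (1 - s) * (\<integral>x. h x \<partial>\<nu>)"
  using continuous_bounded[OF assms(5)] integral_mix[OF assms(1-4)] assms(5)
  by (metis borel_measurable_continuous_onI)

lemma integral_empirical_continuous:
  fixes h :: "'a \<Rightarrow> real"
  assumes "n \<ge> 1" "continuous_on UNIV h"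
  shows "(\<integral>y. h y \<partial>empirical T n x) = birkhoff_sum T n h x / real n"
  using assms by (simp add: integral_empirical borel_measurable_continuous_onI)

lemma integral_abs_le:
  fixes h :: "'a \<Rightarrow> real"
  assumes \<mu>: "\<mu> \<in> prob_measures" and "continuous_on UNIV h" "\<And>x. \<bar>h x\<bar> \<le> B"
  shows "\<bar>\<integral>x. h x \<partial>\<mu>\<bar> \<le> B"
proof -
  interpret prob_space \<mu> by (rule prob_measuresD[OF \<mu>])
  have "\<bar>\<integral>x. h x \<partial>\<mu>\<bar> \<le> (\<integral>x. \<bar>h x\<bar> \<partial>\<mu>)" by (rule integral_abs_bound)
  also have "\<dots> \<le> (\<integral>x. B \<partial>\<mu>)"
    using continuous_integrable[OF \<mu> assms(2)] assms(3) by (intro integral_mono) auto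
  finally show ?thesis using prob_space by simp
qed

lemma integral_diff_le:
  fixes h k :: "'a \<Rightarrow> real"
  assumes \<mu>: "\<mu> \<in> prob_measures" and "continuous_on UNIV h" "continuous_on UNIV k" "\<And>x. \<bar>h x - k x\<bar> \<le> e"
  shows "\<bar>(\<integral>x. h x \<partial>\<mu>) - (\<integral>x. k x \<partial>\<mu>)\<bar> \<le> e"
  using integral_abs_le[OF \<mu>, of "\<lambda>x. h x - k x" e] assms
  by (simp add: continuous_on_diff continuous_integrable)

text \<open>Total boundedness gives finitely many balls of radius \<open>e / 2\<close>; the label is
  the least index of a ball containing the point, so points with equal labels share a ball.\<close>

lemma fine_labels:
  assumes e: "0 < e"
  obtains a :: "'a \<Rightarrow> nat" and R where "\<And>x. a x < R" "a \<in> measurable borel (count_space UNIV)"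
    "\<And>x y. a x = a y \<Longrightarrow> dist x y < e"
proof -
  obtain k where k: "finite k" "UNIV \<subseteq> (\<Union>x\<in>k. ball (x :: 'a) (e/2))"
    using compact_UNIV e unfolding compact_eq_totally_bounded by (meson half_gt_zero)
  then have "k \<noteq> {}" by auto
  obtain c and N :: nat where c: "k = c ` {i. i < N}"
    using finite_imp_nat_seg_image_inj_on[OF k(1)] by metis
  define a where "a x = (LEAST i. dist (c i) x < e/2)" for x
  have a: "a x < N \<and> dist (c (a x)) x < e/2" for x
  proof -
    obtain y where y: "y \<in> k" "dist y x < e/2" using k(2) by fastforce
    then obtain i where i: "i < N" "dist (c i) x < e/2" unfolding c by auto
    have "dist (c (a x)) x < e/2" unfolding a_def by (rule LeastI[of _ i]) fact
    moreover have "a x \<le> i" unfolding a_def by (rule Least_le) fact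
    ultimately show ?thesis using i by simp
  qed
  show thesis
  proof (rule that[of a N])
    show "a \<in> measurable borel (count_space UNIV)"
    proof -
      have "(\<lambda>x. dist (c i) x < e/2) \<in> measurable borel (count_space UNIV)" for i
      proof -
        have "(\<lambda>x. dist (c i) x) \<in> borel_measurable borel"
          by (intro borel_measurable_continuous_onI continuous_intros)
        then show ?thesis by measurable
      qed
      then show ?thesis unfolding a_def[abs_def] by (rule measurable_Least)
    qed
    show "dist x y < e" if "a x = a y" for x y
      using a[of x] a[of y] that by (metis dist_triangle_half_r)
  qed (use a in auto)
qed

text \<open>Skorokhod's device: the atoms of a refining sequence of finite partitions are laid out
  as nested subintervals of the unit interval whose lengths are the limit masses, and the limit
  measure is the image of Lebesgue measure under the resulting map into \<open>X\<close>.\<close>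

lemma prob_measures_seq_compact:
  fixes M :: "nat \<Rightarrow> 'a measure"
  assumes M: "\<And>n. M n \<in> prob_measures"
  obtains r \<mu> where "strict_mono r" "\<mu> \<in> prob_measures" "weak_conv (M \<circ> r) \<mu>"
proof -
  have "\<exists>(a :: 'a \<Rightarrow> nat) R. (\<forall>x. a x < R) \<and> a \<in> measurable borel (count_space UNIV)
      \<and> (\<forall>x y. a x = a y \<longrightarrow> dist x y < 1 / real (Suc l))" for l
  proof -
    have "0 < 1 / real (Suc l)" by simp
    from fine_labels[OF this] show ?thesis by metis
  qed
  then obtain a R where aR: "\<And>l x. a l (x::'a) < (R l :: nat)" 
    and a_meas [measurable]: "\<And>l. a l \<in> measurable borel (count_space UNIV)"
    and a_dist: "\<And>l x y. a l x = a l y \<Longrightarrow> dist x y < 1 / real (Suc l)"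
    by metis
  have Rpos: "0 < R l" for l using aR[of l] by (metis less_nat_zero_code not_gr_zero)
  \<comment> \<open>\<open>Y x l\<close> packs the first \<open>l\<close> labels of \<open>x\<close>
    into one number in mixed radix, with values below \<open>K l\<close>. Division by
    \<open>R l\<close> forgets the last label, the remainder recovers it.\<close>
  define Y where "Y x = rec_nat 0 (\<lambda>l y. y * R l + a l x)" for x
  define K where "K = rec_nat 1 (\<lambda>l k. k * R l)"
  have Y0: "Y x 0 = 0" and YS: "Y x (Suc l) = Y x l * R l + a l x" for x l by (simp_all add: Y_def)
  have K0: "K 0 = 1" and KS: "K (Suc l) = K l * R l" for l by (simp_all add: K_def)
  have YK: "Y x l < K l" for x l
  proof (induction l)
    case (Suc l)
    have "Y x l * R l + a l x < Suc (Y x l) * R l" using aR[of l x] by simp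
    also have "\<dots> \<le> K l * R l" using Suc by (intro mult_right_mono) auto
    finally show ?case by (simp add: YS KS)
  qed (simp add: Y0 K0)
  have Ydiv: "Y x (Suc l) div R l = Y x l" and Ymod: "Y x (Suc l) mod R l = a l x" for x l
    using aR[of l x] by (simp_all add: YS)
  have Ymeas [measurable]: "(\<lambda>x. Y x l) \<in> measurable borel (count_space UNIV)" for l
    by (induction l) (simp_all add: Y0 YS)
  have Yset: "(\<lambda>x. Y x l) -` {j} \<in> sets borel" for l j
    using measurable_sets[OF Ymeas, of "{j}" l] by simp
  \<comment> \<open>The masses of all atoms at all levels are enumerated through pairs, so that one
    diagonal subsequence serves all of them.\<close>
  define u where "u n i = measure (M n) ((\<lambda>x. Y x (fst (prod_decode i))) -` {snd (prod_decode i)})" for n i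
  have u01: "0 \<le> u n i" "u n i \<le> 1" for n i
    using prob_space.prob_le_1[OF prob_measuresD(1)[OF M]] by (auto simp: u_def)
  obtain r where r: "strict_mono r" "\<And>i. convergent (\<lambda>n. u (r n) i)"
    using convergent_diagonal[of u] u01 by (metis abs_of_nonneg)
  define m where "m l j = lim (\<lambda>n. u (r n) (prod_encode (l, j)))" for l j
  have m_lim: "(\<lambda>n. measure (M (r n)) ((\<lambda>x. Y x l) -` {j})) \<longlonglongrightarrow> m l j" for l j
    using convergent_LIMSEQ_iff[THEN iffD1, OF r(2), of "prod_encode (l, j)"] by (simp add: m_def u_def)
  have m_nn: "0 \<le> m l j" for l j by (rule LIMSEQ_le_const[OF m_lim]) auto
  have sumM: "(\<Sum>j<K l. measure (M n) ((\<lambda>x. Y x l) -` {j})) = 1" for l n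
  proof -
    interpret prob_space "M n" by (rule prob_measuresD[OF M])
    show ?thesis
      using integral_finite_valued[of "M n" "{..<K l}" "\<lambda>x. Y x l" "\<lambda>_. 1"] YK Yset prob_space_axioms
        prob_measuresD(2,3)[OF M, of n] measure_prob_measures_UNIV[OF M, of n] by simp
  qed
  have summ: "(\<Sum>j<K l. m l j) = 1" for l
  proof -
    have "(\<lambda>n. \<Sum>j<K l. measure (M (r n)) ((\<lambda>x. Y x l) -` {j})) \<longlonglongrightarrow> (\<Sum>j<K l. m l j)"
      by (intro tendsto_sum m_lim)
    then show ?thesis unfolding sumM by (simp add: LIMSEQ_const_iff)
  qed
  have m_split: "m l j = (\<Sum>i<R l. m (Suc l) (j * R l + i))" for l j
  proof (rule LIMSEQ_unique[OF m_lim])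
    have eq: "measure (M n) ((\<lambda>x. Y x l) -` {j}) = (\<Sum>i<R l. measure (M n) ((\<lambda>x. Y x (Suc l)) -` {j * R l + i}))" for n
    proof -
      interpret prob_space "M n" by (rule prob_measuresD[OF M])
      have "(\<lambda>x. Y x l) -` {j} = (\<Union>i<R l. (\<lambda>x. Y x (Suc l)) -` {j * R l + i})"
      proof (intro set_eqI iffI)
        fix x assume "x \<in> (\<lambda>x. Y x l) -` {j}"
        then have "Y x (Suc l) = j * R l + a l x" by (simp add: YS)
        then show "x \<in> (\<Union>i<R l. (\<lambda>x. Y x (Suc l)) -` {j * R l + i})" using aR by blast
      next
        fix x assume "x \<in> (\<Union>i<R l. (\<lambda>x. Y x (Suc l)) -` {j * R l + i})"
        then obtain i where i: "i < R l" "Y x (Suc l) = j * R l + i" by blast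
        then have "Y x l = (j * R l + i) div R l" using Ydiv[of x l] by simp
        then show "x \<in> (\<lambda>x. Y x l) -` {j}" using i(1) by simp
      qed
      moreover have "disjoint_family_on (\<lambda>i. (\<lambda>x. Y x (Suc l)) -` {j * R l + i}) {..<R l}"
        by (auto simp: disjoint_family_on_def)
      moreover have "(\<lambda>i. (\<lambda>x. Y x (Suc l)) -` {j * R l + i}) ` {..<R l} \<subseteq> events"
        unfolding prob_measuresD(2)[OF M] using Yset by blast
      ultimately show ?thesis
        using finite_measure_finite_Union[of "{..<R l}" "\<lambda>i. (\<lambda>x. Y x (Suc l)) -` {j * R l + i}"] by simp
    qed
    show "(\<lambda>n. measure (M (r n)) ((\<lambda>x. Y x l) -` {j})) \<longlonglongrightarrow> (\<Sum>i<R l. m (Suc l) (j * R l + i))"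
      unfolding eq by (intro tendsto_sum m_lim)
  qed
  \<comment> \<open>\<open>F l j\<close> is the left end of the \<open>j\<close>-th subinterval at
    level \<open>l\<close>. Additivity of the limit masses makes level \<open>Suc l\<close> a
    subdivision of level \<open>l\<close>, and \<open>J l t\<close> below picks the subinterval
    containing \<open>t\<close>.\<close>
  define F where "F l j = (\<Sum>i<j. m l i)" for l j
  have F0: "F l 0 = 0" and FS: "F l (Suc j) = F l j + m l j" and FK: "F l (K l) = 1" for l j
    using summ by (simp_all add: F_def)
  have F_mono: "i \<le> j \<Longrightarrow> F l i \<le> F l j" for l i j
    unfolding F_def using m_nn by (intro sum_mono2) auto
  have F_ref: "F (Suc l) (j * R l) = F l j" for l j
  proof (induction j)
    case (Suc j)
    have "F (Suc l) (Suc j * R l) = F (Suc l) (j * R l) + (\<Sum>i<R l. m (Suc l) (j * R l + i))"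
      unfolding F_def using sum_lessThan_add[of "m (Suc l)" "j * R l" "R l"] by (simp add: add.commute)
    then show ?case using Suc by (simp only: FS m_split[of l j, symmetric])
  qed (simp add: F_def)
  define J where "J l t = (LEAST j. t < F l (Suc j))" for l t
  have J: "F l (J l t) \<le> t" "t < F l (Suc (J l t))" "J l t < K l" if "t \<in> {0..<1}" for l t
  proof -
    have K: "K l \<noteq> 0" using YK[of _ l] by (metis less_nat_zero_code)
    have ex: "t < F l (Suc (K l - 1))" using that FK[of l] K by simp
    then show "t < F l (Suc (J l t))" unfolding J_def by (rule LeastI)
    have "J l t \<le> K l - 1" unfolding J_def by (rule Least_le) fact
    then show "J l t < K l" using K by simp
    show "F l (J l t) \<le> t"
    proof (cases "J l t")
      case 0 then show ?thesis using that by (simp add: F0)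
    next
      case (Suc j)
      then have "\<not> t < F l (Suc j)" unfolding J_def using not_less_Least by (metis lessI)
      then show ?thesis using Suc by simp
    qed
  qed
  have J_unique: "J l t = j" if "t \<in> {0..<1}" "F l j \<le> t" "t < F l (Suc j)" for l t j
    using J(1,2)[OF that(1), of l] that(2,3) F_mono[of "Suc j" "J l t" l] F_mono[of "Suc (J l t)" j l]
    by (metis linorder_neqE_nat Suc_leI less_le_not_le order_trans leD le_less_trans)
  have J_div: "J (Suc l) t div R l = J l t" if t: "t \<in> {0..<1}" for l t
  proof (rule J_unique[OF t, symmetric])
    let ?j = "J (Suc l) t"
    have "F l (?j div R l) = F (Suc l) (?j div R l * R l)" by (simp add: F_ref)
    also have "\<dots> \<le> F (Suc l) ?j" by (rule F_mono) (simp add: div_times_less_eq_dividend)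
    finally show "F l (?j div R l) \<le> t" using J(1)[OF t, of "Suc l"] by simp
    have "Suc ?j \<le> Suc (?j div R l) * R l"
      using Rpos[of l] by (metis Suc_leI dividend_less_div_times mult_Suc add.commute)
    then have "F (Suc l) (Suc ?j) \<le> F (Suc l) (Suc (?j div R l) * R l)" by (rule F_mono)
    then show "t < F l (Suc (?j div R l))" using J(2)[OF t, of "Suc l"] unfolding F_ref by simp
  qed
  define rep where "rep l j = (SOME x. Y x l = j)" for l j
  \<comment> \<open>A half-open subinterval that contains \<open>t\<close> has positive length. An
    empty atom would have mass 0 along the whole sequence, so the atom does contain a point.\<close>
  have rep: "Y (rep l (J l t)) l = J l t" if t: "t \<in> {0..<1}" for l t
  proof -
    have "0 < m l (J l t)" using J(1,2)[OF t, of l] by (simp add: FS)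
    moreover have "m l (J l t) = 0" if "(\<lambda>x. Y x l) -` {J l t} = {}"
      using m_lim[of l "J l t"] unfolding that by (simp add: LIMSEQ_const_iff)
    ultimately obtain x where "Y x l = J l t" by fastforce
    then show ?thesis unfolding rep_def by (rule someI)
  qed
  have nested: "Y x l = J l t" if t: "t \<in> {0..<1}" and "l \<le> l'" "Y x l' = J l' t" for l l' t x
    using that(2,3)
  proof (induction rule: dec_induct)
    case (step k)
    have "Y x k = J k t" using Ydiv[of x k] J_div[OF t, of k] step.prems by simp
    then show ?case by (rule step.IH)
  qed
  define p where "p l t = rep l (J l t)" for l t
  \<comment> \<open>By nestedness the representatives of all levels beyond \<open>k\<close> carry
    the same label \<open>a k\<close>. Hence they form a Cauchy sequence, whose limit is \<pi>
    t.\<close>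
  have p_dist: "dist (p l t) (p l' t) < 1 / real (Suc k)" if "t \<in> {0..<1}" "Suc k \<le> l" "Suc k \<le> l'" for l l' t k
  proof (rule a_dist)
    have "Y (p l t) (Suc k) = Y (p l' t) (Suc k)"
      using nested[OF that(1,2), of "p l t"] nested[OF that(1,3), of "p l' t"] rep[OF that(1)] by (simp add: p_def)
    then show "a k (p l t) = a k (p l' t)" by (metis Ymod)
  qed
  have "Cauchy (\<lambda>l. p l t)" if "t \<in> {0..<1}" for t
  proof (rule metric_CauchyI)
    fix e :: real assume "0 < e"
    then obtain k where "1 / real (Suc k) < e" using nat_approx_posE by blast
    then show "\<exists>N. \<forall>m\<ge>N. \<forall>n\<ge>N. dist (p m t) (p n t) < e"
      using p_dist[OF that] by (meson less_trans)
  qed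
  then have "\<exists>y. (\<lambda>l. p l t) \<longlonglongrightarrow> y" if "t \<in> {0..<1}" for t
    using compact_imp_complete[OF compact_UNIV] that unfolding complete_def by blast
  then obtain \<pi> where \<pi>: "\<And>t. t \<in> {0..<1} \<Longrightarrow> (\<lambda>l. p l t) \<longlonglongrightarrow> \<pi> t" by metis
  define N where "N = restrict_space lborel {0..<1::real}"
  have spN: "space N = {0..<1}" by (simp add: N_def space_restrict_space)
  have prN: "prob_space N"
    by (rule prob_spaceI) (simp add: N_def space_restrict_space emeasure_restrict_space)
  have J_meas: "J l \<in> measurable N (count_space UNIV)" for l
  proof -
    have "J l \<in> measurable borel (count_space UNIV)"
      unfolding J_def[abs_def] by (rule measurable_Least) measurable
    then show ?thesis unfolding N_def by (intro measurable_restrict_space1) simp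
  qed
  have p_meas: "p l \<in> borel_measurable N" for l
    unfolding p_def[abs_def] by (rule measurable_compose[OF J_meas]) simp
  have \<pi>_meas: "\<pi> \<in> borel_measurable N"
    by (rule borel_measurable_LIMSEQ_metric[where f = p]) (use \<pi> spN p_meas in auto)
  define \<mu> where "\<mu> = distr N borel \<pi>"
  have "\<mu> \<in> prob_measures"
    unfolding prob_measures_def \<mu>_def using prob_space.prob_space_distr[OF prN \<pi>_meas] by simp
  moreover have "weak_conv (M \<circ> r) \<mu>"
    unfolding weak_conv_def
  proof (intro allI impI)
    fix h :: "'a \<Rightarrow> real" assume h: "continuous_on UNIV h"
    interpret N: prob_space N by (rule prN)
    obtain B where B: "0 < B" "\<And>x. \<bar>h x\<bar> \<le> B" using continuous_bounded[OF h] by blast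
    have hb [measurable]: "h \<in> borel_measurable borel" using h by (rule borel_measurable_continuous_onI)
    define S where "S l = (\<Sum>j<K l. h (rep l j) * m l j)" for l
    have NJ: "measure N (J l -` {j} \<inter> space N) = m l j" if "j < K l" for l j
    proof -
      have "J l -` {j} \<inter> space N = {F l j..<F l (Suc j)}"
      proof (intro set_eqI iffI)
        fix t assume t: "t \<in> {F l j..<F l (Suc j)}"
        have "0 \<le> F l j" using F_mono[of 0 j l] F0 by simp
        moreover have "F l (Suc j) \<le> 1" using F_mono[of "Suc j" "K l" l] that FK by simp
        ultimately have t01: "t \<in> {0..<1}" using t by auto
        then show "t \<in> J l -` {j} \<inter> space N" using J_unique[of t l j] t spN by auto
      next
        fix t assume "t \<in> J l -` {j} \<inter> space N"
        then show "t \<in> {F l j..<F l (Suc j)}" using J(1,2)[of t l] spN by auto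
      qed
      moreover have "{F l j..<F l (Suc j)} \<subseteq> {0..<1}"
        using F_mono[of 0 j l] F0[of l] F_mono[of "Suc j" "K l" l] that FK[of l] by auto
      ultimately show ?thesis
        using m_nn[of l j] by (simp add: N_def measure_restrict_space FS)
    qed
    have S_int: "S l = (\<integral>t. h (p l t) \<partial>N)" for l
      unfolding S_def p_def using J(3) spN NJ measurable_sets[OF J_meas[of l]]
      by (subst integral_finite_valued[OF prN, of "{..<K l}" "J l" "\<lambda>j. h (rep l j)"]) auto
    have "(\<lambda>l. \<integral>t. h (p l t) \<partial>N) \<longlonglongrightarrow> (\<integral>t. h (\<pi> t) \<partial>N)"
    proof (rule integral_dominated_convergence[where w = "\<lambda>_. B"])
      show "AE t in N. (\<lambda>l. h (p l t)) \<longlonglongrightarrow> h (\<pi> t)"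
        by (rule AE_I2, rule continuous_on_tendsto_compose[OF h \<pi>]) (simp_all add: spN)
    qed (use B p_meas \<pi>_meas in \<open>auto intro: measurable_compose[OF _ hb]\<close>)
    also have "(\<integral>t. h (\<pi> t) \<partial>N) = (\<integral>x. h x \<partial>\<mu>)"
      unfolding \<mu>_def using \<pi>_meas by (simp add: integral_distr)
    finally have S_lim: "S \<longlonglongrightarrow> (\<integral>x. h x \<partial>\<mu>)" by (simp add: S_int[symmetric])
    show "(\<lambda>n. \<integral>x. h x \<partial>(M \<circ> r) n) \<longlonglongrightarrow> (\<integral>x. h x \<partial>\<mu>)"
    proof (rule LIMSEQ_I)
      fix e :: real assume e: "0 < e"
      obtain \<delta> where \<delta>: "0 < \<delta>" "\<And>x y. dist x y < \<delta> \<Longrightarrow> dist (h x) (h y) < e/4"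
        using uniform_modulus[OF h, of "e/4"] e by auto
      obtain k where k: "1 / real (Suc k) < \<delta>" using nat_approx_posE \<delta>(1) by blast
      obtain l0 where l0: "\<And>l. l \<ge> l0 \<Longrightarrow> norm (S l - (\<integral>x. h x \<partial>\<mu>)) < e/4"
        using LIMSEQ_D[OF S_lim, of "e/4"] e by auto
      define l where "l = max l0 (Suc k)"
      \<comment> \<open>Replacing \<open>h\<close> by its value at the representative of the atom
        costs at most \<open>e / 4\<close> for every \<open>n\<close> at once, because the atoms of
        level \<open>l\<close> refine the labels \<open>a k\<close>. This uniformity allows
        \<open>l\<close> to be fixed before \<open>n\<close>.\<close>
      have app: "\<bar>(\<integral>x. h x \<partial>M n) - (\<Sum>j<K l. h (rep l j) * measure (M n) ((\<lambda>x. Y x l) -` {j}))\<bar> \<le> e/4" for n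
      proof -
        interpret Mn: prob_space "M n" by (rule prob_measuresD[OF M])
        have [measurable_cong]: "sets (M n) = sets borel" by (rule prob_measuresD[OF M])
        have sp: "space (M n) = UNIV" by (rule prob_measuresD[OF M])
        have m1: "(\<lambda>x. h (rep l (Y x l))) \<in> borel_measurable borel"
          by (rule measurable_compose[OF Ymeas]) simp
        have i1: "integrable (M n) (\<lambda>x. h (rep l (Y x l)))"
          by (rule prob_measures_integrable[OF M m1 B(2)])
        have "\<bar>(\<integral>x. h x \<partial>M n) - (\<integral>x. h (rep l (Y x l)) \<partial>M n)\<bar> = \<bar>\<integral>x. h x - h (rep l (Y x l)) \<partial>M n\<bar>"
          using continuous_integrable[OF M h] i1 by simp
        also have "\<dots> \<le> (\<integral>x. \<bar>h x - h (rep l (Y x l))\<bar> \<partial>M n)" by (rule integral_abs_bound)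
        also have "\<dots> \<le> (\<integral>x. e/4 \<partial>M n)"
        proof (rule integral_mono)
          show "integrable (M n) (\<lambda>x. \<bar>h x - h (rep l (Y x l))\<bar>)"
            using continuous_integrable[OF M h, of n] i1 by auto
          fix x
          have Y: "Y (rep l (Y x l)) l = Y x l" unfolding rep_def by (rule someI[of _ x]) simp
          have "Y (rep l (Y x l)) (l - i) = Y x (l - i)" for i
          proof (induction i)
            case (Suc i)
            show ?case
            proof (cases "l - i")
              case (Suc q)
              then have "l - Suc i = q" by simp
              then show ?thesis using Suc.IH Suc Ydiv by metis
            qed (use Suc in simp)
          qed (use Y in simp)
          from this[of "l - Suc k"] have "Y (rep l (Y x l)) (Suc k) = Y x (Suc k)" by (simp add: l_def)
          then have "a k x = a k (rep l (Y x l))" using Ymod by metis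
          then have "dist x (rep l (Y x l)) < \<delta>" using a_dist k by (meson less_trans)
          then show "\<bar>h x - h (rep l (Y x l))\<bar> \<le> e/4" using \<delta>(2) by (fastforce simp: dist_real_def)
        qed auto
        also have "\<dots> = e/4" using Mn.prob_space by simp
        also have "(\<integral>x. h (rep l (Y x l)) \<partial>M n) = (\<Sum>j<K l. h (rep l j) * measure (M n) ((\<lambda>x. Y x l) -` {j}))"
          using integral_finite_valued[OF Mn.prob_space_axioms, of "{..<K l}" "\<lambda>x. Y x l" "\<lambda>j. h (rep l j)"]
            YK Yset prob_measuresD(2)[OF M, of n] by (simp add: sp)
        finally show ?thesis .
      qed
      have "(\<lambda>n. \<Sum>j<K l. h (rep l j) * measure (M (r n)) ((\<lambda>x. Y x l) -` {j})) \<longlonglongrightarrow> S l"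
        unfolding S_def by (intro tendsto_intros m_lim)
      from LIMSEQ_D[OF this, of "e/4"] e obtain n0 where
        n0: "\<And>n. n \<ge> n0 \<Longrightarrow> norm ((\<Sum>j<K l. h (rep l j) * measure (M (r n)) ((\<lambda>x. Y x l) -` {j})) - S l) < e/4"
        by auto
      have "norm ((\<integral>x. h x \<partial>(M \<circ> r) n) - (\<integral>x. h x \<partial>\<mu>)) < e" if "n \<ge> n0" for n
      proof -
        have "\<bar>S l - (\<integral>x. h x \<partial>\<mu>)\<bar> < e/4" using l0[of l] by (simp add: l_def)
        then show ?thesis using app[of "r n"] n0[OF that] unfolding real_norm_def comp_def by arith
      qed
      then show "\<exists>no. \<forall>n\<ge>no. norm ((\<integral>x. h x \<partial>(M \<circ> r) n) - (\<integral>x. h x \<partial>\<mu>)) < e" by blast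
    qed
  qed
  ultimately show thesis using that r(1) by blast
qed


section \<open>The separating sequence and the metric built from it\<close>

lemma f_cont: "continuous_on UNIV (apply_bcontfun (f k))"
  by (simp add: continuous_on_apply_bcontfun)

lemma f_range: "0 \<le> f k x" "f k x \<le> 1"
  using dense_f unfolding dense_in_C01_def Let_def by auto

lemma f_abs_le: "\<bar>f k x\<bar> \<le> 1"
  using f_range[of k x] by simp

lemma f_approx:
  fixes h :: "'a \<Rightarrow> real"
  assumes h: "continuous_on UNIV h" "\<And>x. 0 \<le> h x \<and> h x \<le> 1" and e: "0 < e"
  obtains k where "\<And>x. \<bar>f k x - h x\<bar> < e"
proof -
  have "h \<in> bcontfun"
    unfolding bcontfun_def using h by (auto intro!: boundedI[of _ 1])
  then have Bh: "apply_bcontfun (Bcontfun h) = h" by (rule Bcontfun_inverse)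
  then have "Bcontfun h \<in> {h. \<forall>x. apply_bcontfun h x \<in> {0..1}}" using h(2) by simp
  then have "Bcontfun h \<in> closure (range f)"
    using dense_f unfolding dense_in_C01_def Let_def by blast
  then obtain k where k: "dist (f k) (Bcontfun h) < e"
    unfolding closure_approachable using e by auto
  show thesis
  proof (rule that)
    fix x show "\<bar>f k x - h x\<bar> < e"
      using dist_bounded[of "f k" x "Bcontfun h"] k by (simp add: Bh dist_real_def)
  qed
qed

lemma prob_measures_eq_fI:
  fixes \<mu> \<nu> :: "'a measure"
  assumes \<mu>: "\<mu> \<in> prob_measures" and \<nu>: "\<nu> \<in> prob_measures"
    and eq: "\<And>k. (\<integral>x. f k x \<partial>\<mu>) = (\<integral>x. f k x \<partial>\<nu>)"
  shows "\<mu> = \<nu>"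
proof (rule prob_measures_eq_continuousI[OF \<mu> \<nu>])
  fix h :: "'a \<Rightarrow> real" assume h: "continuous_on UNIV h" "\<And>x. 0 \<le> h x \<and> h x \<le> 1"
  have "\<bar>(\<integral>x. h x \<partial>\<mu>) - (\<integral>x. h x \<partial>\<nu>)\<bar> \<le> e" if e: "0 < e" for e
  proof -
    obtain k where k: "\<And>x. \<bar>f k x - h x\<bar> < e / 2" using f_approx[OF h, of "e/2"] e by auto
    have "\<bar>(\<integral>x. f k x \<partial>\<rho>) - (\<integral>x. h x \<partial>\<rho>)\<bar> \<le> e / 2" if "\<rho> \<in> prob_measures" for \<rho>
      using integral_diff_le[OF that f_cont h(1), of k "e/2"] k by (simp add: less_imp_le)
    from this[OF \<mu>] this[OF \<nu>] eq[of k] show ?thesis by arith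
  qed
  then show "(\<integral>x. h x \<partial>\<mu>) = (\<integral>x. h x \<partial>\<nu>)"
    by (metis abs_le_zero_iff field_le_epsilon add_0 eq_iff_diff_eq_0)
qed

definition d :: "'a \<Rightarrow> 'a \<Rightarrow> real" where "d = rho_dist f"

lemma d_eq: "d x y = (\<Sum>k. (1/2) ^ Suc k * \<bar>f k x - f k y\<bar>)"
  unfolding d_def rho_dist_def rho_def
  by (simp add: integral_return borel_measurable_continuous_onI[OF f_cont])

lemma f_diff_le: "\<bar>f k x - f k y\<bar> \<le> 1"
  using f_range[of k x] f_range[of k y] by (simp add: abs_le_iff)

lemma d_term_le: "norm ((1/2) ^ Suc k * \<bar>f k x - f k y\<bar>) \<le> (1/2) ^ Suc k"
  using f_diff_le[of k x y] by (simp add: mult_le_one)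

lemma summable_half: "summable (\<lambda>k. (1/2::real) ^ Suc k)"
  using power_half_series sums_iff by blast

lemma d_summable: "summable (\<lambda>k. (1/2) ^ Suc k * \<bar>f k x - f k y\<bar>)"
  by (rule summable_comparison_test'[OF summable_half, of 0]) (use d_term_le in auto)

lemma d_nonneg: "0 \<le> d x y"
  unfolding d_eq by (rule suminf_nonneg[OF d_summable]) simp

lemma d_refl [simp]: "d x x = 0"
  by (simp add: d_eq)

lemma d_sym: "d x y = d y x"
  by (simp add: d_eq abs_minus_commute)

lemma d_triangle: "d x z \<le> d x y + d y z"
  unfolding d_eq suminf_add[OF d_summable d_summable]
proof (rule suminf_le[OF _ d_summable summable_add[OF d_summable d_summable]])
  fix k
  show "(1/2) ^ Suc k * \<bar>f k x - f k z\<bar> \<le> (1/2) ^ Suc k * \<bar>f k x - f k y\<bar> + (1/2) ^ Suc k * \<bar>f k y - f k z\<bar>"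
    unfolding distrib_left[symmetric] by (rule mult_left_mono) auto
qed

lemma d_cont: "continuous_on UNIV (\<lambda>p. d (fst p) (snd p))"
proof (rule uniform_limit_theorem)
  show "uniform_limit UNIV (\<lambda>n p. \<Sum>k<n. (1/2) ^ Suc k * \<bar>f k (fst p) - f k (snd p)\<bar>)
      (\<lambda>p. d (fst p) (snd p)) sequentially"
    unfolding d_eq by (rule Weierstrass_m_test[OF d_term_le summable_half])
  show "\<forall>\<^sub>F n in sequentially. continuous_on UNIV
      (\<lambda>p. \<Sum>k<n. (1/2) ^ Suc k * \<bar>f k (fst p) - f k (snd p)\<bar>)"
    by (intro always_eventually allI continuous_intros continuous_on_compose2[OF f_cont]) auto
qed simp

lemma continuous_on_d:
  assumes "continuous_on S g" "continuous_on S h"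
  shows "continuous_on S (\<lambda>x. d (g x) (h x))"
  using continuous_on_compose2[OF d_cont, of S "\<lambda>x. (g x, h x)"] assms
  by (simp add: continuous_on_Pair)

lemma compact_UNIV2: "compact (UNIV :: ('a \<times> 'a) set)"
  using compact_Times[OF compact_UNIV compact_UNIV] by simp

lemma d_small:
  assumes "0 < e" obtains \<delta> where "0 < \<delta>" "\<And>x y. dist x y < \<delta> \<Longrightarrow> d x y < e"
proof -
  have "\<exists>\<delta>>0. \<forall>p\<in>UNIV. \<forall>q\<in>UNIV. dist q p < \<delta> \<longrightarrow> dist (d (fst q) (snd q)) (d (fst p) (snd p)) < e"
    using compact_uniformly_continuous[OF d_cont compact_UNIV2] assms
    unfolding uniformly_continuous_on_def by simp
  then obtain \<delta> where \<delta>: "0 < \<delta>" "\<And>p q. dist q p < \<delta> \<Longrightarrow> dist (d (fst q) (snd q)) (d (fst p) (snd p)) < e"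
    by auto
  show thesis
  proof (rule that[OF \<delta>(1)])
    fix x y :: 'a assume "dist x y < \<delta>"
    then show "d x y < e" using \<delta>(2)[of "(x, y)" "(y, y)"] d_nonneg[of x y] by (simp add: dist_Pair_Pair dist_real_def)
  qed
qed

text \<open>The function \<open>min 1 (dist x z)\<close> of \<open>z\<close> vanishes at
  \<open>x\<close> but not at \<open>y\<close>; an \<open>f k\<close> approximating it to within a
  third of its value at \<open>y\<close> separates the two points.\<close>

lemma d_pos: "x \<noteq> y \<Longrightarrow> 0 < d x y"
proof -
  assume xy: "x \<noteq> y"
  let ?h = "\<lambda>z. min 1 (dist x z)"
  have pos: "0 < ?h y / 3" using xy by simp
  have "continuous_on UNIV ?h" by (intro continuous_intros)
  then obtain k where k: "\<And>z. \<bar>f k z - ?h z\<bar> < ?h y / 3"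
    using f_approx[of ?h "?h y / 3"] pos by auto
  define c where "c = min 1 (dist x y)"
  have "\<bar>f k x\<bar> < c / 3" "\<bar>f k y - c\<bar> < c / 3" "0 < c"
    using k[of x] k[of y] pos by (simp_all add: c_def)
  then have "f k x \<noteq> f k y" by arith
  then have "0 < (1/2) ^ Suc k * \<bar>f k x - f k y\<bar>" by simp
  then show "0 < d x y" unfolding d_eq by (intro suminf_pos2[OF d_summable]) auto
qed

text \<open>On the compact set of pairs at \<open>dist\<close>-distance at least \<open>e\<close>
  the continuous function \<open>d\<close> has a positive minimum. Together with
  \<open>d_small\<close> this makes the two metrics uniformly equivalent, so that moduli of
  continuity transfer to \<open>d\<close>.\<close>

lemma dist_small:
  assumes "0 < e" obtains \<delta> where "0 < \<delta>" "\<And>x y. d x y < \<delta> \<Longrightarrow> dist x y < e"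
proof -
  let ?K = "{p :: 'a \<times> 'a. e \<le> dist (fst p) (snd p)}"
  have "closed ?K" by (intro closed_Collect_le continuous_intros)
  then have K: "compact ?K" using compact_UNIV2 closed_Int_compact[of ?K UNIV] by simp
  show thesis
  proof (cases "?K = {}")
    case True
    then have "dist x y < e" for x y :: 'a by (auto simp: not_le[symmetric])
    then show ?thesis using that[of 1] by simp
  next
    case False
    obtain p where p: "p \<in> ?K" "\<And>q. q \<in> ?K \<Longrightarrow> d (fst p) (snd p) \<le> d (fst q) (snd q)"
      using continuous_attains_inf[OF K False continuous_on_subset[OF d_cont]] by auto
    have "fst p \<noteq> snd p" using p(1) assms by auto
    then have "0 < d (fst p) (snd p)" by (rule d_pos)
    moreover have "dist x y < e" if "d x y < d (fst p) (snd p)" for x y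
      using p(2)[of "(x, y)"] that by (auto simp: not_le[symmetric])
    ultimately show ?thesis by (rule that)
  qed
qed

lemma d_modulus:
  fixes h :: "'a \<Rightarrow> 'b::metric_space"
  assumes "continuous_on UNIV h" "0 < e"
  obtains \<delta> where "0 < \<delta>" "\<And>x y. d x y \<le> \<delta> \<Longrightarrow> dist (h x) (h y) < e"
proof -
  obtain \<eta> where \<eta>: "0 < \<eta>" "\<And>x y. dist x y < \<eta> \<Longrightarrow> dist (h x) (h y) < e"
    using uniform_modulus[OF assms] by blast
  obtain \<delta> where "0 < \<delta>" "\<And>x y. d x y < \<delta> \<Longrightarrow> dist x y < \<eta>"
    using dist_small[OF \<eta>(1)] by blast
  then show thesis using that[of "\<delta>/2"] \<eta>(2) by simp
qed

section \<open>Iterates, invariant measures and limits of empirical measures\<close>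

lemma cont_Tn: "continuous_on UNIV (T ^^ n)"
proof (induction n)
  case (Suc n)
  then show ?case using continuous_on_compose2[OF cont_T] by (simp add: comp_def)
qed (simp add: continuous_on_id)

lemma measurable_Tn: "T ^^ n \<in> measurable borel borel"
  by (rule borel_measurable_continuous_onI[OF cont_Tn])

lemma invariantD:
  assumes "\<mu> \<in> invariant_measures T"
  shows "\<mu> \<in> prob_measures" "distr \<mu> borel T = \<mu>"
  using assms by (auto simp: invariant_measures_def)

lemma distr_Tn:
  assumes "\<mu> \<in> invariant_measures T"
  shows "distr \<mu> borel (T ^^ n) = \<mu>"
proof (induction n)
  case 0
  show ?case using prob_measuresD[OF invariantD(1)[OF assms]] distr_id2[of borel \<mu>] by (simp add: id_def)
next
  case (Suc n)
  have s: "sets \<mu> = sets borel" using prob_measuresD[OF invariantD(1)[OF assms]] by simp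
  have "distr \<mu> borel (T ^^ Suc n) = distr (distr \<mu> borel (T ^^ n)) borel T"
    using measurable_Tn[of n] measurable_Tn[of 1] s
    by (subst distr_distr) (auto simp: comp_def cong: measurable_cong_sets)
  then show ?case unfolding Suc invariantD(2)[OF assms] .
qed

lemma measure_vimage_Tn:
  assumes "\<mu> \<in> invariant_measures T" "A \<in> sets borel"
  shows "measure \<mu> ((T ^^ n) -` A) = measure \<mu> A"
proof -
  have s: "sets \<mu> = sets borel" "space \<mu> = UNIV" using prob_measuresD[OF invariantD(1)[OF assms(1)]] by simp_all
  have "measure (distr \<mu> borel (T ^^ n)) A = measure \<mu> ((T ^^ n) -` A)"
    using measurable_Tn[of n] s assms(2) by (subst measure_distr) (auto cong: measurable_cong_sets)
  then show ?thesis using distr_Tn[OF assms(1)] by simp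
qed

lemma vimage_Tn_sets: "A \<in> sets borel \<Longrightarrow> (T ^^ n) -` A \<in> sets borel"
  using measurable_sets[OF measurable_Tn, of A n] by simp

lemma integral_Tn:
  fixes h :: "'a \<Rightarrow> real"
  assumes "\<mu> \<in> invariant_measures T" "h \<in> borel_measurable borel"
  shows "(\<integral>x. h ((T ^^ n) x) \<partial>\<mu>) = (\<integral>x. h x \<partial>\<mu>)"
proof -
  have s: "sets \<mu> = sets borel" using prob_measuresD[OF invariantD(1)[OF assms(1)]] by simp
  have "(\<integral>x. h x \<partial>distr \<mu> borel (T ^^ n)) = (\<integral>x. h ((T ^^ n) x) \<partial>\<mu>)"
    using measurable_Tn[of n] s assms(2) by (intro integral_distr) (auto cong: measurable_cong_sets)
  then show ?thesis using distr_Tn[OF assms(1)] by simp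
qed

lemma invariantI:
  assumes \<mu>: "\<mu> \<in> prob_measures"
    and "\<And>h :: 'a \<Rightarrow> real. continuous_on UNIV h \<Longrightarrow> (\<integral>x. h (T x) \<partial>\<mu>) = (\<integral>x. h x \<partial>\<mu>)"
  shows "\<mu> \<in> invariant_measures T"
proof -
  have s: "sets \<mu> = sets borel" using prob_measuresD[OF \<mu>] by simp
  have T: "T \<in> measurable \<mu> borel" using measurable_Tn[of 1] s by (simp cong: measurable_cong_sets)
  interpret prob_space \<mu> by (rule prob_measuresD[OF \<mu>])
  have "distr \<mu> borel T \<in> prob_measures" using prob_space_distr[OF T] by (simp add: prob_measures_def)
  then have "distr \<mu> borel T = \<mu>"
  proof (rule prob_measures_eq_continuousI[OF _ \<mu>])
    fix h :: "'a \<Rightarrow> real" assume "continuous_on UNIV h"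
    then show "(\<integral>x. h x \<partial>distr \<mu> borel T) = (\<integral>x. h x \<partial>\<mu>)"
      using assms(2)[of h] T by (simp add: integral_distr borel_measurable_continuous_onI)
  qed
  then show ?thesis using \<mu> by (simp add: invariant_measures_def)
qed

lemma invariant_weak_limit:
  assumes "\<And>n. M n \<in> invariant_measures T" "\<mu> \<in> prob_measures" "weak_conv M \<mu>"
  shows "\<mu> \<in> invariant_measures T"
proof (rule invariantI[OF assms(2)])
  fix h :: "'a \<Rightarrow> real" assume h: "continuous_on UNIV h"
  have "(\<lambda>n. \<integral>x. h x \<partial>M n) \<longlonglongrightarrow> (\<integral>x. h x \<partial>\<mu>)"
    using assms(3) h by (simp add: weak_conv_def)
  moreover have "(\<lambda>n. \<integral>x. h (T x) \<partial>M n) \<longlonglongrightarrow> (\<integral>x. h (T x) \<partial>\<mu>)"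
    using assms(3) continuous_on_compose2[OF h cont_T] by (simp add: weak_conv_def)
  moreover have "(\<integral>x. h (T x) \<partial>M n) = (\<integral>x. h x \<partial>M n)" for n
    using integral_Tn[OF assms(1), of h n 1] h by (simp add: borel_measurable_continuous_onI)
  ultimately show "(\<integral>x. h (T x) \<partial>\<mu>) = (\<integral>x. h x \<partial>\<mu>)"
    by (simp add: LIMSEQ_unique)
qed

lemma invariant_seq_compact:
  fixes M :: "nat \<Rightarrow> 'a measure"
  assumes "\<And>n. M n \<in> invariant_measures T"
  obtains r \<mu> where "strict_mono r" "\<mu> \<in> invariant_measures T" "weak_conv (M \<circ> r) \<mu>"
proof -
  obtain r \<mu> where r: "strict_mono r" "\<mu> \<in> prob_measures" "weak_conv (M \<circ> r) \<mu>"
    using prob_measures_seq_compact[OF invariantD(1)[OF assms]] .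
  moreover have "\<mu> \<in> invariant_measures T"
    by (rule invariant_weak_limit[OF _ r(2,3)]) (simp add: assms)
  ultimately show thesis using that by blast
qed

lemma mix_invariant:
  assumes "\<mu> \<in> invariant_measures T" "\<nu> \<in> invariant_measures T" "0 \<le> s" "s \<le> 1"
  shows "mix s \<mu> \<nu> \<in> invariant_measures T"
proof (rule invariantI)
  note p = invariantD(1)[OF assms(1)] invariantD(1)[OF assms(2)]
  show "mix s \<mu> \<nu> \<in> prob_measures" by (rule mix_in_prob_measures[OF p assms(3,4)])
  fix h :: "'a \<Rightarrow> real" assume h: "continuous_on UNIV h"
  have hT: "continuous_on UNIV (\<lambda>x. h (T x))" using continuous_on_compose2[OF h cont_T] by simp
  show "(\<integral>x. h (T x) \<partial>mix s \<mu> \<nu>) = (\<integral>x. h x \<partial>mix s \<mu> \<nu>)"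
    unfolding integral_mix_continuous[OF p assms(3,4) h] integral_mix_continuous[OF p assms(3,4) hT]
    using integral_Tn[OF assms(1), of h 1] integral_Tn[OF assms(2), of h 1] h
    by (simp add: borel_measurable_continuous_onI)
qed

lemma birkhoff_sum_add:
  "birkhoff_sum T (m + n) h x = birkhoff_sum T m h x + birkhoff_sum T n h ((T ^^ m) x)"
proof -
  have "(T ^^ (m + i)) x = (T ^^ i) ((T ^^ m) x)" for i
    by (metis add.commute comp_apply funpow_add)
  then show ?thesis by (simp add: birkhoff_sum_def sum_lessThan_add)
qed

lemma birkhoff_sum_abs_le:
  fixes h :: "'a \<Rightarrow> real"
  assumes "\<And>x. \<bar>h x\<bar> \<le> B"
  shows "\<bar>birkhoff_sum T n h x\<bar> \<le> real n * B"
proof -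
  have "\<bar>birkhoff_sum T n h x\<bar> \<le> (\<Sum>i<n. \<bar>h ((T ^^ i) x)\<bar>)" unfolding birkhoff_sum_def by (rule sum_abs)
  also have "\<dots> \<le> (\<Sum>i<n. B)" using assms by (rule sum_mono)
  finally show ?thesis by simp
qed

lemma empirical_prob: "empirical T (Suc n) x \<in> prob_measures"
  by (rule empirical_in_prob_measures) simp

text \<open>Birkhoff sums of \<open>h\<close> composed with \<open>T\<close> and of \<open>h\<close>
  differ by two boundary terms, so the two integrals against an empirical measure of length
  \<open>n\<close> differ by at most \<open>2 * B / n\<close>.\<close>

lemma empirical_limit_invariant:
  assumes r: "strict_mono r" and \<mu>: "\<mu> \<in> prob_measures" and conv: "weak_conv (\<lambda>i. empirical T (Suc (r i)) x) \<mu>"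
  shows "\<mu> \<in> invariant_measures T"
proof (rule invariantI[OF \<mu>])
  fix h :: "'a \<Rightarrow> real" assume h: "continuous_on UNIV h"
  have hT: "continuous_on UNIV (\<lambda>x. h (T x))" using continuous_on_compose2[OF h cont_T] by simp
  obtain B where B: "0 < B" "\<And>x. \<bar>h x\<bar> \<le> B" using continuous_bounded[OF h] by blast
  have shift: "birkhoff_sum T n (\<lambda>x. h (T x)) x = birkhoff_sum T n h x - h x + h ((T ^^ n) x)" for n
    by (induction n) (simp_all add: birkhoff_sum_def)
  have "(\<lambda>i. (\<integral>y. h (T y) \<partial>empirical T (Suc (r i)) x) - (\<integral>y. h y \<partial>empirical T (Suc (r i)) x)) \<longlonglongrightarrow> 0"
  proof (rule Lim_null_comparison)
    show "\<forall>\<^sub>F i in sequentially. norm ((\<integral>y. h (T y) \<partial>empirical T (Suc (r i)) x) - (\<integral>y. h y \<partial>empirical T (Suc (r i)) x))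
        \<le> 2 * B * (1 / real (Suc (r i)))"
    proof (intro always_eventually allI)
      fix i
      have "\<bar>h ((T ^^ Suc (r i)) x) - h x\<bar> \<le> 2 * B"
        using B(2)[of "(T ^^ Suc (r i)) x"] B(2)[of x] by arith
      moreover have "(\<integral>y. h (T y) \<partial>empirical T (Suc (r i)) x) - (\<integral>y. h y \<partial>empirical T (Suc (r i)) x)
          = (h ((T ^^ Suc (r i)) x) - h x) / real (Suc (r i))"
        using integral_empirical_continuous[OF _ h, of "Suc (r i)" x] integral_empirical_continuous[OF _ hT, of "Suc (r i)" x]
        by (simp add: shift diff_divide_distrib add_divide_distrib)
      ultimately show "norm ((\<integral>y. h (T y) \<partial>empirical T (Suc (r i)) x) - (\<integral>y. h y \<partial>empirical T (Suc (r i)) x))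
        \<le> 2 * B * (1 / real (Suc (r i)))"
        by (simp add: divide_right_mono)
    qed
    have "(\<lambda>i. 1 / real (Suc (r i))) \<longlonglongrightarrow> 0"
      using LIMSEQ_subseq_LIMSEQ[OF LIMSEQ_Suc[OF lim_inverse_n'] r] by (simp add: comp_def)
    then show "(\<lambda>i. 2 * B * (1 / real (Suc (r i)))) \<longlonglongrightarrow> 0" by (rule tendsto_mult_right_zero)
  qed
  moreover have "(\<lambda>i. (\<integral>y. h (T y) \<partial>empirical T (Suc (r i)) x) - (\<integral>y. h y \<partial>empirical T (Suc (r i)) x))
      \<longlonglongrightarrow> (\<integral>x. h (T x) \<partial>\<mu>) - (\<integral>x. h x \<partial>\<mu>)"
    using conv h hT unfolding weak_conv_def by (intro tendsto_diff) auto
  ultimately have "0 = (\<integral>x. h (T x) \<partial>\<mu>) - (\<integral>x. h x \<partial>\<mu>)" by (rule LIMSEQ_unique)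
  then show "(\<integral>x. h (T x) \<partial>\<mu>) = (\<integral>x. h x \<partial>\<mu>)" by simp
qed

lemma empirical_subseq_limit:
  assumes r: "strict_mono (r :: nat \<Rightarrow> nat)"
  obtains q \<mu> where "strict_mono q" "\<mu> \<in> invariant_measures T" "weak_conv (\<lambda>i. empirical T (Suc (r (q i))) x) \<mu>"
proof -
  obtain q \<mu> where q: "strict_mono q" "\<mu> \<in> prob_measures" "weak_conv ((\<lambda>i. empirical T (Suc (r i)) x) \<circ> q) \<mu>"
    using prob_measures_seq_compact[of "\<lambda>i. empirical T (Suc (r i)) x", OF empirical_prob] .
  then have c: "weak_conv (\<lambda>i. empirical T (Suc (r (q i))) x) \<mu>" by (simp add: comp_def)
  show thesis
    using that[OF q(1) empirical_limit_invariant[OF strict_mono_o[OF r q(1)] q(2)]] c by (simp add: comp_def)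
qed

section \<open>Sets with null boundary under weak convergence\<close>

lemma outer_approx:
  assumes \<mu>: "\<mu> \<in> prob_measures" and C: "closed C" and e: "0 < e"
  obtains h :: "'a \<Rightarrow> real" where "continuous_on UNIV h" "\<And>x. indicator C x \<le> h x" "(\<integral>x. h x \<partial>\<mu>) < measure \<mu> C + e"
proof (cases "C = {}")
  case True
  then show thesis using that[of "\<lambda>_. 0"] e by simp
next
  case False
  have "\<forall>\<^sub>F k in sequentially. (\<integral>x. max 0 (1 - real k * infdist x C) \<partial>\<mu>) < measure \<mu> C + e"
    using order_tendstoD(2)[OF measure_closed_approx[OF \<mu> C False]] e by simp
  then obtain k where k: "(\<integral>x. max 0 (1 - real k * infdist x C) \<partial>\<mu>) < measure \<mu> C + e"
    by (auto simp: eventually_sequentially)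
  show thesis
    by (rule that[OF _ _ k]) (auto intro!: continuous_intros simp: indicator_def)
qed

lemma measure_le_integral:
  fixes h :: "'a \<Rightarrow> real"
  assumes \<mu>: "\<mu> \<in> prob_measures" and h: "continuous_on UNIV h" and C: "C \<in> sets borel" "\<And>x. indicator C x \<le> h x"
  shows "measure \<mu> C \<le> (\<integral>x. h x \<partial>\<mu>)"
proof -
  interpret prob_space \<mu> by (rule prob_measuresD[OF \<mu>])
  have "(\<integral>x. indicator C x \<partial>\<mu>) \<le> (\<integral>x. h x \<partial>\<mu>)"
    using continuous_integrable[OF \<mu> h] C prob_measuresD[OF \<mu>]
    by (intro integral_mono) (auto simp: emeasure_eq_measure)
  then show ?thesis using prob_measuresD[OF \<mu>] by simp
qed

lemma measure_Compl_prob: "\<mu> \<in> prob_measures \<Longrightarrow> C \<in> sets borel \<Longrightarrow> measure \<mu> (- C) = 1 - measure \<mu> C"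
  using prob_space.prob_compl[of \<mu> C] prob_measuresD[of \<mu>] by (simp add: Compl_eq_Diff_UNIV)

text \<open>A quantitative portmanteau theorem. Continuous majorants of the indicators of
  \<open>closure C\<close> and \<open>closure (- C)\<close> bound the masses of \<open>C\<close> and
  of its complement from above. As the boundary is null, their \<mu>-integrals exceed the
  \<mu>-masses by less than \<open>e\<close>, and the two upper bounds combine into a two-sided
  one.\<close>

lemma null_boundary_nbhd:
  assumes \<mu>: "\<mu> \<in> prob_measures" and C: "C \<in> sets borel" "measure \<mu> (frontier C) = 0" and e: "0 < e"
  obtains h k :: "'a \<Rightarrow> real" where "continuous_on UNIV h" "continuous_on UNIV k"
    "\<And>\<nu>. \<nu> \<in> prob_measures \<Longrightarrow> \<bar>(\<integral>x. h x \<partial>\<nu>) - (\<integral>x. h x \<partial>\<mu>)\<bar> < e \<Longrightarrow> \<bar>(\<integral>x. k x \<partial>\<nu>) - (\<integral>x. k x \<partial>\<mu>)\<bar> < e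
       \<Longrightarrow> \<bar>measure \<nu> C - measure \<mu> C\<bar> < 2 * e"
proof -
  interpret prob_space \<mu> by (rule prob_measuresD[OF \<mu>])
  have s: "events = sets borel" by (rule prob_measuresD[OF \<mu>])
  have cl: "measure \<mu> (closure C) = measure \<mu> C" and cl': "measure \<mu> (closure (- C)) = measure \<mu> (- C)"
  proof -
    have "measure \<mu> (D \<union> frontier C) = measure \<mu> D" if "D \<in> sets borel" for D
      using that C(2) s by (intro measure_Un_null_set) (auto simp: null_sets_def emeasure_eq_measure)
    moreover have "closure C = C \<union> frontier C" "closure (- C) = - C \<union> frontier C"
      by (auto simp: frontier_def closure_def interior_closure)
    ultimately show "measure \<mu> (closure C) = measure \<mu> C" "measure \<mu> (closure (- C)) = measure \<mu> (- C)"
      using C(1) by simp_all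
  qed
  obtain h :: "'a \<Rightarrow> real" where h: "continuous_on UNIV h" "\<And>x. indicator (closure C) x \<le> h x"
      "(\<integral>x. h x \<partial>\<mu>) < measure \<mu> (closure C) + e"
    using outer_approx[OF \<mu> closed_closure e] by blast
  obtain k :: "'a \<Rightarrow> real" where k: "continuous_on UNIV k" "\<And>x. indicator (closure (- C)) x \<le> k x"
      "(\<integral>x. k x \<partial>\<mu>) < measure \<mu> (closure (- C)) + e"
    using outer_approx[OF \<mu> closed_closure e] by blast
  have hC: "indicator C x \<le> h x" for x
    by (rule order_trans[OF _ h(2)]) (use closure_subset[of C] in \<open>auto simp: indicator_def\<close>)
  have kC: "indicator (- C) x \<le> k x" for x
    by (rule order_trans[OF _ k(2)]) (use closure_subset[of "- C"] in \<open>auto simp: indicator_def\<close>)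
  show thesis
  proof (rule that[OF h(1) k(1)])
    fix \<nu> assume \<nu>: "\<nu> \<in> prob_measures" "\<bar>(\<integral>x. h x \<partial>\<nu>) - (\<integral>x. h x \<partial>\<mu>)\<bar> < e" "\<bar>(\<integral>x. k x \<partial>\<nu>) - (\<integral>x. k x \<partial>\<mu>)\<bar> < e"
    have "measure \<nu> C \<le> (\<integral>x. h x \<partial>\<nu>)" by (rule measure_le_integral[OF \<nu>(1) h(1) C(1) hC])
    moreover have "measure \<nu> (- C) \<le> (\<integral>x. k x \<partial>\<nu>)"
      by (rule measure_le_integral[OF \<nu>(1) k(1) _ kC]) (use C(1) in auto)
    ultimately show "\<bar>measure \<nu> C - measure \<mu> C\<bar> < 2 * e"
      using \<nu> h(3) k(3) cl cl' measure_Compl_prob[OF \<mu> C(1)] measure_Compl_prob[OF \<nu>(1) C(1)] by arith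
  qed
qed

lemma weak_conv_measure:
  fixes \<mu> :: "'a measure"
  assumes M: "\<And>n. M n \<in> prob_measures" and \<mu>: "\<mu> \<in> prob_measures" and conv: "weak_conv M \<mu>"
    and C: "C \<in> sets borel" "measure \<mu> (frontier C) = 0"
  shows "(\<lambda>n. measure (M n) C) \<longlonglongrightarrow> measure \<mu> C"
proof (rule LIMSEQ_I)
  fix e :: real assume e: "0 < e"
  obtain h k :: "'a \<Rightarrow> real" where hk: "continuous_on UNIV h" "continuous_on UNIV k"
    "\<And>\<nu>. \<nu> \<in> prob_measures \<Longrightarrow> \<bar>(\<integral>x. h x \<partial>\<nu>) - (\<integral>x. h x \<partial>\<mu>)\<bar> < e/2 \<Longrightarrow> \<bar>(\<integral>x. k x \<partial>\<nu>) - (\<integral>x. k x \<partial>\<mu>)\<bar> < e/2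
       \<Longrightarrow> \<bar>measure \<nu> C - measure \<mu> C\<bar> < 2 * (e/2)"
    using null_boundary_nbhd[OF \<mu> C, of "e/2"] e by (metis half_gt_zero)
  have "(\<lambda>n. \<integral>x. h x \<partial>M n) \<longlonglongrightarrow> (\<integral>x. h x \<partial>\<mu>)" "(\<lambda>n. \<integral>x. k x \<partial>M n) \<longlonglongrightarrow> (\<integral>x. k x \<partial>\<mu>)"
    using conv hk(1,2) by (auto simp: weak_conv_def)
  from LIMSEQ_D[OF this(1), of "e/2"] LIMSEQ_D[OF this(2), of "e/2"] e
  obtain n1 n2 where "\<And>n. n \<ge> n1 \<Longrightarrow> \<bar>(\<integral>x. h x \<partial>M n) - (\<integral>x. h x \<partial>\<mu>)\<bar> < e/2"
    "\<And>n. n \<ge> n2 \<Longrightarrow> \<bar>(\<integral>x. k x \<partial>M n) - (\<integral>x. k x \<partial>\<mu>)\<bar> < e/2" by auto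
  then have "\<bar>measure (M n) C - measure \<mu> C\<bar> < e" if "n \<ge> max n1 n2" for n
    using hk(3)[OF M] that by fastforce
  then show "\<exists>no. \<forall>n\<ge>no. norm (measure (M n) C - measure \<mu> C) < e"
    by (intro exI[of _ "max n1 n2"]) auto
qed

end

section \<open>Entropy of finite-valued observables\<close>

text \<open>Shannon entropy of the partition into the fibres of \<open>X\<close>. With labels in
  place of partitions, joins become pairs and words. Fibres of mass 0 contribute 0 because
  \<open>ln 0 = 0\<close>.\<close>

definition ent :: "'a measure \<Rightarrow> ('a \<Rightarrow> 'b) \<Rightarrow> real" where
  "ent \<mu> X = (\<Sum>v\<in>range X. - (measure \<mu> (X -` {v}) * ln (measure \<mu> (X -` {v}))))"

lemma minus_ln_ge: "0 \<le> p \<Longrightarrow> p \<le> 1 \<Longrightarrow> 0 \<le> - (p * ln p)" for p :: real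
  by (cases "p = 0") (auto intro!: mult_nonneg_nonpos)

lemma minus_xlnx_le: "0 \<le> p \<Longrightarrow> - (p * ln p) \<le> 1 - p" for p :: real
proof (cases "p = 0")
  case False
  assume "0 \<le> p"
  with False have p: "0 < p" by simp
  have "- ln p \<le> 1 / p - 1" using ln_le_minus_one[of "1/p"] p by (simp add: ln_div)
  then have "p * - ln p \<le> p * (1 / p - 1)" using p by (intro mult_left_mono) auto
  also have "p * (1 / p - 1) = 1 - p" using p by (simp add: right_diff_distrib)
  finally show ?thesis by simp
qed simp

lemma simple_functionD_borel:
  assumes "simple_function borel X"
  shows "finite (range X)" "X -` {v} \<in> sets borel"
proof -
  show "finite (range X)" using assms by (simp add: simple_function_def)
  show "X -` {v} \<in> sets borel"
    using simple_functionD(2)[OF assms, of "{v}"] by simp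
qed

text \<open>The hypothesis says that \<open>X\<close> factors through \<open>Z\<close>; choosing a
  point in each fibre of \<open>Z\<close> defines the factor map.\<close>

lemma simple_function_cong_labels:
  fixes X :: "'a::topological_space \<Rightarrow> 'b" and Z :: "'a \<Rightarrow> 'c"
  assumes "simple_function borel Z" "\<And>x y. Z x = Z y \<Longrightarrow> X x = X y"
  shows "simple_function borel X"
proof -
  have "(\<lambda>z. X (SOME y. Z y = z)) \<circ> Z = X"
  proof
    fix x
    have "Z (SOME y. Z y = Z x) = Z x" by (rule someI[of _ x]) simp
    then have "X (SOME y. Z y = Z x) = X x" by (rule assms(2))
    then show "((\<lambda>z. X (SOME y. Z y = z)) \<circ> Z) x = X x" by simp
  qed
  then show ?thesis using simple_function_compose[OF assms(1), of "\<lambda>z. X (SOME y. Z y = z)"] by simp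
qed

lemma integral_label:
  fixes X :: "'a::topological_space \<Rightarrow> 'b"
  assumes \<mu>: "\<mu> \<in> prob_measures" and X: "simple_function borel X" and "range X \<subseteq> V" "finite V"
  shows "(\<integral>x. q (X x) \<partial>\<mu>) = (\<Sum>v\<in>V. q v * measure \<mu> (X -` {v}))"
  using integral_finite_valued[of \<mu> V X q] assms simple_functionD_borel[OF X] prob_measuresD[OF \<mu>]
  by auto

lemma integrable_label:
  fixes X :: "'a::topological_space \<Rightarrow> 'b" and q :: "'b \<Rightarrow> real"
  assumes \<mu>: "\<mu> \<in> prob_measures" and X: "simple_function borel X"
  shows "integrable \<mu> (\<lambda>x. q (X x))"
proof -
  have "(\<lambda>x. q (X x)) \<in> borel_measurable borel"
    using simple_function_compose[OF X, of q] borel_measurable_simple_function by (auto simp: comp_def)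
  moreover have "\<bar>q (X x)\<bar> \<le> (\<Sum>v\<in>range X. \<bar>q v\<bar>)" for x
    using simple_functionD_borel(1)[OF X] by (intro member_le_sum) auto
  ultimately show ?thesis by (rule prob_measures_integrable[OF \<mu>])
qed

lemma sum_measure_label:
  fixes X :: "'a::topological_space \<Rightarrow> 'b"
  assumes \<mu>: "\<mu> \<in> prob_measures" and X: "simple_function borel X" and "range X \<subseteq> V" "finite V"
  shows "(\<Sum>v\<in>V. measure \<mu> (X -` {v})) = 1"
  using integral_label[OF assms, of "\<lambda>_. 1"] prob_measuresD[OF \<mu>] measure_prob_measures_UNIV[OF \<mu>] by simp

lemma ent_integral:
  fixes X :: "'a::topological_space \<Rightarrow> 'b"
  assumes \<mu>: "\<mu> \<in> prob_measures" and X: "simple_function borel X"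
  shows "ent \<mu> X = (\<integral>x. - ln (measure \<mu> (X -` {X x})) \<partial>\<mu>)"
  using integral_label[OF \<mu> X, of "range X" "\<lambda>v. - ln (measure \<mu> (X -` {v}))"] simple_functionD_borel[OF X]
  by (simp add: ent_def mult.commute)

lemma AE_label_pos:
  fixes X :: "'a::topological_space \<Rightarrow> 'b"
  assumes \<mu>: "\<mu> \<in> prob_measures" and X: "simple_function borel X"
  shows "AE x in \<mu>. 0 < measure \<mu> (X -` {X x})"
proof -
  have s: "sets \<mu> = sets borel" by (rule prob_measuresD[OF \<mu>])
  have "(\<Union>v\<in>{v \<in> range X. measure \<mu> (X -` {v}) = 0}. X -` {v}) \<in> null_sets \<mu>"
    using simple_functionD_borel[OF X] s
    by (intro null_sets_UN') (auto simp: null_sets_def emeasure_prob_measures[OF \<mu>] countable_finite)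
  then show ?thesis
    by (rule AE_I') (auto simp: less_le)
qed

lemma ent_nonneg:
  fixes X :: "'a::topological_space \<Rightarrow> 'b"
  assumes \<mu>: "\<mu> \<in> prob_measures"
  shows "0 \<le> ent \<mu> X"
  unfolding ent_def using prob_space.prob_le_1[OF prob_measuresD(1)[OF \<mu>]]
  by (intro sum_nonneg minus_ln_ge) auto

lemma ent_superset:
  assumes "range X \<subseteq> V" "finite V"
  shows "ent \<mu> X = (\<Sum>v\<in>V. - (measure \<mu> (X -` {v}) * ln (measure \<mu> (X -` {v}))))"
  unfolding ent_def
proof (rule sum.mono_neutral_left[OF assms(2,1)], rule ballI)
  fix v assume "v \<in> V - range X"
  then have "X -` {v} = {}" by auto
  then show "- (measure \<mu> (X -` {v}) * ln (measure \<mu> (X -` {v}))) = 0" by simp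
qed

text \<open>Gibbs' inequality for a subprobability \<open>q\<close>: summing
  \<open>ln x \<le> x - 1\<close> at the ratios of \<open>q\<close> to the true masses leaves the
  total of \<open>q\<close> minus 1, which is at most 0. Positivity almost everywhere keeps the
  default value \<open>ln 0 = 0\<close> from entering.\<close>

lemma ent_gibbs:
  fixes X :: "'a::topological_space \<Rightarrow> 'b" and q :: "'b \<Rightarrow> real"
  assumes \<mu>: "\<mu> \<in> prob_measures" and X: "simple_function borel X"
    and q: "\<And>v. v \<in> range X \<Longrightarrow> 0 \<le> q v" "(\<Sum>v\<in>range X. q v) \<le> 1" "AE x in \<mu>. 0 < q (X x)"
  shows "ent \<mu> X \<le> (\<integral>x. - ln (q (X x)) \<partial>\<mu>)"
proof -
  let ?p = "\<lambda>v. measure \<mu> (X -` {v})"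
  have "- (?p v * ln (?p v)) \<le> - ln (q v) * ?p v + (q v - ?p v)" if v: "v \<in> range X" for v
  proof (cases "?p v = 0")
    case True
    then show ?thesis using q(1)[OF v] by simp
  next
    case False
    then have p: "0 < ?p v" by (simp add: less_le)
    have "0 < q v"
    proof (rule ccontr)
      assume "\<not> 0 < q v"
      then have "AE x in \<mu>. x \<notin> X -` {v}" using q(3) by (auto elim: eventually_mono)
      then have "?p v = 0"
        using AE_iff_measurable[of "X -` {v}" \<mu> "\<lambda>x. x \<notin> X -` {v}"] simple_functionD_borel(2)[OF X, of v] prob_measuresD[OF \<mu>]
        by (simp add: measure_def vimage_def)
      then show False using p by simp
    qed
    then have "ln (q v / ?p v) \<le> q v / ?p v - 1" using p by (intro ln_le_minus_one) simp
    then have "?p v * ln (q v / ?p v) \<le> ?p v * (q v / ?p v - 1)" using p by (intro mult_left_mono) auto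
    then show ?thesis using p \<open>0 < q v\<close> by (simp add: ln_div algebra_simps)
  qed
  then have "ent \<mu> X \<le> (\<Sum>v\<in>range X. - ln (q v) * ?p v + (q v - ?p v))"
    unfolding ent_def by (rule sum_mono)
  also have "\<dots> = (\<integral>x. - ln (q (X x)) \<partial>\<mu>) + ((\<Sum>v\<in>range X. q v) - 1)"
    using integral_label[OF \<mu> X, of "range X" "\<lambda>v. - ln (q v)"] sum_measure_label[OF \<mu> X, of "range X"]
      simple_functionD_borel(1)[OF X] by (simp add: sum.distrib sum_subtractf sum_negf)
  finally show ?thesis using q(2) by simp
qed

text \<open>Fibres of \<open>Z\<close> lie inside fibres of \<open>X\<close>, so \<open>- ln\<close>
  of the fibre mass is pointwise at least as large for \<open>Z\<close>. Almost every point lies in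
  a fibre of positive mass, where \<open>ln\<close> is monotone.\<close>

lemma ent_data_processing:
  fixes X :: "'a::topological_space \<Rightarrow> 'b" and Z :: "'a \<Rightarrow> 'c"
  assumes \<mu>: "\<mu> \<in> prob_measures" and Z: "simple_function borel Z" and XZ: "\<And>x y. Z x = Z y \<Longrightarrow> X x = X y"
  shows "ent \<mu> X \<le> ent \<mu> Z"
proof -
  interpret prob_space \<mu> by (rule prob_measuresD[OF \<mu>])
  have X: "simple_function borel X" by (rule simple_function_cong_labels[OF Z XZ])
  show ?thesis
    unfolding ent_integral[OF \<mu> X] ent_integral[OF \<mu> Z]
  proof (rule integral_mono_AE)
    show "integrable \<mu> (\<lambda>x. - ln (measure \<mu> (X -` {X x})))"
      using integrable_label[OF \<mu> X, of "\<lambda>v. - ln (measure \<mu> (X -` {v}))"] .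
    show "integrable \<mu> (\<lambda>x. - ln (measure \<mu> (Z -` {Z x})))"
      using integrable_label[OF \<mu> Z, of "\<lambda>v. - ln (measure \<mu> (Z -` {v}))"] .
    show "AE x in \<mu>. - ln (measure \<mu> (X -` {X x})) \<le> - ln (measure \<mu> (Z -` {Z x}))"
      using AE_label_pos[OF \<mu> Z]
    proof eventually_elim
      case (elim x)
      have "Z -` {Z x} \<subseteq> X -` {X x}" by (auto dest: XZ)
      then have "measure \<mu> (Z -` {Z x}) \<le> measure \<mu> (X -` {X x})"
        using simple_functionD_borel(2)[OF X] prob_measuresD(2)[OF \<mu>] by (intro finite_measure_mono) auto
      then show ?case using elim by simp
    qed
  qed
qed

text \<open>The average of \<open>- ln k\<close> bounds the conditional entropy of \<open>B\<close> given \<open>Z\<close> for every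
  Markov kernel \<open>k\<close>, with equality for the conditional distribution.\<close>

lemma ent_kernel:
  fixes Z :: "'a::topological_space \<Rightarrow> 'b" and B :: "'a \<Rightarrow> 'c" and k :: "'b \<Rightarrow> 'c \<Rightarrow> real"
  assumes \<mu>: "\<mu> \<in> prob_measures" and Z: "simple_function borel Z" and B: "simple_function borel B"
    and k: "\<And>z b. 0 \<le> k z b" "\<And>z. (\<Sum>b\<in>range B. k z b) \<le> 1" "AE x in \<mu>. 0 < k (Z x) (B x)"
  shows "ent \<mu> (\<lambda>x. (Z x, B x)) \<le> ent \<mu> Z + (\<integral>x. - ln (k (Z x) (B x)) \<partial>\<mu>)"
proof -
  let ?p = "\<lambda>v. measure \<mu> (Z -` {v})"
  let ?W = "\<lambda>x. (Z x, B x)"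
  have W: "simple_function borel ?W" by (rule simple_function_Pair[OF Z B])
  note fin = simple_functionD_borel(1)[OF Z] simple_functionD_borel(1)[OF B]
  \<comment> \<open>The mass of the fibre of \<open>Z\<close> times the kernel is a subprobability
    on pairs. Gibbs' inequality is applied to it, and the logarithm of the product splits into the
    two terms of the bound.\<close>
  define q where "q zb = ?p (fst zb) * k (fst zb) (snd zb)" for zb
  have qn: "0 \<le> q v" for v using k(1) by (simp add: q_def)
  have "ent \<mu> ?W \<le> (\<integral>x. - ln (q (?W x)) \<partial>\<mu>)"
  proof (rule ent_gibbs[OF \<mu> W qn])
    have "(\<Sum>v\<in>range ?W. q v) \<le> (\<Sum>v\<in>range Z \<times> range B. q v)"
      using fin qn by (intro sum_mono2) auto
    also have "\<dots> = (\<Sum>z\<in>range Z. ?p z * (\<Sum>b\<in>range B. k z b))"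
      by (simp add: q_def sum.cartesian_product' sum_distrib_left)
    also have "\<dots> \<le> (\<Sum>z\<in>range Z. ?p z * 1)"
      using k(2) by (intro sum_mono mult_left_mono) auto
    also have "\<dots> = 1" using sum_measure_label[OF \<mu> Z subset_refl fin(1)] by simp
    finally show "(\<Sum>v\<in>range ?W. q v) \<le> 1" .
    show "AE x in \<mu>. 0 < q (Z x, B x)"
      using AE_label_pos[OF \<mu> Z] k(3) by eventually_elim (simp add: q_def)
  qed
  also have "\<dots> = (\<integral>x. - ln (?p (Z x)) + - ln (k (Z x) (B x)) \<partial>\<mu>)"
  proof (rule integral_cong_AE)
    show "AE x in \<mu>. - ln (q (Z x, B x)) = - ln (?p (Z x)) + - ln (k (Z x) (B x))"
      using AE_label_pos[OF \<mu> Z] k(3) by eventually_elim (simp add: q_def ln_mult)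
    show "(\<lambda>x. - ln (q (Z x, B x))) \<in> borel_measurable \<mu>"
      using integrable_label[OF \<mu> W, of "\<lambda>v. - ln (q v)"] by (rule borel_measurable_integrable)
    show "(\<lambda>x. - ln (?p (Z x)) + - ln (k (Z x) (B x))) \<in> borel_measurable \<mu>"
      using integrable_label[OF \<mu> W, of "\<lambda>v. - ln (?p (fst v)) + - ln (k (fst v) (snd v))"]
      by (auto dest: borel_measurable_integrable)
  qed
  also have "\<dots> = ent \<mu> Z + (\<integral>x. - ln (k (Z x) (B x)) \<partial>\<mu>)"
    unfolding ent_integral[OF \<mu> Z]
    using integrable_label[OF \<mu> W, of "\<lambda>v. - ln (?p (fst v))"] integrable_label[OF \<mu> W, of "\<lambda>v. - ln (k (fst v) (snd v))"]
    by (subst Bochner_Integration.integral_add) auto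
  finally show ?thesis .
qed

text \<open>This is the kernel that ignores \<open>Z\<close> and always uses the distribution of
  \<open>B\<close>.\<close>

lemma ent_pair_le:
  fixes Z :: "'a::topological_space \<Rightarrow> 'b" and B :: "'a \<Rightarrow> 'c"
  assumes \<mu>: "\<mu> \<in> prob_measures" and Z: "simple_function borel Z" and B: "simple_function borel B"
  shows "ent \<mu> (\<lambda>x. (Z x, B x)) \<le> ent \<mu> Z + ent \<mu> B"
  unfolding ent_integral[OF \<mu> B]
proof (rule ent_kernel[OF \<mu> Z B, of "\<lambda>_ b. measure \<mu> (B -` {b})"])
  show "(\<Sum>b\<in>range B. measure \<mu> (B -` {b})) \<le> 1"
    using sum_measure_label[OF \<mu> B subset_refl] simple_functionD_borel[OF B] by simp
qed (simp, rule AE_label_pos[OF \<mu> B])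

text \<open>Each of the two parts of the mixed mass is at most the whole, so monotonicity of
  \<open>ln\<close> bounds its contribution. The excess sums to the binary entropy of
  \<open>s\<close>, which is at most 1 independently of \<open>X\<close>; per unit of time it
  vanishes.\<close>

lemma ent_mix_le:
  fixes X :: "'a::topological_space \<Rightarrow> 'b"
  assumes \<mu>: "\<mu> \<in> prob_measures" and \<nu>: "\<nu> \<in> prob_measures" and s: "0 \<le> s" "s \<le> 1"
    and X: "simple_function borel X"
  shows "ent (mix s \<mu> \<nu>) X \<le> s * ent \<mu> X + (1 - s) * ent \<nu> X + 1"
proof -
  let ?p = "\<lambda>\<rho> v. measure \<rho> (X -` {v})"
  have aux: "- (s * a * ln p) \<le> s * - (a * ln a) + a * - (s * ln s)"
    if "0 \<le> a" "0 \<le> s" "s * a \<le> p" for s a p :: real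
  proof (cases "s * a = 0")
    case False
    then have pos: "0 < s" "0 < a" using that by (auto simp: less_le)
    then have "ln (s * a) \<le> ln p" using that by (subst ln_le_cancel_iff) (auto intro: less_le_trans[of 0 "s * a"])
    then have "s * a * ln (s * a) \<le> s * a * ln p" using pos by (intro mult_left_mono) auto
    then show ?thesis using pos by (simp add: ln_mult algebra_simps)
  qed auto
  have 1: "- (?p (mix s \<mu> \<nu>) v * ln (?p (mix s \<mu> \<nu>) v)) \<le>
      (s * - (?p \<mu> v * ln (?p \<mu> v)) + ?p \<mu> v * - (s * ln s))
      + ((1 - s) * - (?p \<nu> v * ln (?p \<nu> v)) + ?p \<nu> v * - ((1 - s) * ln (1 - s)))" for v
  proof -
    have m: "?p (mix s \<mu> \<nu>) v = s * ?p \<mu> v + (1 - s) * ?p \<nu> v"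
      using measure_mix[OF \<mu> \<nu> simple_functionD_borel(2)[OF X] s] .
    have "0 \<le> s * ?p \<mu> v" "0 \<le> (1 - s) * ?p \<nu> v" using s by simp_all
    then have a: "s * ?p \<mu> v \<le> ?p (mix s \<mu> \<nu>) v" and b: "(1 - s) * ?p \<nu> v \<le> ?p (mix s \<mu> \<nu>) v"
      using m by linarith+
    have "- (?p (mix s \<mu> \<nu>) v * ln (?p (mix s \<mu> \<nu>) v)) =
      - (s * ?p \<mu> v * ln (?p (mix s \<mu> \<nu>) v)) + - ((1 - s) * ?p \<nu> v * ln (?p (mix s \<mu> \<nu>) v))"
      by (subst (1) m) (simp add: algebra_simps)
    then show ?thesis using aux[OF _ s(1) a] aux[OF _ _ b] s by simp
  qed
  note fin = simple_functionD_borel(1)[OF X]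
  have "ent (mix s \<mu> \<nu>) X \<le> (\<Sum>v\<in>range X. (s * - (?p \<mu> v * ln (?p \<mu> v)) + ?p \<mu> v * - (s * ln s))
      + ((1 - s) * - (?p \<nu> v * ln (?p \<nu> v)) + ?p \<nu> v * - ((1 - s) * ln (1 - s))))"
    unfolding ent_def by (rule sum_mono[OF 1])
  also have "\<dots> = s * ent \<mu> X + (1 - s) * ent \<nu> X + (- (s * ln s) + - ((1 - s) * ln (1 - s)))"
    unfolding ent_def sum.distrib sum_distrib_left[symmetric] sum_distrib_right[symmetric]
      sum_measure_label[OF \<mu> X subset_refl fin] sum_measure_label[OF \<nu> X subset_refl fin] by simp
  also have "\<dots> \<le> s * ent \<mu> X + (1 - s) * ent \<nu> X + 1"
    using minus_xlnx_le[of s] minus_xlnx_le[of "1 - s"] s by simp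
  finally show ?thesis .
qed

lemma ent_le_ln_card:
  fixes X :: "'a::topological_space \<Rightarrow> 'b"
  assumes \<mu>: "\<mu> \<in> prob_measures" and X: "simple_function borel X" and V: "range X \<subseteq> V" "finite V"
  shows "ent \<mu> X \<le> ln (real (card V))"
proof -
  interpret prob_space \<mu> by (rule prob_measuresD[OF \<mu>])
  have c: "0 < card V" using V by (metis card_gt_0_iff empty_is_image subset_empty UNIV_not_empty)
  have le: "card (range X) \<le> card V" using V by (simp add: card_mono)
  have "ent \<mu> X \<le> (\<integral>x. - ln (1 / real (card V)) \<partial>\<mu>)"
    by (rule ent_gibbs[OF \<mu> X, of "\<lambda>_. 1 / real (card V)"]) (use c le in auto)
  then show ?thesis using c by (simp add: ln_div prob_space)
qed

text \<open>Fekete's lemma. The limit is also the infimum of the quotients: being an infimum yields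
  upper semicontinuity later, being a limit yields the comparison of rates.\<close>

lemma subadditive_limit:
  fixes a :: "nat \<Rightarrow> real"
  assumes nn: "\<And>n. 0 \<le> a n" and sub: "\<And>m n. a (m + n) \<le> a m + a n"
  obtains L where "(\<lambda>n. a n / real n) \<longlonglongrightarrow> L" "\<And>n. n \<ge> 1 \<Longrightarrow> L \<le> a n / real n"
proof -
  define S where "S = (\<lambda>n. a n / real n) ` {1..}"
  define L where "L = Inf S"
  have bdd: "bdd_below S" unfolding S_def by (rule bdd_belowI[of _ 0]) (auto simp: nn)
  have low: "L \<le> a n / real n" if "n \<ge> 1" for n
    unfolding L_def by (rule cInf_lower[OF _ bdd]) (use that in \<open>auto simp: S_def\<close>)
  have mult: "a (q * m + r) \<le> real q * a m + a r" for q m r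
  proof (induction q)
    case (Suc q)
    then show ?case using sub[of m "q * m + r"] by (simp add: algebra_simps)
  qed simp
  have "(\<lambda>n. a n / real n) \<longlonglongrightarrow> L"
  proof (rule LIMSEQ_I)
    fix e :: real assume e: "0 < e"
    have "\<exists>x\<in>S. x < L + e / 2"
      using cInf_lessD[of S "L + e / 2"] e by (auto simp: L_def S_def)
    then obtain m where m: "m \<ge> 1" "a m / real m < L + e / 2" by (auto simp: S_def)
    define C where "C = (\<Sum>r<m. a r)"
    obtain N where N: "2 * C / e < real N" using reals_Archimedean2 by blast
    have "norm (a n / real n - L) < e" if n: "n \<ge> max 1 N" for n
    proof -
      have n0: "0 < real n" using n by simp
      have "a n \<le> real (n div m) * a m + a (n mod m)" using mult[of "n div m" m "n mod m"] by simp
      also have "a (n mod m) \<le> C"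
        unfolding C_def using m(1) nn by (intro member_le_sum) auto
      also have "real (n div m) * a m \<le> real n / real m * a m"
        by (intro mult_right_mono nn) (rule of_nat_div_le_of_nat)
      finally have "a n / real n \<le> (real n / real m * a m + C) / real n" using n0 by (simp add: divide_right_mono)
      also have "\<dots> = a m / real m + C / real n" using n0 m(1) by (simp add: field_simps)
      also have "C / real n < e / 2"
      proof -
        have "2 * C / e < real n" using N n by linarith
        then show ?thesis using e n0 by (simp add: field_simps)
      qed
      finally have "a n / real n < L + e" using m(2) by simp
      then show ?thesis using low[of n] n by simp
    qed
    then show "\<exists>no. \<forall>n\<ge>no. norm (a n / real n - L) < e" by blast
  qed
  then show thesis using that low by blast
qed

context compact_dynamics
begin

section \<open>Itineraries, entropy rates and their relation to metric entropy\<close>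

definition itinerary :: "('a \<Rightarrow> 'b) \<Rightarrow> nat \<Rightarrow> 'a \<Rightarrow> 'b list" where
  "itinerary X n x = map (\<lambda>i. X ((T ^^ i) x)) [0..<n]"

lemma length_itinerary [simp]: "length (itinerary X n x) = n"
  by (simp add: itinerary_def)

lemma nth_itinerary [simp]: "i < n \<Longrightarrow> itinerary X n x ! i = X ((T ^^ i) x)"
  by (simp add: itinerary_def)

lemma itinerary_eq_iff: "itinerary X n x = itinerary X n y \<longleftrightarrow> (\<forall>i<n. X ((T ^^ i) x) = X ((T ^^ i) y))"
  by (auto simp: itinerary_def)

lemma itinerary_Suc: "itinerary X (Suc n) x = itinerary X n x @ [X ((T ^^ n) x)]"
  by (simp add: itinerary_def)

lemma funpow_add_apply: "(T ^^ (m + i)) x = (T ^^ i) ((T ^^ m) x)"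
  by (metis add.commute comp_apply funpow_add)

lemma itinerary_add: "itinerary X (m + n) x = itinerary X m x @ itinerary X n ((T ^^ m) x)"
  by (induction n) (simp_all add: itinerary_Suc funpow_add_apply, simp add: itinerary_def)

lemma simple_function_Tn: "simple_function borel X \<Longrightarrow> simple_function borel (\<lambda>x. X ((T ^^ n) x))"
  using simple_function_comp[OF measurable_Tn] by blast

lemma simple_function_itinerary:
  assumes "simple_function borel X" shows "simple_function borel (itinerary X n)"
proof (induction n)
  case 0
  then show ?case by (simp add: itinerary_def[abs_def])
next
  case (Suc n)
  have "simple_function borel (\<lambda>x. (itinerary X n x, X ((T ^^ n) x)))"
    by (intro simple_function_Pair Suc simple_function_Tn assms)
  then show ?case by (rule simple_function_cong_labels) (simp add: itinerary_Suc)
qed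

lemma ent_Tn:
  assumes \<mu>: "\<mu> \<in> invariant_measures T" and X: "simple_function borel X"
  shows "ent \<mu> (\<lambda>x. X ((T ^^ n) x)) = ent \<mu> X"
proof -
  have "measure \<mu> ((\<lambda>x. X ((T ^^ n) x)) -` {v}) = measure \<mu> (X -` {v})" for v
    using measure_vimage_Tn[OF \<mu> simple_functionD_borel(2)[OF X], of n v] by (simp add: vimage_def)
  moreover have "range (\<lambda>x. X ((T ^^ n) x)) \<subseteq> range X" by auto
  ultimately show ?thesis
    using ent_superset[of "\<lambda>x. X ((T ^^ n) x)" "range X" \<mu>] simple_functionD_borel(1)[OF X]
    by (simp add: ent_def)
qed

lemma ent_itinerary_add:
  assumes \<mu>: "\<mu> \<in> invariant_measures T" and X: "simple_function borel X"
  shows "ent \<mu> (itinerary X (m + n)) \<le> ent \<mu> (itinerary X m) + ent \<mu> (itinerary X n)"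
proof -
  note p = invariantD(1)[OF \<mu>] and s = simple_function_itinerary[OF X]
  have "ent \<mu> (itinerary X (m + n)) \<le> ent \<mu> (\<lambda>x. (itinerary X m x, itinerary X n ((T ^^ m) x)))"
    by (rule ent_data_processing[OF p simple_function_Pair[OF s simple_function_Tn[OF s]]])
      (simp add: itinerary_add)
  also have "\<dots> \<le> ent \<mu> (itinerary X m) + ent \<mu> (\<lambda>x. itinerary X n ((T ^^ m) x))"
    by (rule ent_pair_le[OF p s simple_function_Tn[OF s]])
  finally show ?thesis using ent_Tn[OF \<mu> s] by simp
qed

definition entropy_rate :: "'a measure \<Rightarrow> ('a \<Rightarrow> 'b) \<Rightarrow> real" where
  "entropy_rate \<mu> X = lim (\<lambda>n. ent \<mu> (itinerary X n) / real n)"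

lemma entropy_rate:
  assumes \<mu>: "\<mu> \<in> invariant_measures T" and X: "simple_function borel X"
  shows entropy_rate_LIMSEQ: "(\<lambda>n. ent \<mu> (itinerary X n) / real n) \<longlonglongrightarrow> entropy_rate \<mu> X"
    and entropy_rate_le: "n \<ge> 1 \<Longrightarrow> entropy_rate \<mu> X \<le> ent \<mu> (itinerary X n) / real n"
proof -
  obtain L where L: "(\<lambda>n. ent \<mu> (itinerary X n) / real n) \<longlonglongrightarrow> L"
      "\<And>n. n \<ge> 1 \<Longrightarrow> L \<le> ent \<mu> (itinerary X n) / real n"
    using subadditive_limit[of "\<lambda>n. ent \<mu> (itinerary X n)",
        OF ent_nonneg[OF invariantD(1)[OF \<mu>]] ent_itinerary_add[OF \<mu> X]] by metis
  then have "L = entropy_rate \<mu> X" unfolding entropy_rate_def by (simp add: limI)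
  with L show "(\<lambda>n. ent \<mu> (itinerary X n) / real n) \<longlonglongrightarrow> entropy_rate \<mu> X"
    "n \<ge> 1 \<Longrightarrow> entropy_rate \<mu> X \<le> ent \<mu> (itinerary X n) / real n" by auto
qed

text \<open>The word of \<open>Q\<close> is revealed letter by letter, given the whole word of
  \<open>P\<close>. The kernel reads only the current letter of \<open>P\<close>, and by invariance
  every letter costs the same integral.\<close>

lemma ent_itinerary_kernel:
  fixes P :: "'a \<Rightarrow> 'b" and Q :: "'a \<Rightarrow> 'c" and k :: "'b \<Rightarrow> 'c \<Rightarrow> real"
  assumes \<mu>: "\<mu> \<in> invariant_measures T" and P: "simple_function borel P" and Q: "simple_function borel Q"
    and k: "\<And>a b. 0 < k a b" "\<And>a. (\<Sum>b\<in>range Q. k a b) \<le> 1"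
  shows "ent \<mu> (itinerary Q n) \<le> ent \<mu> (itinerary P n) + real n * (\<integral>x. - ln (k (P x) (Q x)) \<partial>\<mu>)"
proof -
  note p = invariantD(1)[OF \<mu>]
  let ?c = "\<integral>x. - ln (k (P x) (Q x)) \<partial>\<mu>"
  note sP = simple_function_itinerary[OF P] and sQ = simple_function_itinerary[OF Q]
  have kint: "(\<integral>x. - ln (k (P ((T ^^ N) x)) (Q ((T ^^ N) x))) \<partial>\<mu>) = ?c" for N
  proof -
    have "(\<lambda>x. - ln (k (P x) (Q x))) \<in> borel_measurable borel"
      using simple_function_compose[OF simple_function_Pair[OF P Q], of "\<lambda>v. - ln (k (fst v) (snd v))"]
      by (auto simp: comp_def dest: borel_measurable_simple_function)
    then show ?thesis using integral_Tn[OF \<mu>, of "\<lambda>x. - ln (k (P x) (Q x))" N] by simp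
  qed
  have "N \<le> n \<Longrightarrow> ent \<mu> (\<lambda>x. (itinerary P n x, itinerary Q N x)) \<le> ent \<mu> (itinerary P n) + real N * ?c" for N
  proof (induction N)
    case 0
    have "ent \<mu> (\<lambda>x. (itinerary P n x, itinerary Q 0 x)) \<le> ent \<mu> (itinerary P n)"
      by (rule ent_data_processing[OF p sP]) (simp add: itinerary_def)
    then show ?case by simp
  next
    case (Suc N)
    have rg: "range (\<lambda>x. Q ((T ^^ N) x)) \<subseteq> range Q" by auto
    let ?Z = "\<lambda>x. (itinerary P n x, itinerary Q N x)"
    have sZ: "simple_function borel ?Z" by (rule simple_function_Pair[OF sP sQ])
    have "ent \<mu> (\<lambda>x. (itinerary P n x, itinerary Q (Suc N) x)) \<le> ent \<mu> (\<lambda>x. (?Z x, Q ((T ^^ N) x)))"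
      by (rule ent_data_processing[OF p simple_function_Pair[OF sZ simple_function_Tn[OF Q]]])
        (simp add: itinerary_Suc)
    also have "\<dots> \<le> ent \<mu> ?Z + (\<integral>x. - ln (k (fst (?Z x) ! N) (Q ((T ^^ N) x))) \<partial>\<mu>)"
    proof (rule ent_kernel[OF p sZ simple_function_Tn[OF Q], of "\<lambda>z. k (fst z ! N)"])
      show "(\<Sum>b\<in>range (\<lambda>x. Q ((T ^^ N) x)). k (fst z ! N) b) \<le> 1" for z :: "'b list \<times> 'c list"
        by (rule order_trans[OF sum_mono2[OF simple_functionD_borel(1)[OF Q] rg] k(2)]) (simp add: k less_imp_le)
    qed (simp_all add: k less_imp_le)
    also have "(\<integral>x. - ln (k (fst (?Z x) ! N) (Q ((T ^^ N) x))) \<partial>\<mu>) = ?c"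
      using Suc.prems kint[of N] by simp
    finally show ?case using Suc by (simp add: algebra_simps)
  qed
  from this[of n] have "ent \<mu> (\<lambda>x. (itinerary P n x, itinerary Q n x)) \<le> ent \<mu> (itinerary P n) + real n * ?c" by simp
  moreover have "ent \<mu> (itinerary Q n) \<le> ent \<mu> (\<lambda>x. (itinerary P n x, itinerary Q n x))"
    by (rule ent_data_processing[OF p simple_function_Pair[OF sP sQ]]) simp
  ultimately show ?thesis by simp
qed

definition fibres :: "('a \<Rightarrow> 'b) \<Rightarrow> 'a set set" where
  "fibres X = (\<lambda>v. X -` {v}) ` range X"

lemma finite_partition_fibres:
  assumes "simple_function borel X" shows "finite_partition (fibres X)"
  unfolding finite_partition_def partition_on_def fibres_def
  using simple_functionD_borel[OF assms] by (auto simp: disjoint_def)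

text \<open>Cells with empty intersection put the empty set into the join, whereas fibres over the
  range are nonempty. The empty set contributes 0 to the entropy, so it is inserted on both
  sides.\<close>

lemma iterated_join_fibres: "insert {} (iterated_join T (fibres X) n) = insert {} (fibres (itinerary X n))"
proof (intro set_eqI iffI)
  fix S assume "S \<in> insert {} (iterated_join T (fibres X) n)"
  show "S \<in> insert {} (fibres (itinerary X n))"
  proof (cases "S = {}")
    case False
    with \<open>S \<in> _\<close> obtain A where A: "S = (\<Inter>i<n. (T ^^ i) -` A i)" "\<forall>i<n. A i \<in> fibres X"
      by (auto simp: iterated_join_def)
    from False obtain x where x: "x \<in> S" by blast
    have "A i = X -` {X ((T ^^ i) x)}" if i: "i < n" for i
    proof -
      obtain v where "A i = X -` {v}" using A(2) i unfolding fibres_def by blast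
      moreover have "(T ^^ i) x \<in> A i" using A(1) x i by blast
      ultimately show ?thesis by simp
    qed
    then have "S = itinerary X n -` {itinerary X n x}"
      using A(1) by (auto simp: itinerary_eq_iff)
    then show ?thesis by (simp add: fibres_def)
  qed simp
next
  fix S assume "S \<in> insert {} (fibres (itinerary X n))"
  then consider "S = {}" | x where "S = itinerary X n -` {itinerary X n x}" by (auto simp: fibres_def)
  then show "S \<in> insert {} (iterated_join T (fibres X) n)"
  proof cases
    case 2
    have "S = (\<Inter>i<n. (T ^^ i) -` (X -` {X ((T ^^ i) x)}))" using 2 by (auto simp: itinerary_eq_iff)
    then have "S \<in> iterated_join T (fibres X) n"
      unfolding iterated_join_def by (intro CollectI exI[of _ "\<lambda>i. X -` {X ((T ^^ i) x)}"]) (auto simp: fibres_def)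
    then show ?thesis by simp
  qed simp
qed

lemma partition_entropy_join:
  assumes X: "simple_function borel X"
  shows "partition_entropy \<mu> (iterated_join T (fibres X) n) = ent \<mu> (itinerary X n)"
proof -
  let ?g = "\<lambda>A. measure \<mu> A * ln (measure \<mu> A)"
  let ?N = "itinerary X n"
  have fin: "finite (range ?N)" by (rule simple_functionD_borel[OF simple_function_itinerary[OF X]])
  have finS: "finite (insert {} (fibres ?N))" using fin by (simp add: fibres_def)
  have "sum ?g (iterated_join T (fibres X) n) = sum ?g (insert {} (iterated_join T (fibres X) n))"
  proof (rule sum.mono_neutral_left)
    show "finite (insert {} (iterated_join T (fibres X) n))" unfolding iterated_join_fibres by (rule finS)
  qed auto
  also have "\<dots> = sum ?g (insert {} (fibres ?N))" unfolding iterated_join_fibres ..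
  also have "\<dots> = sum ?g (fibres ?N)"
    by (rule sum.mono_neutral_right[OF finS]) auto
  also have "\<dots> = (\<Sum>v\<in>range ?N. ?g (?N -` {v}))"
    unfolding fibres_def by (rule sum.reindex_cong[of "\<lambda>v. ?N -` {v}" "range ?N"]) (auto simp: inj_on_def)
  finally show ?thesis by (simp add: partition_entropy_def ent_def sum_negf)
qed

lemma entropy_rate_le_metric_entropy:
  assumes X: "simple_function borel X"
  shows "ereal (entropy_rate \<mu> X) \<le> metric_entropy T \<mu>"
  unfolding metric_entropy_def entropy_rate_def partition_entropy_join[OF X, symmetric]
  by (rule SUP_upper) (simp add: finite_partition_fibres[OF X])

text \<open>A finite partition becomes an observable by labelling each point with its cell; the
  fibres are the cells again.\<close>

lemma metric_entropy_greater:
  assumes "ereal c < metric_entropy T \<mu>"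
  obtains X :: "'a \<Rightarrow> 'a set" where "simple_function borel X" "c < entropy_rate \<mu> X"
proof -
  obtain P where P: "finite_partition P" "ereal c < ereal (lim (\<lambda>n. partition_entropy \<mu> (iterated_join T P n) / real n))"
    using assms unfolding metric_entropy_def less_SUP_iff by auto
  define X where "X x = (THE A. A \<in> P \<and> x \<in> A)" for x
  have ex: "\<exists>!A. A \<in> P \<and> x \<in> A" for x
  proof -
    have "x \<in> \<Union>P" using P(1) by (simp add: finite_partition_def partition_on_def)
    then obtain A where "A \<in> P" "x \<in> A" by blast
    moreover have "disjoint P" using P(1) by (simp add: finite_partition_def partition_on_def)
    ultimately show ?thesis unfolding disjoint_def by (intro ex1I[of _ A]) auto
  qed
  have X: "X x \<in> P" "x \<in> X x" for x using theI'[OF ex[of x]] by (auto simp: X_def)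
  have X_eq: "X x = A \<longleftrightarrow> x \<in> A" if "A \<in> P" for x A
    using ex[of x] X[of x] that by blast
  have fib: "X -` {A} = A" if "A \<in> P" for A using X_eq[OF that] by auto
  have rg: "range X = P"
  proof (intro subset_antisym subsetI)
    fix A assume A: "A \<in> P"
    then have "A \<noteq> {}" using P(1) by (auto simp: finite_partition_def partition_on_def)
    then obtain x where "x \<in> A" by blast
    then show "A \<in> range X" using X_eq[OF A] by blast
  qed (use X in auto)
  have "simple_function borel X"
    unfolding simple_function_def using P(1) rg fib by (auto simp: finite_partition_def)
  moreover have "fibres X = P" unfolding fibres_def rg using fib by simp
  ultimately show thesis
    using that[of X] P(2) partition_entropy_join[of X \<mu>] by (simp add: entropy_rate_def)
qed

lemma metric_entropy_nonneg:
  assumes \<mu>: "\<mu> \<in> invariant_measures T" shows "0 \<le> metric_entropy T \<mu>"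
proof -
  have X: "simple_function borel (\<lambda>x::'a. ())" by simp
  have "0 \<le> entropy_rate \<mu> (\<lambda>x::'a. ())"
    by (rule LIMSEQ_le_const[OF entropy_rate_LIMSEQ[OF \<mu> X]])
      (auto intro!: exI[of _ 0] divide_nonneg_nonneg ent_nonneg invariantD(1)[OF \<mu>])
  then show ?thesis using entropy_rate_le_metric_entropy[OF X, of \<mu>] by (metis ereal_less_eq(3) order_trans zero_ereal_def)
qed


section \<open>Covering orbits with prescribed empirical measure\<close>

definition uniform_on :: "'a set \<Rightarrow> 'a measure" where
  "uniform_on R = distr (measure_pmf (pmf_of_set R)) borel (\<lambda>x. x)"

lemma uniform_on_prob: "uniform_on R \<in> prob_measures"
  unfolding prob_measures_def uniform_on_def
  by (auto intro!: prob_space.prob_space_distr prob_space_measure_pmf)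

lemma measure_uniform_on:
  assumes "finite R" "R \<noteq> {}" "B \<in> sets borel"
  shows "measure (uniform_on R) B = real (card (R \<inter> B)) / real (card R)"
  unfolding uniform_on_def using assms by (subst measure_distr) (auto simp: measure_pmf_of_set)

lemma integral_uniform_on:
  fixes h :: "'a \<Rightarrow> real"
  assumes "finite R" "R \<noteq> {}" "h \<in> borel_measurable borel"
  shows "(\<integral>x. h x \<partial>uniform_on R) = (\<Sum>x\<in>R. h x) / real (card R)"
  unfolding uniform_on_def using assms by (subst integral_distr) (auto simp: integral_pmf_of_set)

text \<open>Injectivity on \<open>R\<close> gives every attained value mass
  \<open>1 / card R\<close>. This turns cardinalities into entropies.\<close>

lemma ent_uniform_on:
  assumes R: "finite R" "R \<noteq> {}" and X: "simple_function borel X" and inj: "inj_on X R"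
  shows "ent (uniform_on R) X = ln (real (card R))"
proof -
  have c: "0 < card R" using R by (simp add: card_gt_0_iff)
  have m: "measure (uniform_on R) (X -` {v}) = (if v \<in> X ` R then 1 / real (card R) else 0)" for v
  proof (cases "v \<in> X ` R")
    case True
    then obtain x where x: "x \<in> R" "v = X x" by blast
    then have "R \<inter> X -` {v} = {x}" using inj by (auto dest: inj_onD)
    then show ?thesis using measure_uniform_on[OF R simple_functionD_borel(2)[OF X], of v] True by simp
  next
    case False
    then have "R \<inter> X -` {v} = {}" by auto
    then show ?thesis using measure_uniform_on[OF R simple_functionD_borel(2)[OF X], of v] False by simp
  qed
  have "ent (uniform_on R) X = (\<Sum>v\<in>range X. if v \<in> X ` R then ln (real (card R)) / real (card R) else 0)"
    unfolding ent_def m by (rule sum.cong) (use c in \<open>auto simp: ln_div\<close>)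
  also have "\<dots> = (\<Sum>v\<in>X ` R. ln (real (card R)) / real (card R))"
    using simple_functionD_borel(1)[OF X]
    by (subst sum.If_cases) (auto intro!: arg_cong[where f = card] simp: Int_absorb1 image_mono)
  also have "\<dots> = ln (real (card R))" using c by (simp add: card_image[OF inj])
  finally show ?thesis .
qed

lemma ent_itinerary_le_general:
  fixes X :: "'a \<Rightarrow> nat"
  assumes \<nu>: "\<nu> \<in> prob_measures" and X: "simple_function borel X" and N: "\<And>x. X x < N"
  shows "ent \<nu> (\<lambda>x. itinerary X n ((T ^^ i) x)) \<le> real n * ln (real N)"
proof -
  let ?V = "{w. set w \<subseteq> {..<N} \<and> length w = n}"
  have "ent \<nu> (\<lambda>x. itinerary X n ((T ^^ i) x)) \<le> ln (real (card ?V))"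
    using N by (intro ent_le_ln_card[OF \<nu> simple_function_Tn[OF simple_function_itinerary[OF X]]])
      (auto simp: itinerary_def finite_lists_length_eq)
  also have "card ?V = N ^ n" by (simp add: card_lists_length_eq)
  also have "ln (real (N ^ n)) = real n * ln (real N)"
    using N[of undefined] by (simp add: ln_realpow)
  finally show ?thesis .
qed

text \<open>The time interval is cut at \<open>j\<close> and then every \<open>K\<close> steps; the
  two end pieces have length at most \<open>K\<close> and cost at most \<open>K * ln N\<close> each.
  The lemma will be applied to a uniform distribution on finitely many points, so the block
  entropies stay attached to their positions.\<close>

lemma ent_itinerary_blocks:
  fixes X :: "'a \<Rightarrow> nat"
  assumes \<nu>: "\<nu> \<in> prob_measures" and X: "simple_function borel X" and N: "\<And>x. X x < N"
    and K: "0 < K" and n: "K \<le> n" and j: "j < K"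
  shows "ent \<nu> (itinerary X n) \<le> (\<Sum>s<(n - j) div K. ent \<nu> (\<lambda>x. itinerary X K ((T ^^ (j + s * K)) x)))
     + 2 * real K * ln (real N)"
proof -
  have lnN: "0 \<le> ln (real N)" using N[of undefined] by simp
  note s = simple_function_itinerary[OF X]
  have split: "ent \<nu> (itinerary X (m + k)) \<le> ent \<nu> (itinerary X m) + ent \<nu> (\<lambda>x. itinerary X k ((T ^^ m) x))" for m k
  proof -
    have "ent \<nu> (itinerary X (m + k)) \<le> ent \<nu> (\<lambda>x. (itinerary X m x, itinerary X k ((T ^^ m) x)))"
      by (rule ent_data_processing[OF \<nu> simple_function_Pair[OF s simple_function_Tn[OF s]]])
        (simp add: itinerary_add)
    also have "\<dots> \<le> ent \<nu> (itinerary X m) + ent \<nu> (\<lambda>x. itinerary X k ((T ^^ m) x))"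
      by (rule ent_pair_le[OF \<nu> s simple_function_Tn[OF s]])
    finally show ?thesis .
  qed
  let ?g = "\<lambda>s. ent \<nu> (\<lambda>x. itinerary X K ((T ^^ (j + s * K)) x))"
  have blocks: "ent \<nu> (itinerary X (j + q * K)) \<le> real K * ln (real N) + (\<Sum>s<q. ?g s)" for q
  proof (induction q)
    case 0
    have "ent \<nu> (itinerary X j) \<le> real j * ln (real N)"
      using ent_itinerary_le_general[OF \<nu> X N, of j 0] by simp
    also have "\<dots> \<le> real K * ln (real N)" using j lnN by (intro mult_right_mono) auto
    finally show ?case by simp
  next
    case (Suc q)
    have "ent \<nu> (itinerary X (j + Suc q * K)) \<le> ent \<nu> (itinerary X (j + q * K)) + ?g q"
      using split[of "j + q * K" K] by (simp add: ac_simps)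
    then show ?case using Suc by simp
  qed
  let ?q = "(n - j) div K" and ?r = "(n - j) mod K"
  have nd: "n = (j + ?q * K) + ?r" using j n by simp
  have "ent \<nu> (itinerary X n) \<le> ent \<nu> (itinerary X (j + ?q * K)) + ent \<nu> (\<lambda>x. itinerary X ?r ((T ^^ (j + ?q * K)) x))"
    using split[of "j + ?q * K" ?r] nd by simp
  also have "ent \<nu> (\<lambda>x. itinerary X ?r ((T ^^ (j + ?q * K)) x)) \<le> real ?r * ln (real N)"
    by (rule ent_itinerary_le_general[OF \<nu> X N])
  also have "\<dots> \<le> real K * ln (real N)"
    using K lnN by (intro mult_right_mono) (auto intro: less_imp_le)
  also have "ent \<nu> (itinerary X (j + ?q * K)) \<le> real K * ln (real N) + (\<Sum>s<?q. ?g s)" by (rule blocks)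
  finally show ?thesis by simp
qed

text \<open>Counting by entropy: \<open>ln (card R)\<close> is the entropy of the itinerary under
  the uniform distribution on \<open>R\<close>. It is cut into blocks for each of the
  \<open>K\<close> offsets, and every block entropy is estimated by Gibbs' inequality against the
  one distribution \<open>p\<close>. Summing over the offsets leaves at most one full sum of the
  costs \<open>- ln p\<close> along each orbit, which is what \<open>le\<close> controls.\<close>

lemma card_itineraries_le:
  fixes X :: "'a \<Rightarrow> nat" and p :: "nat list \<Rightarrow> real"
  assumes X: "simple_function borel X" and N: "\<And>x. X x < N" and K: "0 < K" and n: "K \<le> n"
    and p: "\<And>w. 0 < p w" "\<And>w. p w \<le> 1" "(\<Sum>w\<in>range (itinerary X K). p w) \<le> 1"
    and R: "finite R" "R \<noteq> {}" "inj_on (itinerary X n) R"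
    and le: "\<And>x. x \<in> R \<Longrightarrow> (\<Sum>i<n. - ln (p (itinerary X K ((T ^^ i) x)))) \<le> real n * (real K * b)"
  shows "ln (real (card R)) \<le> real n * b + 2 * real K * ln (real N)"
proof -
  let ?\<nu> = "uniform_on R"
  let ?L = "\<lambda>i x. - ln (p (itinerary X K ((T ^^ i) x)))"
  note \<nu> = uniform_on_prob[of R] and sK = simple_function_itinerary[OF X, of K]
  have L_meas: "?L i \<in> borel_measurable borel" for i
    using simple_function_compose[OF simple_function_Tn[OF sK, of i], of "\<lambda>w. - ln (p w)"]
    by (auto simp: comp_def dest: borel_measurable_simple_function)
  have L_nn: "0 \<le> ?L i x" for i x using p(1,2) by simp
  define g where "g i = (\<integral>x. ?L i x \<partial>?\<nu>)" for i
  have g_nn: "0 \<le> g i" for i unfolding g_def by (rule Bochner_Integration.integral_nonneg) (rule L_nn)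
  have eg: "ent ?\<nu> (\<lambda>x. itinerary X K ((T ^^ i) x)) \<le> g i" for i
    unfolding g_def
  proof (rule ent_gibbs[OF \<nu> simple_function_Tn[OF sK]])
    have "(\<Sum>v\<in>range (\<lambda>x. itinerary X K ((T ^^ i) x)). p v) \<le> (\<Sum>w\<in>range (itinerary X K). p w)"
      using simple_functionD_borel(1)[OF sK] by (intro sum_mono2) (auto simp: p less_imp_le)
    then show "(\<Sum>v\<in>range (\<lambda>x. itinerary X K ((T ^^ i) x)). p v) \<le> 1" using p(3) by simp
  qed (simp_all add: p less_imp_le)
  have "real K * ln (real (card R)) = (\<Sum>j<K. ent ?\<nu> (itinerary X n))"
    using ent_uniform_on[OF R(1,2) simple_function_itinerary[OF X] R(3)] by simp
  also have "\<dots> \<le> (\<Sum>j<K. (\<Sum>s<(n - j) div K. g (j + s * K)) + 2 * real K * ln (real N))"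
  proof (rule sum_mono)
    fix j assume "j \<in> {..<K}"
    then have "ent ?\<nu> (itinerary X n) \<le> (\<Sum>s<(n - j) div K. ent ?\<nu> (\<lambda>x. itinerary X K ((T ^^ (j + s * K)) x)))
     + 2 * real K * ln (real N)"
      by (intro ent_itinerary_blocks[OF \<nu> X N K n]) simp
    also have "(\<Sum>s<(n - j) div K. ent ?\<nu> (\<lambda>x. itinerary X K ((T ^^ (j + s * K)) x))) \<le> (\<Sum>s<(n - j) div K. g (j + s * K))"
      by (rule sum_mono[OF eg])
    finally show "ent ?\<nu> (itinerary X n) \<le> (\<Sum>s<(n - j) div K. g (j + s * K)) + 2 * real K * ln (real N)" by simp
  qed
  also have "\<dots> = (\<Sum>(j, s)\<in>(SIGMA j:{..<K}. {..<(n - j) div K}). g (j + s * K)) + real K * (2 * real K * ln (real N))"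
    by (simp add: sum.distrib sum.Sigma)
  \<comment> \<open>Offset and block number are remainder and quotient of the starting time modulo
    \<open>K\<close>, so every time below \<open>n\<close> occurs at most once.\<close>
  also have "(\<Sum>(j, s)\<in>(SIGMA j:{..<K}. {..<(n - j) div K}). g (j + s * K)) \<le> (\<Sum>i<n. g i)"
  proof -
    let ?S = "SIGMA j:{..<K}. {..<(n - j) div K}" and ?f = "\<lambda>(j, s). j + s * K"
    have inj: "inj_on ?f ?S"
    proof (rule inj_onI, clarify)
      fix j s j' s' assume a: "j < K" "j' < K" "j + s * K = j' + s' * K"
      have "(j + s * K) mod K = j" "(j' + s' * K) mod K = j'" using a(1,2) by simp_all
      then have jj: "j = j'" using a(3) by metis
      then show "j = j' \<and> s = s'" using a(3) K by simp
    qed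
    have sub: "?f ` ?S \<subseteq> {..<n}"
    proof clarify
      fix j s assume a: "j < K" "s < (n - j) div K"
      then have "Suc s * K \<le> (n - j) div K * K" by (intro mult_right_mono) auto
      also have "\<dots> \<le> n - j" by simp
      finally show "j + s * K < n" using K by simp
    qed
    have "(\<Sum>(j, s)\<in>?S. g (j + s * K)) = (\<Sum>i\<in>?f ` ?S. g i)"
      by (subst sum.reindex[OF inj]) (simp add: split_def comp_def)
    also have "\<dots> \<le> (\<Sum>i<n. g i)" using sub g_nn by (intro sum_mono2) auto
    finally show ?thesis .
  qed
  also have "(\<Sum>i<n. g i) = (\<Sum>x\<in>R. \<Sum>i<n. ?L i x) / real (card R)"
    unfolding g_def integral_uniform_on[OF R(1,2) L_meas] sum_divide_distrib[symmetric]
    by (subst sum.swap) simp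
  also have "\<dots> \<le> (\<Sum>x\<in>R. real n * (real K * b)) / real (card R)"
    using le by (intro divide_right_mono sum_mono) auto
  also have "\<dots> = real n * (real K * b)" using R by simp
  finally have "real K * ln (real (card R)) \<le> real K * (real n * b + 2 * real K * ln (real N))"
    by (simp add: algebra_simps)
  then show ?thesis using K by (subst (asm) mult_le_cancel_left_pos) auto
qed

text \<open>Partitions into disjointified balls of a common radius \<open>r\<close>; the radius is varied to keep
  the boundaries null.\<close>

definition ball_label :: "(nat \<Rightarrow> 'a) \<Rightarrow> real \<Rightarrow> 'a \<Rightarrow> nat" where
  "ball_label c r x = (LEAST i. dist (c i) x < r)"

definition ball_cover :: "(nat \<Rightarrow> 'a) \<Rightarrow> nat \<Rightarrow> real \<Rightarrow> bool" where
  "ball_cover c N e \<longleftrightarrow> (\<forall>x. \<exists>i<N. dist (c i) x < e)"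

definition null_spheres :: "(nat \<Rightarrow> 'a) \<Rightarrow> nat \<Rightarrow> 'a measure \<Rightarrow> real \<Rightarrow> bool" where
  "null_spheres c N \<mu> r \<longleftrightarrow> (\<forall>i<N. measure \<mu> {x. dist (c i) x = r} = 0)"

lemma ball_cover_exists:
  assumes e: "0 < e" obtains c N where "ball_cover c N e"
proof -
  obtain k where k: "finite k" "UNIV \<subseteq> (\<Union>x\<in>k. ball (x :: 'a) e)"
    using compact_UNIV e unfolding compact_eq_totally_bounded by meson
  obtain c and N :: nat where c: "k = c ` {i. i < N}"
    using finite_imp_nat_seg_image_inj_on[OF k(1)] by metis
  have "\<exists>i<N. dist (c i) x < e" for x
  proof -
    obtain y where y: "y \<in> k" "dist y x < e" using k(2) by fastforce
    then show ?thesis unfolding c by auto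
  qed
  then show thesis using that unfolding ball_cover_def by blast
qed

lemma ball_label:
  assumes "ball_cover c N e" "e \<le> r"
  shows ball_label_less: "ball_label c r x < N"
    and dist_ball_label: "dist (c (ball_label c r x)) x < r"
    and ball_label_eqD: "ball_label c r x = ball_label c r y \<Longrightarrow> dist x y < 2 * r"
    and ball_label_cong: "(\<And>i. i < N \<Longrightarrow> dist (c i) x < r \<longleftrightarrow> dist (c i) y < r) \<Longrightarrow> ball_label c r x = ball_label c r y"
proof -
  have *: "ball_label c r x < N \<and> dist (c (ball_label c r x)) x < r" for x
  proof -
    obtain i where i: "i < N" "dist (c i) x < e" using assms unfolding ball_cover_def by blast
    then have ir: "dist (c i) x < r" using assms(2) by simp
    have "dist (c (ball_label c r x)) x < r" unfolding ball_label_def by (rule LeastI[of _ i]) fact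
    moreover have "ball_label c r x \<le> i" unfolding ball_label_def by (rule Least_le) fact
    ultimately show ?thesis using i by simp
  qed
  then show "ball_label c r x < N" "dist (c (ball_label c r x)) x < r" by auto
  show "dist x y < 2 * r" if "ball_label c r x = ball_label c r y"
    using *[of x] *[of y] that dist_triangle3[of x y "c (ball_label c r y)"] by (simp add: dist_commute)
  assume a: "\<And>i. i < N \<Longrightarrow> dist (c i) x < r \<longleftrightarrow> dist (c i) y < r"
  show "ball_label c r x = ball_label c r y"
  proof (rule antisym)
    show "ball_label c r x \<le> ball_label c r y"
      unfolding ball_label_def[of c r x] by (rule Least_le) (use * a in blast)
    show "ball_label c r y \<le> ball_label c r x"
      unfolding ball_label_def[of c r y] by (rule Least_le) (use * a in blast)
  qed
qed

lemma ball_label_simple: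
  assumes "ball_cover c N e" "e \<le> r"
  shows "simple_function borel (ball_label c r)"
proof -
  have "(\<lambda>x. dist (c i) x < r) \<in> measurable borel (count_space UNIV)" for i
  proof -
    have "(\<lambda>x. dist (c i) x) \<in> borel_measurable borel"
      by (intro borel_measurable_continuous_onI continuous_intros)
    then show ?thesis by measurable
  qed
  then have "ball_label c r \<in> measurable borel (count_space UNIV)"
    unfolding ball_label_def[abs_def] by (rule measurable_Least)
  moreover have "range (ball_label c r) \<subseteq> {..<N}" using ball_label_less[OF assms] by auto
  ultimately show ?thesis
    unfolding simple_function_def by (auto intro: finite_subset dest: measurable_sets)
qed

text \<open>The distance from a centre has a distribution with at most countably many atoms, and
  only finitely many centres matter.\<close>

lemma null_spheres_countable:
  assumes \<mu>: "\<mu> \<in> prob_measures"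
  shows "countable {r. \<not> null_spheres c N \<mu> r}"
proof -
  have "countable {r. measure \<mu> {x. dist (c i) x = r} \<noteq> 0}" for i
  proof -
    let ?D = "distr \<mu> borel (\<lambda>x. dist (c i) x)"
    have m: "(\<lambda>x. dist (c i) x) \<in> borel_measurable \<mu>"
      using prob_measuresD(2)[OF \<mu>]
      by (auto cong: measurable_cong_sets intro!: borel_measurable_continuous_onI continuous_intros)
    interpret D: prob_space ?D by (rule prob_space.prob_space_distr[OF prob_measuresD(1)[OF \<mu>] m])
    interpret D: finite_borel_measure ?D by unfold_locales (auto simp: )
    have "measure ?D {r} = measure \<mu> {x. dist (c i) x = r}" for r
      using m prob_measuresD(3)[OF \<mu>] by (simp add: measure_distr vimage_def)
    then show ?thesis using D.countable_atoms by (simp add: zero_less_measure_iff)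
  qed
  then have "countable (\<Union>i<N. {r. measure \<mu> {x. dist (c i) x = r} \<noteq> 0})" by auto
  moreover have "{r. \<not> null_spheres c N \<mu> r} = (\<Union>i<N. {r. measure \<mu> {x. dist (c i) x = r} \<noteq> 0})"
    by (auto simp: null_spheres_def)
  ultimately show ?thesis by simp
qed

text \<open>At a point none of whose first \<open>n\<close> iterates lies on one of the spheres, all
  comparisons of distances with \<open>r\<close> are locally constant, and so is the itinerary. The
  boundary is thus covered by preimages of null spheres, which are null by invariance.\<close>

lemma frontier_itinerary_null:
  assumes \<mu>: "\<mu> \<in> invariant_measures T" and c: "ball_cover c N e" "e \<le> r" and null: "null_spheres c N \<mu> r"
  shows "measure \<mu> (frontier (itinerary (ball_label c r) n -` {w})) = 0"
proof -
  interpret prob_space \<mu> by (rule prob_measuresD[OF invariantD(1)[OF \<mu>]])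
  have s: "events = sets borel" by (rule prob_measuresD[OF invariantD(1)[OF \<mu>]])
  let ?S = "\<lambda>i. {x. dist (c i) x = r}"
  let ?B = "\<Union>i<n. \<Union>j<N. (T ^^ i) -` ?S j"
  let ?C = "itinerary (ball_label c r) n -` {w}"
  have "closed (?S j)" for j by (intro closed_Collect_eq continuous_intros)
  then have Ss: "?S j \<in> sets borel" for j by simp
  have "?B \<in> null_sets \<mu>"
  proof (intro null_sets_UN' countable_finite finite_lessThan)
    fix i j assume "j \<in> {..<N}"
    then have "measure \<mu> ((T ^^ i) -` ?S j) = 0"
      using measure_vimage_Tn[OF \<mu> Ss] null by (simp add: null_spheres_def)
    then show "(T ^^ i) -` ?S j \<in> null_sets \<mu>"
      using vimage_Tn_sets[OF Ss] s by (simp add: null_sets_def emeasure_eq_measure)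
  qed
  moreover have "frontier ?C \<subseteq> ?B"
  proof (rule ccontr)
    assume "\<not> frontier ?C \<subseteq> ?B"
    then obtain x where x: "x \<in> frontier ?C" "x \<notin> ?B" by blast
    define V where "V i j = (if dist (c j) ((T ^^ i) x) < r then {y. dist (c j) ((T ^^ i) y) < r}
      else {y. r < dist (c j) ((T ^^ i) y)})" for i j
    let ?U = "\<Inter>i<n. \<Inter>j<N. V i j"
    have "open (V i j)" for i j
      unfolding V_def by (auto intro!: open_Collect_less continuous_intros continuous_on_compose2[OF cont_Tn])
    then have U: "open ?U" by (intro open_INT) auto
    have xU: "x \<in> ?U" using x(2) by (auto simp: V_def not_less less_le)
    have eq: "itinerary (ball_label c r) n y = itinerary (ball_label c r) n x" if y: "y \<in> ?U" for y
      unfolding itinerary_eq_iff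
    proof (intro allI impI)
      fix i assume i: "i < n"
      show "ball_label c r ((T ^^ i) y) = ball_label c r ((T ^^ i) x)"
      proof (rule ball_label_cong[OF c])
        fix j assume j: "j < N"
        have "y \<in> V i j" using y i j by blast
        then show "dist (c j) ((T ^^ i) y) < r \<longleftrightarrow> dist (c j) ((T ^^ i) x) < r"
          by (auto simp: V_def split: if_splits)
      qed
    qed
    show False
    proof (cases "x \<in> ?C")
      case True
      then have "?U \<subseteq> ?C" using eq by auto
      then have "x \<in> interior ?C" using U xU by (rule interiorI[rotated 2])
      then show False using x(1) by (simp add: frontier_def)
    next
      case False
      then have "?U \<inter> ?C = {}" using eq by auto
      then have "?U \<inter> closure ?C = {}" using U open_Int_closure_eq_empty by metis
      then show False using x(1) xU by (auto simp: frontier_def)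
    qed
  qed
  ultimately have "frontier ?C \<in> null_sets \<mu>"
    using null_sets_subset[of ?B \<mu> "frontier ?C"] s frontier_closed by auto
  then show ?thesis by (simp add: null_sets_def measure_def)
qed


text \<open>A basic weak neighbourhood of \<mu>, pulled back to the points whose empirical measure
  of length \<open>n\<close> lies in it.\<close>

definition near :: "('a \<Rightarrow> real) set \<Rightarrow> real \<Rightarrow> 'a measure \<Rightarrow> nat \<Rightarrow> 'a set" where
  "near H \<theta> \<mu> n = {x. \<forall>h\<in>H. \<bar>birkhoff_sum T n h x / real n - (\<integral>y. h y \<partial>\<mu>)\<bar> < \<theta>}"

lemma null_radius_exists:
  assumes "\<mu> \<in> prob_measures" "a < b" obtains r where "a < r" "r < b" "null_spheres c N \<mu> r"
proof -
  have "\<not> {a<..<b} \<subseteq> {r. \<not> null_spheres c N \<mu> r}"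
    using null_spheres_countable[OF assms(1)] uncountable_open_interval[of a b] assms(2) countable_subset by blast
  then show thesis using that by auto
qed

text \<open>Segments near \<mu> have nearly the word frequencies of \<mu>, because the atoms of the
  partition have null boundary. Coding words with probabilities close to those of \<mu> therefore
  costs little more than \<open>h\<close> per step, which bounds the number of itineraries. Segments
  with equal itineraries lie in one Bowen ball.\<close>

lemma bowen_ball_covering:
  assumes \<mu>: "\<mu> \<in> invariant_measures T" and h: "\<And>X :: 'a \<Rightarrow> nat. simple_function borel X \<Longrightarrow> entropy_rate \<mu> X \<le> h"
    and \<epsilon>: "0 < \<epsilon>" and \<eta>: "0 < \<eta>"
  obtains H \<theta> n0 where "finite H" "\<And>g. g \<in> H \<Longrightarrow> continuous_on UNIV g" "0 < \<theta>"
    "\<And>n. n \<ge> n0 \<Longrightarrow> \<exists>R. finite R \<and> R \<subseteq> near H \<theta> \<mu> n \<and> real (card R) \<le> exp (real n * (h + \<eta>))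
        \<and> near H \<theta> \<mu> n \<subseteq> (\<Union>x\<in>R. bowen_ball d T n x \<epsilon>)"
proof -
  note pr = invariantD(1)[OF \<mu>]
  interpret prob_space \<mu> by (rule prob_measuresD[OF pr])
  obtain \<delta> where \<delta>: "0 < \<delta>" "\<And>x y. dist x y < \<delta> \<Longrightarrow> d x y < \<epsilon>" using d_small[OF \<epsilon>] by blast
  obtain c N where c: "ball_cover c N (\<delta>/4)" using ball_cover_exists[of "\<delta>/4"] \<delta>(1) by auto
  obtain r where r: "\<delta>/4 < r" "r < \<delta>/2" "null_spheres c N \<mu> r"
    using null_radius_exists[OF pr, of "\<delta>/4" "\<delta>/2"] \<delta>(1) by auto
  define a where "a = ball_label c r"
  have r': "\<delta>/4 \<le> r" using r by simp
  have aN: "a x < N" for x unfolding a_def by (rule ball_label_less[OF c r'])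
  have a: "simple_function borel a" unfolding a_def by (rule ball_label_simple[OF c r'])
  have a_d: "d x y \<le> \<epsilon>" if "a x = a y" for x y
  proof -
    have "dist x y < 2 * r" using ball_label_eqD[OF c r'] that by (simp add: a_def)
    then show ?thesis using \<delta>(2)[of x y] r(2) by simp
  qed
  have "(\<lambda>n. ent \<mu> (itinerary a n) / real n) \<longlonglongrightarrow> entropy_rate \<mu> a" by (rule entropy_rate_LIMSEQ[OF \<mu> a])
  moreover have "entropy_rate \<mu> a < h + \<eta>/8" using h[OF a] \<eta> by simp
  ultimately have "\<forall>\<^sub>F n in sequentially. ent \<mu> (itinerary a n) / real n < h + \<eta>/8" by (rule order_tendstoD)
  then obtain K0 where K0: "\<And>n. n \<ge> K0 \<Longrightarrow> ent \<mu> (itinerary a n) / real n < h + \<eta>/8"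
    by (auto simp: eventually_sequentially)
  define K where "K = max 1 K0"
  have K: "0 < K" by (simp add: K_def)
  have E: "ent \<mu> (itinerary a K) \<le> real K * (h + \<eta>/8)"
    using K0[of K] K by (simp add: K_def field_simps)
  let ?I = "itinerary a K"
  have sI: "simple_function borel ?I" by (rule simple_function_itinerary[OF a])
  define W where "W = range ?I"
  have finW: "finite W" unfolding W_def by (rule simple_functionD_borel[OF sI])
  define M where "M = real (card W)"
  have "card W \<noteq> 0" using finW by (simp add: W_def)
  then have M: "1 \<le> M" by (simp add: M_def)
  define q where "q w = measure \<mu> (?I -` {w})" for w
  have q: "0 \<le> q w" "q w \<le> 1" for w by (auto simp: q_def)
  have q1: "(\<Sum>w\<in>W. q w) = 1" unfolding q_def W_def
    by (rule sum_measure_label[OF pr sI subset_refl]) (use finW in \<open>simp add: W_def\<close>)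
  \<comment> \<open>Chosen so that the factor \<open>1 - \<tau>\<close> in \<open>p\<close> costs
    exactly \<open>K * \<eta> / 8\<close> in the logarithm.\<close>
  define \<tau> where "\<tau> = 1 - exp (- (real K * \<eta> / 8))"
  have Kp: "0 < real K" using K by simp
  have \<tau>: "0 < \<tau>" "\<tau> < 1" using Kp \<eta> by (auto simp: \<tau>_def)
  have ln\<tau>: "- ln (1 - \<tau>) = real K * \<eta> / 8" by (simp add: \<tau>_def)
  \<comment> \<open>Mixing with the uniform distribution on the words bounds \<open>- ln p\<close>
    by \<open>L\<close>, also for words of \<mu>-mass 0, which a segment near \<mu> may still
    contain.\<close>
  define p where "p w = (1 - \<tau>) * q w + \<tau> / M" for w
  have pl: "\<tau> / M \<le> p w" "(1 - \<tau>) * q w \<le> p w" for w using \<tau> q[of w] M by (auto simp: p_def)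
  have tM: "0 < \<tau> / M" using \<tau> M by simp
  have p0: "0 < p w" for w using pl(1)[of w] tM by linarith
  have p1: "p w \<le> 1" for w
  proof -
    have "(1 - \<tau>) * q w \<le> (1 - \<tau>) * 1" using \<tau> q by (intro mult_left_mono) auto
    moreover have "\<tau> / M \<le> \<tau>" using \<tau> M by (simp add: field_simps)
    ultimately show ?thesis by (simp add: p_def)
  qed
  have psum: "(\<Sum>w\<in>W. p w) \<le> 1"
    using q1 M by (simp add: p_def sum.distrib sum_distrib_left[symmetric] M_def[symmetric])
  define L where "L = - ln (\<tau> / M)"
  have pL: "- ln (p w) \<le> L" for w using pl(1)[of w] tM p0[of w] by (simp add: L_def)
  have pn: "0 \<le> - ln (p w)" for w using p0[of w] p1[of w] by simp
  have L0: "0 \<le> L" using pL pn order_trans by blast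
  \<comment> \<open>The error allowed in the frequency of one word: \<open>M\<close> words of cost
    at most \<open>L\<close> lose at most \<open>K * \<eta> / 8\<close> together. The summand 1
    covers the case \<open>L = 0\<close>.\<close>
  define kap where "kap = real K * \<eta> / 8 / (M * (L + 1))"
  have Mpos: "0 < M * (L + 1)" using M L0 by (intro mult_pos_pos) auto
  have kap: "0 < kap" using Kp \<eta> Mpos by (simp add: kap_def)
  have kapM: "kap * M * L \<le> real K * \<eta> / 8"
  proof -
    have "kap * M * L \<le> kap * (M * (L + 1))" using kap M by (simp add: algebra_simps)
    also have "kap * (M * (L + 1)) = real K * \<eta> / 8"
      using Mpos M L0 by (intro iffD1[OF nonzero_eq_divide_eq kap_def]) auto
    finally show ?thesis .
  qed
  have "\<forall>w. \<exists>g k :: 'a \<Rightarrow> real. continuous_on UNIV g \<and> continuous_on UNIV k \<and>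
    (\<forall>\<nu> \<in> prob_measures. \<bar>(\<integral>x. g x \<partial>\<nu>) - (\<integral>x. g x \<partial>\<mu>)\<bar> < kap/2 \<longrightarrow> \<bar>(\<integral>x. k x \<partial>\<nu>) - (\<integral>x. k x \<partial>\<mu>)\<bar> < kap/2
       \<longrightarrow> \<bar>measure \<nu> (?I -` {w}) - measure \<mu> (?I -` {w})\<bar> < 2 * (kap/2))"
  proof
    fix w
    have "measure \<mu> (frontier (?I -` {w})) = 0"
      unfolding a_def by (rule frontier_itinerary_null[OF \<mu> c r' r(3)])
    from null_boundary_nbhd[OF pr simple_functionD_borel(2)[OF sI] this, of "kap/2"] kap
    show "\<exists>g k :: 'a \<Rightarrow> real. continuous_on UNIV g \<and> continuous_on UNIV k \<and>
    (\<forall>\<nu> \<in> prob_measures. \<bar>(\<integral>x. g x \<partial>\<nu>) - (\<integral>x. g x \<partial>\<mu>)\<bar> < kap/2 \<longrightarrow> \<bar>(\<integral>x. k x \<partial>\<nu>) - (\<integral>x. k x \<partial>\<mu>)\<bar> < kap/2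
       \<longrightarrow> \<bar>measure \<nu> (?I -` {w}) - measure \<mu> (?I -` {w})\<bar> < 2 * (kap/2))"
      by (metis half_gt_zero)
  qed
  then obtain g k :: "nat list \<Rightarrow> 'a \<Rightarrow> real" where gk: "\<And>w. continuous_on UNIV (g w)" "\<And>w. continuous_on UNIV (k w)"
    "\<And>w \<nu>. \<nu> \<in> prob_measures \<Longrightarrow> \<bar>(\<integral>x. g w x \<partial>\<nu>) - (\<integral>x. g w x \<partial>\<mu>)\<bar> < kap/2 \<Longrightarrow> \<bar>(\<integral>x. k w x \<partial>\<nu>) - (\<integral>x. k w x \<partial>\<mu>)\<bar> < kap/2
       \<Longrightarrow> \<bar>measure \<nu> (?I -` {w}) - q w\<bar> < kap"
    unfolding choice_iff q_def by (auto simp: )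
  define H where "H = g ` W \<union> k ` W"
  have finH: "finite H" using finW by (simp add: H_def)
  have contH: "continuous_on UNIV u" if "u \<in> H" for u using that gk(1,2) by (auto simp: H_def)
  \<comment> \<open>The three eighths are the excess of the entropy of words of length
    \<open>K\<close> over \<open>h\<close>, the smoothing of \<open>p\<close>, and the frequency
    errors. Of the remainder, \<open>\<eta> / 2\<close> absorbs \<open>2 * K * ln N\<close> once
    \<open>n\<close> is large.\<close>
  define b where "b = h + 3 * \<eta> / 8"
  have key: "(\<Sum>i<n. - ln (p (?I ((T ^^ i) x)))) \<le> real n * (real K * b)" if n: "1 \<le> n" and x: "x \<in> near H (kap/2) \<mu> n" for n x
  proof -
    let ?\<nu> = "empirical T n x"
    have \<nu>: "?\<nu> \<in> prob_measures" by (rule empirical_in_prob_measures[OF n])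
    have u: "\<bar>(\<integral>y. u y \<partial>?\<nu>) - (\<integral>y. u y \<partial>\<mu>)\<bar> < kap/2" if "u \<in> H" for u
      using x that unfolding near_def integral_empirical_continuous[OF n contH[OF that]] by blast
    have close: "measure ?\<nu> (?I -` {w}) \<le> q w + kap" if "w \<in> W" for w
      using gk(3)[OF \<nu> u u, of w] that by (simp add: H_def)
    have m: "(\<lambda>y. - ln (p (?I y))) \<in> borel_measurable borel"
      using simple_function_compose[OF sI, of "\<lambda>w. - ln (p w)"]
      by (auto simp: comp_def dest: borel_measurable_simple_function)
    have "(\<Sum>i<n. - ln (p (?I ((T ^^ i) x)))) / real n = (\<integral>y. - ln (p (?I y)) \<partial>?\<nu>)"
      using integral_empirical[OF n m, of T x] by (simp add: birkhoff_sum_def)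
    also have "\<dots> = (\<Sum>w\<in>W. - ln (p w) * measure ?\<nu> (?I -` {w}))"
      by (rule integral_label[OF \<nu> sI]) (use finW in \<open>auto simp: W_def\<close>)
    also have "\<dots> \<le> (\<Sum>w\<in>W. - ln (p w) * (q w + kap))"
      using close pn by (intro sum_mono mult_left_mono) auto
    also have "\<dots> \<le> (\<Sum>w\<in>W. (- (q w * ln (q w)) + q w * (real K * \<eta> / 8)) + L * kap)"
    proof (rule sum_mono)
      fix w assume "w \<in> W"
      have "- ln (p w) * q w \<le> - (q w * ln (q w)) + q w * (real K * \<eta> / 8)"
      proof (cases "q w = 0")
        case False
        then have q0: "0 < q w" using q[of w] by simp
        then have "ln ((1 - \<tau>) * q w) \<le> ln (p w)" using pl(2)[of w] \<tau> p0[of w] by (subst ln_le_cancel_iff) auto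
        then have "- ln (p w) \<le> - ln (q w) + real K * \<eta> / 8" using q0 \<tau> ln\<tau> by (simp add: ln_mult)
        then have "q w * - ln (p w) \<le> q w * (- ln (q w) + real K * \<eta> / 8)" using q0 by (intro mult_left_mono) auto
        then show ?thesis by (simp add: algebra_simps)
      qed simp
      moreover have "- ln (p w) * kap \<le> L * kap" using pL[of w] kap by (intro mult_right_mono) auto
      ultimately show "- ln (p w) * (q w + kap) \<le> - (q w * ln (q w)) + q w * (real K * \<eta> / 8) + L * kap"
        by (simp add: distrib_left)
    qed
    also have "\<dots> = ent \<mu> ?I + real K * \<eta> / 8 + kap * M * L"
    proof -
      have "(\<Sum>w\<in>W. q w * (real K * \<eta> / 8)) = real K * \<eta> / 8"
        by (simp only: sum_distrib_right[symmetric] q1 mult_1_left)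
      moreover have "(\<Sum>w\<in>W. - (q w * ln (q w))) = ent \<mu> ?I" by (simp add: ent_def q_def W_def)
      ultimately show ?thesis by (simp only: sum.distrib) (simp add: M_def)
    qed
    also have "\<dots> \<le> real K * b" using E kapM by (simp add: b_def algebra_simps)
    finally show ?thesis using n by (simp add: field_simps)
  qed
  obtain n1 where n1: "2 * real K * ln (real N) / (\<eta> / 2) < real n1" using reals_Archimedean2 by blast
  show thesis
  proof (rule that[OF finH contH])
    show "0 < kap/2" using kap by simp
    fix n assume n: "n \<ge> max n1 K"
    let ?S = "near H (kap/2) \<mu> n"
    \<comment> \<open>One point of \<open>?S\<close> for each itinerary that occurs in
      \<open>?S\<close>.\<close>
    obtain R where R: "R \<subseteq> ?S" "inj_on (itinerary a n) R" "itinerary a n ` ?S = itinerary a n ` R"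
      using subset_image_inj[of "itinerary a n ` ?S" "itinerary a n" ?S] by auto
    have finR: "finite R"
      using simple_functionD_borel(1)[OF simple_function_itinerary[OF a, of n]] R(2)
      by (meson finite_imageD finite_subset image_mono subset_UNIV)
    have "real (card R) \<le> exp (real n * (h + \<eta>))"
    proof (cases "R = {}")
      case False
      have "ln (real (card R)) \<le> real n * b + 2 * real K * ln (real N)"
        by (rule card_itineraries_le[OF a aN K _ p0 p1 psum[unfolded W_def] finR False R(2)])
          (use n R(1) key K in auto)
      also have "2 * real K * ln (real N) \<le> real n * (\<eta> / 2)"
      proof -
        have "2 * real K * ln (real N) / (\<eta> / 2) \<le> real n" using n1 n by linarith
        then show ?thesis using \<eta> by (simp add: field_simps)
      qed
      also have "real n * b + real n * (\<eta> / 2) \<le> real n * (h + \<eta>)"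
        unfolding distrib_left[symmetric] using \<eta> by (intro mult_left_mono) (auto simp: b_def)
      finally have "exp (ln (real (card R))) \<le> exp (real n * (h + \<eta>))" by simp
      then show ?thesis using False finR by (simp add: card_gt_0_iff)
    qed simp
    moreover have "?S \<subseteq> (\<Union>x\<in>R. bowen_ball d T n x \<epsilon>)"
    proof
      fix y assume "y \<in> ?S"
      then have "itinerary a n y \<in> itinerary a n ` R" unfolding R(3)[symmetric] by (rule imageI)
      then obtain x where x: "x \<in> R" "itinerary a n x = itinerary a n y" by force
      then have "y \<in> bowen_ball d T n x \<epsilon>" using a_d by (simp add: bowen_ball_def itinerary_eq_iff)
      then show "y \<in> (\<Union>x\<in>R. bowen_ball d T n x \<epsilon>)" using x(1) by blast
    qed
    ultimately show "\<exists>R. finite R \<and> R \<subseteq> ?S \<and> real (card R) \<le> exp (real n * (h + \<eta>))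
        \<and> ?S \<subseteq> (\<Union>x\<in>R. bowen_ball d T n x \<epsilon>)"
      using finR R(1) by blast
  qed
qed

section \<open>Upper bounds for the pressure\<close>

lemma pressure_sum_le_lim: "pressure_sum d T Z t \<phi> n \<epsilon> \<le> pressure_lim d T Z t \<phi> \<epsilon>"
  using incseq_le[OF incseq_pressure_sum pressure_sum_tendsto] .

lemma pressure_lim_zeroI:
  assumes "\<And>n. pressure_sum d T Z t \<phi> n \<epsilon> = 0" shows "pressure_lim d T Z t \<phi> \<epsilon> = 0"
  using assms by (simp add: pressure_lim_def limI)

text \<open>The cost of a cover is an infinite sum in \<open>ennreal\<close>, hence the supremum of
  its finite subsums.\<close>

lemma pressure_sum_leI:
  assumes "C \<in> ball_covers d T Z n \<epsilon>"
    and "\<And>F. finite F \<Longrightarrow> F \<subseteq> C \<Longrightarrow> (\<Sum>(m, x)\<in>F.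
      ennreal (exp (- t * real m + (SUP y\<in>bowen_ball d T m x \<epsilon>. birkhoff_sum T m \<phi> y)))) \<le> B"
  shows "pressure_sum d T Z t \<phi> n \<epsilon> \<le> B"
proof -
  have "(\<Sum>\<^sub>\<infinity>(m, x)\<in>C. ennreal (exp (- t * real m + (SUP y\<in>bowen_ball d T m x \<epsilon>. birkhoff_sum T m \<phi> y)))) \<le> B"
  proof (subst nonneg_infsum_complete)
    show "(SUP F\<in>{F. finite F \<and> F \<subseteq> C}. \<Sum>(m, x)\<in>F.
      ennreal (exp (- t * real m + (SUP y\<in>bowen_ball d T m x \<epsilon>. birkhoff_sum T m \<phi> y)))) \<le> B"
      by (rule SUP_least, rule assms(2)) simp_all
  qed simp
  then show ?thesis unfolding pressure_sum_def using assms(1) by (rule INF_lower2[rotated])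
qed

text \<open>Covers of the pieces with geometrically decreasing costs are united. The scale
  \<epsilon> stays fixed, so a reduction to countably many pieces can precede the limit over
  \<epsilon>.\<close>

lemma pressure_lim_Union_zero:
  fixes Z :: "nat \<Rightarrow> 'a set"
  assumes "\<And>i. pressure_lim d T (Z i) t \<phi> \<epsilon> = 0"
  shows "pressure_lim d T (\<Union>i. Z i) t \<phi> \<epsilon> = 0"
proof (rule pressure_lim_zeroI)
  fix n
  let ?w = "\<lambda>(m, x). ennreal (exp (- t * real m + (SUP y\<in>bowen_ball d T m x \<epsilon>. birkhoff_sum T m \<phi> y)))"
  have "pressure_sum d T (\<Union>i. Z i) t \<phi> n \<epsilon> \<le> ennreal e" if e: "0 < e" for e
  proof -
    have "\<forall>i. \<exists>C. C \<in> ball_covers d T (Z i) n \<epsilon> \<and> infsum ?w C < ennreal (e * (1/2) ^ Suc i)"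
    proof
      fix i
      have "pressure_sum d T (Z i) t \<phi> n \<epsilon> = 0"
        using pressure_sum_le_lim[of "Z i" t \<phi> n \<epsilon>] assms by simp
      then have "pressure_sum d T (Z i) t \<phi> n \<epsilon> < ennreal (e * (1/2) ^ Suc i)" using e by simp
      then show "\<exists>C. C \<in> ball_covers d T (Z i) n \<epsilon> \<and> infsum ?w C < ennreal (e * (1/2) ^ Suc i)"
        unfolding pressure_sum_def INF_less_iff by blast
    qed
    from choice[OF this] obtain C where
      "\<forall>i. C i \<in> ball_covers d T (Z i) n \<epsilon> \<and> infsum ?w (C i) < ennreal (e * (1/2) ^ Suc i)" ..
    then have C: "C i \<in> ball_covers d T (Z i) n \<epsilon>" "infsum ?w (C i) < ennreal (e * (1/2) ^ Suc i)" for i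
      by (simp_all only: spec[of _ i, THEN conjunct1] spec[of _ i, THEN conjunct2])
    show ?thesis
    proof (rule pressure_sum_leI[of "\<Union>i. C i"])
      show "(\<Union>i. C i) \<in> ball_covers d T (\<Union>i. Z i) n \<epsilon>"
        using C(1) by (fastforce simp: ball_covers_def)
      fix F assume F: "finite F" "F \<subseteq> (\<Union>i. C i)"
      obtain j where j: "finite j" "F \<subseteq> (\<Union>i\<in>j. C i)"
        using finite_subset_Union[of F "range C"] F by (metis finite_subset_image)
      have "sum ?w F \<le> (\<Sum>x\<in>F. \<Sum>i\<in>j. if x \<in> C i then ?w x else 0)"
      proof (rule sum_mono)
        fix x assume "x \<in> F"
        then obtain i where i: "i \<in> j" "x \<in> C i" using j(2) by blast
        have "(if x \<in> C i then ?w x else 0) \<le> (\<Sum>i\<in>j. if x \<in> C i then ?w x else 0)"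
          by (rule member_le_sum[OF i(1) _ j(1)]) simp
        then show "?w x \<le> (\<Sum>i\<in>j. if x \<in> C i then ?w x else 0)" using i(2) by simp
      qed
      also have "\<dots> = (\<Sum>i\<in>j. sum ?w (F \<inter> C i))"
        unfolding sum.inter_restrict[OF F(1)] by (rule sum.swap)
      also have "\<dots> \<le> (\<Sum>i\<in>j. ennreal (e * (1/2) ^ Suc i))"
      proof (rule sum_mono)
        fix i
        have "sum ?w (F \<inter> C i) \<le> infsum ?w (C i)"
          by (subst nonneg_infsum_complete) (use F(1) in \<open>auto intro!: SUP_upper\<close>)
        then show "sum ?w (F \<inter> C i) \<le> ennreal (e * (1/2) ^ Suc i)" using C(2)[of i] by simp
      qed
      also have "\<dots> = ennreal (\<Sum>i\<in>j. e * (1/2) ^ Suc i)" using e by (subst sum_ennreal) auto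
      also have "\<dots> \<le> ennreal e"
      proof (rule ennreal_leI)
        have "(\<Sum>i\<in>j. (1/2::real) ^ Suc i) \<le> 1"
          using sum_le_suminf[OF summable_half j(1)] power_half_series by (simp add: sums_iff)
        then show "(\<Sum>i\<in>j. e * (1/2) ^ Suc i) \<le> e"
          unfolding sum_distrib_left[symmetric] using e by (intro mult_left_le) auto
      qed
      finally show "sum ?w F \<le> ennreal e" .
    qed
  qed
  note le = this
  have "pressure_sum d T (\<Union>i. Z i) t \<phi> n \<epsilon> \<le> 0"
    by (rule ennreal_le_epsilon) (simp add: le)
  then show "pressure_sum d T (\<Union>i. Z i) t \<phi> n \<epsilon> = 0" by simp
qed

lemma pressure_lim_mono:
  assumes "Z \<subseteq> Z'" shows "pressure_lim d T Z t \<phi> \<epsilon> \<le> pressure_lim d T Z' t \<phi> \<epsilon>"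
proof (rule LIMSEQ_le[OF pressure_sum_tendsto pressure_sum_tendsto])
  have "pressure_sum d T Z t \<phi> n \<epsilon> \<le> pressure_sum d T Z' t \<phi> n \<epsilon>" for n
    unfolding pressure_sum_def
  proof (rule INF_superset_mono[OF _ order_refl])
    show "ball_covers d T Z' n \<epsilon> \<subseteq> ball_covers d T Z n \<epsilon>"
      using assms unfolding ball_covers_def by fast
  qed
  then show "\<exists>N. \<forall>n\<ge>N. pressure_sum d T Z t \<phi> n \<epsilon> \<le> pressure_sum d T Z' t \<phi> n \<epsilon>" by simp
qed


lemma near_mono: "H \<subseteq> H' \<Longrightarrow> \<theta>' \<le> \<theta> \<Longrightarrow> near H' \<theta>' \<mu> n \<subseteq> near H \<theta> \<mu> n"
  unfolding near_def by (auto intro: less_le_trans)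

lemma birkhoff_sum_diff_le:
  fixes \<phi> :: "'a \<Rightarrow> real"
  assumes "\<And>i. i < n \<Longrightarrow> d ((T ^^ i) x) ((T ^^ i) y) \<le> \<epsilon>" "\<And>x y. d x y \<le> \<epsilon> \<Longrightarrow> \<bar>\<phi> x - \<phi> y\<bar> \<le> \<tau>"
  shows "\<bar>birkhoff_sum T n \<phi> x - birkhoff_sum T n \<phi> y\<bar> \<le> real n * \<tau>"
proof -
  have "\<bar>birkhoff_sum T n \<phi> x - birkhoff_sum T n \<phi> y\<bar> = \<bar>\<Sum>i<n. \<phi> ((T ^^ i) x) - \<phi> ((T ^^ i) y)\<bar>"
    by (simp add: birkhoff_sum_def sum_subtractf)
  also have "\<dots> \<le> (\<Sum>i<n. \<bar>\<phi> ((T ^^ i) x) - \<phi> ((T ^^ i) y)\<bar>)" by (rule sum_abs)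
  also have "\<dots> \<le> (\<Sum>i<n. \<tau>)" using assms by (intro sum_mono) auto
  finally show ?thesis by simp
qed

lemma bowen_ball_sup_le:
  fixes \<phi> :: "'a \<Rightarrow> real"
  assumes \<epsilon>: "0 \<le> \<epsilon>" and mod: "\<And>x y. d x y \<le> \<epsilon> \<Longrightarrow> \<bar>\<phi> x - \<phi> y\<bar> \<le> \<tau>" and z: "z \<in> bowen_ball d T m x \<epsilon>"
  shows "(SUP y\<in>bowen_ball d T m x \<epsilon>. birkhoff_sum T m \<phi> y) \<le> birkhoff_sum T m \<phi> z + 2 * real m * \<tau>"
proof (rule cSUP_least)
  show "bowen_ball d T m x \<epsilon> \<noteq> {}" using z by blast
  fix y assume "y \<in> bowen_ball d T m x \<epsilon>"
  then have "\<bar>birkhoff_sum T m \<phi> x - birkhoff_sum T m \<phi> y\<bar> \<le> real m * \<tau>"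
    by (intro birkhoff_sum_diff_le[OF _ mod]) (auto simp: bowen_ball_def)
  moreover have "\<bar>birkhoff_sum T m \<phi> x - birkhoff_sum T m \<phi> z\<bar> \<le> real m * \<tau>"
    using z by (intro birkhoff_sum_diff_le[OF _ mod]) (auto simp: bowen_ball_def)
  ultimately show "birkhoff_sum T m \<phi> y \<le> birkhoff_sum T m \<phi> z + 2 * real m * \<tau>" by linarith
qed

text \<open>Points that return infinitely often lie in the covers of arbitrarily large lengths
  \<open>n\<close>, and the cost of the cover of length \<open>n\<close> decays geometrically, so
  tails of the family are cheap covers.\<close>

lemma pressure_lim_local:
  fixes \<phi> :: "'a \<Rightarrow> real"
  assumes \<mu>: "\<mu> \<in> invariant_measures T" and \<phi>: "continuous_on UNIV \<phi>"
    and hs: "metric_entropy T \<mu> + ereal (\<integral>x. \<phi> x \<partial>\<mu>) \<le> ereal s" and st: "s < t" and \<epsilon>: "0 < \<epsilon>"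
    and mod: "\<And>x y. d x y \<le> \<epsilon> \<Longrightarrow> \<bar>\<phi> x - \<phi> y\<bar> \<le> (t - s) / 8"
  obtains H \<theta> where "finite H" "\<And>g. g \<in> H \<Longrightarrow> continuous_on UNIV g" "0 < \<theta>"
    "pressure_lim d T {x. \<forall>N. \<exists>n\<ge>N. x \<in> near H \<theta> \<mu> n} t \<phi> \<epsilon> = 0"
proof -
  \<comment> \<open>The gap \<open>t - s\<close> consists of eight shares: one for the number of
    balls, one for the Birkhoff average, two for the oscillation of \<phi> inside a ball. The
    remaining four give the decay rate \<open>exp (- 4 * \<tau>)\<close>.\<close>
  define \<tau> where "\<tau> = (t - s) / 8"
  have \<tau>: "0 < \<tau>" using st by (simp add: \<tau>_def)
  define I where "I = (\<integral>x. \<phi> x \<partial>\<mu>)"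
  define h where "h = s - I"
  have hme: "metric_entropy T \<mu> \<le> ereal h"
    using hs unfolding h_def I_def by (cases "metric_entropy T \<mu>") auto
  have hr: "entropy_rate \<mu> X \<le> h" if "simple_function borel X" for X :: "'a \<Rightarrow> nat"
    using entropy_rate_le_metric_entropy[OF that, of \<mu>] hme by (metis ereal_less_eq(3) order_trans)
  obtain H' \<theta>' n0 where H': "finite H'" "\<And>g. g \<in> H' \<Longrightarrow> continuous_on UNIV g" "0 < \<theta>'"
    and R: "\<And>n. n \<ge> n0 \<Longrightarrow> \<exists>R. finite R \<and> R \<subseteq> near H' \<theta>' \<mu> n \<and> real (card R) \<le> exp (real n * (h + \<tau>))
        \<and> near H' \<theta>' \<mu> n \<subseteq> (\<Union>x\<in>R. bowen_ball d T n x \<epsilon>)"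
    using bowen_ball_covering[OF \<mu> hr \<epsilon> \<tau>] by metis
  define H where "H = insert \<phi> H'"
  define \<theta> where "\<theta> = min \<theta>' \<tau>"
  let ?Z = "{x. \<forall>N. \<exists>n\<ge>N. x \<in> near H \<theta> \<mu> n}"
  let ?w = "\<lambda>(m, x). ennreal (exp (- t * real m + (SUP y\<in>bowen_ball d T m x \<epsilon>. birkhoff_sum T m \<phi> y)))"
  have "\<forall>n. \<exists>R. n \<ge> max 1 n0 \<longrightarrow> finite R \<and> near H \<theta> \<mu> n \<subseteq> (\<Union>x\<in>R. bowen_ball d T n x \<epsilon>) \<and>
      (\<Sum>x\<in>R. ?w (n, x)) \<le> ennreal (exp (- 4 * \<tau>) ^ n)"
  proof
    fix n
    show "\<exists>R. n \<ge> max 1 n0 \<longrightarrow> finite R \<and> near H \<theta> \<mu> n \<subseteq> (\<Union>x\<in>R. bowen_ball d T n x \<epsilon>) \<and>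
      (\<Sum>x\<in>R. ?w (n, x)) \<le> ennreal (exp (- 4 * \<tau>) ^ n)"
    proof (cases "n \<ge> max 1 n0")
      case True
      then obtain R where R: "finite R" "real (card R) \<le> exp (real n * (h + \<tau>))"
          "near H' \<theta>' \<mu> n \<subseteq> (\<Union>x\<in>R. bowen_ball d T n x \<epsilon>)" using R[of n] by auto
      \<comment> \<open>Only balls meeting the smaller neighbourhood are kept: the supremum over
        such a ball is compared with the Birkhoff sum at a common point, where the average of \<phi>
        is under control.\<close>
      define Q where "Q = {x \<in> R. bowen_ball d T n x \<epsilon> \<inter> near H \<theta> \<mu> n \<noteq> {}}"
      have Q: "finite Q" "card Q \<le> card R" using R(1) by (auto simp: Q_def intro: card_mono)
      have cov: "near H \<theta> \<mu> n \<subseteq> (\<Union>x\<in>Q. bowen_ball d T n x \<epsilon>)"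
      proof
        fix y assume y: "y \<in> near H \<theta> \<mu> n"
        then have "y \<in> near H' \<theta>' \<mu> n" using near_mono[of H' H \<theta> \<theta>' \<mu> n] by (auto simp: H_def \<theta>_def)
        then obtain x where "x \<in> R" "y \<in> bowen_ball d T n x \<epsilon>" using R(3) by blast
        then show "y \<in> (\<Union>x\<in>Q. bowen_ball d T n x \<epsilon>)" using y by (auto simp: Q_def)
      qed
      have w: "?w (n, x) \<le> ennreal (exp (real n * (I + 3 * \<tau> - t)))" if "x \<in> Q" for x
      proof -
        obtain z where z: "z \<in> bowen_ball d T n x \<epsilon>" "z \<in> near H \<theta> \<mu> n" using \<open>x \<in> Q\<close> by (auto simp: Q_def)
        have "\<bar>birkhoff_sum T n \<phi> z / real n - I\<bar> < \<tau>" using z(2) by (auto simp: near_def H_def \<theta>_def I_def)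
        then have "birkhoff_sum T n \<phi> z / real n \<le> I + \<tau>" by linarith
        then have "birkhoff_sum T n \<phi> z \<le> real n * (I + \<tau>)" using True by (simp add: field_simps)
        moreover have "(SUP y\<in>bowen_ball d T n x \<epsilon>. birkhoff_sum T n \<phi> y) \<le> birkhoff_sum T n \<phi> z + 2 * real n * \<tau>"
          by (rule bowen_ball_sup_le[OF _ _ z(1)]) (use \<epsilon> mod in \<open>auto simp: \<tau>_def\<close>)
        ultimately have "- t * real n + (SUP y\<in>bowen_ball d T n x \<epsilon>. birkhoff_sum T n \<phi> y) \<le> real n * (I + 3 * \<tau> - t)"
          by (simp add: algebra_simps)
        then show ?thesis by (simp add: ennreal_leI)
      qed
      have "(\<Sum>x\<in>Q. ?w (n, x)) \<le> (\<Sum>x\<in>Q. ennreal (exp (real n * (I + 3 * \<tau> - t))))" by (rule sum_mono[OF w])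
      also have "\<dots> = ennreal (real (card Q) * exp (real n * (I + 3 * \<tau> - t)))"
        by (simp add: ennreal_mult' ennreal_of_nat_eq_real_of_nat)
      also have "\<dots> \<le> ennreal (exp (real n * (h + \<tau>)) * exp (real n * (I + 3 * \<tau> - t)))"
        using Q(2) R(2) by (intro ennreal_leI mult_right_mono) auto
      also have "exp (real n * (h + \<tau>)) * exp (real n * (I + 3 * \<tau> - t)) = exp (- 4 * \<tau>) ^ n"
        by (simp add: exp_add[symmetric] exp_of_nat_mult[symmetric]) (simp add: h_def \<tau>_def field_simps)
      finally show ?thesis using Q(1) cov by blast
    qed blast
  qed
  from choice[OF this] obtain R where "\<forall>n. n \<ge> max 1 n0 \<longrightarrow> finite (R n) \<and> near H \<theta> \<mu> n \<subseteq> (\<Union>x\<in>R n. bowen_ball d T n x \<epsilon>) \<and>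
      (\<Sum>x\<in>R n. ?w (n, x)) \<le> ennreal (exp (- 4 * \<tau>) ^ n)" ..
  then have Rn: "finite (R n)" "near H \<theta> \<mu> n \<subseteq> (\<Union>x\<in>R n. bowen_ball d T n x \<epsilon>)"
      "(\<Sum>x\<in>R n. ?w (n, x)) \<le> ennreal (exp (- 4 * \<tau>) ^ n)" if "n \<ge> max 1 n0" for n using that by auto
  define \<rho> where "\<rho> = exp (- 4 * \<tau>)"
  have \<rho>: "0 < \<rho>" "\<rho> < 1" using \<tau> by (auto simp: \<rho>_def)
  have bound: "pressure_sum d T ?Z t \<phi> N \<epsilon> \<le> ennreal (\<rho> ^ N' / (1 - \<rho>))" if N': "N' \<ge> N" "N' \<ge> max 1 n0" for N N'
  proof (rule pressure_sum_leI)
    let ?C = "SIGMA n:{N'..}. R n"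
    show "?C \<in> ball_covers d T ?Z N \<epsilon>"
      unfolding ball_covers_def
    proof (intro CollectI conjI)
      show "countable ?C" using Rn(1) N' by (intro countable_SIGMA) (auto intro: countable_finite)
      show "\<forall>(m, x)\<in>?C. N \<le> m" using N' by auto
      show "?Z \<subseteq> (\<Union>(m, x)\<in>?C. bowen_ball d T m x \<epsilon>)"
      proof
        fix y assume "y \<in> ?Z"
        then obtain n where n: "n \<ge> N'" "y \<in> near H \<theta> \<mu> n" by blast
        then obtain x where "x \<in> R n" "y \<in> bowen_ball d T n x \<epsilon>" using Rn(2)[of n] N' by fastforce
        then show "y \<in> (\<Union>(m, x)\<in>?C. bowen_ball d T m x \<epsilon>)" using n(1) by (auto intro!: bexI[of _ "(n, x)"])
      qed
    qed
    fix F assume F: "finite F" "F \<subseteq> ?C"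
    obtain M where M: "\<And>n. n \<in> fst ` F \<Longrightarrow> n \<le> M"
      using finite_nat_set_iff_bounded_le[of "fst ` F"] F(1) by auto
    have FM: "F \<subseteq> (SIGMA n:{N'..M}. R n)"
    proof
      fix p assume p: "p \<in> F"
      then have "p \<in> ?C" "fst p \<le> M" using F(2) M[of "fst p"] by auto
      then show "p \<in> (SIGMA n:{N'..M}. R n)" by (cases p) auto
    qed
    have "sum ?w F \<le> sum ?w (SIGMA n:{N'..M}. R n)"
      using FM Rn(1) N' by (intro sum_mono2 finite_SigmaI) auto
    also have "\<dots> = (\<Sum>n\<in>{N'..M}. \<Sum>x\<in>R n. ?w (n, x))"
      using Rn(1) N' by (subst sum.Sigma) auto
    also have "\<dots> \<le> (\<Sum>n\<in>{N'..M}. ennreal (\<rho> ^ n))"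
      using Rn(3) N' unfolding \<rho>_def by (intro sum_mono) auto
    also have "\<dots> = ennreal (\<Sum>n\<in>{N'..M}. \<rho> ^ n)" using \<rho> by (subst sum_ennreal) auto
    also have "\<dots> \<le> ennreal (\<rho> ^ N' / (1 - \<rho>))"
    proof (rule ennreal_leI)
      have "(\<Sum>n\<in>{N'..M}. \<rho> ^ n) = (if M < N' then 0 else (\<rho> ^ N' - \<rho> ^ Suc M) / (1 - \<rho>))"
        using sum_gp[of \<rho> N' M] \<rho> by simp
      also have "\<dots> \<le> \<rho> ^ N' / (1 - \<rho>)" using \<rho> by (auto intro!: divide_right_mono divide_nonneg_nonneg)
      finally show "(\<Sum>n\<in>{N'..M}. \<rho> ^ n) \<le> \<rho> ^ N' / (1 - \<rho>)" .
    qed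
    finally show "sum ?w F \<le> ennreal (\<rho> ^ N' / (1 - \<rho>))" .
  qed
  have "pressure_lim d T ?Z t \<phi> \<epsilon> = 0"
  proof (rule pressure_lim_zeroI)
    fix N
    have "(\<lambda>N'. ennreal (\<rho> ^ N' / (1 - \<rho>))) \<longlonglongrightarrow> ennreal (0 / (1 - \<rho>))"
      using \<rho> by (intro tendsto_intros tendsto_ennrealI LIMSEQ_realpow_zero) auto
    then have "pressure_sum d T ?Z t \<phi> N \<epsilon> \<le> ennreal (0 / (1 - \<rho>))"
      by (rule LIMSEQ_le_const) (use bound in \<open>auto intro!: exI[of _ "max N (max 1 n0)"]\<close>)
    then show "pressure_sum d T ?Z t \<phi> N \<epsilon> = 0" by simp
  qed
  moreover have "finite H" "0 < \<theta>" using H' \<tau> by (auto simp: H_def \<theta>_def)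
  moreover have "continuous_on UNIV g" if "g \<in> H" for g using that H'(2) \<phi> by (auto simp: H_def)
  ultimately show thesis using that by blast
qed

text \<open>A countable base of the weak topology, in terms of the separating sequence \<open>f\<close>.\<close>

definition box :: "rat list \<times> nat \<Rightarrow> 'a measure set" where
  "box i = {\<nu> \<in> prob_measures. \<forall>k<length (fst i).
     \<bar>(\<integral>x. f k x \<partial>\<nu>) - of_rat (fst i ! k)\<bar> < 1 / real (Suc (snd i))}"

lemma finite_family_bounded:
  assumes "finite H" "\<And>g. g \<in> H \<Longrightarrow> continuous_on UNIV (g :: 'a \<Rightarrow> real)"
  obtains B where "0 < B" "\<And>g x. g \<in> H \<Longrightarrow> \<bar>g x\<bar> \<le> B"
proof -
  have "\<exists>B>0. \<forall>g\<in>H. \<forall>x. \<bar>g x\<bar> \<le> B" using assms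
  proof (induction H rule: finite_induct)
    case (insert g H)
    then obtain B where B: "0 < B" "\<forall>g\<in>H. \<forall>x. \<bar>g x\<bar> \<le> B" by auto
    obtain B' where B': "0 < B'" "\<And>x. \<bar>g x\<bar> \<le> B'" using continuous_bounded[of g] insert.prems by auto
    have "\<forall>k\<in>insert g H. \<forall>x. \<bar>k x\<bar> \<le> max B B'"
      using B(2) B'(2) by (auto simp: le_max_iff_disj)
    then show ?case using B(1) by (intro exI[of _ "max B B'"]) auto
  qed (auto intro: exI[of _ 1])
  then show thesis using that by blast
qed

text \<open>The test functions are moved into the unit interval, approximated by members of
  \<open>f\<close>, and the integrals of these by rationals.\<close>

lemma box_base:
  assumes \<mu>: "\<mu> \<in> prob_measures" and H: "finite H" "\<And>g. g \<in> H \<Longrightarrow> continuous_on UNIV (g :: 'a \<Rightarrow> real)" and \<theta>: "0 < \<theta>"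
  obtains i where "\<mu> \<in> box i" "\<And>\<nu> g. \<nu> \<in> box i \<Longrightarrow> g \<in> H \<Longrightarrow> \<bar>(\<integral>x. g x \<partial>\<nu>) - (\<integral>x. g x \<partial>\<mu>)\<bar> < \<theta>"
proof -
  obtain B where B: "0 < B" "\<And>g x. g \<in> H \<Longrightarrow> \<bar>g x\<bar> \<le> B" using finite_family_bounded[OF H] by blast
  \<comment> \<open>Passing from \<nu> to \<mu> involves four errors of size at most
    \<open>e\<close>: two approximations by \<open>f (k g)\<close> and two widths of the box.
    Undoing the rescaling multiplies them by \<open>2 * B\<close>.\<close>
  define e where "e = \<theta> / (16 * B)"
  have e: "0 < e" using \<theta> B by (simp add: e_def)
  have ex: "\<exists>k. \<forall>x. \<bar>f k x - (g x + B) / (2 * B)\<bar> < e" if g: "g \<in> H" for g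
  proof -
    have "continuous_on UNIV (\<lambda>x. (g x + B) / (2 * B))" using H(2)[OF g] B(1) by (intro continuous_intros) auto
    moreover have "0 \<le> (g x + B) / (2 * B) \<and> (g x + B) / (2 * B) \<le> 1" for x
      using B(2)[OF g, of x] B(1) by (auto simp: abs_le_iff divide_simps)
    ultimately show ?thesis using f_approx[OF _ _ e] by metis
  qed
  then obtain k where k: "\<And>g x. g \<in> H \<Longrightarrow> \<bar>f (k g) x - (g x + B) / (2 * B)\<bar> < e" by metis
  obtain m where m: "\<And>g. g \<in> H \<Longrightarrow> k g < m"
    using finite_nat_set_iff_bounded[of "k ` H"] H(1) by auto
  obtain j where j: "1 / real (Suc j) < e" using nat_approx_posE[OF e] by blast
  have "\<exists>q. \<bar>(\<integral>x. f k x \<partial>\<mu>) - of_rat q\<bar> < 1 / real (Suc j)" for k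
  proof -
    have "0 < 1 / real (Suc j)" by simp
    then obtain q where "(\<integral>x. f k x \<partial>\<mu>) < of_rat q" "of_rat q < (\<integral>x. f k x \<partial>\<mu>) + 1 / real (Suc j)"
      using of_rat_dense[of "\<integral>x. f k x \<partial>\<mu>" "(\<integral>x. f k x \<partial>\<mu>) + 1 / real (Suc j)"] by auto
    then show ?thesis by (intro exI[of _ q]) linarith
  qed
  then obtain q where q: "\<And>k. \<bar>(\<integral>x. f k x \<partial>\<mu>) - of_rat (q k)\<bar> < 1 / real (Suc j)" by metis
  let ?i = "(map q [0..<m], j)"
  show thesis
  proof (rule that)
    show "\<mu> \<in> box ?i" using \<mu> q by (simp add: box_def)
    fix \<nu> g assume \<nu>: "\<nu> \<in> box ?i" and g: "g \<in> H"
    have pr: "\<nu> \<in> prob_measures" using \<nu> by (simp add: box_def)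
    let ?u = "\<lambda>x. (g x + B) / (2 * B)"
    have uc: "continuous_on UNIV ?u" using H(2)[OF g] B(1) by (intro continuous_intros) auto
    have u: "\<bar>(\<integral>x. f (k g) x \<partial>\<rho>) - (\<integral>x. ?u x \<partial>\<rho>)\<bar> \<le> e" if "\<rho> \<in> prob_measures" for \<rho>
      by (rule integral_diff_le[OF that f_cont uc]) (rule less_imp_le[OF k[OF g]])
    have ui: "(\<integral>x. ?u x \<partial>\<rho>) = ((\<integral>x. g x \<partial>\<rho>) + B) / (2 * B)" if "\<rho> \<in> prob_measures" for \<rho>
    proof -
      interpret prob_space \<rho> by (rule prob_measuresD[OF that])
      show ?thesis using continuous_integrable[OF that H(2)[OF g]] by (simp add: prob_space)
    qed
    have "\<bar>(\<integral>x. f (k g) x \<partial>\<nu>) - of_rat (q (k g))\<bar> < 1 / real (Suc j)"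
      using \<nu> m[OF g] by (simp add: box_def)
    then have "\<bar>(\<integral>x. ?u x \<partial>\<nu>) - (\<integral>x. ?u x \<partial>\<mu>)\<bar> < 4 * e"
      using q[of "k g"] j u[OF pr] u[OF \<mu>] by arith
    also have "(\<integral>x. ?u x \<partial>\<nu>) - (\<integral>x. ?u x \<partial>\<mu>) = ((\<integral>x. g x \<partial>\<nu>) - (\<integral>x. g x \<partial>\<mu>)) / (2 * B)"
      unfolding ui[OF pr] ui[OF \<mu>] by (simp add: diff_divide_distrib add_divide_distrib)
    finally have "\<bar>(\<integral>x. g x \<partial>\<nu>) - (\<integral>x. g x \<partial>\<mu>)\<bar> < 4 * e * (2 * B)"
      using B(1) by (simp add: abs_divide pos_divide_less_eq)
    also have "\<dots> \<le> \<theta>" using B(1) \<theta> by (simp add: e_def)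
    finally show "\<bar>(\<integral>x. g x \<partial>\<nu>) - (\<integral>x. g x \<partial>\<mu>)\<bar> < \<theta>" .
  qed
qed

lemma pressure_scale_le:
  assumes "pressure_lim d T Z t \<phi> \<epsilon> = 0" shows "pressure_scale d T Z \<phi> \<epsilon> \<le> ereal t"
  unfolding pressure_scale_def using assms by (intro Inf_lower) simp

lemma eventually_modulus:
  fixes \<phi> :: "'a \<Rightarrow> real"
  assumes "continuous_on UNIV \<phi>" "0 < \<tau>"
  shows "\<forall>\<^sub>F \<epsilon> in at_right 0. \<forall>x y. d x y \<le> \<epsilon> \<longrightarrow> \<bar>\<phi> x - \<phi> y\<bar> \<le> \<tau>"
proof -
  obtain \<delta> where \<delta>: "0 < \<delta>" "\<And>x y. d x y \<le> \<delta> \<Longrightarrow> dist (\<phi> x) (\<phi> y) < \<tau>" using d_modulus[OF assms] by blast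
  have "\<forall>\<^sub>F \<epsilon> in at_right 0. \<epsilon> < \<delta>" using \<delta>(1) by (rule eventually_at_right_real[THEN eventually_mono]) simp
  then show ?thesis
  proof eventually_elim
    case (elim \<epsilon>)
    show ?case
    proof (intro allI impI)
      fix x y assume "d x y \<le> \<epsilon>"
      then have "d x y \<le> \<delta>" using elim by simp
      from \<delta>(2)[OF this] show "\<bar>\<phi> x - \<phi> y\<bar> \<le> \<tau>" by (simp add: dist_real_def)
    qed
  qed
qed

text \<open>The neighbourhoods of \<open>pressure_lim_local\<close> vary with the measure and may be
  uncountably many. Each contains a box around its measure, and the return set of that box inherits
  zero cost; there are only countably many boxes.\<close>

lemma pressure_scale_upper:
  fixes \<phi> :: "'a \<Rightarrow> real"
  assumes \<phi>: "continuous_on UNIV \<phi>" and st: "s < t"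
    and Z: "\<And>x. x \<in> Z \<Longrightarrow> \<exists>\<mu> r. \<mu> \<in> invariant_measures T \<and> strict_mono (r :: nat \<Rightarrow> nat)
      \<and> weak_conv (\<lambda>i. empirical T (Suc (r i)) x) \<mu> \<and> metric_entropy T \<mu> + ereal (\<integral>x. \<phi> x \<partial>\<mu>) \<le> ereal s"
  shows "\<forall>\<^sub>F \<epsilon> in at_right 0. pressure_scale d T Z \<phi> \<epsilon> \<le> ereal t"
proof -
  have "0 < (t - s) / 8" using st by simp
  from eventually_modulus[OF \<phi> this] eventually_at_right_less[of "0::real"]
  show ?thesis
  proof eventually_elim
    case (elim \<epsilon>)
    define good where "good i \<longleftrightarrow> pressure_lim d T {x. \<forall>N. \<exists>n\<ge>N. empirical T (Suc n) x \<in> box i} t \<phi> \<epsilon> = 0" for i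
    \<comment> \<open>Boxes whose return set has positive cost are replaced by the empty set, so
      that a single union over all natural numbers can be formed.\<close>
    define W where "W n = (if good (from_nat n) then {x. \<forall>N. \<exists>k\<ge>N. empirical T (Suc k) x \<in> box (from_nat n)} else {})" for n
    have empty: "pressure_lim d T {} t \<phi> \<epsilon> = 0"
    proof (rule pressure_lim_zeroI)
      fix n
      have "pressure_sum d T {} t \<phi> n \<epsilon> \<le> 0"
        by (rule pressure_sum_leI[of "{}"]) (auto simp: ball_covers_def)
      then show "pressure_sum d T {} t \<phi> n \<epsilon> = 0" by simp
    qed
    have "pressure_lim d T (W n) t \<phi> \<epsilon> = 0" for n using empty by (auto simp: W_def good_def)
    then have U: "pressure_lim d T (\<Union>n. W n) t \<phi> \<epsilon> = 0" by (rule pressure_lim_Union_zero)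
    have "Z \<subseteq> (\<Union>n. W n)"
    proof
      fix x assume "x \<in> Z"
      from Z[OF this] obtain \<mu> r where \<mu>: "\<mu> \<in> invariant_measures T" "strict_mono (r :: nat \<Rightarrow> nat)"
        "weak_conv (\<lambda>i. empirical T (Suc (r i)) x) \<mu>" "metric_entropy T \<mu> + ereal (\<integral>x. \<phi> x \<partial>\<mu>) \<le> ereal s" by blast
      obtain H \<theta> where H: "finite H" "\<And>g. g \<in> H \<Longrightarrow> continuous_on UNIV g" "0 < \<theta>"
        "pressure_lim d T {x. \<forall>N. \<exists>n\<ge>N. x \<in> near H \<theta> \<mu> n} t \<phi> \<epsilon> = 0"
        using pressure_lim_local[OF \<mu>(1) \<phi> \<mu>(4) st elim(2)] elim(1) by blast
      obtain i where i: "\<mu> \<in> box i" "\<And>\<nu> g. \<nu> \<in> box i \<Longrightarrow> g \<in> H \<Longrightarrow> \<bar>(\<integral>x. g x \<partial>\<nu>) - (\<integral>x. g x \<partial>\<mu>)\<bar> < \<theta>"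
        using box_base[OF invariantD(1)[OF \<mu>(1)] H(1,2,3)] by blast
      have nr: "x \<in> near H \<theta> \<mu> (Suc n)" if "empirical T (Suc n) x \<in> box i" for n x
        unfolding near_def
      proof (intro CollectI ballI)
        fix g assume g: "g \<in> H"
        show "\<bar>birkhoff_sum T (Suc n) g x / real (Suc n) - (\<integral>y. g y \<partial>\<mu>)\<bar> < \<theta>"
          using i(2)[OF that g] integral_empirical_continuous[OF _ H(2)[OF g], of "Suc n" x] by simp
      qed
      have "{x. \<forall>N. \<exists>n\<ge>N. empirical T (Suc n) x \<in> box i} \<subseteq> {x. \<forall>N. \<exists>n\<ge>N. x \<in> near H \<theta> \<mu> n}"
      proof (intro subsetI CollectI allI)
        fix x N assume "x \<in> {x. \<forall>N. \<exists>n\<ge>N. empirical T (Suc n) x \<in> box i}"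
        then obtain n where "n \<ge> N" "empirical T (Suc n) x \<in> box i" by blast
        then show "\<exists>n\<ge>N. x \<in> near H \<theta> \<mu> n" using nr by (intro exI[of _ "Suc n"]) auto
      qed
      from pressure_lim_mono[OF this, of t \<phi> \<epsilon>] have gi: "good i" using H(4) by (simp add: good_def)
      have "\<forall>\<^sub>F n in sequentially. empirical T (Suc (r n)) x \<in> box i"
      proof -
        have "\<forall>\<^sub>F n in sequentially. \<forall>k\<in>{..<length (fst i)}. \<bar>(\<integral>y. f k y \<partial>empirical T (Suc (r n)) x) - of_rat (fst i ! k)\<bar> < 1 / real (Suc (snd i))"
        proof (rule eventually_ball_finite[OF finite_lessThan], rule ballI)
          fix k assume k: "k \<in> {..<length (fst i)}"
          have "(\<lambda>n. \<bar>(\<integral>y. f k y \<partial>empirical T (Suc (r n)) x) - of_rat (fst i ! k)\<bar>) \<longlonglongrightarrow> \<bar>(\<integral>y. f k y \<partial>\<mu>) - of_rat (fst i ! k)\<bar>"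
            using \<mu>(3) f_cont[of k] unfolding weak_conv_def by (intro tendsto_intros) auto
          then show "\<forall>\<^sub>F n in sequentially. \<bar>(\<integral>y. f k y \<partial>empirical T (Suc (r n)) x) - of_rat (fst i ! k)\<bar> < 1 / real (Suc (snd i))"
            by (rule order_tendstoD(2)) (use i(1) k in \<open>simp add: box_def\<close>)
        qed
        then show ?thesis by eventually_elim (simp add: box_def empirical_prob)
      qed
      then obtain n0 where n0: "\<And>n. n \<ge> n0 \<Longrightarrow> empirical T (Suc (r n)) x \<in> box i" by (auto simp: eventually_sequentially)
      have "\<exists>k\<ge>N. empirical T (Suc k) x \<in> box i" for N
        using n0[of "max n0 N"] seq_suble[OF \<mu>(2), of "max n0 N"] by (intro exI[of _ "r (max n0 N)"]) auto
      then have "x \<in> W (to_nat i)" using gi by (simp add: W_def)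
      then show "x \<in> (\<Union>n. W n)" by blast
    qed
    from pressure_lim_mono[OF this, of t \<phi> \<epsilon>] U have "pressure_lim d T Z t \<phi> \<epsilon> = 0" by simp
    then show ?case by (rule pressure_scale_le)
  qed
qed

end

text \<open>Only the limit 0 needs an argument. For \<open>t\<close> in the unit interval
  \<open>\<bar>t * ln t\<bar> \<le> 2 * sqrt t\<close>, which is \<open>minus_xlnx_le\<close> at
  \<open>sqrt t\<close>.\<close>

lemma tendsto_xlnx:
  fixes p :: "nat \<Rightarrow> real"
  assumes p: "p \<longlonglongrightarrow> q" and nn: "\<And>n. 0 \<le> p n"
  shows "(\<lambda>n. p n * ln (p n)) \<longlonglongrightarrow> q * ln q"
proof (cases "q = 0")
  case False
  then show ?thesis by (intro tendsto_intros p)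
next
  case True
  have bound: "norm (t * ln t) \<le> 2 * sqrt t" if t: "0 \<le> t" "t \<le> 1" for t :: real
  proof (cases "t = 0")
    case False
    then have s: "0 < sqrt t" using t by simp
    have "t * ln t = sqrt t * (2 * (sqrt t * ln (sqrt t)))"
      using t False by (simp add: ln_sqrt)
    moreover have "0 \<le> - (sqrt t * ln (sqrt t))" using t by (intro minus_ln_ge) auto
    moreover have "- (sqrt t * ln (sqrt t)) \<le> 1" using minus_xlnx_le[of "sqrt t"] s by linarith
    ultimately show ?thesis using s by (simp add: abs_mult)
  qed simp
  have "\<forall>\<^sub>F n in sequentially. p n < 1" using order_tendstoD(2)[OF p] True by simp
  then have "\<forall>\<^sub>F n in sequentially. norm (p n * ln (p n)) \<le> 2 * sqrt (p n)"
    by eventually_elim (rule bound[OF nn less_imp_le])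
  moreover have "(\<lambda>n. 2 * sqrt (p n)) \<longlonglongrightarrow> 0"
    using tendsto_mult_right_zero[OF tendsto_real_sqrt[OF p[unfolded True], unfolded real_sqrt_zero], of 2] .
  ultimately have "(\<lambda>n. p n * ln (p n)) \<longlonglongrightarrow> 0" by (rule Lim_null_comparison)
  then show ?thesis using True by simp
qed

context compact_dynamics
begin

section \<open>An upper semicontinuous substitute for the entropy\<close>

lemma closed_separated:
  fixes A B :: "'a set"
  assumes A: "closed A" and B: "closed B" and AB: "A \<inter> B = {}"
  shows "\<exists>\<gamma>>0. \<forall>x\<in>A. \<forall>y\<in>B. \<gamma> \<le> dist x y"
proof (cases "A = {} \<or> B = {}")
  case True
  then show ?thesis by (intro exI[of _ 1]) auto
next
  case False
  have "compact A" using closed_Int_compact[OF A compact_UNIV] by simp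
  then obtain x where x: "x \<in> A" "\<And>y. y \<in> A \<Longrightarrow> infdist x B \<le> infdist y B"
    using continuous_attains_inf[of A "\<lambda>x. infdist x B"] False continuous_on_infdist[OF continuous_on_id] by blast
  have "x \<notin> B" using x(1) AB by blast
  then have "0 < infdist x B"
    using in_closed_iff_infdist_zero[OF B] False infdist_nonneg[of x B] by (metis less_eq_real_def)
  moreover have "infdist x B \<le> dist y z" if "y \<in> A" "z \<in> B" for y z
    using x(2)[OF that(1)] infdist_le[OF that(2), of y] by simp
  ultimately show ?thesis by (intro exI[of _ "infdist x B"]) simp
qed

text \<open>Closed subsets of the fibres of \<open>X\<close> that miss only mass \<tau> have mutual
  distances at least \<gamma>, so an atom of \<open>P\<close>, whose points are closer than
  \<gamma>, meets at most one of them. The kernel gives the corresponding label probability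
  \<open>1 - \<theta>\<close> and every other label \<open>\<theta> / q\<close>. As \<gamma> is
  fixed before \<open>P\<close>, it serves ball partitions of all small radii
  simultaneously.\<close>

lemma fine_partition_kernel:
  fixes X :: "'a \<Rightarrow> 'b" and \<kappa> :: real
  assumes \<mu>: "\<mu> \<in> prob_measures" and X: "simple_function borel X" and \<kappa>: "0 < \<kappa>"
  obtains \<gamma> where "0 < \<gamma>" "\<And>P :: 'a \<Rightarrow> nat. simple_function borel P \<Longrightarrow> (\<And>x y. P x = P y \<Longrightarrow> dist x y < \<gamma>) \<Longrightarrow>
     \<exists>k :: nat \<Rightarrow> 'b \<Rightarrow> real. (\<forall>a b. 0 < k a b) \<and> (\<forall>a. (\<Sum>b\<in>range X. k a b) \<le> 1) \<and> (\<integral>x. - ln (k (P x) (X x)) \<partial>\<mu>) \<le> \<kappa>"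
proof -
  interpret prob_space \<mu> by (rule prob_measuresD[OF \<mu>])
  have s: "events = sets borel" "space \<mu> = UNIV" using prob_measuresD[OF \<mu>] by auto
  define V where "V = range X"
  have V: "finite V" "V \<noteq> {}" unfolding V_def using simple_functionD_borel[OF X] by auto
  define q where "q = real (card V)"
  have q: "1 \<le> q" using V by (simp add: q_def Suc_leI card_gt_0_iff)
  define \<theta> where "\<theta> = min (1/2) (1 - exp (- (\<kappa>/2)))"
  have "exp (- (\<kappa>/2)) < 1" using \<kappa> by simp
  then have \<theta>: "0 < \<theta>" "\<theta> \<le> 1/2" unfolding \<theta>_def by linarith+
  have "exp (- (\<kappa>/2)) \<le> 1 - \<theta>" by (auto simp: \<theta>_def)
  then have "ln (exp (- (\<kappa>/2))) \<le> ln (1 - \<theta>)" using \<theta> by (subst ln_le_cancel_iff) auto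
  then have ln\<theta>: "- ln (1 - \<theta>) \<le> \<kappa>/2" by simp
  define L where "L = ln (q / \<theta>)"
  have "1 \<le> q / \<theta>" using q \<theta> by (simp add: field_simps)
  then have L: "0 \<le> L" by (simp add: L_def)
  \<comment> \<open>Outside the closed sets the kernel costs at most \<open>L\<close>, on them at
    most \<open>- ln (1 - \<theta>)\<close>. With mass at most \<tau> outside, both contributions
    stay below \<open>\<kappa> / 2\<close>.\<close>
  define \<tau> where "\<tau> = \<kappa> / 2 / (L + 1)"
  have \<tau>: "0 < \<tau>" using \<kappa> L by (simp add: \<tau>_def)
  have "\<forall>v. \<exists>K. closed K \<and> K \<subseteq> X -` {v} \<and> measure \<mu> (X -` {v} - K) < \<tau> / q"
  proof
    fix v
    have "0 < \<tau> / q" using \<tau> q by simp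
    from prob_measures_closed_inner[OF \<mu> simple_functionD_borel(2)[OF X] this]
    show "\<exists>K. closed K \<and> K \<subseteq> X -` {v} \<and> measure \<mu> (X -` {v} - K) < \<tau> / q" by metis
  qed
  from choice[OF this] obtain K where "\<forall>v. closed (K v) \<and> K v \<subseteq> X -` {v} \<and> measure \<mu> (X -` {v} - K v) < \<tau> / q" ..
  then have K: "closed (K v)" "K v \<subseteq> X -` {v}" "measure \<mu> (X -` {v} - K v) < \<tau> / q" for v by auto
  have "\<exists>\<gamma>>0. \<forall>x\<in>K (fst p). \<forall>y\<in>K (snd p). \<gamma> \<le> dist x y" if "p \<in> {p \<in> V \<times> V. fst p \<noteq> snd p}" for p
  proof (rule closed_separated[OF K(1) K(1)])
    have "X x = fst p" if "x \<in> K (fst p)" for x using K(2)[of "fst p"] that by auto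
    moreover have "X x = snd p" if "x \<in> K (snd p)" for x using K(2)[of "snd p"] that by auto
    ultimately show "K (fst p) \<inter> K (snd p) = {}" using that by force
  qed
  then have "\<forall>p\<in>{p \<in> V \<times> V. fst p \<noteq> snd p}. \<exists>\<gamma>. 0 < \<gamma> \<and> (\<forall>x\<in>K (fst p). \<forall>y\<in>K (snd p). \<gamma> \<le> dist x y)"
    by (intro ballI)
  from bchoice[OF this] obtain \<delta> where "\<forall>p\<in>{p \<in> V \<times> V. fst p \<noteq> snd p}. 0 < \<delta> p \<and> (\<forall>x\<in>K (fst p). \<forall>y\<in>K (snd p). \<delta> p \<le> dist x y)" ..
  then have \<delta>: "0 < \<delta> p \<and> (\<forall>x\<in>K (fst p). \<forall>y\<in>K (snd p). \<delta> p \<le> dist x y)"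
    if "p \<in> {p \<in> V \<times> V. fst p \<noteq> snd p}" for p using that by (rule bspec)
  define \<gamma> where "\<gamma> = Min (insert 1 (\<delta> ` {p \<in> V \<times> V. fst p \<noteq> snd p}))"
  have fin: "finite {p \<in> V \<times> V. fst p \<noteq> snd p}" using V(1) by simp
  have \<gamma>: "0 < \<gamma>" unfolding \<gamma>_def using fin \<delta> by (subst Min_gr_iff) auto
  have sep: "v = v'" if "v \<in> V" "v' \<in> V" "x \<in> K v" "y \<in> K v'" "dist x y < \<gamma>" for v v' x y
  proof (rule ccontr)
    assume "v \<noteq> v'"
    then have p: "(v, v') \<in> {p \<in> V \<times> V. fst p \<noteq> snd p}" using that by simp
    then have "\<gamma> \<le> \<delta> (v, v')" unfolding \<gamma>_def using fin by (intro Min_le) auto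
    also have "\<dots> \<le> dist x y" using \<delta>[OF p] that by simp
    finally show False using that by simp
  qed
  show thesis
  proof (rule that[OF \<gamma>])
    fix P :: "'a \<Rightarrow> nat" assume P: "simple_function borel P" "\<And>x y. P x = P y \<Longrightarrow> dist x y < \<gamma>"
    define i where "i a = (SOME v. \<exists>x. P x = a \<and> v \<in> V \<and> x \<in> K v)" for a
    have i: "i (P x) = v" if "v \<in> V" "x \<in> K v" for x v
    proof -
      have "\<exists>v x'. P x' = P x \<and> v \<in> V \<and> x' \<in> K v" using that by blast
      then have "\<exists>x'. P x' = P x \<and> i (P x) \<in> V \<and> x' \<in> K (i (P x))" unfolding i_def by (rule someI_ex)
      then show ?thesis using sep P(2) that by blast
    qed
    define k where "k a b = (if b = i a then 1 - \<theta> else \<theta> / q)" for a b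
    have k0: "0 < k a b" for a b using \<theta> q by (simp add: k_def)
    have klow: "\<theta> / q \<le> k a b" for a b
    proof -
      have "\<theta> / q \<le> \<theta>" using \<theta> q by (simp add: field_simps)
      then show ?thesis using \<theta> by (simp add: k_def)
    qed
    have ksum: "(\<Sum>b\<in>range X. k a b) \<le> 1" for a
    proof -
      have "(\<Sum>b\<in>V. k a b) \<le> (\<Sum>b\<in>V. (if b = i a then 1 - \<theta> else 0) + \<theta> / q)"
        using \<theta> q by (intro sum_mono) (auto simp: k_def)
      also have "\<dots> \<le> (1 - \<theta>) + \<theta>" using V(1) \<theta> q by (simp add: sum.distrib q_def[symmetric])
      finally show ?thesis by (simp add: V_def)
    qed
    define Off where "Off = (\<Union>v\<in>V. X -` {v} - K v)"
    have Offs: "X -` {v} - K v \<in> events" for v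
      using simple_functionD_borel(2)[OF X, of v] K(1)[of v] s by auto
    have Off: "Off \<in> events" unfolding Off_def using Offs V(1) by auto
    have "measure \<mu> Off \<le> (\<Sum>v\<in>V. measure \<mu> (X -` {v} - K v))"
      unfolding Off_def using Offs V(1) by (intro finite_measure_subadditive_finite) auto
    also have "\<dots> \<le> (\<Sum>v\<in>V. \<tau> / q)" using K(3) by (intro sum_mono less_imp_le)
    also have "\<dots> = \<tau>" using q by (simp add: q_def)
    finally have mOff: "measure \<mu> Off \<le> \<tau>" .
    have "(\<integral>x. - ln (k (P x) (X x)) \<partial>\<mu>) \<le> (\<integral>x. \<kappa>/2 + L * indicator Off x \<partial>\<mu>)"
    proof (rule integral_mono)
      show "integrable \<mu> (\<lambda>x. - ln (k (P x) (X x)))"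
        using integrable_label[OF \<mu> simple_function_Pair[OF P(1) X], of "\<lambda>v. - ln (k (fst v) (snd v))"] by simp
      show "integrable \<mu> (\<lambda>x. \<kappa>/2 + L * indicator Off x)" using Off by (auto simp: emeasure_eq_measure)
      fix x
      show "- ln (k (P x) (X x)) \<le> \<kappa>/2 + L * indicator Off x"
      proof (cases "x \<in> Off")
        case True
        have "ln (\<theta> / q) \<le> ln (k (P x) (X x))" using klow k0 \<theta> q by (subst ln_le_cancel_iff) auto
        moreover have "L = - ln (\<theta> / q)" using \<theta> q by (simp add: L_def ln_div)
        ultimately show ?thesis using True \<kappa> by simp
      next
        case False
        then have "x \<in> K (X x)" by (auto simp: Off_def V_def)
        then have "i (P x) = X x" by (intro i) (auto simp: V_def)
        then show ?thesis using False ln\<theta> by (simp add: k_def)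
      qed
    qed
    also have "\<dots> = \<kappa>/2 + L * measure \<mu> Off"
      using Off s measure_prob_measures_UNIV[OF \<mu>]
      by (subst Bochner_Integration.integral_add) (auto simp: emeasure_eq_measure)
    also have "L * measure \<mu> Off \<le> L * \<tau>" using mOff L by (rule mult_left_mono)
    also have "L * \<tau> \<le> (L + 1) * \<tau>" using \<tau> by simp
    also have "(L + 1) * \<tau> = \<kappa> / 2" using L by (simp add: \<tau>_def field_simps)
    finally show "\<exists>k :: nat \<Rightarrow> 'b \<Rightarrow> real. (\<forall>a b. 0 < k a b) \<and> (\<forall>a. (\<Sum>b\<in>range X. k a b) \<le> 1) \<and> (\<integral>x. - ln (k (P x) (X x)) \<partial>\<mu>) \<le> \<kappa>"
      using k0 ksum by (intro exI[of _ k]) auto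
  qed
qed

text \<open>Averaging the entropies of \<open>ball_label c r\<close> over the radius makes the finite-stage entropies
  weakly continuous: for each limit measure only countably many radii give charged boundaries.\<close>

definition radius_measure :: "real \<Rightarrow> real measure" where
  "radius_measure e = uniform_measure lborel {e..2 * e}"

text \<open>The sum runs over a set of words independent of \<open>r\<close>, so measurability in
  \<open>r\<close> and convergence can be checked term by term. For \<open>r \<ge> e\<close> it is
  the entropy of the itinerary.\<close>

definition label_ent :: "(nat \<Rightarrow> 'a) \<Rightarrow> nat \<Rightarrow> nat \<Rightarrow> 'a measure \<Rightarrow> real \<Rightarrow> real" where
  "label_ent c N n \<nu> r = (\<Sum>w\<in>{w. set w \<subseteq> {..<N} \<and> length w = n}.
     - (measure \<nu> (itinerary (ball_label c r) n -` {w}) * ln (measure \<nu> (itinerary (ball_label c r) n -` {w}))))"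

definition mean_ent :: "(nat \<Rightarrow> 'a) \<Rightarrow> nat \<Rightarrow> real \<Rightarrow> nat \<Rightarrow> 'a measure \<Rightarrow> real" where
  "mean_ent c N e n \<nu> = (\<integral>r. label_ent c N n \<nu> r \<partial>radius_measure e)"

lemma prob_space_radius: "0 < e \<Longrightarrow> prob_space (radius_measure e)"
  unfolding radius_measure_def by (rule prob_space_uniform_measure) auto

lemma AE_radius: "0 < e \<Longrightarrow> AE r in radius_measure e. e \<le> r \<and> r \<le> 2 * e"
  unfolding radius_measure_def by (rule AE_uniform_measureI) auto

lemma AE_radius_null:
  assumes "0 < e" "\<nu> \<in> prob_measures" shows "AE r in radius_measure e. null_spheres c N \<nu> r"
proof -
  have "AE r in lborel. null_spheres c N \<nu> r"
    by (rule AE_I'[OF countable_imp_null_set_lborel[OF null_spheres_countable[OF assms(2)]]]) auto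
  then show ?thesis unfolding radius_measure_def using assms(1)
    by (intro AE_uniform_measureI) (auto elim: eventually_mono)
qed

lemma label_ent_eq:
  assumes "ball_cover c N e" "e \<le> r"
  shows "label_ent c N n \<nu> r = ent \<nu> (itinerary (ball_label c r) n)"
  unfolding label_ent_def
  by (rule ent_superset[symmetric]) (use ball_label_less[OF assms] in \<open>auto simp: itinerary_def finite_lists_length_eq\<close>)

lemma label_ent_bounds:
  assumes \<nu>: "\<nu> \<in> prob_measures"
  shows "0 \<le> label_ent c N n \<nu> r" "label_ent c N n \<nu> r \<le> real (N ^ n)"
proof -
  interpret prob_space \<nu> by (rule prob_measuresD[OF \<nu>])
  have "0 \<le> - (measure \<nu> A * ln (measure \<nu> A)) \<and> - (measure \<nu> A * ln (measure \<nu> A)) \<le> 1" for A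
    using minus_ln_ge[of "measure \<nu> A"] minus_xlnx_le[of "measure \<nu> A"] measure_nonneg[of \<nu> A] prob_le_1[of A]
    by linarith
  then have 1: "0 \<le> - (measure \<nu> A * ln (measure \<nu> A))" "- (measure \<nu> A * ln (measure \<nu> A)) \<le> 1" for A by blast+
  show "0 \<le> label_ent c N n \<nu> r" unfolding label_ent_def by (rule sum_nonneg) (rule 1)
  have "label_ent c N n \<nu> r \<le> (\<Sum>w\<in>{w. set w \<subseteq> {..<N} \<and> length w = n}. 1)"
    unfolding label_ent_def by (rule sum_mono) (rule 1)
  then show "label_ent c N n \<nu> r \<le> real (N ^ n)" by (simp add: card_lists_length_eq)
qed

text \<open>Labels are jointly measurable in radius and point, hence so is the set of pairs with a
  prescribed itinerary; the mass of its section at \<open>r\<close> is then measurable in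
  \<open>r\<close>.\<close>

lemma label_ent_measurable:
  assumes \<nu>: "\<nu> \<in> prob_measures"
  shows "label_ent c N n \<nu> \<in> borel_measurable (radius_measure e)"
proof -
  interpret prob_space \<nu> by (rule prob_measuresD[OF \<nu>])
  have sets: "sets (borel \<Otimes>\<^sub>M \<nu>) = sets (borel \<Otimes>\<^sub>M (borel :: 'a measure))"
    by (rule sets_pair_measure_cong[OF refl prob_measuresD(2)[OF \<nu>]])
  have m: "(\<lambda>r. measure \<nu> (itinerary (ball_label c r) n -` {w})) \<in> borel_measurable borel" for w
  proof -
    let ?Q = "{p :: real \<times> 'a. itinerary (ball_label c (fst p)) n (snd p) = w}"
    have lab: "(\<lambda>p :: real \<times> 'a. ball_label c (fst p) ((T ^^ i) (snd p))) \<in> measurable (borel \<Otimes>\<^sub>M borel) (count_space UNIV)" for i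
      unfolding ball_label_def
    proof (rule measurable_Least)
      fix j
      have 1: "(\<lambda>y. dist (c j) ((T ^^ i) y)) \<in> borel_measurable borel"
        by (intro borel_measurable_continuous_onI continuous_intros continuous_on_compose2[OF cont_Tn]) auto
      have [measurable]: "(\<lambda>p :: real \<times> 'a. dist (c j) ((T ^^ i) (snd p))) \<in> borel_measurable (borel \<Otimes>\<^sub>M borel)"
        by (rule measurable_compose[OF measurable_snd 1])
      show "(\<lambda>p :: real \<times> 'a. dist (c j) ((T ^^ i) (snd p)) < fst p) \<in> measurable (borel \<Otimes>\<^sub>M borel) (count_space UNIV)"
        by measurable
    qed
    have "?Q \<in> sets (borel \<Otimes>\<^sub>M (borel :: 'a measure))"
    proof (cases "length w = n")
      case True
      have "?Q = (\<Inter>i<n. {p. ball_label c (fst p) ((T ^^ i) (snd p)) = w ! i}) \<inter> UNIV"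
        using True by (auto simp: itinerary_def list_eq_iff_nth_eq)
      also have "\<dots> \<in> sets (borel \<Otimes>\<^sub>M (borel :: 'a measure))"
      proof (cases "n = 0")
        case True
        then show ?thesis using sets.top[of "borel \<Otimes>\<^sub>M (borel :: 'a measure)"] by (simp add: space_pair_measure)
      next
        case False
        have "{p. ball_label c (fst p) ((T ^^ i) (snd p)) = w ! i} \<in> sets (borel \<Otimes>\<^sub>M (borel :: 'a measure))" for i
          using measurable_sets[OF lab[of i], of "{w ! i}"] by (simp add: vimage_def space_pair_measure)
        then show ?thesis using False by (intro sets.Int sets.finite_INT)
          (auto simp: lessThan_empty_iff space_pair_measure sets.top[of "borel \<Otimes>\<^sub>M (borel :: 'a measure)", simplified space_pair_measure space_borel UNIV_Times_UNIV])
      qed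
      finally show ?thesis .
    next
      case False
      then have "?Q = {}" by auto
      then show ?thesis by simp
    qed
    then have "?Q \<in> sets (borel \<Otimes>\<^sub>M \<nu>)" unfolding sets .
    then have "(\<lambda>r. emeasure \<nu> (Pair r -` ?Q)) \<in> borel_measurable borel"
      by (rule measurable_emeasure_Pair)
    then have "(\<lambda>r. enn2real (emeasure \<nu> (Pair r -` ?Q))) \<in> borel_measurable borel" by measurable
    moreover have "Pair r -` ?Q = itinerary (ball_label c r) n -` {w}" for r by auto
    ultimately show ?thesis by (simp add: measure_def)
  qed
  have "label_ent c N n \<nu> \<in> borel_measurable borel"
    unfolding label_ent_def[abs_def] using m by measurable
  then show ?thesis by (simp add: radius_measure_def measurable_def)
qed

lemma label_ent_integrable:
  assumes "0 < e" "\<nu> \<in> prob_measures" shows "integrable (radius_measure e) (label_ent c N n \<nu>)"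
proof -
  interpret R: prob_space "radius_measure e" by (rule prob_space_radius[OF assms(1)])
  show ?thesis
    by (rule R.integrable_const_bound[of _ "real (N ^ n)"])
      (use label_ent_bounds[OF assms(2)] label_ent_measurable[OF assms(2)] in \<open>auto\<close>)
qed


lemma mean_ent_add:
  assumes c: "ball_cover c N e" and e: "0 < e" and \<nu>: "\<nu> \<in> invariant_measures T"
  shows "mean_ent c N e (m + n) \<nu> \<le> mean_ent c N e m \<nu> + mean_ent c N e n \<nu>"
proof -
  note i = label_ent_integrable[OF e invariantD(1)[OF \<nu>]]
  have "mean_ent c N e (m + n) \<nu> \<le> (\<integral>r. label_ent c N m \<nu> r + label_ent c N n \<nu> r \<partial>radius_measure e)"
    unfolding mean_ent_def
  proof (rule integral_mono_AE[OF i Bochner_Integration.integrable_add[OF i i]])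
    show "AE r in radius_measure e. label_ent c N (m + n) \<nu> r \<le> label_ent c N m \<nu> r + label_ent c N n \<nu> r"
      using AE_radius[OF e]
    proof eventually_elim
      case (elim r)
      then have r: "e \<le> r" by simp
      show ?case unfolding label_ent_eq[OF c r] by (rule ent_itinerary_add[OF \<nu> ball_label_simple[OF c r]])
    qed
  qed
  then show ?thesis using i by (simp add: mean_ent_def)
qed

lemma mean_ent_nonneg: "\<nu> \<in> prob_measures \<Longrightarrow> 0 \<le> mean_ent c N e n \<nu>"
  unfolding mean_ent_def by (rule Bochner_Integration.integral_nonneg) (rule label_ent_bounds)

lemma mean_ent_le:
  assumes e: "0 < e" and c: "ball_cover c N e" and \<nu>: "\<nu> \<in> prob_measures"
  shows "mean_ent c N e n \<nu> \<le> real n * ln (real N)"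
proof -
  interpret R: prob_space "radius_measure e" by (rule prob_space_radius[OF e])
  have "mean_ent c N e n \<nu> \<le> (\<integral>r. real n * ln (real N) \<partial>radius_measure e)"
    unfolding mean_ent_def
  proof (rule integral_mono_AE[OF label_ent_integrable[OF e \<nu>]])
    show "AE r in radius_measure e. label_ent c N n \<nu> r \<le> real n * ln (real N)"
      using AE_radius[OF e]
    proof eventually_elim
      case (elim r)
      then have r: "e \<le> r" by simp
      show ?case
        unfolding label_ent_eq[OF c r]
        using ent_itinerary_le_general[OF \<nu> ball_label_simple[OF c r] ball_label_less[OF c r], of n 0] by simp
    qed
  qed simp
  then show ?thesis by (simp add: R.prob_space)
qed

text \<open>For almost every radius the spheres are null for the limit measure, so all word masses
  converge, and with them the entropies. The number of words \<open>N ^ n\<close> dominates.\<close>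

lemma mean_ent_weak_conv:
  assumes e: "0 < e" and c: "ball_cover c N e"
    and M: "\<And>i. M i \<in> invariant_measures T" and \<nu>: "\<nu> \<in> invariant_measures T" and conv: "weak_conv M \<nu>"
  shows "(\<lambda>i. mean_ent c N e n (M i)) \<longlonglongrightarrow> mean_ent c N e n \<nu>"
  unfolding mean_ent_def
proof (rule integral_dominated_convergence[where w = "\<lambda>_. real (N ^ n)"])
  interpret R: prob_space "radius_measure e" by (rule prob_space_radius[OF e])
  note pr = invariantD(1)[OF M] invariantD(1)[OF \<nu>]
  show "AE r in radius_measure e. (\<lambda>i. label_ent c N n (M i) r) \<longlonglongrightarrow> label_ent c N n \<nu> r"
    using AE_radius[OF e] AE_radius_null[OF e pr(2), of c N]
  proof eventually_elim
    case (elim r)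
    then have r: "e \<le> r" by simp
    have "(\<lambda>i. measure (M i) (itinerary (ball_label c r) n -` {w})) \<longlonglongrightarrow> measure \<nu> (itinerary (ball_label c r) n -` {w})" for w
    proof (rule weak_conv_measure[OF pr conv])
      show "itinerary (ball_label c r) n -` {w} \<in> sets borel"
        by (rule simple_functionD_borel[OF simple_function_itinerary[OF ball_label_simple[OF c r]]])
      show "measure \<nu> (frontier (itinerary (ball_label c r) n -` {w})) = 0"
        using frontier_itinerary_null[OF \<nu> c r] elim by blast
    qed
    then show ?case unfolding label_ent_def by (intro tendsto_sum tendsto_minus tendsto_xlnx) auto
  qed
  show "integrable (radius_measure e) (\<lambda>_. real (N ^ n))" by simp
  show "AE r in radius_measure e. norm (label_ent c N n (M i) r) \<le> real (N ^ n)" for i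
    using label_ent_bounds[OF pr(1)] by simp
  show "label_ent c N n \<nu> \<in> borel_measurable (radius_measure e)" by (rule label_ent_measurable[OF pr(2)])
  show "label_ent c N n (M i) \<in> borel_measurable (radius_measure e)" for i by (rule label_ent_measurable[OF pr(1)])
qed

lemma mean_ent_mix:
  assumes e: "0 < e" and c: "ball_cover c N e" and \<mu>: "\<mu> \<in> prob_measures" and \<nu>: "\<nu> \<in> prob_measures" and s: "0 \<le> s" "s \<le> 1"
  shows "mean_ent c N e n (mix s \<mu> \<nu>) \<le> s * mean_ent c N e n \<mu> + (1 - s) * mean_ent c N e n \<nu> + 1"
proof -
  interpret R: prob_space "radius_measure e" by (rule prob_space_radius[OF e])
  note i = label_ent_integrable[OF e]
  note m = mix_in_prob_measures[OF \<mu> \<nu> s]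
  have int: "integrable (radius_measure e) (\<lambda>r. s * label_ent c N n \<mu> r + (1 - s) * label_ent c N n \<nu> r + 1)"
    using i[OF \<mu>] i[OF \<nu>] by (intro Bochner_Integration.integrable_add integrable_mult_right) auto
  have "mean_ent c N e n (mix s \<mu> \<nu>) \<le> (\<integral>r. s * label_ent c N n \<mu> r + (1 - s) * label_ent c N n \<nu> r + 1 \<partial>radius_measure e)"
    unfolding mean_ent_def
  proof (rule integral_mono_AE[OF i[OF m] int])
    show "AE r in radius_measure e. label_ent c N n (mix s \<mu> \<nu>) r \<le> s * label_ent c N n \<mu> r + (1 - s) * label_ent c N n \<nu> r + 1"
      using AE_radius[OF e]
    proof eventually_elim
      case (elim r)
      then have r: "e \<le> r" by simp
      show ?case unfolding label_ent_eq[OF c r]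
        by (rule ent_mix_le[OF \<mu> \<nu> s simple_function_itinerary[OF ball_label_simple[OF c r]]])
    qed
  qed
  also have "\<dots> = s * mean_ent c N e n \<mu> + (1 - s) * mean_ent c N e n \<nu> + 1"
    using i[OF \<mu>] i[OF \<nu>] unfolding mean_ent_def
    by (simp add: Bochner_Integration.integral_add R.prob_space)
  finally show ?thesis .
qed

text \<open>\<open>F\<close> is the limit of \<open>mean_ent n\<close> divided by \<open>n\<close>.
  By subadditivity it is an infimum of weakly continuous functionals, hence upper semicontinuous,
  and the additive 1 in \<open>mean_ent_mix\<close> vanishes in the limit, hence convexity. No ball
  partition has a rate above the entropy, so neither has their mean; and at \<open>\<mu>0\<close>
  balls of small radius nearly determine an almost optimal partition, so \<open>F\<close> exceeds
  \<open>c0\<close> there.\<close>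

lemma usc_entropy:
  assumes \<mu>0: "\<mu>0 \<in> invariant_measures T" and c0: "ereal c0 < metric_entropy T \<mu>0"
  obtains F :: "'a measure \<Rightarrow> real" and B where
    "\<And>\<nu>. \<nu> \<in> invariant_measures T \<Longrightarrow> ereal (F \<nu>) \<le> metric_entropy T \<nu>" "c0 < F \<mu>0"
    "\<And>\<nu>. \<nu> \<in> invariant_measures T \<Longrightarrow> 0 \<le> F \<nu> \<and> F \<nu> \<le> B"
    "\<And>M \<nu> \<delta>. (\<And>i. M i \<in> invariant_measures T) \<Longrightarrow> \<nu> \<in> invariant_measures T \<Longrightarrow> weak_conv M \<nu> \<Longrightarrow> 0 < \<delta>
       \<Longrightarrow> \<forall>\<^sub>F i in sequentially. F (M i) < F \<nu> + \<delta>"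
    "\<And>s \<mu> \<nu>. \<mu> \<in> invariant_measures T \<Longrightarrow> \<nu> \<in> invariant_measures T \<Longrightarrow> 0 \<le> s \<Longrightarrow> s \<le> 1
       \<Longrightarrow> F (mix s \<mu> \<nu>) \<le> s * F \<mu> + (1 - s) * F \<nu>"
proof -
  obtain X :: "'a \<Rightarrow> 'a set" where X: "simple_function borel X" "c0 < entropy_rate \<mu>0 X"
    using metric_entropy_greater[OF c0] by blast
  define \<kappa> where "\<kappa> = (entropy_rate \<mu>0 X - c0) / 2"
  have \<kappa>: "0 < \<kappa>" using X(2) by (simp add: \<kappa>_def)
  obtain \<gamma> where \<gamma>: "0 < \<gamma>" "\<And>P :: 'a \<Rightarrow> nat. simple_function borel P \<Longrightarrow> (\<And>x y. P x = P y \<Longrightarrow> dist x y < \<gamma>) \<Longrightarrow>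
     \<exists>k :: nat \<Rightarrow> 'a set \<Rightarrow> real. (\<forall>a b. 0 < k a b) \<and> (\<forall>a. (\<Sum>b\<in>range X. k a b) \<le> 1) \<and> (\<integral>x. - ln (k (P x) (X x)) \<partial>\<mu>0) \<le> \<kappa>"
    using fine_partition_kernel[OF invariantD(1)[OF \<mu>0] X(1) \<kappa>] by blast
  \<comment> \<open>Radii reach \<open>2 * e\<close>, and points with equal labels are less than two
    radii apart, hence closer than \<gamma>.\<close>
  define e where "e = \<gamma> / 4"
  have e: "0 < e" using \<gamma>(1) by (simp add: e_def)
  obtain c N where c: "ball_cover c N e" using ball_cover_exists[OF e] by blast
  interpret R: prob_space "radius_measure e" by (rule prob_space_radius[OF e])
  let ?\<Phi> = "mean_ent c N e"
  define F where "F \<nu> = lim (\<lambda>n. ?\<Phi> n \<nu> / real n)" for \<nu>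
  have F: "(\<lambda>n. ?\<Phi> n \<nu> / real n) \<longlonglongrightarrow> F \<nu>" "\<And>n. n \<ge> 1 \<Longrightarrow> F \<nu> \<le> ?\<Phi> n \<nu> / real n"
    if \<nu>: "\<nu> \<in> invariant_measures T" for \<nu>
  proof -
    obtain L where L: "(\<lambda>n. ?\<Phi> n \<nu> / real n) \<longlonglongrightarrow> L" "\<And>n. n \<ge> 1 \<Longrightarrow> L \<le> ?\<Phi> n \<nu> / real n"
      using subadditive_limit[of "\<lambda>n. ?\<Phi> n \<nu>", OF mean_ent_nonneg[OF invariantD(1)[OF \<nu>]] mean_ent_add[OF c e \<nu>]]
      by metis
    then have "L = F \<nu>" unfolding F_def by (simp add: limI)
    with L show "(\<lambda>n. ?\<Phi> n \<nu> / real n) \<longlonglongrightarrow> F \<nu>" "\<And>n. n \<ge> 1 \<Longrightarrow> F \<nu> \<le> ?\<Phi> n \<nu> / real n" by auto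
  qed
  show thesis
  proof (rule that[of F "ln (real N)"])
    fix \<nu> assume \<nu>: "\<nu> \<in> invariant_measures T"
    note pr = invariantD(1)[OF \<nu>]
    have "0 \<le> F \<nu>" by (rule LIMSEQ_le_const[OF F(1)[OF \<nu>]]) (auto intro!: exI[of _ 0] divide_nonneg_nonneg mean_ent_nonneg pr)
    moreover have "F \<nu> \<le> ln (real N)" using F(2)[OF \<nu>, of 1] mean_ent_le[OF e c pr, of 1] by simp
    ultimately show "0 \<le> F \<nu> \<and> F \<nu> \<le> ln (real N)" by simp
    show "ereal (F \<nu>) \<le> metric_entropy T \<nu>"
    proof (cases "metric_entropy T \<nu>")
      case (real h)
      \<comment> \<open>The rates converge for each radius separately. Their positive part above
        \<open>h\<close> tends to 0 for almost every radius and is dominated by a constant, so its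
        mean tends to 0 as well.\<close>
      define u where "u n r = max (label_ent c N n \<nu> r / real n - h) 0" for n r
      have lN: "AE r in radius_measure e. label_ent c N n \<nu> r / real n \<le> ln (real N)" for n
        using AE_radius[OF e]
      proof eventually_elim
        case (elim r)
        then have r: "e \<le> r" by simp
        have "label_ent c N n \<nu> r \<le> real n * ln (real N)"
          unfolding label_ent_eq[OF c r]
          using ent_itinerary_le_general[OF pr ball_label_simple[OF c r] ball_label_less[OF c r], of n 0] by simp
        moreover have "0 \<le> ln (real N)" using ball_label_less[OF c r, of undefined] by simp
        ultimately show ?case by (cases "n = 0") (auto simp: field_simps)
      qed
      have h0: "0 \<le> h" using metric_entropy_nonneg[OF \<nu>] real by simp
      have umeas: "u n \<in> borel_measurable (radius_measure e)" for n
        unfolding u_def[abs_def] using label_ent_measurable[OF pr, of c N n e] by measurable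
      have "(\<lambda>n. \<integral>r. u n r \<partial>radius_measure e) \<longlonglongrightarrow> (\<integral>r. 0 \<partial>radius_measure e)"
      proof (rule integral_dominated_convergence[where w = "\<lambda>_. max (ln (real N)) 0"])
        show "AE r in radius_measure e. (\<lambda>n. u n r) \<longlonglongrightarrow> 0"
          using AE_radius[OF e]
        proof eventually_elim
          case (elim r)
          then have r: "e \<le> r" by simp
          note sf = ball_label_simple[OF c r]
          have "(\<lambda>n. u n r) \<longlonglongrightarrow> max (entropy_rate \<nu> (ball_label c r) - h) 0"
            unfolding u_def label_ent_eq[OF c r] by (intro tendsto_intros entropy_rate_LIMSEQ[OF \<nu> sf])
          moreover have "entropy_rate \<nu> (ball_label c r) \<le> h"
            using entropy_rate_le_metric_entropy[OF sf, of \<nu>] real by simp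
          ultimately show ?case by (simp add: max_def)
        qed
        show "AE r in radius_measure e. norm (u n r) \<le> max (ln (real N)) 0" for n
          using lN[of n] by eventually_elim (use h0 in \<open>auto simp: u_def\<close>)
      qed (use umeas in auto)
      then have u0: "(\<lambda>n. \<integral>r. u n r \<partial>radius_measure e) \<longlonglongrightarrow> 0" by simp
      have uint: "integrable (radius_measure e) (u n)" for n
      proof (rule R.integrable_const_bound[OF _ umeas])
        show "AE r in radius_measure e. norm (u n r) \<le> max (ln (real N)) 0"
          using lN[of n] by eventually_elim (use h0 in \<open>auto simp: u_def\<close>)
      qed
      have "?\<Phi> n \<nu> / real n - h \<le> (\<integral>r. u n r \<partial>radius_measure e)" for n
      proof -
        have i: "integrable (radius_measure e) (\<lambda>r. label_ent c N n \<nu> r / real n)"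
          using label_ent_integrable[OF e pr] by auto
        have "?\<Phi> n \<nu> / real n - h = (\<integral>r. label_ent c N n \<nu> r / real n - h \<partial>radius_measure e)"
          unfolding mean_ent_def using i by (simp add: R.prob_space)
        also have "\<dots> \<le> (\<integral>r. u n r \<partial>radius_measure e)"
          using i uint by (intro integral_mono) (auto simp: u_def)
        finally show ?thesis .
      qed
      then have "F \<nu> - h \<le> 0"
        by (intro LIMSEQ_le[OF tendsto_diff[OF F(1)[OF \<nu>] tendsto_const] u0]) auto
      then show ?thesis using real by simp
    qed (use metric_entropy_nonneg[OF \<nu>] in auto)
  next
    \<comment> \<open>For every radius the word of \<open>X\<close> costs at most
      \<open>n * \<kappa>\<close> beyond the word of the ball labels; averaging over the radius
      preserves this.\<close>
    have k: "ent \<mu>0 (itinerary X n) \<le> ?\<Phi> n \<mu>0 + real n * \<kappa>" for n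
    proof -
      note pr = invariantD(1)[OF \<mu>0]
      have "(\<integral>r. ent \<mu>0 (itinerary X n) \<partial>radius_measure e) \<le> (\<integral>r. label_ent c N n \<mu>0 r + real n * \<kappa> \<partial>radius_measure e)"
      proof (rule integral_mono_AE)
        show "integrable (radius_measure e) (\<lambda>r. label_ent c N n \<mu>0 r + real n * \<kappa>)"
          using label_ent_integrable[OF e pr] by simp
        show "AE r in radius_measure e. ent \<mu>0 (itinerary X n) \<le> label_ent c N n \<mu>0 r + real n * \<kappa>"
          using AE_radius[OF e]
        proof eventually_elim
          case (elim r)
          then have r: "e \<le> r" by simp
          note sf = ball_label_simple[OF c r]
          have "dist x y < \<gamma>" if "ball_label c r x = ball_label c r y" for x y
            using ball_label_eqD[OF c r that] elim by (simp add: e_def)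
          from \<gamma>(2)[OF sf this] obtain k :: "nat \<Rightarrow> 'a set \<Rightarrow> real" where
            k: "\<And>a b. 0 < k a b" "\<And>a. (\<Sum>b\<in>range X. k a b) \<le> 1" "(\<integral>x. - ln (k (ball_label c r x) (X x)) \<partial>\<mu>0) \<le> \<kappa>" by auto
          have "ent \<mu>0 (itinerary X n) \<le> ent \<mu>0 (itinerary (ball_label c r) n) + real n * (\<integral>x. - ln (k (ball_label c r x) (X x)) \<partial>\<mu>0)"
            by (rule ent_itinerary_kernel[OF \<mu>0 sf X(1) k(1,2)])
          also have "\<dots> \<le> ent \<mu>0 (itinerary (ball_label c r) n) + real n * \<kappa>"
            using k(3) by (intro add_left_mono mult_left_mono) auto
          finally show ?case unfolding label_ent_eq[OF c r] .
        qed
      qed simp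
      then show ?thesis using label_ent_integrable[OF e pr] by (simp add: mean_ent_def R.prob_space)
    qed
    have "entropy_rate \<mu>0 X \<le> F \<mu>0 + \<kappa>"
    proof (rule LIMSEQ_le[OF entropy_rate_LIMSEQ[OF \<mu>0 X(1)] tendsto_add[OF F(1)[OF \<mu>0] tendsto_const]])
      have "ent \<mu>0 (itinerary X n) / real n \<le> ?\<Phi> n \<mu>0 / real n + \<kappa>" if "n \<ge> 1" for n
        using k[of n] that by (simp add: field_simps)
      then show "\<exists>N. \<forall>n\<ge>N. ent \<mu>0 (itinerary X n) / real n \<le> ?\<Phi> n \<mu>0 / real n + \<kappa>" by blast
    qed
    then show "c0 < F \<mu>0" using X(2) by (simp add: \<kappa>_def field_simps)
  next
    fix M \<nu> and \<delta> :: real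
    assume M: "\<And>i. M i \<in> invariant_measures T" and \<nu>: "\<nu> \<in> invariant_measures T" and conv: "weak_conv M \<nu>" and \<delta>: "0 < \<delta>"
    have "\<forall>\<^sub>F n in sequentially. ?\<Phi> n \<nu> / real n < F \<nu> + \<delta>"
      using order_tendstoD(2)[OF F(1)[OF \<nu>]] \<delta> by simp
    then obtain n where n: "n \<ge> 1" "?\<Phi> n \<nu> / real n < F \<nu> + \<delta>"
      unfolding eventually_sequentially by (metis nat_le_linear order_refl)
    have "(\<lambda>i. ?\<Phi> n (M i) / real n) \<longlonglongrightarrow> ?\<Phi> n \<nu> / real n"
      using mean_ent_weak_conv[OF e c M \<nu> conv] n(1) by (intro tendsto_intros) auto
    from order_tendstoD(2)[OF this n(2)]
    show "\<forall>\<^sub>F i in sequentially. F (M i) < F \<nu> + \<delta>"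
      by eventually_elim (use F(2)[OF M n(1)] in \<open>auto intro: le_less_trans\<close>)
  next
    fix s \<mu> \<nu> assume a: "\<mu> \<in> invariant_measures T" "\<nu> \<in> invariant_measures T" "0 \<le> s" "s \<le> (1::real)"
    have l: "(\<lambda>n. s * (?\<Phi> n \<mu> / real n) + (1 - s) * (?\<Phi> n \<nu> / real n) + 1 / real n) \<longlonglongrightarrow> s * F \<mu> + (1 - s) * F \<nu> + 0"
      by (intro tendsto_intros F a lim_1_over_n)
    have "F (mix s \<mu> \<nu>) \<le> s * F \<mu> + (1 - s) * F \<nu> + 0"
    proof (rule LIMSEQ_le_const[OF l])
      have "F (mix s \<mu> \<nu>) \<le> s * (?\<Phi> n \<mu> / real n) + (1 - s) * (?\<Phi> n \<nu> / real n) + 1 / real n" if n: "n \<ge> 1" for n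
      proof -
        have "F (mix s \<mu> \<nu>) \<le> ?\<Phi> n (mix s \<mu> \<nu>) / real n" by (rule F(2)[OF mix_invariant[OF a] n])
        also have "\<dots> \<le> (s * ?\<Phi> n \<mu> + (1 - s) * ?\<Phi> n \<nu> + 1) / real n"
          using mean_ent_mix[OF e c invariantD(1)[OF a(1)] invariantD(1)[OF a(2)] a(3,4), of n]
          by (intro divide_right_mono) auto
        finally show ?thesis by (simp add: add_divide_distrib)
      qed
      then show "\<exists>N. \<forall>n\<ge>N. F (mix s \<mu> \<nu>) \<le> s * (?\<Phi> n \<mu> / real n) + (1 - s) * (?\<Phi> n \<nu> / real n) + 1 / real n" by blast
    qed
    then show "F (mix s \<mu> \<nu>) \<le> s * F \<mu> + (1 - s) * F \<nu>" by simp
  qed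
qed


section \<open>Ergodic measures as maximizers\<close>

lemma invariant_split:
  assumes \<nu>: "\<nu> \<in> invariant_measures T" and A: "A \<in> sets borel" "T -` A = A" and m: "0 < measure \<nu> A" "measure \<nu> A < 1"
  obtains \<nu>1 \<nu>2 where "\<nu>1 \<in> invariant_measures T" "\<nu>2 \<in> invariant_measures T" "\<nu>1 \<noteq> \<nu>2"
    "\<nu> = mix (measure \<nu> A) \<nu>1 \<nu>2"
proof -
  note pr = invariantD(1)[OF \<nu>]
  interpret prob_space \<nu> by (rule prob_measuresD[OF pr])
  have s: "events = sets borel" "space \<nu> = UNIV" using prob_measuresD[OF pr] by auto
  have cond: "uniform_measure \<nu> C \<in> invariant_measures T" "\<And>D. D \<in> sets borel \<Longrightarrow> measure (uniform_measure \<nu> C) D = measure \<nu> (C \<inter> D) / measure \<nu> C"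
    if C: "C \<in> sets borel" "T -` C = C" "0 < measure \<nu> C" for C
  proof -
    show meas: "measure (uniform_measure \<nu> C) D = measure \<nu> (C \<inter> D) / measure \<nu> C" if "D \<in> sets borel" for D
      using C that s by (intro measure_uniform_measure) (auto simp: emeasure_eq_measure)
    have "prob_space (uniform_measure \<nu> C)"
      using C(3) by (intro prob_space_uniform_measure) (auto simp: emeasure_eq_measure)
    then have p: "uniform_measure \<nu> C \<in> prob_measures" using s by (simp add: prob_measures_def)
    have T: "T \<in> measurable (uniform_measure \<nu> C) borel"
      using measurable_Tn[of 1] s by (simp cong: measurable_cong_sets)
    interpret U: prob_space "uniform_measure \<nu> C" by fact
    have dp: "distr (uniform_measure \<nu> C) borel T \<in> prob_measures"
      using U.prob_space_distr[OF T] by (simp add: prob_measures_def)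
    have "distr (uniform_measure \<nu> C) borel T = uniform_measure \<nu> C"
    proof (rule prob_measures_eqI[OF dp p])
      fix D :: "'a set" assume D: "D \<in> sets borel"
      have TD: "T -` D \<in> sets borel" using vimage_Tn_sets[OF D, of 1] by simp
      have "measure (distr (uniform_measure \<nu> C) borel T) D = measure (uniform_measure \<nu> C) (T -` D)"
        using D T s by (simp add: measure_distr)
      also have "\<dots> = measure \<nu> (T -` (C \<inter> D)) / measure \<nu> C"
        using meas[OF TD] C(2) by (simp add: vimage_Int)
      also have "\<dots> = measure (uniform_measure \<nu> C) D"
        using measure_vimage_Tn[OF \<nu>, of "C \<inter> D" 1] C(1) D meas[OF D] by simp
      finally show "measure (distr (uniform_measure \<nu> C) borel T) D = measure (uniform_measure \<nu> C) D" .
    qed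
    then show "uniform_measure \<nu> C \<in> invariant_measures T" using p by (simp add: invariant_measures_def)
  qed
  have A': "- A \<in> sets borel" "T -` (- A) = - A" using A by (auto simp: vimage_Compl)
  have m': "measure \<nu> (- A) = 1 - measure \<nu> A" by (rule measure_Compl_prob[OF pr A(1)])
  then have m0: "0 < measure \<nu> (- A)" using m by simp
  let ?a = "uniform_measure \<nu> A" and ?b = "uniform_measure \<nu> (- A)"
  note ca = cond[OF A m(1)] and cb = cond[OF A' m0]
  have ne: "?a \<noteq> ?b"
  proof
    assume eq: "?a = ?b"
    have "measure ?a A = 1" using ca(2)[OF A(1)] m by simp
    moreover have "measure ?b A = 0" using cb(2)[OF A(1)] by simp
    ultimately show False using eq by simp
  qed
  have "\<nu> = mix (measure \<nu> A) ?a ?b"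
  proof (rule prob_measures_eqI[OF pr])
    show "mix (measure \<nu> A) ?a ?b \<in> prob_measures"
      by (rule mix_in_prob_measures[OF invariantD(1)[OF ca(1)] invariantD(1)[OF cb(1)]]) (use m in auto)
    fix D :: "'a set" assume D: "D \<in> sets borel"
    have "measure (mix (measure \<nu> A) ?a ?b) D = measure \<nu> (A \<inter> D) + measure \<nu> (- A \<inter> D)"
      using measure_mix[OF invariantD(1)[OF ca(1)] invariantD(1)[OF cb(1)] D, of "measure \<nu> A"] m m0
      by (simp add: ca(2)[OF D] cb(2)[OF D] m'[symmetric])
    also have "\<dots> = measure \<nu> ((A \<inter> D) \<union> (- A \<inter> D))"
      using A D s by (intro finite_measure_Union[symmetric]) auto
    also have "(A \<inter> D) \<union> (- A \<inter> D) = D" by auto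
    finally show "measure \<nu> D = measure (mix (measure \<nu> A) ?a ?b) D" ..
  qed
  then show thesis using that ca(1) cb(1) ne by blast
qed

text \<open>A weakly continuous, strictly convex functional: the weighted sum of squares of the
  coordinates that separate measures.\<close>

definition quad :: "'a measure \<Rightarrow> real" where
  "quad \<nu> = (\<Sum>k. (1/2) ^ Suc k * (\<integral>x. f k x \<partial>\<nu>)\<^sup>2)"

lemma integral_f_bounds: "\<nu> \<in> prob_measures \<Longrightarrow> \<bar>\<integral>x. f k x \<partial>\<nu>\<bar> \<le> 1"
  by (rule integral_abs_le[OF _ f_cont f_abs_le])

lemma quad_term_le: "\<nu> \<in> prob_measures \<Longrightarrow> norm ((1/2) ^ Suc k * (\<integral>x. f k x \<partial>\<nu>)\<^sup>2) \<le> (1/2) ^ Suc k"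
  using integral_f_bounds[of \<nu> k] by (simp add: abs_square_le_1 mult_left_le)

lemma quad_summable: "\<nu> \<in> prob_measures \<Longrightarrow> summable (\<lambda>k. (1/2) ^ Suc k * (\<integral>x. f k x \<partial>\<nu>)\<^sup>2)"
  by (rule summable_comparison_test'[OF summable_half, of 0]) (rule quad_term_le)

lemma quad_bounds:
  assumes "\<nu> \<in> prob_measures" shows "0 \<le> quad \<nu>" "quad \<nu> \<le> 1"
proof -
  show "0 \<le> quad \<nu>" unfolding quad_def by (rule suminf_nonneg[OF quad_summable[OF assms]]) simp
  have "quad \<nu> \<le> (\<Sum>k. (1/2) ^ Suc k)"
    unfolding quad_def by (rule suminf_le[OF _ quad_summable[OF assms] summable_half])
      (use quad_term_le[OF assms] in \<open>auto simp: abs_le_iff\<close>)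
  then show "quad \<nu> \<le> 1" using power_half_series by (simp add: sums_iff)
qed

lemma quad_weak_conv:
  assumes M: "\<And>n. M n \<in> prob_measures" and conv: "weak_conv M \<nu>"
  shows "(\<lambda>n. quad (M n)) \<longlonglongrightarrow> quad \<nu>"
proof -
  have "((\<lambda>n. \<Sum>k. (1/2) ^ Suc k * (\<integral>x. f k x \<partial>M n)\<^sup>2) \<longlongrightarrow> (\<Sum>k. (1/2) ^ Suc k * (\<integral>x. f k x \<partial>\<nu>)\<^sup>2)) sequentially"
  proof (rule tannerys_theorem[THEN conjunct2, THEN conjunct2, OF _ _ summable_half])
    show "(\<lambda>n. (1/2) ^ Suc k * (\<integral>x. f k x \<partial>M n)\<^sup>2) \<longlonglongrightarrow> (1/2) ^ Suc k * (\<integral>x. f k x \<partial>\<nu>)\<^sup>2" for k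
      using conv f_cont[of k] unfolding weak_conv_def by (intro tendsto_intros) auto
    show "\<forall>\<^sub>F (k, n) in sequentially \<times>\<^sub>F sequentially. norm ((1/2) ^ Suc k * (\<integral>x. f k x \<partial>M n)\<^sup>2) \<le> (1/2) ^ Suc k"
      by (rule always_eventually) (use quad_term_le[OF M] in auto)
  qed simp
  then show ?thesis by (simp add: quad_def)
qed

text \<open>For each square the convexity defect is \<open>s * (1 - s)\<close> times the squared
  difference of the coordinates, and distinct measures differ in some coordinate.\<close>

lemma quad_mix_less:
  assumes \<mu>: "\<mu> \<in> prob_measures" and \<nu>: "\<nu> \<in> prob_measures" and ne: "\<mu> \<noteq> \<nu>" and s: "0 < s" "s < 1"
  shows "quad (mix s \<mu> \<nu>) < s * quad \<mu> + (1 - s) * quad \<nu>"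
proof -
  let ?a = "\<lambda>k. \<integral>x. f k x \<partial>\<mu>" and ?b = "\<lambda>k. \<integral>x. f k x \<partial>\<nu>"
  have mixp: "mix s \<mu> \<nu> \<in> prob_measures" using s by (intro mix_in_prob_measures[OF \<mu> \<nu>]) auto
  define D where "D k = (1/2::real) ^ Suc k * (?a k - ?b k)\<^sup>2" for k
  have int: "(\<integral>x. f k x \<partial>mix s \<mu> \<nu>) = s * ?a k + (1 - s) * ?b k" for k
    using s by (intro integral_mix_continuous[OF \<mu> \<nu> _ _ f_cont]) auto
  have id: "(s * x + (1 - s) * y)\<^sup>2 = s * x\<^sup>2 + (1 - s) * y\<^sup>2 - s * (1 - s) * (x - y)\<^sup>2" for x y :: real
    by (simp add: power2_eq_square algebra_simps)
  have D: "s * (1 - s) * D k = s * ((1/2) ^ Suc k * (?a k)\<^sup>2) + (1 - s) * ((1/2) ^ Suc k * (?b k)\<^sup>2)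
      - (1/2) ^ Suc k * (\<integral>x. f k x \<partial>mix s \<mu> \<nu>)\<^sup>2" for k
  proof -
    have "s * (1 - s) * (c * Z) = s * (c * X) + (1 - s) * (c * Y) - c * (s * X + (1 - s) * Y - s * (1 - s) * Z)"
      for c X Y Z :: real by algebra
    then show ?thesis unfolding int id D_def .
  qed
  have sm: "(\<lambda>k. s * (1 - s) * D k) sums (s * quad \<mu> + (1 - s) * quad \<nu> - quad (mix s \<mu> \<nu>))"
    unfolding D quad_def by (intro sums_diff sums_add sums_mult summable_sums quad_summable \<mu> \<nu> mixp)
  obtain k where "?a k \<noteq> ?b k" using prob_measures_eq_fI[OF \<mu> \<nu>] ne by blast
  then have pos: "0 < s * (1 - s) * D k" using s by (simp add: D_def)
  have "0 < (\<Sum>k. s * (1 - s) * D k)"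
    by (rule suminf_pos2[OF sums_summable[OF sm] _ pos]) (use s in \<open>auto simp: D_def\<close>)
  then show ?thesis using sums_unique[OF sm] by simp
qed

text \<open>A maximizer of a strictly convex functional on the simplex of invariant measures is an
  extreme point, hence ergodic. The term \<open>\<kappa> * quad\<close> enforces strictness.\<close>

lemma ergodic_maximizer:
  fixes F :: "'a measure \<Rightarrow> real" and \<psi> :: "'a \<Rightarrow> real"
  assumes ex: "\<mu>0 \<in> invariant_measures T" and \<psi>: "continuous_on UNIV \<psi>" and b: "0 \<le> b" and \<kappa>: "0 < \<kappa>"
    and bd: "\<And>\<nu>. \<nu> \<in> invariant_measures T \<Longrightarrow> 0 \<le> F \<nu> \<and> F \<nu> \<le> B"
    and usc: "\<And>M \<nu> \<delta>. (\<And>i. M i \<in> invariant_measures T) \<Longrightarrow> \<nu> \<in> invariant_measures T \<Longrightarrow> weak_conv M \<nu> \<Longrightarrow> 0 < \<delta>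
       \<Longrightarrow> \<forall>\<^sub>F i in sequentially. F (M i) < F \<nu> + \<delta>"
    and conv: "\<And>s \<mu> \<nu>. \<mu> \<in> invariant_measures T \<Longrightarrow> \<nu> \<in> invariant_measures T \<Longrightarrow> 0 \<le> s \<Longrightarrow> s \<le> 1
       \<Longrightarrow> F (mix s \<mu> \<nu>) \<le> s * F \<mu> + (1 - s) * F \<nu>"
  obtains \<nu> where "\<nu> \<in> ergodic_measures T"
    "\<forall>\<mu>\<in>invariant_measures T. (\<integral>x. \<psi> x \<partial>\<mu>) + b * F \<mu> \<le> (\<integral>x. \<psi> x \<partial>\<nu>) + b * F \<nu> + \<kappa>"
proof -
  define W where "W \<nu> = (\<integral>x. \<psi> x \<partial>\<nu>) + b * F \<nu> + \<kappa> * quad \<nu>" for \<nu>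
  let ?I = "invariant_measures T"
  obtain C where C: "0 < C" "\<And>x. \<bar>\<psi> x\<bar> \<le> C" using continuous_bounded[OF \<psi>] by blast
  have Wb: "W \<nu> \<le> C + b * B + \<kappa>" if "\<nu> \<in> ?I" for \<nu>
  proof -
    have "b * F \<nu> \<le> b * B" using bd[OF that] b by (intro mult_left_mono) auto
    moreover have "\<kappa> * quad \<nu> \<le> \<kappa>" using quad_bounds[OF invariantD(1)[OF that]] \<kappa> by simp
    ultimately show ?thesis
      unfolding W_def using integral_abs_le[OF invariantD(1)[OF that] \<psi> C(2)] by linarith
  qed
  define S where "S = Sup (W ` ?I)"
  have bdd: "bdd_above (W ` ?I)" by (rule bdd_aboveI2[OF Wb])
  have WS: "W \<nu> \<le> S" if "\<nu> \<in> ?I" for \<nu> unfolding S_def by (rule cSup_upper[OF imageI[OF that] bdd])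
  have "\<exists>\<nu>\<in>?I. S - 1 / real (Suc n) < W \<nu>" for n
    using less_cSup_iff[of "W ` ?I" "S - 1 / real (Suc n)"] ex bdd by (auto simp: S_def)
  then obtain M where M: "\<And>n. M n \<in> ?I" "\<And>n. S - 1 / real (Suc n) < W (M n)" by metis
  obtain r \<nu> where r: "strict_mono r" "\<nu> \<in> ?I" "weak_conv (M \<circ> r) \<nu>" using invariant_seq_compact[OF M(1)] .
  have MI: "(M \<circ> r) i \<in> ?I" for i using M(1) by simp
  have "S \<le> W \<nu> + e" if e: "0 < e" for e
  proof -
    define \<delta> where "\<delta> = e / (3 + b + \<kappa>)"
    have \<delta>: "0 < \<delta>" using e b \<kappa> by (simp add: \<delta>_def)
    have "(\<lambda>i. \<integral>x. \<psi> x \<partial>(M \<circ> r) i) \<longlonglongrightarrow> (\<integral>x. \<psi> x \<partial>\<nu>)" using r(3) \<psi> by (simp add: weak_conv_def)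
    then have 1: "\<forall>\<^sub>F i in sequentially. (\<integral>x. \<psi> x \<partial>(M \<circ> r) i) < (\<integral>x. \<psi> x \<partial>\<nu>) + \<delta>"
      by (rule order_tendstoD) (use \<delta> in simp)
    have 2: "\<forall>\<^sub>F i in sequentially. F ((M \<circ> r) i) < F \<nu> + \<delta>" by (rule usc[OF MI r(2,3) \<delta>])
    have 3: "\<forall>\<^sub>F i in sequentially. quad ((M \<circ> r) i) < quad \<nu> + \<delta>"
      by (rule order_tendstoD(2)[OF quad_weak_conv[OF invariantD(1)[OF MI] r(3)]]) (use \<delta> in simp)
    have "(\<lambda>i. 1 / real (Suc (r i))) \<longlonglongrightarrow> 0"
      using LIMSEQ_subseq_LIMSEQ[OF LIMSEQ_Suc[OF lim_inverse_n'] r(1)] by (simp add: comp_def)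
    then have 4: "\<forall>\<^sub>F i in sequentially. 1 / real (Suc (r i)) < \<delta>" using \<delta> by (rule order_tendstoD)
    from 1 2 3 4 have "\<forall>\<^sub>F i in sequentially. S \<le> W \<nu> + e"
    proof eventually_elim
      case (elim i)
      have "b * F ((M \<circ> r) i) \<le> b * (F \<nu> + \<delta>)" using elim(2) b by (intro mult_left_mono) auto
      moreover have "\<kappa> * quad ((M \<circ> r) i) \<le> \<kappa> * (quad \<nu> + \<delta>)" using elim(3) \<kappa> by (intro mult_left_mono) auto
      ultimately have "W ((M \<circ> r) i) \<le> W \<nu> + \<delta> + b * \<delta> + \<kappa> * \<delta>"
        using elim(1) by (simp add: W_def algebra_simps)
      moreover have "S < W ((M \<circ> r) i) + \<delta>" using M(2)[of "r i"] elim(4) by simp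
      ultimately have "S \<le> W \<nu> + \<delta> * (3 + b + \<kappa>)" using \<delta> by (simp add: algebra_simps)
      also have "\<delta> * (3 + b + \<kappa>) = e" using b \<kappa> by (simp add: \<delta>_def)
      finally show ?case .
    qed
    then show ?thesis by simp
  qed
  then have max: "S \<le> W \<nu>" by (rule field_le_epsilon)
  have "\<nu> \<in> ergodic_measures T"
    unfolding ergodic_measures_def
  proof (intro CollectI conjI ballI impI r(2))
    fix A :: "'a set" assume A: "A \<in> sets borel" "T -` A = A"
    interpret prob_space \<nu> by (rule prob_measuresD[OF invariantD(1)[OF r(2)]])
    show "measure \<nu> A = 0 \<or> measure \<nu> A = 1"
    proof (rule ccontr)
      assume "\<not> (measure \<nu> A = 0 \<or> measure \<nu> A = 1)"
      then have m: "0 < measure \<nu> A" "measure \<nu> A < 1" using prob_le_1[of A] by (auto simp: less_le)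
      define s where "s = measure \<nu> A"
      obtain \<nu>1 \<nu>2 where sp: "\<nu>1 \<in> ?I" "\<nu>2 \<in> ?I" "\<nu>1 \<noteq> \<nu>2" "\<nu> = mix s \<nu>1 \<nu>2"
        using invariant_split[OF r(2) A m] unfolding s_def by blast
      have s: "0 < s" "s < 1" using m by (auto simp: s_def)
      note p = invariantD(1)[OF sp(1)] invariantD(1)[OF sp(2)]
      have "(\<integral>x. \<psi> x \<partial>\<nu>) = s * (\<integral>x. \<psi> x \<partial>\<nu>1) + (1 - s) * (\<integral>x. \<psi> x \<partial>\<nu>2)"
        unfolding sp(4) using s by (intro integral_mix_continuous[OF p _ _ \<psi>]) auto
      moreover have "b * F \<nu> \<le> b * (s * F \<nu>1 + (1 - s) * F \<nu>2)"
        unfolding sp(4) using s b by (intro mult_left_mono conv[OF sp(1,2)]) auto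
      moreover have "\<kappa> * quad \<nu> < \<kappa> * (s * quad \<nu>1 + (1 - s) * quad \<nu>2)"
        unfolding sp(4) using quad_mix_less[OF p sp(3) s] \<kappa> by (intro mult_strict_left_mono)
      ultimately have "W \<nu> < s * W \<nu>1 + (1 - s) * W \<nu>2" by (simp add: W_def algebra_simps)
      also have "\<dots> \<le> s * S + (1 - s) * S"
        using WS[OF sp(1)] WS[OF sp(2)] s by (intro add_mono mult_left_mono) auto
      also have "\<dots> = S" by (simp add: algebra_simps)
      finally show False using max by simp
    qed
  qed
  \<comment> \<open>The term \<open>\<kappa> * quad\<close> lies between 0 and \<kappa>, so deleting
    it from both sides costs \<kappa>.\<close>
  moreover have "(\<integral>x. \<psi> x \<partial>\<mu>) + b * F \<mu> \<le> (\<integral>x. \<psi> x \<partial>\<nu>) + b * F \<nu> + \<kappa>" if "\<mu> \<in> ?I" for \<mu>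
  proof -
    have "W \<mu> \<le> W \<nu>" using WS[OF that] max by simp
    moreover have "0 \<le> \<kappa> * quad \<mu>" using quad_bounds[OF invariantD(1)[OF that]] \<kappa> by simp
    moreover have "\<kappa> * quad \<nu> \<le> \<kappa>" using quad_bounds[OF invariantD(1)[OF r(2)]] \<kappa> by simp
    ultimately show ?thesis by (simp add: W_def)
  qed
  ultimately show thesis using that by blast
qed

end

section \<open>Gluing orbits with the almost product property\<close>

locale almost_product_system = compact_dynamics T f
  for T :: "'a::metric_space \<Rightarrow> 'a" and f :: "nat \<Rightarrow> ('a \<Rightarrow>\<^sub>C real)" +
  fixes g :: "nat \<Rightarrow> nat"
  assumes blowup: "blowup_function g"
    and almost_product: "almost_product_property (rho_dist f) T g"
begin

lemma blowup_small:
  assumes "0 < \<kappa>" shows "\<forall>\<^sub>F n in sequentially. real (g n) \<le> \<kappa> * real n"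
proof -
  have "(\<lambda>n. real (g n) / real n) \<longlonglongrightarrow> 0" using blowup by (simp add: blowup_function_def)
  then have "\<forall>\<^sub>F n in sequentially. real (g n) / real n < \<kappa>" using assms by (rule order_tendstoD)
  then show ?thesis using eventually_gt_at_top[of 0]
    by eventually_elim (simp add: pos_divide_less_eq)
qed

text \<open>At most \<open>g n\<close> times are uncontrolled and cost \<open>2 * B\<close> each, a
  negligible share for large \<open>n\<close> since \<open>g n / n\<close> tends to 0. At all other
  times the modulus of continuity of \<open>h\<close> applies.\<close>

lemma trace_birkhoff:
  fixes h :: "'a \<Rightarrow> real"
  assumes h: "continuous_on UNIV h" and \<kappa>: "0 < \<kappa>"
  obtains \<epsilon>' n0 where "0 < \<epsilon>'" "\<And>n x z e. n \<ge> n0 \<Longrightarrow> e \<le> \<epsilon>' \<Longrightarrow> z \<in> blowup_ball d T g n x e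
    \<Longrightarrow> \<bar>birkhoff_sum T n h x - birkhoff_sum T n h z\<bar> \<le> \<kappa> * real n"
proof -
  obtain B where B: "0 < B" "\<And>x. \<bar>h x\<bar> \<le> B" using continuous_bounded[OF h] by blast
  obtain \<delta> where \<delta>: "0 < \<delta>" "\<And>x y. d x y \<le> \<delta> \<Longrightarrow> dist (h x) (h y) < \<kappa>/2"
    using d_modulus[OF h, of "\<kappa>/2"] \<kappa> by (metis half_gt_zero)
  have "0 < \<kappa> / (4 * B)" using \<kappa> B by simp
  from blowup_small[OF this] obtain n0 where n0: "\<And>n. n \<ge> n0 \<Longrightarrow> real (g n) \<le> \<kappa> / (4 * B) * real n"
    by (auto simp: eventually_sequentially)
  show thesis
  proof (rule that[OF \<delta>(1)])
    fix n x z e assume n: "n \<ge> n0" and e: "e \<le> \<delta>" and z: "z \<in> blowup_ball d T g n x e"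
    obtain L where L: "L \<subseteq> {..<n}" "card ({..<n} - L) \<le> g n" "\<And>j. j \<in> L \<Longrightarrow> d ((T ^^ j) x) ((T ^^ j) z) \<le> e"
      using z unfolding blowup_ball_def by blast
    let ?u = "\<lambda>j. \<bar>h ((T ^^ j) x) - h ((T ^^ j) z)\<bar>"
    have "\<bar>birkhoff_sum T n h x - birkhoff_sum T n h z\<bar> = \<bar>\<Sum>j<n. h ((T ^^ j) x) - h ((T ^^ j) z)\<bar>"
      by (simp add: birkhoff_sum_def sum_subtractf)
    also have "\<dots> \<le> (\<Sum>j<n. ?u j)" by (rule sum_abs)
    also have "\<dots> = (\<Sum>j\<in>{..<n} - L. ?u j) + (\<Sum>j\<in>L. ?u j)"
      using L(1) by (intro sum.subset_diff) auto
    also have "(\<Sum>j\<in>{..<n} - L. ?u j) \<le> (\<Sum>j\<in>{..<n} - L. 2 * B)"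
    proof (rule sum_mono)
      fix j show "?u j \<le> 2 * B" using B(2)[of "(T ^^ j) x"] B(2)[of "(T ^^ j) z"] by arith
    qed
    also have "\<dots> \<le> real (g n) * (2 * B)" using L(2) B(1) by simp
    also have "\<dots> \<le> \<kappa> / (4 * B) * real n * (2 * B)" using n0[OF n] B(1) by (intro mult_right_mono) auto
    also have "\<dots> = \<kappa> / 2 * real n" using B(1) by simp
    also have "(\<Sum>j\<in>L. ?u j) \<le> (\<Sum>j\<in>L. \<kappa>/2)"
    proof (rule sum_mono)
      fix j assume "j \<in> L"
      then have "d ((T ^^ j) x) ((T ^^ j) z) \<le> \<delta>" using L(3) e by (meson order_trans)
      from \<delta>(2)[OF this] show "?u j \<le> \<kappa>/2" by (simp add: dist_real_def)
    qed
    also have "\<dots> \<le> \<kappa>/2 * real n"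
      using card_mono[OF finite_lessThan L(1)] \<kappa> by simp
    finally show "\<bar>birkhoff_sum T n h x - birkhoff_sum T n h z\<bar> \<le> \<kappa> * real n" by simp
  qed
qed

lemma trace_birkhoff_finite:
  fixes H :: "('a \<Rightarrow> real) set"
  assumes "finite H" "\<And>h. h \<in> H \<Longrightarrow> continuous_on UNIV h" and \<kappa>: "0 < \<kappa>"
  obtains \<epsilon>' n0 where "0 < \<epsilon>'" "\<forall>h\<in>H. \<forall>n\<ge>n0. \<forall>x z e. e \<le> \<epsilon>' \<longrightarrow> z \<in> blowup_ball d T g n x e
    \<longrightarrow> \<bar>birkhoff_sum T n h x - birkhoff_sum T n h z\<bar> \<le> \<kappa> * real n"
proof -
  have "\<exists>\<epsilon>'>0. \<exists>n0. \<forall>h\<in>H. \<forall>n\<ge>n0. \<forall>x z e. e \<le> \<epsilon>' \<longrightarrow> z \<in> blowup_ball d T g n x e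
    \<longrightarrow> \<bar>birkhoff_sum T n h x - birkhoff_sum T n h z\<bar> \<le> \<kappa> * real n" using assms(1,2)
  proof (induction H rule: finite_induct)
    case (insert h H)
    then obtain a n1 where a: "0 < a" "\<forall>h\<in>H. \<forall>n\<ge>n1. \<forall>x z e. e \<le> a \<longrightarrow> z \<in> blowup_ball d T g n x e
      \<longrightarrow> \<bar>birkhoff_sum T n h x - birkhoff_sum T n h z\<bar> \<le> \<kappa> * real n" by auto
    obtain b n2 where b: "0 < b" "\<And>n x z e. n \<ge> n2 \<Longrightarrow> e \<le> b \<Longrightarrow> z \<in> blowup_ball d T g n x e
      \<Longrightarrow> \<bar>birkhoff_sum T n h x - birkhoff_sum T n h z\<bar> \<le> \<kappa> * real n"
      using trace_birkhoff[of h \<kappa>] insert.prems \<kappa> by (metis insertI1)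
    show ?case
    proof (intro exI[of _ "min a b"] conjI exI[of _ "max n1 n2"] ballI allI impI)
      fix u n x z e assume u: "u \<in> insert h H" and n: "max n1 n2 \<le> n" and e: "e \<le> min a b" and z: "z \<in> blowup_ball d T g n x e"
      show "\<bar>birkhoff_sum T n u x - birkhoff_sum T n u z\<bar> \<le> \<kappa> * real n"
      proof (cases "u = h")
        case True
        then show ?thesis using b(2)[of n e z x] n e z by simp
      next
        case False
        then show ?thesis using a(2)[rule_format, of u n e z x] u n e z by simp
      qed
    qed (use a b in simp)
  qed (auto intro: exI[of _ 1])
  then show thesis by (elim exE conjE) (rule that)
qed

text \<open>Apart from at most \<open>2 * g n\<close> exceptional times of the two tracers, the
  triangle inequality transfers separation at the price of \<open>2 * e\<close> in the
  scale.\<close>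

lemma separated_trace:
  assumes sep: "separated_points d T \<delta> n \<epsilon> x y" and z: "z \<in> blowup_ball d T g n x e" and z': "z' \<in> blowup_ball d T g n y e"
  shows "\<delta> * real n - 2 * real (g n) \<le> real (card {j. j < n \<and> \<epsilon> - 2 * e < d ((T ^^ j) z) ((T ^^ j) z')})"
proof -
  obtain L where L: "L \<subseteq> {..<n}" "card ({..<n} - L) \<le> g n" "\<And>j. j \<in> L \<Longrightarrow> d ((T ^^ j) x) ((T ^^ j) z) \<le> e"
    using z unfolding blowup_ball_def by blast
  obtain L' where L': "L' \<subseteq> {..<n}" "card ({..<n} - L') \<le> g n" "\<And>j. j \<in> L' \<Longrightarrow> d ((T ^^ j) y) ((T ^^ j) z') \<le> e"
    using z' unfolding blowup_ball_def by blast
  let ?S = "{j. j < n \<and> d ((T ^^ j) x) ((T ^^ j) y) > \<epsilon>}"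
  let ?S' = "{j. j < n \<and> \<epsilon> - 2 * e < d ((T ^^ j) z) ((T ^^ j) z')}"
  have "?S \<subseteq> ?S' \<union> (({..<n} - L) \<union> ({..<n} - L'))"
  proof
    fix j assume j: "j \<in> ?S"
    show "j \<in> ?S' \<union> (({..<n} - L) \<union> ({..<n} - L'))"
    proof (cases "j \<in> L \<and> j \<in> L'")
      case True
      have "d ((T ^^ j) x) ((T ^^ j) y) \<le> d ((T ^^ j) x) ((T ^^ j) z) + (d ((T ^^ j) z) ((T ^^ j) z') + d ((T ^^ j) z') ((T ^^ j) y))"
        by (rule order_trans[OF d_triangle add_left_mono[OF d_triangle]])
      then show ?thesis using j L(3)[of j] L'(3)[of j] True d_sym[of "(T ^^ j) z'" "(T ^^ j) y"] by auto
    qed (use j in auto)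
  qed
  then have "card ?S \<le> card (?S' \<union> (({..<n} - L) \<union> ({..<n} - L')))" by (intro card_mono) auto
  also have "\<dots> \<le> card ?S' + card (({..<n} - L) \<union> ({..<n} - L'))" by (rule card_Un_le)
  also have "\<dots> \<le> card ?S' + (card ({..<n} - L) + card ({..<n} - L'))" by (intro add_left_mono card_Un_le)
  also have "\<dots> \<le> card ?S' + (g n + g n)" using L(2) L'(2) by (intro add_left_mono add_mono)
  finally have "real (card ?S) \<le> real (card ?S' + (g n + g n))" by (rule of_nat_mono)
  then show ?thesis using sep unfolding separated_points_def by simp
qed

lemma trace_exists:
  obtains m :: "real \<Rightarrow> nat" where "\<forall>k (x :: nat \<Rightarrow> 'a) \<epsilon> n. k \<ge> 1 \<longrightarrow> (\<forall>j<k. 0 < \<epsilon> j \<and> 1 \<le> n j \<and> m (\<epsilon> j) \<le> n j) \<longrightarrow>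
    (\<exists>z. \<forall>j<k. (T ^^ (\<Sum>i<j. n i)) z \<in> blowup_ball d T g (n j) (x j) (\<epsilon> j))"
proof -
  obtain m :: "real \<Rightarrow> nat" where m: "\<forall>k\<ge>1. \<forall>(x :: nat \<Rightarrow> 'a) (\<epsilon> :: nat \<Rightarrow> real) (n :: nat \<Rightarrow> nat).
        (\<forall>j<k. 0 < \<epsilon> j \<and> 1 \<le> n j \<and> m (\<epsilon> j) \<le> n j) \<longrightarrow>
        (\<Inter>j<k. (T ^^ (\<Sum>i<j. n i)) -` blowup_ball d T g (n j) (x j) (\<epsilon> j)) \<noteq> {}"
    using almost_product unfolding almost_product_property_def d_def[symmetric] by blast
  show thesis
  proof (rule that[of m], intro allI impI)
    fix k :: nat and x :: "nat \<Rightarrow> 'a" and \<epsilon> :: "nat \<Rightarrow> real" and n :: "nat \<Rightarrow> nat"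
    assume "k \<ge> 1" "\<forall>j<k. 0 < \<epsilon> j \<and> 1 \<le> n j \<and> m (\<epsilon> j) \<le> n j"
    then have "(\<Inter>j<k. (T ^^ (\<Sum>i<j. n i)) -` blowup_ball d T g (n j) (x j) (\<epsilon> j)) \<noteq> {}" using m by simp
    then show "\<exists>z. \<forall>j<k. (T ^^ (\<Sum>i<j. n i)) z \<in> blowup_ball d T g (n j) (x j) (\<epsilon> j)" by fastforce
  qed
qed

text \<open>\<open>good \<epsilon>0 \<nu> c\<close>: the orbit segments that follow \<open>\<nu>\<close> grow at rate at least \<open>c\<close>, when segments
  are distinguished at scale above \<open>\<epsilon>0\<close> on a positive proportion of times. The proportion may
  depend on the precision, which is what makes the notion convex.\<close>

definition good :: "real \<Rightarrow> 'a measure \<Rightarrow> real \<Rightarrow> bool" where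
  "good \<epsilon>0 \<nu> c \<longleftrightarrow> (\<forall>c'<c. \<forall>(H :: ('a \<Rightarrow> real) set) \<theta>. finite H \<longrightarrow> (\<forall>h\<in>H. continuous_on UNIV h) \<longrightarrow> 0 < \<theta> \<longrightarrow>
     (\<exists>\<delta>>0. \<exists>\<epsilon>1>\<epsilon>0. \<exists>n0. \<forall>n\<ge>n0. \<exists>E. finite E \<and> exp (real n * c') \<le> real (card E)
        \<and> separated_set d T \<delta> n \<epsilon>1 E \<and> E \<subseteq> near H \<theta> \<nu> n))"

lemma goodD:
  assumes "good \<epsilon>0 \<nu> c" "c' < c" "finite H" "\<And>h. h \<in> H \<Longrightarrow> continuous_on UNIV h" "0 < \<theta>"
  obtains \<delta> \<epsilon>1 n0 where "0 < \<delta>" "\<epsilon>0 < \<epsilon>1" "\<forall>n\<ge>n0. \<exists>E. finite E \<and> exp (real n * c') \<le> real (card E)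
        \<and> separated_set d T \<delta> n \<epsilon>1 E \<and> E \<subseteq> near H \<theta> \<nu> n"
proof -
  have "\<exists>\<delta>>0. \<exists>\<epsilon>1>\<epsilon>0. \<exists>n0. \<forall>n\<ge>n0. \<exists>E. finite E \<and> exp (real n * c') \<le> real (card E)
        \<and> separated_set d T \<delta> n \<epsilon>1 E \<and> E \<subseteq> near H \<theta> \<nu> n"
    by (rule assms(1)[unfolded good_def, rule_format, OF assms(2,3) _ assms(5)]) (rule assms(4))
  then show thesis by (elim exE conjE) (rule that)
qed

lemma good_mono:
  assumes "good \<epsilon>0 \<nu> c" "c' \<le> c" shows "good \<epsilon>0 \<nu> c'"
  unfolding good_def
proof (intro allI impI)
  fix b and H :: "('a \<Rightarrow> real) set" and \<theta> :: real
  assume b: "b < c'" and H: "finite H" "\<forall>h\<in>H. continuous_on UNIV h" "0 < \<theta>"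
  have "b < c" using b assms(2) by simp
  then show "\<exists>\<delta>>0. \<exists>\<epsilon>1>\<epsilon>0. \<exists>n0. \<forall>n\<ge>n0. \<exists>E. finite E \<and> exp (real n * b) \<le> real (card E)
        \<and> separated_set d T \<delta> n \<epsilon>1 E \<and> E \<subseteq> near H \<theta> \<nu> n"
    by (rule assms(1)[unfolded good_def, rule_format, OF _ H(1) _ H(3)]) (use H(2) in blast)
qed

text \<open>A neighbourhood of \<rho> of half the width lies inside the given one of \<nu>, and
  every rate above \<open>c'\<close> suffices. So a pair that is approximated by good pairs is good,
  the closedness that the hyperplane argument needs.\<close>

lemma good_closed:
  assumes \<nu>: "\<nu> \<in> prob_measures"
    and "\<And>c' (H :: ('a \<Rightarrow> real) set) \<theta>. c' < c \<Longrightarrow> finite H \<Longrightarrow> (\<And>h. h \<in> H \<Longrightarrow> continuous_on UNIV h) \<Longrightarrow> 0 < \<theta> \<Longrightarrow>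
      \<exists>\<rho> c''. good \<epsilon>0 \<rho> c'' \<and> c' < c'' \<and> (\<forall>h\<in>H. \<bar>(\<integral>x. h x \<partial>\<rho>) - (\<integral>x. h x \<partial>\<nu>)\<bar> < \<theta>)"
  shows "good \<epsilon>0 \<nu> c"
  unfolding good_def
proof (intro allI impI)
  fix c' and H :: "('a \<Rightarrow> real) set" and \<theta> :: real assume c': "c' < c" and H: "finite H" "\<forall>h\<in>H. continuous_on UNIV h" and \<theta>: "0 < \<theta>"
  then have "\<exists>\<rho> c''. good \<epsilon>0 \<rho> c'' \<and> c' < c'' \<and> (\<forall>h\<in>H. \<bar>(\<integral>x. h x \<partial>\<rho>) - (\<integral>x. h x \<partial>\<nu>)\<bar> < \<theta>/2)"
    by (intro assms(2)) auto
  then obtain \<rho> c'' where l: "good \<epsilon>0 \<rho> c''" "c' < c''" "\<forall>h\<in>H. \<bar>(\<integral>x. h x \<partial>\<rho>) - (\<integral>x. h x \<partial>\<nu>)\<bar> < \<theta>/2" by blast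
  have sub: "near H (\<theta>/2) \<rho> n \<subseteq> near H \<theta> \<nu> n" for n
  proof
    fix x assume x: "x \<in> near H (\<theta>/2) \<rho> n"
    have "\<bar>birkhoff_sum T n h x / real n - (\<integral>y. h y \<partial>\<nu>)\<bar> < \<theta>" if "h \<in> H" for h
    proof -
      have "\<bar>birkhoff_sum T n h x / real n - (\<integral>y. h y \<partial>\<rho>)\<bar> < \<theta>/2" using x that by (simp add: near_def)
      moreover have "\<bar>(\<integral>x. h x \<partial>\<rho>) - (\<integral>x. h x \<partial>\<nu>)\<bar> < \<theta>/2" using l(3) that by blast
      ultimately show ?thesis by arith
    qed
    then show "x \<in> near H \<theta> \<nu> n" by (simp add: near_def)
  qed
  have \<theta>2: "0 < \<theta>/2" using \<theta> by simp
  obtain \<delta> \<epsilon>1 n0 where E: "0 < \<delta>" "\<epsilon>0 < \<epsilon>1" "\<forall>n\<ge>n0. \<exists>E. finite E \<and> exp (real n * c') \<le> real (card E)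
        \<and> separated_set d T \<delta> n \<epsilon>1 E \<and> E \<subseteq> near H (\<theta>/2) \<rho> n"
    using goodD[OF l(1,2) H(1) H(2)[rule_format] \<theta>2] .
  show "\<exists>\<delta>>0. \<exists>\<epsilon>1>\<epsilon>0. \<exists>n0. \<forall>n\<ge>n0. \<exists>E. finite E \<and> exp (real n * c') \<le> real (card E)
        \<and> separated_set d T \<delta> n \<epsilon>1 E \<and> E \<subseteq> near H \<theta> \<nu> n"
  proof (rule exI[of _ \<delta>], rule conjI[OF E(1)], rule exI[of _ \<epsilon>1], rule conjI[OF E(2)], rule exI[of _ n0], intro allI impI)
    fix n assume "n0 \<le> n"
    from E(3)[rule_format, OF this] obtain E where "finite E" "exp (real n * c') \<le> real (card E)"
      "separated_set d T \<delta> n \<epsilon>1 E" "E \<subseteq> near H (\<theta>/2) \<rho> n" by blast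
    then show "\<exists>E. finite E \<and> exp (real n * c') \<le> real (card E) \<and> separated_set d T \<delta> n \<epsilon>1 E \<and> E \<subseteq> near H \<theta> \<nu> n"
      using sub[of n] by (intro exI[of _ E]) auto
  qed
qed

lemma ereal_exp_ge: "ereal r \<le> z \<Longrightarrow> ereal (exp r) \<le> ereal_exp z"
  by (cases z) (auto simp: ereal_exp_def)

lemma good_ergodic:
  assumes sep: "uniform_separation_property (rho_dist f) T" and \<eta>: "0 < \<eta>"
  obtains \<epsilon>0 where "0 < \<epsilon>0" "\<And>\<nu> c. \<nu> \<in> ergodic_measures T \<Longrightarrow> ereal (c + \<eta>) \<le> metric_entropy T \<nu> \<Longrightarrow> good \<epsilon>0 \<nu> c"
proof -
  from sep[unfolded uniform_separation_property_def d_def[symmetric], rule_format, OF \<eta>]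
  obtain \<delta> \<epsilon> where \<delta>: "0 < \<delta>" "0 < \<epsilon>" and "\<forall>\<nu>\<in>ergodic_measures T. \<forall>F. weak_star_nhd \<nu> F \<longrightarrow> (\<exists>n0. \<forall>n\<ge>n0.
       ereal_of_enat (max_separated d T F \<delta> n \<epsilon>) \<ge> ereal_exp (ereal (real n) * (metric_entropy T \<nu> - ereal \<eta>)))"
    by (elim exE conjE) (rule that)
  then have N: "\<exists>n0. \<forall>n\<ge>n0. ereal_of_enat (max_separated d T F \<delta> n \<epsilon>) \<ge> ereal_exp (ereal (real n) * (metric_entropy T \<nu> - ereal \<eta>))"
    if "\<nu> \<in> ergodic_measures T" "weak_star_nhd \<nu> F" for \<nu> F using that by simp
  show thesis
  \<comment> \<open>\<open>good\<close> demands separation strictly above \<epsilon>0. Half of the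
    given scale leaves room for the losses in tracing, and it depends on \<eta> only.\<close>
  proof (rule that[of "\<epsilon>/2"])
    show "0 < \<epsilon>/2" using \<delta> by simp
    fix \<nu> c assume \<nu>: "\<nu> \<in> ergodic_measures T" and c: "ereal (c + \<eta>) \<le> metric_entropy T \<nu>"
    have pr: "\<nu> \<in> prob_measures" using \<nu> invariantD(1) by (auto simp: ergodic_measures_def)
    show "good (\<epsilon>/2) \<nu> c"
      unfolding good_def
    proof (intro allI impI)
      fix c' and H :: "('a \<Rightarrow> real) set" and \<theta> :: real assume c': "c' < c" and H: "finite H" "\<forall>h\<in>H. continuous_on UNIV (h :: 'a \<Rightarrow> real)" and \<theta>: "0 < \<theta>"
      define F where "F = {\<rho> \<in> prob_measures. \<forall>h\<in>H. \<bar>(\<integral>x. h x \<partial>\<rho>) - (\<integral>x. h x \<partial>\<nu>)\<bar> < \<theta>}"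
      have "openin weak_star F" unfolding F_def by (rule openin_weak_star_nbhd) (use H in auto)
      then have "weak_star_nhd \<nu> F"
        unfolding weak_star_nhd_def using pr \<theta> by (auto simp: F_def intro!: exI[of _ F])
      from N[OF \<nu> this] obtain n0 where n0: "\<And>n. n \<ge> n0 \<Longrightarrow>
       ereal_of_enat (max_separated d T F \<delta> n \<epsilon>) \<ge> ereal_exp (ereal (real n) * (metric_entropy T \<nu> - ereal \<eta>))" by blast
      show "\<exists>\<delta>>0. \<exists>\<epsilon>1>\<epsilon>/2. \<exists>n0. \<forall>n\<ge>n0. \<exists>E. finite E \<and> exp (real n * c') \<le> real (card E)
        \<and> separated_set d T \<delta> n \<epsilon>1 E \<and> E \<subseteq> near H \<theta> \<nu> n"
      proof (rule exI[of _ \<delta>], rule conjI[OF \<delta>(1)], rule exI[of _ \<epsilon>], rule conjI, use \<delta>(2) in simp,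
          rule exI[of _ "max 1 n0"], intro allI impI)
        fix n assume n: "max 1 n0 \<le> n"
        have "ereal c \<le> metric_entropy T \<nu> - ereal \<eta>" using c by (cases "metric_entropy T \<nu>") auto
        then have "ereal (real n) * ereal c \<le> ereal (real n) * (metric_entropy T \<nu> - ereal \<eta>)"
          by (rule ereal_mult_left_mono) simp
        then have "ereal (real n * c) \<le> ereal (real n) * (metric_entropy T \<nu> - ereal \<eta>)" by simp
        from ereal_exp_ge[OF this] n0[of n] n
        have big: "ereal (exp (real n * c)) \<le> ereal_of_enat (max_separated d T F \<delta> n \<epsilon>)" by (metis max.bounded_iff order_trans)
        \<comment> \<open>The maximal cardinality is a supremum in \<open>enat\<close> and can be
          infinite. If all finite separated sets had fewer than \<open>exp (n * c')\<close>
          elements, the supremum would be at most the integer part of this number, which is less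
          than \<open>exp (n * c)\<close> because \<open>n \<ge> 1\<close>.\<close>
        have "\<exists>E. finite E \<and> E \<subseteq> {x. empirical T n x \<in> F} \<and> separated_set d T \<delta> n \<epsilon> E \<and> exp (real n * c') \<le> real (card E)"
        proof (rule ccontr)
          assume no: "\<not> ?thesis"
          let ?K = "nat \<lfloor>exp (real n * c')\<rfloor>"
          have "max_separated d T F \<delta> n \<epsilon> \<le> enat ?K"
            unfolding max_separated_def
          proof (rule SUP_least)
            fix E assume "E \<in> {E. finite E \<and> E \<subseteq> {x. empirical T n x \<in> F} \<and> separated_set d T \<delta> n \<epsilon> E}"
            then have "real (card E) < exp (real n * c')" using no by (auto simp: not_le)
            then have "card E \<le> ?K" by linarith
            then show "enat (card E) \<le> enat ?K" by simp
          qed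
          then have "ereal_of_enat (max_separated d T F \<delta> n \<epsilon>) \<le> ereal_of_enat (enat ?K)" by (rule ereal_of_enat_le_iff[THEN iffD2])
          also have "\<dots> = ereal (real ?K)" by simp
          also have "\<dots> \<le> ereal (exp (real n * c'))" by (simp add: of_nat_floor)
          also have "\<dots> < ereal (exp (real n * c))" using c' n by simp
          finally show False using big by simp
        qed
        then obtain E where E: "finite E" "E \<subseteq> {x. empirical T n x \<in> F}" "separated_set d T \<delta> n \<epsilon> E" "exp (real n * c') \<le> real (card E)" by blast
        have "E \<subseteq> near H \<theta> \<nu> n"
        proof
          fix x assume "x \<in> E"
          then have "empirical T n x \<in> F" using E(2) by blast
          then show "x \<in> near H \<theta> \<nu> n"
            using integral_empirical_continuous[of n _ x] H(2) n by (auto simp: F_def near_def)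
        qed
        then show "\<exists>E. finite E \<and> exp (real n * c') \<le> real (card E) \<and> separated_set d T \<delta> n \<epsilon> E \<and> E \<subseteq> near H \<theta> \<nu> n"
          using E by blast
      qed
    qed
  qed
qed

end

lemma abs_average_diff:
  fixes S I N :: real
  assumes "0 < N" shows "\<bar>S / N - I\<bar> = \<bar>S - N * I\<bar> / N"
proof -
  have "S / N - I = (S - N * I) / N" using assms by (simp add: diff_divide_distrib)
  then show ?thesis using assms by (simp add: abs_divide)
qed

context almost_product_system
begin

section \<open>Good pairs under mixtures, and all invariant measures\<close>

lemma separated_set_subset_mono:
  assumes "separated_set d T \<delta> n \<epsilon> E" "\<delta>' \<le> \<delta>" "\<epsilon>' \<le> \<epsilon>"
  shows "separated_set d T \<delta>' n \<epsilon>' E"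
  unfolding separated_set_def separated_points_def
proof (intro ballI impI)
  fix x y assume xy: "x \<in> E" "y \<in> E" "x \<noteq> y"
  have "\<delta>' * real n \<le> \<delta> * real n" using assms(2) by (intro mult_right_mono) auto
  also have "\<dots> \<le> real (card {j. j < n \<and> d ((T ^^ j) x) ((T ^^ j) y) > \<epsilon>})"
    using assms(1) xy by (simp add: separated_set_def separated_points_def)
  also have "\<dots> \<le> real (card {j. j < n \<and> d ((T ^^ j) x) ((T ^^ j) y) > \<epsilon>'})"
    using assms(3) by (intro of_nat_mono card_mono) auto
  finally show "\<delta>' * real n \<le> real (card {j. j < n \<and> d ((T ^^ j) x) ((T ^^ j) y) > \<epsilon>'})" .
qed

lemma card_shifted_le:
  "card {j. j < n \<and> \<epsilon> < d ((T ^^ j) ((T ^^ m) z)) ((T ^^ j) ((T ^^ m) z'))}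
    \<le> card {j. j < m + n \<and> \<epsilon> < d ((T ^^ j) z) ((T ^^ j) z')}"
proof -
  let ?A = "{j. j < n \<and> \<epsilon> < d ((T ^^ j) ((T ^^ m) z)) ((T ^^ j) ((T ^^ m) z'))}"
  have "card ?A = card ((+) m ` ?A)" by (simp add: card_image)
  also have "\<dots> \<le> card {j. j < m + n \<and> \<epsilon> < d ((T ^^ j) z) ((T ^^ j) z')}"
    by (intro card_mono) (auto simp: funpow_add_apply)
  finally show ?thesis .
qed

lemma glue_two:
  obtains m :: "real \<Rightarrow> nat" where "\<forall>x y n1 n2 e. 0 < e \<longrightarrow> 1 \<le> n1 \<longrightarrow> 1 \<le> n2 \<longrightarrow> m e \<le> n1 \<longrightarrow> m e \<le> n2 \<longrightarrow>
     (\<exists>z. z \<in> blowup_ball d T g n1 x e \<and> (T ^^ n1) z \<in> blowup_ball d T g n2 y e)"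
proof -
  obtain m :: "real \<Rightarrow> nat" where m: "\<forall>k (x :: nat \<Rightarrow> 'a) \<epsilon> n. k \<ge> 1 \<longrightarrow> (\<forall>j<k. 0 < \<epsilon> j \<and> 1 \<le> n j \<and> m (\<epsilon> j) \<le> n j) \<longrightarrow>
    (\<exists>z. \<forall>j<k. (T ^^ (\<Sum>i<j. n i)) z \<in> blowup_ball d T g (n j) (x j) (\<epsilon> j))"
    using trace_exists .
  show thesis
  proof (rule that[of m], intro allI impI)
    fix x y :: 'a and n1 n2 :: nat and e :: real
    assume a: "0 < e" "1 \<le> n1" "1 \<le> n2" "m e \<le> n1" "m e \<le> n2"
    let ?n = "\<lambda>j. if j = 0 then n1 else n2" and ?x = "\<lambda>j::nat. if j = 0 then x else y"
    have "\<exists>z. \<forall>j<2. (T ^^ (\<Sum>i<j. ?n i)) z \<in> blowup_ball d T g (?n j) (?x j) ((\<lambda>_. e) j)"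
      by (rule m[rule_format]) (use a in auto)
    then obtain z where z: "\<And>j. j < 2 \<Longrightarrow> (T ^^ (\<Sum>i<j. ?n i)) z \<in> blowup_ball d T g (?n j) (?x j) e" by auto
    from z[of 0] z[of 1] show "\<exists>z. z \<in> blowup_ball d T g n1 x e \<and> (T ^^ n1) z \<in> blowup_ball d T g n2 y e"
      by (intro exI[of _ z]) simp
  qed
qed

text \<open>For every pair of segments, one of length about \<open>s * n\<close> for
  \<open>\<nu>1\<close> and one for \<open>\<nu>2\<close>, a point tracing both in succession is
  chosen. Cardinalities multiply, so the rates are averaged. Pairs that differ in one component are
  separated during that component, a fixed share of the whole time.\<close>

lemma good_mix:
  assumes g1: "good \<epsilon>0 \<nu>1 c1" and g2: "good \<epsilon>0 \<nu>2 c2" and p: "\<nu>1 \<in> prob_measures" "\<nu>2 \<in> prob_measures"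
    and s: "0 < s" "s < 1" and \<epsilon>0: "0 < \<epsilon>0"
  shows "good \<epsilon>0 (mix s \<nu>1 \<nu>2) (s * c1 + (1 - s) * c2)"
  unfolding good_def
proof (intro allI impI)
  fix c' and H :: "('a \<Rightarrow> real) set" and \<theta> :: real
  assume c': "c' < s * c1 + (1 - s) * c2" and H: "finite H" "\<forall>h\<in>H. continuous_on UNIV h" and \<theta>: "0 < \<theta>"
  define \<kappa> where "\<kappa> = (s * c1 + (1 - s) * c2 - c') / 2"
  have \<kappa>: "0 < \<kappa>" using c' by (simp add: \<kappa>_def)
  define b1 where "b1 = c1 - \<kappa>" define b2 where "b2 = c2 - \<kappa>"
  have "s * b1 + (1 - s) * b2 = s * c1 + (1 - s) * c2 - \<kappa>" by (simp add: b1_def b2_def algebra_simps)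
  then have b: "s * b1 + (1 - s) * b2 = c' + \<kappa>" unfolding \<kappa>_def by (simp add: field_simps)
  have \<theta>4: "0 < \<theta>/4" using \<theta> by simp
  have "b1 < c1" "b2 < c2" using \<kappa> by (auto simp: b1_def b2_def)
  obtain \<delta>1 \<epsilon>1 k1 where E1: "0 < \<delta>1" "\<epsilon>0 < \<epsilon>1" "\<forall>n\<ge>k1. \<exists>E. finite E \<and> exp (real n * b1) \<le> real (card E)
        \<and> separated_set d T \<delta>1 n \<epsilon>1 E \<and> E \<subseteq> near H (\<theta>/4) \<nu>1 n"
    using goodD[OF g1 \<open>b1 < c1\<close> H(1) H(2)[rule_format] \<theta>4] .
  obtain \<delta>2 \<epsilon>2 k2 where E2: "0 < \<delta>2" "\<epsilon>0 < \<epsilon>2" "\<forall>n\<ge>k2. \<exists>E. finite E \<and> exp (real n * b2) \<le> real (card E)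
        \<and> separated_set d T \<delta>2 n \<epsilon>2 E \<and> E \<subseteq> near H (\<theta>/4) \<nu>2 n"
    using goodD[OF g2 \<open>b2 < c2\<close> H(1) H(2)[rule_format] \<theta>4] .
  define \<delta> where "\<delta> = min \<delta>1 \<delta>2"
  define \<epsilon> where "\<epsilon> = min \<epsilon>1 \<epsilon>2"
  \<comment> \<open>The midpoint between \<epsilon>0 and the common scale \<epsilon>. Tracing
    precision \<open>e\<close> lowers the scale by \<open>2 * e\<close>, at most down to the
    midpoint, which is still above \<epsilon>0.\<close>
  define \<epsilon>m where "\<epsilon>m = (\<epsilon>0 + \<epsilon>) / 2"
  have \<delta>: "0 < \<delta>" "\<delta> \<le> \<delta>1" "\<delta> \<le> \<delta>2" using E1 E2 by (auto simp: \<delta>_def)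
  have \<epsilon>: "\<epsilon>0 < \<epsilon>m" "\<epsilon>m < \<epsilon>" "\<epsilon> \<le> \<epsilon>1" "\<epsilon> \<le> \<epsilon>2" using E1 E2 by (auto simp: \<epsilon>_def \<epsilon>m_def)
  obtain e0 k3 where tr: "0 < e0" "\<forall>h\<in>H. \<forall>n\<ge>k3. \<forall>x z e. e \<le> e0 \<longrightarrow> z \<in> blowup_ball d T g n x e
    \<longrightarrow> \<bar>birkhoff_sum T n h x - birkhoff_sum T n h z\<bar> \<le> \<theta>/4 * real n"
    using trace_birkhoff_finite[OF H(1) H(2)[rule_format] \<theta>4] .
  define e where "e = min e0 ((\<epsilon> - \<epsilon>m) / 2)"
  have "e \<le> (\<epsilon> - \<epsilon>m) / 2" unfolding e_def by (rule min.cobounded2)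
  moreover have "0 < e" "e \<le> e0" using tr(1) \<epsilon> by (auto simp: e_def)
  ultimately have e: "0 < e" "e \<le> e0" "\<epsilon>m \<le> \<epsilon> - 2 * e" by auto
  obtain m :: "real \<Rightarrow> nat" where m: "\<forall>x y n1 n2 e. 0 < e \<longrightarrow> 1 \<le> n1 \<longrightarrow> 1 \<le> n2 \<longrightarrow> m e \<le> n1 \<longrightarrow> m e \<le> n2 \<longrightarrow>
     (\<exists>z. z \<in> blowup_ball d T g n1 x e \<and> (T ^^ n1) z \<in> blowup_ball d T g n2 y e)"
    using glue_two .
  have "0 < \<delta>/4" using \<delta> by simp
  from blowup_small[OF this] obtain k4 where k4: "\<And>n. n \<ge> k4 \<Longrightarrow> real (g n) \<le> \<delta>/4 * real n"
    by (auto simp: eventually_sequentially)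
  define N0 where "N0 = Max {1, k1, k2, k3, k4, m e}"
  have N0: "1 \<le> N0" "k1 \<le> N0" "k2 \<le> N0" "k3 \<le> N0" "k4 \<le> N0" "m e \<le> N0" by (auto simp: N0_def)
  obtain B where B: "0 < B" "\<And>h x. h \<in> H \<Longrightarrow> \<bar>h x\<bar> \<le> B" using finite_family_bounded[OF H(1) H(2)[rule_format]] by metis
  define n1 where "n1 n = nat \<lfloor>s * real n\<rfloor>" for n
  have n1: "real (n1 n) \<le> s * real n" "s * real n < real (n1 n) + 1" "n1 n \<le> n" for n
  proof -
    have "0 \<le> s * real n" using s by simp
    then show 1: "real (n1 n) \<le> s * real n" "s * real n < real (n1 n) + 1" unfolding n1_def by linarith+
    have "s * real n \<le> real n" using s by (simp add: mult_left_le_one_le)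
    then show "n1 n \<le> n" using 1 by linarith
  qed
  define t where "t = min s (1 - s)"
  have t: "0 < t" "t \<le> s" "t \<le> 1 - s" using s by (auto simp: t_def)
  \<comment> \<open>For \<open>n\<close> beyond \<open>Q\<close> both pieces have length at least
    \<open>N0\<close> and \<open>t * n / 2\<close>, and rounding \<open>s * n\<close> down costs at
    most \<kappa> per step in the rate and \<open>\<theta> / 4\<close> in the averages.\<close>
  define Q where "Q = Max {2 * (real N0 + 1) / t, (\<bar>b1 - b2\<bar>) / \<kappa>, 8 * B / \<theta>}"
  have Q: "2 * (real N0 + 1) / t \<le> Q" "\<bar>b1 - b2\<bar> / \<kappa> \<le> Q" "8 * B / \<theta> \<le> Q" by (auto simp: Q_def)
  obtain N where N: "Q < real N" using reals_Archimedean2 by blast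
  \<comment> \<open>A piece has at least length \<open>t * n / 2\<close>, and half of its separated
    proportion \<delta> survives the exceptional times, since \<open>g\<close> takes at most
    \<open>\<delta> / 4\<close> for each of the two tracers.\<close>
  define \<delta>' where "\<delta>' = \<delta> * t / 4"
  have \<delta>': "0 < \<delta>'" using \<delta> t by (simp add: \<delta>'_def)
  show "\<exists>\<delta>>0. \<exists>\<epsilon>1>\<epsilon>0. \<exists>n0. \<forall>n\<ge>n0. \<exists>E. finite E \<and> exp (real n * c') \<le> real (card E)
        \<and> separated_set d T \<delta> n \<epsilon>1 E \<and> E \<subseteq> near H \<theta> (mix s \<nu>1 \<nu>2) n"
  proof (rule exI[of _ \<delta>'], rule conjI[OF \<delta>'], rule exI[of _ \<epsilon>m], rule conjI[OF \<epsilon>(1)], rule exI[of _ N], intro allI impI)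
    fix n assume "N \<le> n"
    then have nQ: "Q \<le> real n" using N by linarith
    have nt: "2 * (real N0 + 1) \<le> t * real n"
    proof -
      have "2 * (real N0 + 1) / t \<le> real n" using Q(1) nQ by linarith
      then show ?thesis using t by (simp add: field_simps)
    qed
    have nb: "\<bar>b1 - b2\<bar> \<le> \<kappa> * real n"
    proof -
      have "\<bar>b1 - b2\<bar> / \<kappa> \<le> real n" using Q(2) nQ by linarith
      then show ?thesis using \<kappa> by (simp add: field_simps)
    qed
    have nB: "2 * B \<le> \<theta>/4 * real n"
    proof -
      have "8 * B / \<theta> \<le> real n" using Q(3) nQ by linarith
      then show ?thesis using \<theta> by (simp add: field_simps)
    qed
    define a where "a = n1 n" define a' where "a' = n - n1 n"
    have aa': "n = a + a'" using n1(3)[of n] by (simp add: a_def a'_def)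
    have ts: "t * real n \<le> s * real n" "t * real n \<le> (1 - s) * real n" using t by (auto intro: mult_right_mono)
    have ra': "real a' = real n - real a" using aa' by simp
    have half: "t / 2 * real n = t * real n / 2" by simp
    have abig: "t / 2 * real n \<le> real a" "N0 \<le> a"
    proof -
      have "t * real n / 2 + real N0 \<le> real a" using n1(2)[of n] nt ts(1) unfolding a_def[symmetric] by simp
      moreover have "0 \<le> t * real n" "0 \<le> real N0" using t by auto
      ultimately have "t * real n / 2 \<le> real a" "real N0 \<le> real a" by linarith+
      then show "t / 2 * real n \<le> real a" "N0 \<le> a" unfolding half by simp_all
    qed
    have "(1 - s) * real n \<le> real a'" using n1(1)[of n] ra' unfolding a_def[symmetric] by (simp add: algebra_simps)
    then have "t * real n \<le> real a'" using ts(2) by linarith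
    then have "t * real n / 2 + real N0 \<le> real a'" using nt by simp
    moreover have "0 \<le> t * real n" "0 \<le> real N0" using t by auto
    ultimately have "t * real n / 2 \<le> real a'" "real N0 \<le> real a'" by linarith+
    then have a'big: "t / 2 * real n \<le> real a'" "N0 \<le> a'" unfolding half by simp_all
    obtain F1 where F1: "finite F1" "exp (real a * b1) \<le> real (card F1)" "separated_set d T \<delta>1 a \<epsilon>1 F1" "F1 \<subseteq> near H (\<theta>/4) \<nu>1 a"
      using E1(3)[rule_format, of a] abig(2) N0 by (meson order_trans)
    obtain F2 where F2: "finite F2" "exp (real a' * b2) \<le> real (card F2)" "separated_set d T \<delta>2 a' \<epsilon>2 F2" "F2 \<subseteq> near H (\<theta>/4) \<nu>2 a'"
      using E2(3)[rule_format, of a'] a'big(2) N0 by (meson order_trans)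
    have "\<exists>z. z \<in> blowup_ball d T g a (fst q) e \<and> (T ^^ a) z \<in> blowup_ball d T g a' (snd q) e" for q
      using e(1) abig(2) a'big(2) N0 by (intro m[rule_format]) auto
    then obtain z where z: "\<And>q. z q \<in> blowup_ball d T g a (fst q) e" "\<And>q. (T ^^ a) (z q) \<in> blowup_ball d T g a' (snd q) e"
      by metis
    have block: "\<delta>' * real n \<le> real (card {j. j < k \<and> \<epsilon>m < d ((T ^^ j) v) ((T ^^ j) v')})"
      if k: "t / 2 * real n \<le> real k" "N0 \<le> k" and F: "separated_set d T \<delta> k \<epsilon> F" "x \<in> F" "y \<in> F" "x \<noteq> y"
        and v: "v \<in> blowup_ball d T g k x e" "v' \<in> blowup_ball d T g k y e" for k F x y v v'
    proof -
      have "separated_points d T \<delta> k \<epsilon> x y" using F by (simp add: separated_set_def)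
      from separated_trace[OF this v]
      have "\<delta> * real k - 2 * real (g k) \<le> real (card {j. j < k \<and> \<epsilon> - 2 * e < d ((T ^^ j) v) ((T ^^ j) v')})" .
      also have "\<dots> \<le> real (card {j. j < k \<and> \<epsilon>m < d ((T ^^ j) v) ((T ^^ j) v')})"
        using e(3) by (intro of_nat_mono card_mono) auto
      finally have "\<delta> * real k - 2 * real (g k) \<le> real (card {j. j < k \<and> \<epsilon>m < d ((T ^^ j) v) ((T ^^ j) v')})" .
      moreover have "real (g k) \<le> \<delta>/4 * real k" using k4 k(2) N0 by simp
      moreover have "\<delta>' * real n \<le> \<delta> / 2 * real k"
      proof -
        have "\<delta> / 2 * (t / 2 * real n) \<le> \<delta> / 2 * real k" using k(1) \<delta>(1) by (intro mult_left_mono) auto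
        then show ?thesis by (simp add: \<delta>'_def)
      qed
      ultimately show ?thesis by linarith
    qed
    have sep: "\<delta>' * real n \<le> real (card {j. j < n \<and> \<epsilon>m < d ((T ^^ j) (z q)) ((T ^^ j) (z q'))})"
      if q: "q \<in> F1 \<times> F2" "q' \<in> F1 \<times> F2" "q \<noteq> q'" for q q'
    proof (cases "fst q = fst q'")
      case False
      have "\<delta>' * real n \<le> real (card {j. j < a \<and> \<epsilon>m < d ((T ^^ j) (z q)) ((T ^^ j) (z q'))})"
        by (rule block[OF abig separated_set_subset_mono[OF F1(3) \<delta>(2) \<epsilon>(3)] _ _ False z(1) z(1)]) (use q in auto)
      also have "\<dots> \<le> real (card {j. j < n \<and> \<epsilon>m < d ((T ^^ j) (z q)) ((T ^^ j) (z q'))})"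
        using aa' by (intro of_nat_mono card_mono) auto
      finally show ?thesis .
    next
      case True
      then have ne: "snd q \<noteq> snd q'" using q(3) by (simp add: prod_eq_iff)
      have "\<delta>' * real n \<le> real (card {j. j < a' \<and> \<epsilon>m < d ((T ^^ j) ((T ^^ a) (z q))) ((T ^^ j) ((T ^^ a) (z q')))})"
        by (rule block[OF a'big separated_set_subset_mono[OF F2(3) \<delta>(3) \<epsilon>(4)] _ _ ne z(2) z(2)]) (use q in auto)
      also have "\<dots> \<le> real (card {j. j < n \<and> \<epsilon>m < d ((T ^^ j) (z q)) ((T ^^ j) (z q'))})"
        unfolding aa' by (intro of_nat_mono card_shifted_le)
      finally show ?thesis .
    qed
    have n0: "0 < real n" using nt t by (cases "n = 0") auto
    have inj: "inj_on z (F1 \<times> F2)"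
    proof (rule inj_onI, rule ccontr)
      fix q q' assume q: "q \<in> F1 \<times> F2" "q' \<in> F1 \<times> F2" "z q = z q'" "q \<noteq> q'"
      have "0 < \<delta>' * real n" using \<delta>' n0 by simp
      also have "\<dots> \<le> real (card {j. j < n \<and> \<epsilon>m < d ((T ^^ j) (z q)) ((T ^^ j) (z q'))})" by (rule sep[OF q(1,2,4)])
      also have "\<dots> = 0" unfolding q(3) using \<epsilon>(1) \<epsilon>0 by simp
      finally show False by simp
    qed
    have card: "exp (real n * c') \<le> real (card (z ` (F1 \<times> F2)))"
    proof -
      have "real n * c' \<le> real a * b1 + real a' * b2"
      proof -
        have "real a * b1 + real a' * b2 = real n * (s * b1 + (1 - s) * b2) - (s * real n - real a) * (b1 - b2)"
          unfolding ra' by (simp add: algebra_simps)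
        moreover have "(s * real n - real a) * (b1 - b2) \<le> 1 * \<bar>b1 - b2\<bar>"
        proof -
          have "(s * real n - real a) * (b1 - b2) \<le> (s * real n - real a) * \<bar>b1 - b2\<bar>"
            using n1(1)[of n] by (intro mult_left_mono) (auto simp: a_def)
          also have "\<dots> \<le> 1 * \<bar>b1 - b2\<bar>" using n1(2)[of n] by (intro mult_right_mono) (auto simp: a_def)
          finally show ?thesis .
        qed
        ultimately show ?thesis using nb unfolding b by (simp add: algebra_simps)
      qed
      then have "exp (real n * c') \<le> exp (real a * b1) * exp (real a' * b2)" by (simp add: exp_add[symmetric])
      also have "\<dots> \<le> real (card F1) * real (card F2)" using F1(2) F2(2) by (intro mult_mono) auto
      also have "\<dots> = real (card (z ` (F1 \<times> F2)))" by (simp add: card_image[OF inj] card_cartesian_product)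
      finally show ?thesis .
    qed
    have near: "z q \<in> near H \<theta> (mix s \<nu>1 \<nu>2) n" if q: "q \<in> F1 \<times> F2" for q
      unfolding near_def
    proof (intro CollectI ballI)
      fix h assume h: "h \<in> H"
      let ?i1 = "\<integral>x. h x \<partial>\<nu>1" and ?i2 = "\<integral>x. h x \<partial>\<nu>2"
      have hc: "continuous_on UNIV h" using H(2) h by blast
      have pos: "0 < real a" "0 < real a'" using abig(2) a'big(2) N0(1) by auto
      have part: "\<bar>birkhoff_sum T k h v - real k * (\<integral>x. h x \<partial>\<nu>)\<bar> \<le> \<theta>/2 * real k"
        if "x \<in> near H (\<theta>/4) \<nu> k" "v \<in> blowup_ball d T g k x e" "N0 \<le> k" for x v k \<nu>
      proof -
        have k: "0 < real k" using that(3) N0(1) by simp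
        have "\<bar>birkhoff_sum T k h x / real k - (\<integral>x. h x \<partial>\<nu>)\<bar> < \<theta>/4" using that(1) h by (simp add: near_def)
        then have "\<bar>birkhoff_sum T k h x - real k * (\<integral>x. h x \<partial>\<nu>)\<bar> \<le> \<theta>/4 * real k"
          unfolding abs_average_diff[OF k] using k by (simp add: pos_divide_less_eq)
        moreover have "\<bar>birkhoff_sum T k h x - birkhoff_sum T k h v\<bar> \<le> \<theta>/4 * real k"
          by (rule tr(2)[rule_format, OF h _ e(2) that(2)]) (use that(3) N0 in simp)
        ultimately show ?thesis by linarith
      qed
      have 1: "\<bar>birkhoff_sum T a h (z q) - real a * ?i1\<bar> \<le> \<theta>/2 * real a"
        by (rule part[OF _ z(1) abig(2)]) (use F1(4) q in auto)
      have 2: "\<bar>birkhoff_sum T a' h ((T ^^ a) (z q)) - real a' * ?i2\<bar> \<le> \<theta>/2 * real a'"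
        by (rule part[OF _ z(2) a'big(2)]) (use F2(4) q in auto)
      have 3: "\<bar>real a * ?i1 + real a' * ?i2 - real n * (s * ?i1 + (1 - s) * ?i2)\<bar> \<le> \<theta>/4 * real n"
      proof -
        have "real a * ?i1 + real a' * ?i2 - real n * (s * ?i1 + (1 - s) * ?i2) = (real a - s * real n) * (?i1 - ?i2)"
          unfolding ra' by (simp add: algebra_simps)
        then have "\<bar>real a * ?i1 + real a' * ?i2 - real n * (s * ?i1 + (1 - s) * ?i2)\<bar> = \<bar>real a - s * real n\<bar> * \<bar>?i1 - ?i2\<bar>"
          by (simp add: abs_mult)
        also have "\<dots> \<le> 1 * (2 * B)"
        proof (rule mult_mono)
          show "\<bar>real a - s * real n\<bar> \<le> 1" using n1(1,2)[of n] unfolding a_def by linarith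
          show "\<bar>?i1 - ?i2\<bar> \<le> 2 * B"
            using integral_abs_le[OF p(1) hc B(2)[OF h]] integral_abs_le[OF p(2) hc B(2)[OF h]] by linarith
        qed auto
        finally show ?thesis using nB by simp
      qed
      have "birkhoff_sum T n h (z q) = birkhoff_sum T a h (z q) + birkhoff_sum T a' h ((T ^^ a) (z q))"
        unfolding aa' by (rule birkhoff_sum_add)
      then have "\<bar>birkhoff_sum T n h (z q) - real n * (s * ?i1 + (1 - s) * ?i2)\<bar> \<le> \<theta>/2 * real a + \<theta>/2 * real a' + \<theta>/4 * real n"
        using 1 2 3 by linarith
      also have "\<theta>/2 * real a + \<theta>/2 * real a' = \<theta>/2 * real n" unfolding ra' by (simp add: field_simps)
      also have "\<theta>/2 * real n + \<theta>/4 * real n < \<theta> * real n" using \<theta> n0 by simp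
      finally have "\<bar>birkhoff_sum T n h (z q) - real n * (s * ?i1 + (1 - s) * ?i2)\<bar> / real n < \<theta>"
        using n0 by (simp add: pos_divide_less_eq)
      then show "\<bar>birkhoff_sum T n h (z q) / real n - (\<integral>y. h y \<partial>mix s \<nu>1 \<nu>2)\<bar> < \<theta>"
        using integral_mix_continuous[OF p _ _ hc, of s] s unfolding abs_average_diff[OF n0] by simp
    qed
    show "\<exists>E. finite E \<and> exp (real n * c') \<le> real (card E) \<and> separated_set d T \<delta>' n \<epsilon>m E \<and> E \<subseteq> near H \<theta> (mix s \<nu>1 \<nu>2) n"
    proof (intro exI[of _ "z ` (F1 \<times> F2)"] conjI card)
      show "finite (z ` (F1 \<times> F2))" using F1(1) F2(1) by simp
      show "z ` (F1 \<times> F2) \<subseteq> near H \<theta> (mix s \<nu>1 \<nu>2) n" using near by blast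
      show "separated_set d T \<delta>' n \<epsilon>m (z ` (F1 \<times> F2))"
        unfolding separated_set_def separated_points_def
      proof (intro ballI impI)
        fix x y assume "x \<in> z ` (F1 \<times> F2)" "y \<in> z ` (F1 \<times> F2)" "x \<noteq> y"
        then obtain q q' where q: "q \<in> F1 \<times> F2" "q' \<in> F1 \<times> F2" "q \<noteq> q'" "x = z q" "y = z q'" by blast
        show "\<delta>' * real n \<le> real (card {j. j < n \<and> \<epsilon>m < d ((T ^^ j) x) ((T ^^ j) y)})"
          unfolding q(4,5) by (rule sep[OF q(1-3)])
      qed
    qed
  qed
qed


text \<open>Every invariant measure is good: otherwise a hyperplane separates it from the convex set of
  good pairs \<open>(\<nu>, c)\<close>, and an ergodic maximizer of the separating functional is a good
  measure on the wrong side.\<close>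

lemma good_invariant:
  assumes sep: "uniform_separation_property (rho_dist f) T" and \<eta>: "0 < \<eta>"
  obtains \<epsilon>0 where "0 < \<epsilon>0"
    "\<forall>\<mu> c. \<mu> \<in> invariant_measures T \<longrightarrow> ereal (c + \<eta>) < metric_entropy T \<mu> \<longrightarrow> good \<epsilon>0 \<mu> c"
proof -
  obtain \<epsilon>0 where \<epsilon>0: "0 < \<epsilon>0" and erg: "\<And>\<nu> c. \<nu> \<in> ergodic_measures T \<Longrightarrow> ereal (c + \<eta>) \<le> metric_entropy T \<nu> \<Longrightarrow> good \<epsilon>0 \<nu> c"
    using good_ergodic[OF sep \<eta>] by metis
  show thesis
  proof (rule that[OF \<epsilon>0], intro allI impI)
    fix \<mu> c assume \<mu>: "\<mu> \<in> invariant_measures T" and c: "ereal (c + \<eta>) < metric_entropy T \<mu>"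
    note pr = invariantD(1)[OF \<mu>]
    show "good \<epsilon>0 \<mu> c"
    proof (rule usc_entropy[OF \<mu> c])
    fix F :: "'a measure \<Rightarrow> real" and B assume
      F1: "\<And>\<nu>. \<nu> \<in> invariant_measures T \<Longrightarrow> ereal (F \<nu>) \<le> metric_entropy T \<nu>" and F2: "c + \<eta> < F \<mu>" and
      F3: "\<And>\<nu>. \<nu> \<in> invariant_measures T \<Longrightarrow> 0 \<le> F \<nu> \<and> F \<nu> \<le> B" and
      F4: "\<And>M \<nu> \<delta>. (\<And>i. M i \<in> invariant_measures T) \<Longrightarrow> \<nu> \<in> invariant_measures T \<Longrightarrow> weak_conv M \<nu> \<Longrightarrow> 0 < \<delta>
       \<Longrightarrow> \<forall>\<^sub>F i in sequentially. F (M i) < F \<nu> + \<delta>" and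
      F5: "\<And>s \<mu> \<nu>. \<mu> \<in> invariant_measures T \<Longrightarrow> \<nu> \<in> invariant_measures T \<Longrightarrow> 0 \<le> s \<Longrightarrow> s \<le> 1
       \<Longrightarrow> F (mix s \<mu> \<nu>) \<le> s * F \<mu> + (1 - s) * F \<nu>"
    have B0: "0 \<le> B" using F3[OF \<mu>] by linarith
    show "good \<epsilon>0 \<mu> c"
    proof (rule good_closed[OF pr])
      fix c' and H :: "('a \<Rightarrow> real) set" and \<theta> :: real
      assume c': "c' < c" and H: "finite H" "\<And>h. h \<in> H \<Longrightarrow> continuous_on UNIV h" and \<theta>: "0 < \<theta>"
      show "\<exists>\<rho> c''. good \<epsilon>0 \<rho> c'' \<and> c' < c'' \<and> (\<forall>h\<in>H. \<bar>(\<integral>x. h x \<partial>\<rho>) - (\<integral>x. h x \<partial>\<mu>)\<bar> < \<theta>)"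
      proof (rule ccontr)
        assume no: "\<not> ?thesis"
        define E where "E = {p. fst p \<in> invariant_measures T \<and> good \<epsilon>0 (fst p) (snd p)}"
        define I where "I h \<nu> = (\<integral>x. h x \<partial>\<nu>)" for h :: "'a \<Rightarrow> real" and \<nu>
        \<comment> \<open>Squared Euclidean distance from the pair to \<open>(\<mu>, c)\<close> in
          the finitely many coordinates given by \<open>H\<close> and the rate. If no good pair
          approximates the target, it is at least \<open>m\<close> on \<open>E\<close>.\<close>
        define D where "D p = (\<Sum>h\<in>H. (I h \<mu> - I h (fst p))\<^sup>2) + (c - snd p)\<^sup>2" for p
        define m where "m = (min \<theta> (c - c'))\<^sup>2"
        have m: "0 < m" using \<theta> c' by (simp add: m_def)
        have Dm: "m \<le> D p" if p: "p \<in> E" for p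
        proof (rule ccontr)
          assume "\<not> m \<le> D p"
          then have lt: "D p < m" by simp
          have small: "\<bar>x\<bar> < min \<theta> (c - c')" if "x\<^sup>2 \<le> D p" for x
          proof -
            have "x\<^sup>2 < (min \<theta> (c - c'))\<^sup>2" using that lt by (simp add: m_def)
            then show ?thesis using \<theta> c' by (intro power2_less_imp_less[of "\<bar>x\<bar>"]) auto
          qed
          have nn: "0 \<le> (\<Sum>h\<in>H. (I h \<mu> - I h (fst p))\<^sup>2)" by (rule sum_nonneg) simp
          have "\<bar>c - snd p\<bar> < min \<theta> (c - c')" by (rule small) (use nn in \<open>simp add: D_def\<close>)
          then have "c' < snd p" by linarith
          moreover have "\<bar>I h (fst p) - I h \<mu>\<bar> < \<theta>" if h: "h \<in> H" for h
          proof -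
            have "(I h \<mu> - I h (fst p))\<^sup>2 \<le> (\<Sum>h\<in>H. (I h \<mu> - I h (fst p))\<^sup>2)"
              using h H(1) by (intro member_le_sum) auto
            then have "\<bar>I h \<mu> - I h (fst p)\<bar> < min \<theta> (c - c')" by (intro small) (simp add: D_def add_increasing2)
            then show ?thesis by (simp add: abs_minus_commute)
          qed
          ultimately show False using no p by (auto simp: E_def I_def)
        qed
        have zero: "continuous_on UNIV (\<lambda>x::'a. 0::real)" by simp
        have maximizer: "\<exists>\<nu>\<in>ergodic_measures T. \<forall>\<mu>\<in>invariant_measures T. (\<integral>x. \<psi> x \<partial>\<mu>) + b * F \<mu> \<le> (\<integral>x. \<psi> x \<partial>\<nu>) + b * F \<nu> + \<kappa>"
          if "continuous_on UNIV \<psi>" "0 \<le> b" "0 < \<kappa>" for \<psi> :: "'a \<Rightarrow> real" and b \<kappa>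
        proof (rule ergodic_maximizer[OF \<mu> that])
          show "0 \<le> F \<nu> \<and> F \<nu> \<le> B" if "\<nu> \<in> invariant_measures T" for \<nu> using that by (rule F3)
          show "\<forall>\<^sub>F i in sequentially. F (M i) < F \<nu> + \<delta>" if "\<And>i. M i \<in> invariant_measures T" "\<nu> \<in> invariant_measures T"
            "weak_conv M \<nu>" "0 < \<delta>" for M \<nu> \<delta> using that by (rule F4)
          show "F (mix s \<mu> \<nu>) \<le> s * F \<mu> + (1 - s) * F \<nu>" if "\<mu> \<in> invariant_measures T" "\<nu> \<in> invariant_measures T" "0 \<le> s" "s \<le> 1"
            for s \<mu> \<nu> using that by (rule F5)
        qed (rule bexI)
        obtain \<nu>0 where \<nu>0: "\<nu>0 \<in> ergodic_measures T"
          using maximizer[OF zero order_refl zero_less_one] by (elim bexE) (rule that)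
        have erg_inv: "\<nu> \<in> invariant_measures T" if "\<nu> \<in> ergodic_measures T" for \<nu>
          using that by (simp add: ergodic_measures_def)
        have ergE: "(\<nu>, F \<nu> - \<eta>) \<in> E" if "\<nu> \<in> ergodic_measures T" for \<nu>
          using erg[OF that, of "F \<nu> - \<eta>"] F1[OF erg_inv[OF that]] erg_inv[OF that] by (simp add: E_def)
        \<comment> \<open>The infimum need not be attained, so the argument of the nearest point is
          carried out at a near-minimizer, with explicit slack.\<close>
        define J where "J = Inf (D ` E)"
        have bdd: "bdd_below (D ` E)" by (rule bdd_belowI2[of _ m]) (rule Dm)
        have ne: "D ` E \<noteq> {}" using ergE[OF \<nu>0] by blast
        have JD: "J \<le> D p" if "p \<in> E" for p unfolding J_def by (rule cInf_lower[OF imageI[OF that] bdd])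
        have Jm: "m \<le> J" unfolding J_def by (rule cInf_greatest[OF ne]) (use Dm in auto)
        obtain C where C: "0 < C" "\<And>h x. h \<in> H \<Longrightarrow> \<bar>h x\<bar> \<le> C" using finite_family_bounded[OF H] by metis
        have IC: "\<bar>I h \<nu>\<bar> \<le> C" if "h \<in> H" "\<nu> \<in> invariant_measures T" for h \<nu>
          unfolding I_def using integral_abs_le[OF invariantD(1)[OF that(2)] H(2)[OF that(1)] C(2)[OF that(1)]] .
        \<comment> \<open>A uniform bound for the squared displacement from a near-minimizer to an
          ergodic pair. It allows the step size \<open>t\<close> and the accuracy \<open>k\<close>
          to be fixed before the near-minimizer is chosen.\<close>
        define Q where "Q = real (card H) * (2 * C)\<^sup>2 + (B + \<eta> + \<bar>c\<bar> + J + 2)\<^sup>2"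
        have "2 \<le> B + \<eta> + \<bar>c\<bar> + J + 2" using B0 \<eta> Jm m by simp
        then have "0 < (B + \<eta> + \<bar>c\<bar> + J + 2)\<^sup>2" by (intro zero_less_power) simp
        then have Q: "0 < Q" unfolding Q_def by (intro add_nonneg_pos) auto
        define t where "t = min (1/2) (m / (2 * Q))"
        have t: "0 < t" "t < 1" "t * Q \<le> m / 2"
        proof -
          show "0 < t" using m Q by (simp add: t_def)
          show "t < 1" by (simp add: t_def)
          have "t \<le> m / (2 * Q)" by (simp add: t_def)
          then have "t * Q \<le> m / (2 * Q) * Q" using Q by (intro mult_right_mono) auto
          then show "t * Q \<le> m / 2" using Q by simp
        qed
        define k where "k = min 1 (t * m / 2)"
        have k: "0 < k" "k \<le> 1" "k \<le> t * m / 2" using t m by (auto simp: k_def)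
        have "\<exists>p\<in>E. D p < J + k"
        proof -
          have "J < J + k" using k by simp
          then have "\<exists>x\<in>D ` E. x < J + k" unfolding J_def by (rule cInf_lessD[OF ne])
          then show ?thesis by blast
        qed
        then obtain p where p: "p \<in> E" "D p < J + k" by blast
        \<comment> \<open>Lowering the rate to at most \<open>c\<close> keeps the pair good and does
          not increase the distance. It makes \<open>b\<close> nonnegative, as the maximization
          requires.\<close>
        define z where "z = fst p" define cz where "cz = min c (snd p)"
        have z: "z \<in> invariant_measures T" "good \<epsilon>0 z cz"
          using p(1) good_mono[of \<epsilon>0 "fst p" "snd p" cz] by (auto simp: E_def z_def cz_def)
        have zE: "(z, cz) \<in> E" using z by (simp add: E_def)
        have Dz: "D (z, cz) < J + k"
        proof -
          have "(c - cz)\<^sup>2 \<le> (c - snd p)\<^sup>2" by (cases "snd p \<le> c") (auto simp: cz_def min_def)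
          then have "D (z, cz) \<le> D p" by (simp add: D_def z_def)
          then show ?thesis using p(2) by simp
        qed
        define a where "a h = I h \<mu> - I h z" for h
        define b where "b = c - cz"
        have b: "0 \<le> b" by (simp add: b_def cz_def)
        have DD: "D (z, cz) = (\<Sum>h\<in>H. (a h)\<^sup>2) + b\<^sup>2" by (simp add: D_def a_def b_def)
        have bJ: "b \<le> J + 2"
        proof -
          have "b\<^sup>2 \<le> D (z, cz)" unfolding DD by (simp add: sum_nonneg)
          then have "b\<^sup>2 \<le> J + 1" using Dz k by simp
          moreover have "0 \<le> (b - 1)\<^sup>2" by simp
          then have "2 * b \<le> 1 + b\<^sup>2" by (simp add: power2_diff)
          then have "b \<le> 1 + b\<^sup>2" using b by linarith
          ultimately show ?thesis by simp
        qed
        \<comment> \<open>Together with \<open>b\<close> these coefficients form the linear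
          functional in the direction from the near-minimizer to the target.\<close>
        define \<psi> where "\<psi> x = (\<Sum>h\<in>H. a h * h x)" for x
        have \<psi>c: "continuous_on UNIV \<psi>" unfolding \<psi>_def[abs_def] by (intro continuous_intros H(2))
        have \<psi>I: "(\<integral>x. \<psi> x \<partial>\<nu>) = (\<Sum>h\<in>H. a h * I h \<nu>)" if "\<nu> \<in> invariant_measures T" for \<nu>
          unfolding \<psi>_def I_def using continuous_integrable[OF invariantD(1)[OF that] H(2)]
          by (subst Bochner_Integration.integral_sum) auto
        have m2: "0 < m / 2" using m by simp
        obtain \<nu> where \<nu>: "\<nu> \<in> ergodic_measures T"
          "\<forall>\<mu>\<in>invariant_measures T. (\<integral>x. \<psi> x \<partial>\<mu>) + b * F \<mu> \<le> (\<integral>x. \<psi> x \<partial>\<nu>) + b * F \<nu> + m / 2"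
          using maximizer[OF \<psi>c b m2] by (elim bexE) (rule that)
        note \<nu>i = erg_inv[OF \<nu>(1)]
        \<comment> \<open>The ergodic maximizer is good with this rate. Because
          \<open>c + \<eta> < F \<mu>\<close>, it reaches as far in the chosen direction as the
          target does, up to \<open>m / 2\<close>.\<close>
        define cw where "cw = F \<nu> - \<eta>"
        define \<Delta> where "\<Delta> h = I h \<nu> - I h z" for h
        define \<Gamma> where "\<Gamma> = cw - cz"
        have "(\<Sum>h\<in>H. a h * I h \<mu>) + b * F \<mu> \<le> (\<Sum>h\<in>H. a h * I h \<nu>) + b * F \<nu> + m / 2"
          using \<nu>(2)[rule_format, OF \<mu>] unfolding \<psi>I[OF \<mu>] \<psi>I[OF \<nu>i] .
        moreover have "b * (c + \<eta>) \<le> b * F \<mu>" using F2 b by (intro mult_left_mono) auto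
        ultimately have 1: "(\<Sum>h\<in>H. a h * I h \<mu>) + b * c \<le> (\<Sum>h\<in>H. a h * I h \<nu>) + b * cw + m / 2"
          by (simp add: cw_def algebra_simps)
        have 2: "(\<Sum>h\<in>H. (a h)\<^sup>2) = (\<Sum>h\<in>H. a h * I h \<mu>) - (\<Sum>h\<in>H. a h * I h z)"
          by (simp add: sum_subtractf[symmetric] a_def power2_eq_square algebra_simps)
        have 3: "(\<Sum>h\<in>H. a h * \<Delta> h) = (\<Sum>h\<in>H. a h * I h \<nu>) - (\<Sum>h\<in>H. a h * I h z)"
          by (simp add: sum_subtractf[symmetric] \<Delta>_def right_diff_distrib)
        have 4: "D (z, cz) \<le> (\<Sum>h\<in>H. a h * \<Delta> h) + b * \<Gamma> + m / 2"
          using 1 unfolding DD 2 3 by (simp add: b_def \<Gamma>_def power2_eq_square algebra_simps)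
        \<comment> \<open>A step of size \<open>t\<close> towards the ergodic pair stays in
          \<open>E\<close> by convexity and changes \<open>D\<close> by at most
          \<open>- t * m + t\<^sup>2 * Q\<close>. By the choice of \<open>t\<close> and
          \<open>k\<close> this leads below the infimum \<open>J\<close>.\<close>
        have mixE: "(mix t \<nu> z, t * cw + (1 - t) * cz) \<in> E"
          using ergE[OF \<nu>(1)] zE t good_mix[of \<epsilon>0 \<nu> cw z cz t] \<epsilon>0 mix_invariant[of \<nu> z t] invariantD(1)[OF \<nu>i] invariantD(1)[OF z(1)]
          by (auto simp: E_def cw_def)
        have Imix: "I h (mix t \<nu> z) = I h z + t * \<Delta> h" if "h \<in> H" for h
          unfolding I_def \<Delta>_def using integral_mix_continuous[OF invariantD(1)[OF \<nu>i] invariantD(1)[OF z(1)] _ _ H(2)[OF that], of t] t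
          by (simp add: algebra_simps)
        have "D (mix t \<nu> z, t * cw + (1 - t) * cz) = (\<Sum>h\<in>H. (a h - t * \<Delta> h)\<^sup>2) + (b - t * \<Gamma>)\<^sup>2"
        proof -
          have "(\<Sum>h\<in>H. (I h \<mu> - I h (mix t \<nu> z))\<^sup>2) = (\<Sum>h\<in>H. (a h - t * \<Delta> h)\<^sup>2)"
            by (rule sum.cong) (simp_all add: Imix a_def algebra_simps)
          moreover have "c - (t * cw + (1 - t) * cz) = b - t * \<Gamma>" by (simp add: b_def \<Gamma>_def algebra_simps)
          ultimately show ?thesis by (simp add: D_def)
        qed
        also have "\<dots> = D (z, cz) - 2 * t * ((\<Sum>h\<in>H. a h * \<Delta> h) + b * \<Gamma>) + t\<^sup>2 * ((\<Sum>h\<in>H. (\<Delta> h)\<^sup>2) + \<Gamma>\<^sup>2)"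
        proof -
          have "(\<Sum>h\<in>H. (a h - t * \<Delta> h)\<^sup>2) = (\<Sum>h\<in>H. (a h)\<^sup>2 - 2 * t * (a h * \<Delta> h) + t\<^sup>2 * (\<Delta> h)\<^sup>2)"
            by (rule sum.cong) (simp_all add: power2_eq_square algebra_simps)
          then show ?thesis unfolding DD
            by (simp add: sum.distrib sum_subtractf sum_distrib_left[symmetric]) (simp add: power2_eq_square algebra_simps)
        qed
        also have "\<dots> \<le> D (z, cz) - 2 * t * (m / 2) + t\<^sup>2 * Q"
        proof -
          have "m / 2 \<le> (\<Sum>h\<in>H. a h * \<Delta> h) + b * \<Gamma>" using 4 Dm[OF zE] by simp
          then have "2 * t * (m / 2) \<le> 2 * t * ((\<Sum>h\<in>H. a h * \<Delta> h) + b * \<Gamma>)" using t by (intro mult_left_mono) auto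
          moreover have "t\<^sup>2 * ((\<Sum>h\<in>H. (\<Delta> h)\<^sup>2) + \<Gamma>\<^sup>2) \<le> t\<^sup>2 * Q"
          proof (rule mult_left_mono)
            have "(\<Sum>h\<in>H. (\<Delta> h)\<^sup>2) \<le> (\<Sum>h\<in>H. (2 * C)\<^sup>2)"
            proof (rule sum_mono)
              fix h assume h: "h \<in> H"
              have "\<bar>\<Delta> h\<bar> \<le> 2 * C" using IC[OF h \<nu>i] IC[OF h z(1)] unfolding \<Delta>_def by linarith
              then show "(\<Delta> h)\<^sup>2 \<le> (2 * C)\<^sup>2" using C(1) by (intro power2_le_iff_abs_le[THEN iffD2]) auto
            qed
            moreover have "\<Gamma>\<^sup>2 \<le> (B + \<eta> + \<bar>c\<bar> + J + 2)\<^sup>2"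
            proof -
              have "\<bar>\<Gamma>\<bar> \<le> B + \<eta> + \<bar>c\<bar> + J + 2"
                using F3[OF \<nu>i] \<eta> b bJ B0 unfolding \<Gamma>_def cw_def b_def by linarith
              then show ?thesis using \<open>2 \<le> B + \<eta> + \<bar>c\<bar> + J + 2\<close> by (intro power2_le_iff_abs_le[THEN iffD2]) auto
            qed
            ultimately show "(\<Sum>h\<in>H. (\<Delta> h)\<^sup>2) + \<Gamma>\<^sup>2 \<le> Q" by (simp add: Q_def)
          qed simp
          ultimately show ?thesis by linarith
        qed
        also have "\<dots> < J + k - t * m + t * (t * Q)" using Dz by (simp add: power2_eq_square)
        also have "\<dots> \<le> J + k - t * m + t * (m / 2)" using t by (intro add_left_mono mult_left_mono) auto
        also have "\<dots> \<le> J" using k(3) by (simp add: algebra_simps)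
        finally show False using JD[OF mixE] by simp
      qed
    qed
    qed
  qed
qed

end

section \<open>Moran sets\<close>

context compact_dynamics
begin

text \<open>Only finitely many sets of controlled times are possible, and for each of them the
  condition is an intersection of closed ones.\<close>

lemma closed_blowup_ball: "closed {z. (T ^^ p) z \<in> blowup_ball d T g n x e}"
proof -
  have "{z. (T ^^ p) z \<in> blowup_ball d T g n x e} =
    (\<Union>L\<in>{L. L \<subseteq> {..<n} \<and> card ({..<n} - L) \<le> g n}. \<Inter>j\<in>L. {z. d ((T ^^ j) x) ((T ^^ j) ((T ^^ p) z)) \<le> e})"
    unfolding blowup_ball_def by blast
  also have "closed \<dots>"
  proof (intro closed_UN closed_INT ballI)
    show "finite {L. L \<subseteq> {..<n} \<and> card ({..<n} - L) \<le> g n}"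
      by (rule finite_subset[of _ "Pow {..<n}"]) auto
    show "closed {z. d ((T ^^ j) x) ((T ^^ j) ((T ^^ p) z)) \<le> e}" for j
      by (intro closed_Collect_le continuous_on_d continuous_on_const
          continuous_on_compose2[OF cont_Tn cont_Tn]) auto
  qed
  finally show ?thesis .
qed


end

context almost_product_system
begin

definition moran_start :: "(nat \<Rightarrow> nat) \<Rightarrow> nat \<Rightarrow> nat" where
  "moran_start N j = (\<Sum>i<j. N i)"

definition moran_level :: "(nat \<Rightarrow> nat) \<Rightarrow> (nat \<Rightarrow> real) \<Rightarrow> (nat \<Rightarrow> 'a set) \<Rightarrow> nat \<Rightarrow> 'a set" where
  "moran_level N e E J = {z. \<forall>j<J. \<exists>x\<in>E j. (T ^^ moran_start N j) z \<in> blowup_ball d T g (N j) x (e j)}"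

definition moran_set :: "(nat \<Rightarrow> nat) \<Rightarrow> (nat \<Rightarrow> real) \<Rightarrow> (nat \<Rightarrow> 'a set) \<Rightarrow> 'a set" where
  "moran_set N e E = (\<Inter>J. moran_level N e E J)"

context
  fixes N :: "nat \<Rightarrow> nat" and e :: "nat \<Rightarrow> real" and E :: "nat \<Rightarrow> 'a set" and \<rho> :: real
  assumes N: "\<And>j. 1 \<le> N j" and E: "\<And>j. finite (E j)" "\<And>j. E j \<noteq> {}"
    and tracers: "\<And>J x. (\<forall>j<J. x j \<in> E j) \<Longrightarrow> \<exists>z. \<forall>j<J. (T ^^ (\<Sum>i<j. N i)) z \<in> blowup_ball d T g (N j) (x j) (e j)"
    and distinct_traces: "\<And>j x y z z'. x \<in> E j \<Longrightarrow> y \<in> E j \<Longrightarrow> x \<noteq> y \<Longrightarrow> z \<in> blowup_ball d T g (N j) x (e j) \<Longrightarrow>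
      z' \<in> blowup_ball d T g (N j) y (e j) \<Longrightarrow> \<exists>i<N j. \<rho> < d ((T ^^ i) z) ((T ^^ i) z')"
begin

lemma moran_start_Suc: "moran_start N (Suc j) = moran_start N j + N j"
  by (simp add: moran_start_def)

lemma strict_mono_moran_start: "strict_mono (moran_start N)"
  using N by (intro strict_mono_Suc_iff[THEN iffD2]) (simp add: moran_start_Suc Suc_le_eq)

lemma moran_level_antimono: "J \<le> J' \<Longrightarrow> moran_level N e E J' \<subseteq> moran_level N e E J"
  unfolding moran_level_def by fastforce

lemma closed_moran_level: "closed (moran_level N e E J)"
proof -
  have "moran_level N e E J = (\<Inter>j\<in>{..<J}. \<Union>x\<in>E j. {z. (T ^^ moran_start N j) z \<in> blowup_ball d T g (N j) x (e j)})"
    unfolding moran_level_def by blast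
  then show ?thesis using E(1) by (auto intro!: closed_INT closed_UN closed_blowup_ball)
qed

text \<open>A ball of length \<open>m\<close> only contains tracers of tuples that agree on the blocks completed before
  time \<open>m\<close>, so it accounts for at most a fraction \<open>1 / (\<Prod>i<q. card (E i))\<close> of all tuples.\<close>

lemma moran_count:
  fixes P :: "'i set" and V :: "'i \<Rightarrow> 'a set" and W :: "'i \<Rightarrow> real" and q :: "'i \<Rightarrow> nat"
  assumes P: "finite P" and cover: "moran_level N e E J \<subseteq> (\<Union>p\<in>P. V p)" and q: "\<And>p. p \<in> P \<Longrightarrow> q p \<le> J"
    and sep: "\<And>p z z' l. p \<in> P \<Longrightarrow> z \<in> V p \<Longrightarrow> z' \<in> V p \<Longrightarrow> l < moran_start N (q p) \<Longrightarrow> d ((T ^^ l) z) ((T ^^ l) z') \<le> \<rho>"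
    and W0: "\<And>p. p \<in> P \<Longrightarrow> 0 \<le> W p"
    and W: "\<And>p z. p \<in> P \<Longrightarrow> z \<in> V p \<Longrightarrow> z \<in> moran_level N e E J \<Longrightarrow> 1 \<le> W p * (\<Prod>i<q p. real (card (E i)))"
  shows "1 \<le> (\<Sum>p\<in>P. W p)"
proof -
  let ?Q = "PiE {..<J} E"
  let ?c = "\<lambda>i. real (card (E i))"
  have c: "0 < ?c i" for i using E by (simp add: card_gt_0_iff)
  have finQ: "finite ?Q" using E by (intro finite_PiE) auto
  have "\<exists>z. \<forall>j<J. (T ^^ moran_start N j) z \<in> blowup_ball d T g (N j) (x j) (e j)" if "x \<in> ?Q" for x
    unfolding moran_start_def by (rule tracers) (use that in auto)
  then obtain \<zeta> where \<zeta>: "\<And>x j. x \<in> ?Q \<Longrightarrow> j < J \<Longrightarrow> (T ^^ moran_start N j) (\<zeta> x) \<in> blowup_ball d T g (N j) (x j) (e j)"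
    by metis
  have \<zeta>G: "\<zeta> x \<in> moran_level N e E J" if x: "x \<in> ?Q" for x
    unfolding moran_level_def using \<zeta>[OF x] PiE_mem[OF x] by auto
  \<comment> \<open>The tuples whose selected tracer lies in \<open>V p\<close>. They agree before
    \<open>q p\<close>, so the remaining coordinates determine them.\<close>
  define F where "F p = {x\<in>?Q. \<zeta> x \<in> V p}" for p
  have Fle: "real (card (F p)) \<le> W p * (\<Prod>i<J. ?c i)" if p: "p \<in> P" for p
  proof (cases "F p = {}")
    case True
    then show ?thesis using W0[OF p] by (simp add: prod_nonneg)
  next
    case False
    then obtain x0 where x0: "x0 \<in> ?Q" "\<zeta> x0 \<in> V p" by (auto simp: F_def)
    have agree: "x i = y i" if x: "x \<in> F p" and y: "y \<in> F p" and i: "i < q p" for x y i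
    proof (rule ccontr)
      assume ne: "x i \<noteq> y i"
      have iJ: "i < J" using i q[OF p] by simp
      have xy: "x \<in> ?Q" "y \<in> ?Q" "\<zeta> x \<in> V p" "\<zeta> y \<in> V p" using x y by (auto simp: F_def)
      have "x i \<in> E i" "y i \<in> E i" using xy iJ by auto
      from distinct_traces[OF this ne \<zeta>[OF xy(1) iJ] \<zeta>[OF xy(2) iJ]] obtain l where
        l: "l < N i" "\<rho> < d ((T ^^ (moran_start N i + l)) (\<zeta> x)) ((T ^^ (moran_start N i + l)) (\<zeta> y))"
        by (auto simp: funpow_add_apply[symmetric] add.commute)
      have "moran_start N (Suc i) \<le> moran_start N (q p)"
        using i by (intro strict_mono_less_eq[OF strict_mono_moran_start, THEN iffD2]) simp
      then have "moran_start N i + l < moran_start N (q p)" using l(1) by (simp add: moran_start_Suc)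
      from sep[OF p xy(3,4) this] l(2) show False by simp
    qed
    have "card (F p) \<le> card (PiE {q p..<J} E)"
    proof (rule card_inj_on_le)
      show "inj_on (\<lambda>x. restrict x {q p..<J}) (F p)"
      proof (rule inj_onI)
        fix x y assume x: "x \<in> F p" and y: "y \<in> F p" and eq: "restrict x {q p..<J} = restrict y {q p..<J}"
        show "x = y"
        proof
          fix i
          consider "i < q p" | "i \<in> {q p..<J}" | "J \<le> i" by fastforce
          then show "x i = y i"
          proof cases
            case 1 then show ?thesis by (rule agree[OF x y])
          next
            case 2 then show ?thesis using fun_cong[OF eq, of i] by simp
          next
            case 3
            then have "i \<notin> {..<J}" by simp
            then show ?thesis using x y by (auto simp: F_def PiE_def extensional_def)
          qed
        qed
      qed
      show "(\<lambda>x. restrict x {q p..<J}) ` F p \<subseteq> PiE {q p..<J} E"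
      proof (rule image_subsetI)
        fix x assume "x \<in> F p"
        then have x: "x \<in> ?Q" by (simp add: F_def)
        have "x i \<in> E i" if "i \<in> {q p..<J}" for i using PiE_mem[OF x, of i] that by simp
        then show "restrict x {q p..<J} \<in> PiE {q p..<J} E" by (simp only: restrict_PiE_iff) blast
      qed
      show "finite (PiE {q p..<J} E)" using E by (intro finite_PiE) auto
    qed
    then have 1: "real (card (F p)) \<le> (\<Prod>i\<in>{q p..<J}. ?c i)" by (simp add: card_PiE flip: of_nat_prod)
    have pos: "0 < (\<Prod>i\<in>{q p..<J}. ?c i)" using c by (intro prod_pos) auto
    have "(\<Prod>i\<in>{q p..<J}. ?c i) \<le> W p * (\<Prod>i<q p. ?c i) * (\<Prod>i\<in>{q p..<J}. ?c i)"
      using W[OF p x0(2) \<zeta>G[OF x0(1)]] pos by simp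
    also have "\<dots> = W p * ((\<Prod>i<q p. ?c i) * (\<Prod>i\<in>{q p..<J}. ?c i))" by simp
    also have "(\<Prod>i<q p. ?c i) * (\<Prod>i\<in>{q p..<J}. ?c i) = (\<Prod>i<J. ?c i)"
      using prod.atLeastLessThan_concat[of 0 "q p" J ?c] q[OF p] by (simp add: atLeast0LessThan)
    finally show ?thesis using 1 by linarith
  qed
  have "?Q \<subseteq> (\<Union>p\<in>P. F p)" using cover \<zeta>G by (fastforce simp: F_def)
  then have "card ?Q \<le> card (\<Union>p\<in>P. F p)"
    using P finQ by (intro card_mono) (auto simp: F_def)
  also have "\<dots> \<le> (\<Sum>p\<in>P. card (F p))" by (rule card_UN_le[OF P])
  finally have "real (card ?Q) \<le> (\<Sum>p\<in>P. real (card (F p)))" by (simp flip: of_nat_sum)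
  also have "\<dots> \<le> (\<Sum>p\<in>P. W p * (\<Prod>i<J. ?c i))" by (rule sum_mono[OF Fle])
  also have "\<dots> = (\<Sum>p\<in>P. W p) * (\<Prod>i<J. ?c i)" by (simp add: sum_distrib_right)
  finally have "1 * (\<Prod>i<J. ?c i) \<le> (\<Sum>p\<in>P. W p) * (\<Prod>i<J. ?c i)"
    by (simp add: card_PiE)
  then show ?thesis using c by (subst (asm) mult_le_cancel_right_pos) (auto intro: prod_pos)
qed

text \<open>Balls of a cover are enlarged to open sets of radius \<open>2 * \<epsilon>\<close>. With
  the complements of the closed levels these cover the compact space, so finitely many enlarged
  balls already cover a single level. Two points of an enlarged ball are within
  \<open>4 * \<epsilon> \<le> \<rho>\<close>, hence \<open>moran_count\<close> applies with the
  pressure weights and shows, for \<open>t < s\<close>, that every cover costs at least 1.\<close>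

lemma moran_pressure:
  fixes \<phi> :: "'a \<Rightarrow> real" and q :: "nat \<Rightarrow> nat"
  assumes \<phi>: "continuous_on UNIV \<phi>" and q: "\<And>m. moran_start N (q m) \<le> m"
    and \<epsilon>: "0 < \<epsilon>" "4 * \<epsilon> \<le> \<rho>" and mod: "\<And>x y. d x y \<le> 2 * \<epsilon> \<Longrightarrow> \<bar>\<phi> x - \<phi> y\<bar> \<le> \<tau>"
    and growth: "\<And>m J z. m0 \<le> m \<Longrightarrow> q m \<le> J \<Longrightarrow> z \<in> moran_level N e E J \<Longrightarrow>
      (s + \<tau>) * real m \<le> birkhoff_sum T m \<phi> z + (\<Sum>i<q m. ln (real (card (E i))))"
  shows "ereal s \<le> pressure_scale d T (moran_set N e E) \<phi> \<epsilon>"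
  unfolding pressure_scale_def
proof (rule Inf_greatest, clarsimp, rule ccontr)
  fix t assume lim0: "pressure_lim d T (moran_set N e E) t \<phi> \<epsilon> = 0" and "\<not> s \<le> t"
  then have ts: "t < s" by simp
  let ?w = "\<lambda>(m, x). exp (- t * real m + (SUP y\<in>bowen_ball d T m x \<epsilon>. birkhoff_sum T m \<phi> y))"
  have "1 \<le> pressure_sum d T (moran_set N e E) t \<phi> m0 \<epsilon>"
    unfolding pressure_sum_def
  proof (rule INF_greatest)
    fix C assume C: "C \<in> ball_covers d T (moran_set N e E) m0 \<epsilon>"
    define V where "V p = {z. \<forall>i<fst p. d ((T ^^ i) (snd p)) ((T ^^ i) z) < 2 * \<epsilon>}" for p :: "nat \<times> 'a"
    have openV: "open (V p)" for p
    proof -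
      have "V p = (\<Inter>i\<in>{..<fst p}. {z. d ((T ^^ i) (snd p)) ((T ^^ i) z) < 2 * \<epsilon>})" by (auto simp: V_def)
      then show ?thesis
        by (auto intro!: open_INT open_Collect_less continuous_on_d continuous_on_const cont_Tn)
    qed
    have sub: "bowen_ball d T m x \<epsilon> \<subseteq> V (m, x)" for m x
      using \<epsilon>(1) by (fastforce simp: bowen_ball_def V_def)
    define F where "F i = (case i of Inl p \<Rightarrow> V p | Inr J \<Rightarrow> - moran_level N e E J)" for i
    have "UNIV \<subseteq> (\<Union>i\<in>Inl ` C \<union> range Inr. F i)"
    proof
      fix z
      show "z \<in> (\<Union>i\<in>Inl ` C \<union> range Inr. F i)"
      proof (cases "z \<in> moran_set N e E")
        case True
        then obtain m x where "(m, x) \<in> C" "z \<in> bowen_ball d T m x \<epsilon>"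
          using C by (auto simp: ball_covers_def)
        then show ?thesis using sub by (auto simp: F_def)
      next
        case False
        then obtain J where "z \<notin> moran_level N e E J" by (auto simp: moran_set_def)
        then show ?thesis by (auto simp: F_def)
      qed
    qed
    moreover have "open (F i)" for i
      using openV closed_moran_level by (auto simp: F_def split: sum.splits)
    ultimately obtain D where D: "D \<subseteq> Inl ` C \<union> range Inr" "finite D" "UNIV \<subseteq> (\<Union>i\<in>D. F i)"
      using compactE_image[OF compact_UNIV, of "Inl ` C \<union> range Inr" F] by metis
    define P where "P = Inl -` D"
    define Js where "Js = Inr -` D"
    have fin: "finite P" "finite Js" unfolding P_def Js_def using D(2) by (auto intro: finite_vimageI)
    have PC: "P \<subseteq> C" using D(1) by (auto simp: P_def)
    \<comment> \<open>A level beyond all levels whose complement was selected and beyond the lengths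
      of all selected balls.\<close>
    define J where "J = (\<Sum>j\<in>Js. j) + (\<Sum>p\<in>P. fst p)"
    have JJs: "j \<le> J" if "j \<in> Js" for j
      using member_le_sum[OF that, of "\<lambda>j. j"] fin by (simp add: J_def)
    have JP: "fst p \<le> J" if "p \<in> P" for p
      using member_le_sum[OF that, of fst] fin by (simp add: J_def)
    have m0: "m0 \<le> fst p" if "p \<in> P" for p using that PC C by (cases p) (auto simp: ball_covers_def)
    have qle: "q m \<le> m" for m
      using q[of m] strict_mono_imp_increasing[OF strict_mono_moran_start, of "q m"] by linarith
    have qJ: "q (fst p) \<le> J" if "p \<in> P" for p using qle[of "fst p"] JP[OF that] by linarith
    have "1 \<le> (\<Sum>p\<in>P. ?w p)"
    proof (rule moran_count[where q = "\<lambda>p. q (fst p)" and V = V and J = J, OF fin(1)])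
      show "moran_level N e E J \<subseteq> (\<Union>p\<in>P. V p)"
      proof
        fix z assume z: "z \<in> moran_level N e E J"
        obtain i where i: "i \<in> D" "z \<in> F i" using D(3) by blast
        show "z \<in> (\<Union>p\<in>P. V p)"
        proof (cases i)
          case (Inl p)
          then show ?thesis using i by (auto simp: F_def P_def)
        next
          case (Inr j)
          then have "j \<le> J" using i JJs by (simp add: Js_def)
          then show ?thesis using moran_level_antimono z i Inr by (auto simp: F_def)
        qed
      qed
      fix p assume p: "p \<in> P"
      show "q (fst p) \<le> J" by (rule qJ[OF p])
      show "0 \<le> ?w p" by (simp add: case_prod_beta)
      show "d ((T ^^ l) z) ((T ^^ l) z') \<le> \<rho>" if z: "z \<in> V p" "z' \<in> V p" and l: "l < moran_start N (q (fst p))" for z z' l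
      proof -
        have l: "l < fst p" using l q[of "fst p"] by simp
        have "d ((T ^^ l) z) ((T ^^ l) z') \<le> d ((T ^^ l) z) ((T ^^ l) (snd p)) + d ((T ^^ l) (snd p)) ((T ^^ l) z')"
          by (rule d_triangle)
        also have "\<dots> < 2 * \<epsilon> + 2 * \<epsilon>"
          using z l d_sym[of "(T ^^ l) z" "(T ^^ l) (snd p)"] by (intro add_strict_mono) (auto simp: V_def)
        finally show ?thesis using \<epsilon> by simp
      qed
      show "1 \<le> ?w p * (\<Prod>i<q (fst p). real (card (E i)))" if z: "z \<in> V p" "z \<in> moran_level N e E J" for z
      proof -
        obtain m x where mx: "p = (m, x)" by (cases p)
        have m: "m0 \<le> m" "q m \<le> J" using m0[OF p] qJ[OF p] by (auto simp: mx)
        have "\<bar>birkhoff_sum T m \<phi> x - birkhoff_sum T m \<phi> z\<bar> \<le> real m * \<tau>"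
          using z(1) by (intro birkhoff_sum_diff_le[OF _ mod]) (auto simp: V_def mx less_imp_le)
        moreover have "birkhoff_sum T m \<phi> x \<le> (SUP y\<in>bowen_ball d T m x \<epsilon>. birkhoff_sum T m \<phi> y)"
        proof (rule cSUP_upper)
          show "x \<in> bowen_ball d T m x \<epsilon>" using \<epsilon> by (simp add: bowen_ball_def)
          obtain B where B: "\<And>x. \<bar>\<phi> x\<bar> \<le> B" using continuous_bounded[OF \<phi>] by blast
          show "bdd_above (birkhoff_sum T m \<phi> ` bowen_ball d T m x \<epsilon>)"
          proof (rule bdd_aboveI2)
            fix y show "birkhoff_sum T m \<phi> y \<le> real m * B"
              using birkhoff_sum_abs_le[of \<phi> B m y] B by (auto simp: abs_le_iff)
          qed
        qed
        moreover have "t * real m \<le> s * real m" using ts by (intro mult_right_mono) auto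
        ultimately have "0 \<le> (- t * real m + (SUP y\<in>bowen_ball d T m x \<epsilon>. birkhoff_sum T m \<phi> y)) + (\<Sum>i<q m. ln (real (card (E i))))"
          using growth[OF m z(2)] by (simp add: algebra_simps)
        then have "1 \<le> exp ((- t * real m + (SUP y\<in>bowen_ball d T m x \<epsilon>. birkhoff_sum T m \<phi> y)) + (\<Sum>i<q m. ln (real (card (E i)))))"
          by (simp only: one_le_exp_iff)
        also have "\<dots> = ?w p * (\<Prod>i<q m. exp (ln (real (card (E i)))))"
          by (simp only: exp_add exp_sum[OF finite_lessThan] mx case_prod_conv)
        also have "(\<Prod>i<q m. exp (ln (real (card (E i))))) = (\<Prod>i<q m. real (card (E i)))"
          using E by (intro prod.cong) (auto simp: card_gt_0_iff)
        finally show ?thesis by (simp add: mx)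
      qed
    qed
    then have "1 \<le> (\<Sum>p\<in>P. ennreal (?w p))"
      by (subst sum_ennreal) (auto simp: case_prod_beta)
    also have "\<dots> = (\<Sum>(m, x)\<in>P. ennreal (exp (- t * real m + (SUP y\<in>bowen_ball d T m x \<epsilon>. birkhoff_sum T m \<phi> y))))"
      by (simp add: case_prod_beta)
    also have "\<dots> \<le> (\<Sum>\<^sub>\<infinity>(m, x)\<in>C. ennreal (exp (- t * real m + (SUP y\<in>bowen_ball d T m x \<epsilon>. birkhoff_sum T m \<phi> y))))"
      using fin PC by (subst nonneg_infsum_complete) (auto intro: SUP_upper)
    finally show "1 \<le> (\<Sum>\<^sub>\<infinity>(m, x)\<in>C. ennreal (exp (- t * real m + (SUP y\<in>bowen_ball d T m x \<epsilon>. birkhoff_sum T m \<phi> y))))" .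
  qed
  also have "\<dots> \<le> pressure_lim d T (moran_set N e E) t \<phi> \<epsilon>" by (rule pressure_sum_le_lim)
  finally show False by (simp add: lim0)
qed

end

end

section \<open>Timetables for blocks and stages\<close>

lemma strict_mono_bracket:
  fixes W :: "nat \<Rightarrow> nat"
  assumes mono: "strict_mono W" and W0: "W 0 = 0"
  obtains q where "\<forall>n. W (q n) \<le> n \<and> n < W (Suc (q n))" "\<forall>n k. W k \<le> n \<longrightarrow> n < W (Suc k) \<longrightarrow> q n = k"
    "\<forall>k. q (W k) = k" "mono q"
proof -
  define q where "q j = (LEAST k. j < W (Suc k))" for j
  have ex: "j < W (Suc j)" for j using strict_mono_imp_increasing[OF mono, of "Suc j"] by simp
  have up: "j < W (Suc (q j))" for j unfolding q_def by (rule LeastI[of _ j, OF ex])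
  have lo: "W (q j) \<le> j" for j
  proof (cases "q j")
    case (Suc k)
    then have "\<not> j < W (Suc k)" unfolding q_def by (intro not_less_Least) simp
    then show ?thesis using Suc by simp
  qed (simp add: W0)
  have unique: "q j = k" if "W k \<le> j" "j < W (Suc k)" for j k
  proof -
    have "W k < W (Suc (q j))" "W (q j) < W (Suc k)" using that up[of j] lo[of j] by linarith+
    then show ?thesis using strict_mono_less[OF mono] by fastforce
  qed
  have "q (W k) = k" for k using strict_mono_less[OF mono, of k "Suc k"] by (intro unique) auto
  moreover have "mono q"
  proof (rule monoI)
    fix i j :: nat assume "i \<le> j"
    then have "W (q i) < W (Suc (q j))" using lo[of i] up[of j] by linarith
    then show "q i \<le> q j" using strict_mono_less[OF mono] by fastforce
  qed
  ultimately show thesis using up lo unique by (intro that[of q]) blast+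
qed

text \<open>Stage \<open>k\<close> repeats blocks of length \<open>b k\<close>, as often as
  \<open>r\<close> prescribes, so that it outweighs by the factor \<open>k + 1\<close> both the
  total time before it and a single block of the next stage. During stage \<open>k + 1\<close> only
  the stages \<open>k\<close> and \<open>k + 1\<close> carry weight, and an incomplete block is
  negligible.\<close>

lemma block_schedule:
  fixes b :: "nat \<Rightarrow> nat"
  assumes b: "\<And>k. 1 \<le> b k"
  obtains \<kappa> W :: "nat \<Rightarrow> nat" where "mono \<kappa>" "strict_mono W" "\<forall>k. \<kappa> (W k) = k"
    "\<forall>k j. \<kappa> j = Suc k \<longrightarrow> W k \<le> j \<and> (k + 1) * (\<Sum>i<W k. b (\<kappa> i)) \<le> (\<Sum>i<j. b (\<kappa> i))
      \<and> (k + 1) * b (Suc k) \<le> (\<Sum>i<j. b (\<kappa> i)) \<and> (\<forall>i. W k \<le> i \<and> i \<le> j \<longrightarrow> \<kappa> i = k \<or> \<kappa> i = Suc k)"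
proof -
  define r where "r k w = (k + 1) * (w + b (Suc k)) + 1" for k w
  \<comment> \<open>The pair records the number of blocks and the elapsed time at the beginning of
    stage \<open>k\<close>.\<close>
  define u where "u = rec_nat (0, 0) (\<lambda>k p. (fst p + r k (snd p), snd p + r k (snd p) * b k))"
  define W where "W k = fst (u k)" for k
  define w where "w k = snd (u k)" for k
  have W0: "W 0 = 0" "w 0 = 0" and WS: "W (Suc k) = W k + r k (w k)" "w (Suc k) = w k + r k (w k) * b k" for k
    by (simp_all add: W_def w_def u_def)
  have mono: "strict_mono W" by (rule strict_mono_Suc_iff[THEN iffD2]) (simp add: WS r_def)
  obtain \<kappa> where q: "\<forall>n. W (\<kappa> n) \<le> n \<and> n < W (Suc (\<kappa> n))" "\<forall>n k. W k \<le> n \<longrightarrow> n < W (Suc k) \<longrightarrow> \<kappa> n = k"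
    "\<forall>k. \<kappa> (W k) = k" and \<kappa>_mono: "mono \<kappa>"
    using strict_mono_bracket[OF mono W0(1)] .
  have up: "j < W (Suc (\<kappa> j))" and lo: "W (\<kappa> j) \<le> j" and \<kappa>W: "\<kappa> (W k) = k"
    and unique: "W k \<le> j \<Longrightarrow> j < W (Suc k) \<Longrightarrow> \<kappa> j = k" for j k
    using q by blast+
  have sumW: "(\<Sum>i<W k. b (\<kappa> i)) = w k" for k
  proof (induction k)
    case (Suc k)
    have "(\<Sum>i<W (Suc k). b (\<kappa> i)) = (\<Sum>i<W k. b (\<kappa> i)) + (\<Sum>i\<in>{W k..<W (Suc k)}. b (\<kappa> i))"
      using sum.atLeastLessThan_concat[of 0 "W k" "W (Suc k)" "\<lambda>i. b (\<kappa> i)"] strict_mono_less_eq[OF mono, of k "Suc k"]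
      by (simp add: atLeast0LessThan)
    also have "(\<Sum>i\<in>{W k..<W (Suc k)}. b (\<kappa> i)) = (\<Sum>i\<in>{W k..<W (Suc k)}. b k)"
      by (rule sum.cong) (auto simp: unique)
    finally show ?case using Suc by (simp add: WS)
  qed (simp add: W0)
  show thesis
  proof (rule that[OF \<kappa>_mono mono], intro allI \<kappa>W, intro allI impI)
    fix k j assume j: "\<kappa> j = Suc k"
    have "w (Suc k) = (\<Sum>i<W (Suc k). b (\<kappa> i))" by (simp add: sumW)
    also have "\<dots> \<le> (\<Sum>i<j. b (\<kappa> i))" using lo[of j] j by (intro sum_mono2) auto
    finally have wj: "w (Suc k) \<le> (\<Sum>i<j. b (\<kappa> i))" .
    have "r k (w k) * 1 \<le> r k (w k) * b k" using b by (intro mult_le_mono) auto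
    then have "(k + 1) * (w k + b (Suc k)) \<le> w (Suc k)" by (simp add: WS r_def)
    then have "(k + 1) * w k + (k + 1) * b (Suc k) \<le> (\<Sum>i<j. b (\<kappa> i))" using wj unfolding distrib_left by linarith
    then have "(k + 1) * (\<Sum>i<W k. b (\<kappa> i)) \<le> (\<Sum>i<j. b (\<kappa> i))" "(k + 1) * b (Suc k) \<le> (\<Sum>i<j. b (\<kappa> i))"
      unfolding sumW by linarith+
    moreover have "W k \<le> j" using lo[of j] j strict_mono_less_eq[OF mono, of k "Suc k"] by simp
    moreover have "\<kappa> i = k \<or> \<kappa> i = Suc k" if "W k \<le> i" "i \<le> j" for i
    proof -
      have "\<kappa> (W k) \<le> \<kappa> i" "\<kappa> i \<le> \<kappa> j" using that \<kappa>_mono by (auto dest: monoD)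
      then show ?thesis unfolding j \<kappa>W by linarith
    qed
    ultimately show "W k \<le> j \<and> (k + 1) * (\<Sum>i<W k. b (\<kappa> i)) \<le> (\<Sum>i<j. b (\<kappa> i))
      \<and> (k + 1) * b (Suc k) \<le> (\<Sum>i<j. b (\<kappa> i)) \<and> (\<forall>i. W k \<le> i \<and> i \<le> j \<longrightarrow> \<kappa> i = k \<or> \<kappa> i = Suc k)" by blast
  qed
qed

section \<open>Moran sets with prescribed statistics\<close>

context almost_product_system
begin

text \<open>One length at which the segments of a good measure can be replaced by arbitrary tracers.
  Precision \<open>\<epsilon>0 / 8\<close> lowers the separation scale by at most
  \<open>\<epsilon>0 / 4\<close>, and the bound \<open>\<delta> / 4\<close> on the share of
  \<open>g\<close> leaves at least one separated time.\<close>

lemma good_block: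
  fixes H :: "('a \<Rightarrow> real) set" and m :: "real \<Rightarrow> nat"
  assumes good: "good \<epsilon>0 \<nu> c" and \<epsilon>0: "0 < \<epsilon>0" and c: "c' < c"
    and H: "finite H" "\<And>h. h \<in> H \<Longrightarrow> continuous_on UNIV h" and \<theta>: "0 < \<theta>"
  obtains b e E where "1 \<le> b" "0 < e" "m e \<le> b" "finite E" "exp (real b * c') \<le> real (card E)"
    "\<forall>x\<in>E. \<forall>z\<in>blowup_ball d T g b x e. \<forall>h\<in>H. \<bar>birkhoff_sum T b h z - real b * (\<integral>x. h x \<partial>\<nu>)\<bar> \<le> 2 * \<theta> * real b"
    "\<forall>x\<in>E. \<forall>y\<in>E. x \<noteq> y \<longrightarrow> (\<forall>z\<in>blowup_ball d T g b x e. \<forall>z'\<in>blowup_ball d T g b y e.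
       \<exists>i<b. \<epsilon>0 / 2 < d ((T ^^ i) z) ((T ^^ i) z'))"
proof -
  obtain \<delta> \<epsilon>1 n0 where E: "0 < \<delta>" "\<epsilon>0 < \<epsilon>1" "\<forall>n\<ge>n0. \<exists>E. finite E \<and> exp (real n * c') \<le> real (card E)
        \<and> separated_set d T \<delta> n \<epsilon>1 E \<and> E \<subseteq> near H \<theta> \<nu> n"
    using goodD[OF good c H \<theta>] .
  obtain \<epsilon>' n1 where tr: "0 < \<epsilon>'" "\<forall>h\<in>H. \<forall>n\<ge>n1. \<forall>x z e. e \<le> \<epsilon>' \<longrightarrow> z \<in> blowup_ball d T g n x e
    \<longrightarrow> \<bar>birkhoff_sum T n h x - birkhoff_sum T n h z\<bar> \<le> \<theta> * real n"
    by (rule trace_birkhoff_finite[OF H(1) _ \<theta>]) (erule H(2), rule that)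
  have "0 < \<delta> / 4" using E(1) by simp
  from blowup_small[OF this] obtain n2 where n2: "\<And>n. n \<ge> n2 \<Longrightarrow> real (g n) \<le> \<delta> / 4 * real n"
    by (auto simp: eventually_sequentially)
  define e where "e = min \<epsilon>' (\<epsilon>0 / 8)"
  define b where "b = n0 + n1 + n2 + m e + 1"
  have b: "n0 \<le> b" "n1 \<le> b" "n2 \<le> b" "m e \<le> b" "1 \<le> b" by (simp_all add: b_def)
  have e: "0 < e" "e \<le> \<epsilon>'" "e \<le> \<epsilon>0 / 8" using tr(1) \<epsilon>0 by (simp_all add: e_def)
  obtain E where E': "finite E" "exp (real b * c') \<le> real (card E)" "separated_set d T \<delta> b \<epsilon>1 E" "E \<subseteq> near H \<theta> \<nu> b"
    using E(3) b(1) by blast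
  show thesis
  proof (rule that[OF b(5) e(1) b(4) E'(1,2)]; intro ballI impI)
    fix x z h assume x: "x \<in> E" and z: "z \<in> blowup_ball d T g b x e" and h: "h \<in> H"
    have bp: "0 < real b" using b(5) by simp
    have "\<bar>birkhoff_sum T b h x / real b - (\<integral>x. h x \<partial>\<nu>)\<bar> < \<theta>" using E'(4) x h by (auto simp: near_def)
    then have "\<bar>birkhoff_sum T b h x / real b - (\<integral>x. h x \<partial>\<nu>)\<bar> * real b < \<theta> * real b" using bp by simp
    also have "\<bar>birkhoff_sum T b h x / real b - (\<integral>x. h x \<partial>\<nu>)\<bar> * real b = \<bar>(birkhoff_sum T b h x / real b - (\<integral>x. h x \<partial>\<nu>)) * real b\<bar>"
      by (simp add: abs_mult)
    also have "(birkhoff_sum T b h x / real b - (\<integral>x. h x \<partial>\<nu>)) * real b = birkhoff_sum T b h x - real b * (\<integral>x. h x \<partial>\<nu>)"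
      using bp by (simp add: field_simps)
    finally have "\<bar>birkhoff_sum T b h x - real b * (\<integral>x. h x \<partial>\<nu>)\<bar> < \<theta> * real b" .
    moreover have "\<bar>birkhoff_sum T b h x - birkhoff_sum T b h z\<bar> \<le> \<theta> * real b"
      using tr(2)[rule_format, OF h b(2) e(2) z] .
    ultimately show "\<bar>birkhoff_sum T b h z - real b * (\<integral>x. h x \<partial>\<nu>)\<bar> \<le> 2 * \<theta> * real b" by simp
  next
    fix x y z z' assume xy: "x \<in> E" "y \<in> E" "x \<noteq> y" and z: "z \<in> blowup_ball d T g b x e" "z' \<in> blowup_ball d T g b y e"
    have "separated_points d T \<delta> b \<epsilon>1 x y" using E'(3) xy by (simp add: separated_set_def)
    from separated_trace[OF this z] have "\<delta> * real b - 2 * real (g b) \<le> real (card {j. j < b \<and> \<epsilon>1 - 2 * e < d ((T ^^ j) z) ((T ^^ j) z')})" .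
    moreover have "0 < \<delta> * real b" using E(1) b(5) by simp
    ultimately have "0 < real (card {j. j < b \<and> \<epsilon>1 - 2 * e < d ((T ^^ j) z) ((T ^^ j) z')})"
      using n2[OF b(3)] by (simp add: field_simps)
    then have "{j. j < b \<and> \<epsilon>1 - 2 * e < d ((T ^^ j) z) ((T ^^ j) z')} \<noteq> {}" by (intro notI) simp
    moreover have "\<epsilon>0 / 2 < \<epsilon>1 - 2 * e" using E(2) e(3) \<epsilon>0 by linarith
    ultimately show "\<exists>i<b. \<epsilon>0 / 2 < d ((T ^^ i) z) ((T ^^ i) z')" by (auto intro: less_trans)
  qed
qed

lemma birkhoff_sum_blocks:
  fixes N :: "nat \<Rightarrow> nat"
  shows "birkhoff_sum T (\<Sum>i<j. N i) h z = (\<Sum>i<j. birkhoff_sum T (N i) h ((T ^^ (\<Sum>l<i. N l)) z))"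
  by (induction j) (simp_all add: birkhoff_sum_add birkhoff_sum_def[of T 0])


text \<open>After rescaling into the unit interval, \<open>h\<close> is uniformly close to some
  \<open>f i\<close>, so it suffices to follow the members of \<open>f\<close>.\<close>

lemma integral_diff_limitI:
  fixes h :: "'a \<Rightarrow> real"
  assumes M: "\<And>n. M n \<in> prob_measures" and M': "\<And>n. M' n \<in> prob_measures"
    and lim: "\<And>i. (\<lambda>n. (\<integral>x. f i x \<partial>M n) - (\<integral>x. f i x \<partial>M' n)) \<longlonglongrightarrow> 0" and h: "continuous_on UNIV h"
  shows "(\<lambda>n. (\<integral>x. h x \<partial>M n) - (\<integral>x. h x \<partial>M' n)) \<longlonglongrightarrow> 0"
proof (rule LIMSEQ_I)
  fix e :: real assume e: "0 < e"
  obtain B where B: "0 < B" "\<And>x. \<bar>h x\<bar> \<le> B" using continuous_bounded[OF h] by blast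
  let ?h = "\<lambda>x. (h x + B) / (2 * B)"
  have "continuous_on UNIV ?h" using B by (intro continuous_intros h) auto
  moreover have "0 \<le> ?h x \<and> ?h x \<le> 1" for x using B(1) B(2)[of x] by (auto simp: field_simps abs_le_iff)
  moreover have "0 < e / (8 * B)" using e B by simp
  ultimately obtain i where i: "\<And>x. \<bar>f i x - ?h x\<bar> < e / (8 * B)" using f_approx by metis
  have near: "\<bar>(\<integral>x. h x \<partial>\<rho>) - (2 * B * (\<integral>x. f i x \<partial>\<rho>) - B)\<bar> \<le> e / 4" if \<rho>: "\<rho> \<in> prob_measures" for \<rho>
  proof -
    interpret prob_space \<rho> by (rule prob_measuresD[OF \<rho>])
    have "(\<integral>x. 2 * B * f i x - B \<partial>\<rho>) = 2 * B * (\<integral>x. f i x \<partial>\<rho>) - B"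
      using continuous_integrable[OF \<rho> f_cont[of i]] by (simp add: prob_space)
    moreover have "\<bar>h x - (2 * B * f i x - B)\<bar> \<le> e / 4" for x
    proof -
      have "h x - (2 * B * f i x - B) = - 2 * B * (f i x - ?h x)" using B(1) by (simp add: field_simps)
      then have "\<bar>h x - (2 * B * f i x - B)\<bar> = 2 * B * \<bar>f i x - ?h x\<bar>" using B(1) by (simp add: abs_mult)
      also have "\<dots> \<le> 2 * B * (e / (8 * B))" using i[of x] B(1) by (intro mult_left_mono) auto
      finally show ?thesis using B(1) by simp
    qed
    ultimately show ?thesis
      using integral_diff_le[OF \<rho> h, of "\<lambda>x. 2 * B * f i x - B" "e / 4"]
      by (simp add: continuous_intros f_cont)
  qed
  have "0 < e / (8 * B)" using e B by simp
  from LIMSEQ_D[OF lim this] obtain n0 where n0: "\<And>n. n \<ge> n0 \<Longrightarrow> \<bar>(\<integral>x. f i x \<partial>M n) - (\<integral>x. f i x \<partial>M' n)\<bar> < e / (8 * B)"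
    by (metis diff_zero real_norm_def)
  have "\<bar>(\<integral>x. h x \<partial>M n) - (\<integral>x. h x \<partial>M' n)\<bar> < e" if n: "n \<ge> n0" for n
  proof -
    have "2 * B * \<bar>(\<integral>x. f i x \<partial>M n) - (\<integral>x. f i x \<partial>M' n)\<bar> \<le> 2 * B * (e / (8 * B))"
      using n0[OF n] B(1) by (intro mult_left_mono) auto
    then have "\<bar>2 * B * ((\<integral>x. f i x \<partial>M n) - (\<integral>x. f i x \<partial>M' n))\<bar> \<le> e / 4" using B(1) by (simp add: abs_mult)
    then show ?thesis using near[OF M[of n]] near[OF M'[of n]] e unfolding right_diff_distrib by linarith
  qed
  note bound = this
  show "\<exists>n0. \<forall>n\<ge>n0. norm ((\<integral>x. h x \<partial>M n) - (\<integral>x. h x \<partial>M' n) - 0) < e"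
  proof (rule exI[of _ n0], intro allI impI)
    fix n assume "n0 \<le> n"
    from bound[OF this] show "norm ((\<integral>x. h x \<partial>M n) - (\<integral>x. h x \<partial>M' n) - 0) < e" by simp
  qed
qed


text \<open>A point of the Moran set follows \<open>\<nu> k\<close> during a stage that is long compared with all earlier
  stages and with the blocks of the next one.\<close>

lemma moran_construction:
  fixes \<phi> :: "'a \<Rightarrow> real" and \<nu> :: "nat \<Rightarrow> 'a measure"
  assumes \<epsilon>0: "0 < \<epsilon>0" and \<nu>: "\<And>k. \<nu> k \<in> prob_measures" and good: "\<And>k. good \<epsilon>0 (\<nu> k) (c k)"
    and \<phi>: "continuous_on UNIV \<phi>" and \<eta>: "0 < \<eta>" and gap: "\<And>k. s + \<eta> \<le> c k + (\<integral>x. \<phi> x \<partial>\<nu> k)"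
    and slow: "\<And>h :: 'a \<Rightarrow> real. continuous_on UNIV h \<Longrightarrow> (\<lambda>k. (\<integral>x. h x \<partial>\<nu> (Suc k)) - (\<integral>x. h x \<partial>\<nu> k)) \<longlonglongrightarrow> 0"
  obtains Z \<sigma> r where "strict_mono (r :: nat \<Rightarrow> nat)" "\<forall>k. \<sigma> (r k) = Suc k" "filterlim \<sigma> at_top sequentially"
    "\<forall>z\<in>Z. \<forall>h :: 'a \<Rightarrow> real. continuous_on UNIV h \<longrightarrow>
       (\<lambda>n. (\<integral>x. h x \<partial>empirical T (Suc n) z) - (\<integral>x. h x \<partial>\<nu> (\<sigma> n))) \<longlonglongrightarrow> 0"
    "\<forall>\<^sub>F \<epsilon> in at_right 0. ereal s \<le> pressure_scale d T Z \<phi> \<epsilon>"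
proof -
  obtain m :: "real \<Rightarrow> nat" where m: "\<forall>k (x :: nat \<Rightarrow> 'a) \<epsilon> n. k \<ge> 1 \<longrightarrow> (\<forall>j<k. 0 < \<epsilon> j \<and> 1 \<le> n j \<and> m (\<epsilon> j) \<le> n j) \<longrightarrow>
    (\<exists>z. \<forall>j<k. (T ^^ (\<Sum>i<j. n i)) z \<in> blowup_ball d T g (n j) (x j) (\<epsilon> j))"
    using trace_exists .
  define I where "I h k = (\<integral>x. h x \<partial>\<nu> k)" for h :: "'a \<Rightarrow> real" and k
  \<comment> \<open>Blocks of type \<open>k\<close> test \<phi> and the first \<open>k\<close>
    members of \<open>f\<close> with tolerance \<theta> k. Every \<open>f i\<close> is tested
    eventually and ever more precisely, while the error in \<phi> stays below
    \<open>\<eta> / 8\<close> throughout.\<close>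
  define H where "H k = insert \<phi> ((\<lambda>i. apply_bcontfun (f i)) ` {..<k})" for k :: nat
  define \<theta> where "\<theta> k = min (1 / real (Suc k)) (\<eta> / 16)" for k
  have H: "finite (H k)" "h \<in> H k \<Longrightarrow> continuous_on UNIV h" for h k
    using \<phi> f_cont by (auto simp: H_def)
  have \<theta>: "0 < \<theta> k" for k using \<eta> by (simp add: \<theta>_def)
  define block where "block k b e E \<longleftrightarrow> 1 \<le> b \<and> 0 < e \<and> m e \<le> b \<and> finite E \<and> exp (real b * (c k - \<eta> / 8)) \<le> real (card E) \<and>
    (\<forall>x\<in>E. \<forall>z\<in>blowup_ball d T g b x e. \<forall>h\<in>H k. \<bar>birkhoff_sum T b h z - real b * I h k\<bar> \<le> 2 * \<theta> k * real b) \<and>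
    (\<forall>x\<in>E. \<forall>y\<in>E. x \<noteq> y \<longrightarrow> (\<forall>z\<in>blowup_ball d T g b x e. \<forall>z'\<in>blowup_ball d T g b y e.
       \<exists>i<b. \<epsilon>0 / 2 < d ((T ^^ i) z) ((T ^^ i) z')))" for k b e E
  have "\<exists>b e E. block k b e E" for k
  proof -
    have "c k - \<eta> / 8 < c k" using \<eta> by simp
    show ?thesis
      by (rule good_block[OF good[of k] \<epsilon>0 \<open>c k - \<eta> / 8 < c k\<close> H(1)[of k] _ \<theta>[of k], where m = m], erule H(2))
        (unfold block_def I_def, rule exI, rule exI, rule exI, intro conjI; assumption)
  qed
  then obtain b e E where bl: "\<And>k. block k (b k) (e k) (E k)" by metis
  have b: "1 \<le> b k" for k using bl[of k] by (simp add: block_def)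
  have Ecard: "exp (real (b k) * (c k - \<eta> / 8)) \<le> real (card (E k))" "finite (E k)" for k using bl[of k] by (simp_all add: block_def)
  have E: "finite (E k)" "E k \<noteq> {}" "0 < real (card (E k))" for k
    using Ecard[of k] exp_gt_zero[of "real (b k) * (c k - \<eta> / 8)"] by (auto simp: card_gt_0_iff simp del: exp_gt_zero)
  obtain \<kappa> W :: "nat \<Rightarrow> nat" where \<kappa>: "mono \<kappa>" and W: "strict_mono W" and \<kappa>W: "\<forall>k. \<kappa> (W k) = k"
    and sch: "\<forall>k j. \<kappa> j = Suc k \<longrightarrow> W k \<le> j \<and> (k + 1) * (\<Sum>i<W k. b (\<kappa> i)) \<le> (\<Sum>i<j. b (\<kappa> i))
      \<and> (k + 1) * b (Suc k) \<le> (\<Sum>i<j. b (\<kappa> i)) \<and> (\<forall>i. W k \<le> i \<and> i \<le> j \<longrightarrow> \<kappa> i = k \<or> \<kappa> i = Suc k)"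
    using block_schedule[of b, OF b] .
  define N where "N j = b (\<kappa> j)" for j
  define M where "M j = (\<Sum>i<j. N i)" for j
  have M0: "M 0 = 0" and MS: "M (Suc j) = M j + N j" for j by (simp_all add: M_def)
  have Mmono: "strict_mono M" by (rule strict_mono_Suc_iff[THEN iffD2]) (use b in \<open>simp add: MS N_def Suc_le_eq\<close>)
  obtain q where q: "\<forall>n. M (q n) \<le> n \<and> n < M (Suc (q n))" and qM: "\<forall>k. q (M k) = k" and qmono: "mono q"
    using strict_mono_bracket[OF Mmono M0] .
  have stage: "W k \<le> j" "(k + 1) * M (W k) \<le> M j" "(k + 1) * N j \<le> M j" "W k \<le> i \<Longrightarrow> i \<le> j \<Longrightarrow> \<kappa> i = k \<or> \<kappa> i = Suc k"
    if "\<kappa> j = Suc k" for i j k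
    using sch[rule_format, OF that] that by (auto simp: M_def N_def)
  \<comment> \<open>The stage reached at time \<open>n\<close>, when \<open>q n\<close> blocks are
    complete.\<close>
  define \<sigma>0 where "\<sigma>0 n = \<kappa> (q n)" for n
  have \<sigma>0_mono: "\<sigma>0 n \<le> \<sigma>0 n'" if "n \<le> n'" for n n' unfolding \<sigma>0_def by (intro monoD[OF \<kappa>] monoD[OF qmono] that)
  have \<sigma>0M: "\<sigma>0 (M (W k)) = k" for k using qM \<kappa>W by (simp add: \<sigma>0_def)
  have \<sigma>0_large: "K \<le> \<sigma>0 n" if "M (W K) \<le> n" for K n using \<sigma>0_mono[OF that] by (simp add: \<sigma>0M)
  define G where "G = moran_level N (\<lambda>j. e (\<kappa> j)) (\<lambda>j. E (\<kappa> j))"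
  define Z where "Z = moran_set N (\<lambda>j. e (\<kappa> j)) (\<lambda>j. E (\<kappa> j))"
  have tr: "\<bar>birkhoff_sum T (N i) h ((T ^^ M i) z) - real (N i) * I h (\<kappa> i)\<bar> \<le> 2 * \<theta> (\<kappa> i) * real (N i)"
    if z: "z \<in> G J" "i < J" and h: "h \<in> H (\<kappa> i)" for z J i h
  proof -
    obtain x where x: "x \<in> E (\<kappa> i)" "(T ^^ M i) z \<in> blowup_ball d T g (b (\<kappa> i)) x (e (\<kappa> i))"
      using z by (auto simp: G_def moran_level_def moran_start_def M_def N_def)
    then show ?thesis using bl[of "\<kappa> i"] h by (auto simp: block_def N_def)
  qed
  have rest: "n - M (q n) \<le> N (q n)" for n using q[rule_format, of n] unfolding MS by linarith
  have split_n: "birkhoff_sum T n h z = (\<Sum>i<q n. birkhoff_sum T (N i) h ((T ^^ M i) z)) + birkhoff_sum T (n - M (q n)) h ((T ^^ M (q n)) z)"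
    for n z and h :: "'a \<Rightarrow> real"
    using birkhoff_sum_add[of "M (q n)" "n - M (q n)" h z] birkhoff_sum_blocks[of N "q n" h z] q[rule_format, of n]
    by (simp add: M_def)
  have rN: "real (M j) = (\<Sum>i<j. real (N i))" for j by (simp add: M_def)
  have press: "\<forall>\<^sub>F \<epsilon> in at_right 0. ereal s \<le> pressure_scale d T Z \<phi> \<epsilon>"
  proof -
    obtain B where B: "0 < B" "\<And>x. \<bar>\<phi> x\<bar> \<le> B" using continuous_bounded[OF \<phi>] by blast
    \<comment> \<open>From stage \<open>K + 1\<close> on, the incomplete block takes at most the
      share \<open>1 / K\<close> of the elapsed time, and discarding it costs at most
      \<open>\<eta> / 4\<close> per step.\<close>
    obtain K :: nat where K: "4 * (\<bar>s\<bar> + \<eta> + B) / \<eta> \<le> real K" using real_arch_simple by blast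
    have growth: "(s + \<eta> / 2) * real n \<le> birkhoff_sum T n \<phi> z + (\<Sum>i<q n. ln (real (card (E (\<kappa> i)))))"
      if n: "M (W (Suc K)) \<le> n" and qJ: "q n \<le> J" and z: "z \<in> G J" for n J z
    proof -
      define l where "l = n - M (q n)"
      have nl: "real n = real (M (q n)) + real l" using q[rule_format, of n] by (simp add: l_def)
      obtain k where k: "\<kappa> (q n) = Suc k" "K \<le> k" using \<sigma>0_large[OF n] by (cases "\<kappa> (q n)") (auto simp: \<sigma>0_def)
      have "K * l \<le> (k + 1) * N (q n)" using k(2) rest[of n] by (intro mult_le_mono) (auto simp: l_def)
      also have "\<dots> \<le> n" using stage(3)[OF k(1)] q[rule_format, of n] by linarith
      finally have "real K * real l \<le> real n" by (simp flip: of_nat_mult)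
      moreover have "4 * (\<bar>s\<bar> + \<eta> + B) / \<eta> * real l \<le> real K * real l" using K by (rule mult_right_mono) simp
      ultimately have "4 * (\<bar>s\<bar> + \<eta> + B) / \<eta> * real l \<le> real n" by linarith
      then have small: "(\<bar>s\<bar> + \<eta> + B) * real l \<le> \<eta> / 4 * real n" using \<eta> by (simp add: field_simps)
      \<comment> \<open>Of the surplus \<eta> in \<open>gap\<close> one eighth goes to the Birkhoff
        sum of the tracer and one eighth to the number of segments.\<close>
      have "real (N i) * (s + 3 * \<eta> / 4) \<le> birkhoff_sum T (N i) \<phi> ((T ^^ M i) z) + ln (real (card (E (\<kappa> i))))"
        if i: "i < q n" for i
      proof -
        have iJ: "i < J" using i qJ by simp
        have "\<bar>birkhoff_sum T (N i) \<phi> ((T ^^ M i) z) - real (N i) * I \<phi> (\<kappa> i)\<bar> \<le> 2 * \<theta> (\<kappa> i) * real (N i)"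
          by (rule tr[OF z iJ]) (simp add: H_def)
        moreover have "2 * \<theta> (\<kappa> i) * real (N i) \<le> \<eta> / 8 * real (N i)" by (rule mult_right_mono) (simp_all add: \<theta>_def)
        moreover have "real (N i) * (c (\<kappa> i) - \<eta> / 8) \<le> ln (real (card (E (\<kappa> i))))"
          using Ecard(1)[of "\<kappa> i"] E(3)[of "\<kappa> i"] by (simp add: ln_ge_iff N_def)
        moreover have "real (N i) * (s + \<eta>) \<le> real (N i) * (c (\<kappa> i) + I \<phi> (\<kappa> i))"
          using gap[of "\<kappa> i"] by (intro mult_left_mono) (simp_all add: I_def)
        ultimately show ?thesis by (simp add: algebra_simps)
      qed
      then have "(\<Sum>i<q n. real (N i) * (s + 3 * \<eta> / 4)) \<le> (\<Sum>i<q n. birkhoff_sum T (N i) \<phi> ((T ^^ M i) z) + ln (real (card (E (\<kappa> i)))))"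
        by (intro sum_mono) simp
      then have "real (M (q n)) * (s + 3 * \<eta> / 4) \<le> (\<Sum>i<q n. birkhoff_sum T (N i) \<phi> ((T ^^ M i) z)) + (\<Sum>i<q n. ln (real (card (E (\<kappa> i)))))"
        by (simp add: sum.distrib sum_distrib_right[symmetric] rN)
      moreover have "- (real l * B) \<le> birkhoff_sum T l \<phi> ((T ^^ M (q n)) z)"
        using birkhoff_sum_abs_le[of \<phi> B l "(T ^^ M (q n)) z"] B(2) by (auto simp: abs_le_iff)
      ultimately have "real (M (q n)) * (s + 3 * \<eta> / 4) - real l * B \<le> birkhoff_sum T n \<phi> z + (\<Sum>i<q n. ln (real (card (E (\<kappa> i)))))"
        unfolding split_n[of n] l_def[symmetric] by linarith
      moreover have "(s + 3 * \<eta> / 4) * real l \<le> (\<bar>s\<bar> + \<eta>) * real l" using \<eta> by (intro mult_right_mono) auto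
      ultimately show ?thesis using small unfolding nl by (simp add: algebra_simps)
    qed
    obtain \<delta> where \<delta>: "0 < \<delta>" "\<And>x y. d x y \<le> \<delta> \<Longrightarrow> dist (\<phi> x) (\<phi> y) < \<eta> / 2"
      using d_modulus[OF \<phi>, of "\<eta> / 2"] \<eta> by (metis half_gt_zero)
    have "0 < min (\<delta> / 2) (\<epsilon>0 / 8)" using \<delta> \<epsilon>0 by simp
    from eventually_at_right_real[OF this] show ?thesis
    proof eventually_elim
      case (elim \<epsilon>)
      show ?case unfolding Z_def
      proof (rule moran_pressure[where q = q and \<rho> = "\<epsilon>0 / 2" and \<tau> = "\<eta> / 2" and ?m0.0 = "M (W (Suc K))", OF _ E(1,2) _ _ \<phi>])
        show "1 \<le> N j" for j using b by (simp add: N_def)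
        show "\<exists>z. \<forall>j<J. (T ^^ (\<Sum>i<j. N i)) z \<in> blowup_ball d T g (N j) (x j) (e (\<kappa> j))" for J x
        proof (cases "J = 0")
          case False
          then show ?thesis using bl b by (intro m[rule_format]) (auto simp: block_def N_def)
        qed simp
        show "\<exists>i<N j. \<epsilon>0 / 2 < d ((T ^^ i) z) ((T ^^ i) z')"
          if "x \<in> E (\<kappa> j)" "y \<in> E (\<kappa> j)" "x \<noteq> y" "z \<in> blowup_ball d T g (N j) x (e (\<kappa> j))" "z' \<in> blowup_ball d T g (N j) y (e (\<kappa> j))" for j x y z z'
          using bl[of "\<kappa> j"] that unfolding block_def N_def by blast
        show "moran_start N (q n) \<le> n" for n using q by (simp add: moran_start_def M_def)
        show "0 < \<epsilon>" "4 * \<epsilon> \<le> \<epsilon>0 / 2" using elim by auto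
        show "\<bar>\<phi> x - \<phi> y\<bar> \<le> \<eta> / 2" if "d x y \<le> 2 * \<epsilon>" for x y
          using \<delta>(2)[of x y] that elim by (auto simp: dist_real_def)
        show "(s + \<eta> / 2) * real n \<le> birkhoff_sum T n \<phi> z + (\<Sum>i<q n. ln (real (card (E (\<kappa> i)))))"
          if "M (W (Suc K)) \<le> n" "q n \<le> J" "z \<in> moran_level N (\<lambda>j. e (\<kappa> j)) (\<lambda>j. E (\<kappa> j)) J" for n J z
          using growth that by (simp add: G_def)
      qed
    qed
  qed
  \<comment> \<open>Index \<open>n\<close> of the observed sequence belongs to the empirical measure
    of length \<open>Suc n\<close>. The same shift causes the subtraction of 1 in
    \<open>r\<close>.\<close>
  define \<sigma> where "\<sigma> n = \<sigma>0 (Suc n)" for n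
  have \<sigma>_top: "filterlim \<sigma> at_top sequentially"
    unfolding filterlim_at_top
  proof
    fix K
    have "\<forall>n\<ge>M (W K). K \<le> \<sigma> n" unfolding \<sigma>_def by (intro allI impI \<sigma>0_large) simp
    then show "\<forall>\<^sub>F n in sequentially. K \<le> \<sigma> n" unfolding eventually_sequentially by blast
  qed
  define r where "r k = M (W (Suc k)) - 1" for k
  have pos: "0 < M (W (Suc k))" for k
    using strict_mono_less[OF Mmono, of 0 "W (Suc k)"] strict_mono_less[OF W, of k "Suc k"] by (simp add: M0)
  have r: "strict_mono r"
  proof (rule strict_monoI)
    fix i j :: nat assume "i < j"
    then have "M (W (Suc i)) < M (W (Suc j))" by (simp add: strict_mono_less[OF Mmono] strict_mono_less[OF W])
    then show "r i < r j" using pos[of i] by (simp add: r_def)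
  qed
  have \<sigma>r: "\<forall>k. \<sigma> (r k) = Suc k" using pos by (simp add: \<sigma>_def r_def \<sigma>0M)
  \<comment> \<open>In stage \<open>k + 1\<close> there are three errors of size
    \<open>2 / (k + 1)\<close>: the time before stage \<open>k\<close>, the tolerance of the blocks
    in stages \<open>k\<close> and \<open>k + 1\<close>, and the incomplete block. Measuring blocks
    of stage \<open>k\<close> against the next measure adds the last term. The condition on
    \<open>i\<close> ensures that both stages test \<open>f i\<close>.\<close>
  have track: "\<bar>(\<integral>x. f i x \<partial>empirical T n z) - I (f i) (\<sigma>0 n)\<bar> \<le> 6 / real (\<sigma>0 n) + \<bar>I (f i) (\<sigma>0 n) - I (f i) (\<sigma>0 n - 1)\<bar>"
    if z: "z \<in> Z" and n: "1 \<le> n" and i: "i + 2 \<le> \<sigma>0 n" for z n i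
  proof -
    obtain k where k: "\<kappa> (q n) = Suc k" using i by (cases "\<kappa> (q n)") (auto simp: \<sigma>0_def)
    have ik: "i < k" using i k by (simp add: \<sigma>0_def)
    define a where "a k = I (f i) k" for k
    have a: "\<bar>a k\<bar> \<le> 1" for k unfolding a_def I_def by (rule integral_abs_le[OF \<nu> f_cont f_abs_le])
    define \<tau> where "\<tau> = \<bar>a (Suc k) - a k\<bar>"
    define j where "j = q n"
    define l where "l = n - M j"
    have nl: "real n = real (M j) + real l" "M j \<le> n" using q[rule_format, of n] by (simp_all add: l_def j_def)
    note st = stage[OF k, folded j_def]
    have zG: "z \<in> G j" using z by (simp add: Z_def G_def moran_set_def)
    let ?S = "\<lambda>t. birkhoff_sum T (N t) (f i) ((T ^^ M t) z)"
    have triv: "\<bar>birkhoff_sum T p (f i) x - real p * a (Suc k)\<bar> \<le> 2 * real p" for p x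
    proof -
      have "\<bar>birkhoff_sum T p (f i) x\<bar> \<le> real p" using birkhoff_sum_abs_le[of "f i" 1 p x] f_abs_le by simp
      moreover have "\<bar>real p * a (Suc k)\<bar> \<le> real p" using a[of "Suc k"] by (simp add: abs_mult mult_left_le)
      ultimately show ?thesis by linarith
    qed
    have late: "\<bar>?S t - real (N t) * a (Suc k)\<bar> \<le> real (N t) * (2 / real (Suc k) + \<tau>)" if t: "W k \<le> t" "t < j" for t
    proof -
      have \<kappa>t: "\<kappa> t = k \<or> \<kappa> t = Suc k" using st(4) t by simp
      then have "apply_bcontfun (f i) \<in> H (\<kappa> t)" using ik by (auto simp: H_def)
      from tr[OF zG t(2) this] have "\<bar>?S t - real (N t) * a (\<kappa> t)\<bar> \<le> 2 * \<theta> (\<kappa> t) * real (N t)" by (simp add: a_def)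
      also have "\<dots> \<le> 2 / real (Suc k) * real (N t)"
      proof (rule mult_right_mono)
        have "\<theta> (\<kappa> t) \<le> 1 / real (Suc (\<kappa> t))" by (simp add: \<theta>_def)
        also have "\<dots> \<le> 1 / real (Suc k)" using \<kappa>t by (intro divide_left_mono) auto
        finally show "2 * \<theta> (\<kappa> t) \<le> 2 / real (Suc k)" by simp
      qed simp
      finally have "\<bar>?S t - real (N t) * a (\<kappa> t)\<bar> \<le> real (N t) * (2 / real (Suc k))" by (simp add: mult.commute)
      moreover have "\<bar>real (N t) * a (\<kappa> t) - real (N t) * a (Suc k)\<bar> \<le> real (N t) * \<tau>"
      proof -
        have "\<bar>a (\<kappa> t) - a (Suc k)\<bar> \<le> \<tau>" using \<kappa>t by (auto simp: \<tau>_def)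
        then show ?thesis unfolding right_diff_distrib[symmetric] abs_mult by (simp add: mult_left_mono)
      qed
      ultimately show ?thesis unfolding distrib_left by linarith
    qed
    have "birkhoff_sum T n (f i) z - real n * a (Suc k) =
      (\<Sum>t<j. ?S t - real (N t) * a (Suc k)) + (birkhoff_sum T l (f i) ((T ^^ M j) z) - real l * a (Suc k))"
      unfolding split_n[of n, folded j_def, folded l_def] nl(1) rN
      by (simp add: sum_subtractf sum_distrib_right[symmetric]) (simp add: algebra_simps)
    also have "(\<Sum>t<j. ?S t - real (N t) * a (Suc k)) = (\<Sum>t<W k. ?S t - real (N t) * a (Suc k)) + (\<Sum>t\<in>{W k..<j}. ?S t - real (N t) * a (Suc k))"
      using sum.atLeastLessThan_concat[of 0 "W k" j "\<lambda>t. ?S t - real (N t) * a (Suc k)"] st(1) by (simp add: atLeast0LessThan)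
    finally have eq: "birkhoff_sum T n (f i) z - real n * a (Suc k) = (\<Sum>t<W k. ?S t - real (N t) * a (Suc k)) +
      (\<Sum>t\<in>{W k..<j}. ?S t - real (N t) * a (Suc k)) + (birkhoff_sum T l (f i) ((T ^^ M j) z) - real l * a (Suc k))" .
    have "\<bar>\<Sum>t<W k. ?S t - real (N t) * a (Suc k)\<bar> \<le> (\<Sum>t<W k. 2 * real (N t))"
      by (rule order_trans[OF sum_abs sum_mono]) (rule triv)
    also have "\<dots> = 2 * real (M (W k))" by (simp add: rN sum_distrib_left)
    also have "\<dots> \<le> 2 * real n / real (Suc k)"
    proof -
      have "(k + 1) * M (W k) \<le> n" using st(2) nl(2) by linarith
      then have "real (k + 1) * real (M (W k)) \<le> real n" unfolding of_nat_mult[symmetric] of_nat_le_iff .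
      then show ?thesis by (simp add: field_simps)
    qed
    finally have A1: "\<bar>\<Sum>t<W k. ?S t - real (N t) * a (Suc k)\<bar> \<le> 2 * real n / real (Suc k)" .
    have \<tau>0: "0 \<le> 2 / real (Suc k) + \<tau>" by (simp add: \<tau>_def)
    have "\<bar>\<Sum>t\<in>{W k..<j}. ?S t - real (N t) * a (Suc k)\<bar> \<le> (\<Sum>t\<in>{W k..<j}. real (N t) * (2 / real (Suc k) + \<tau>))"
      by (rule order_trans[OF sum_abs sum_mono]) (use late in simp)
    also have "\<dots> \<le> (\<Sum>t<j. real (N t) * (2 / real (Suc k) + \<tau>))"
      using \<tau>0 by (intro sum_mono2) auto
    also have "\<dots> = real (M j) * (2 / real (Suc k) + \<tau>)" unfolding rN by (rule sum_distrib_right[symmetric])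
    also have "\<dots> \<le> real n * (2 / real (Suc k) + \<tau>)" using nl(2) \<tau>0 by (intro mult_right_mono) auto
    finally have A2: "\<bar>\<Sum>t\<in>{W k..<j}. ?S t - real (N t) * a (Suc k)\<bar> \<le> real n * (2 / real (Suc k) + \<tau>)" .
    have "\<bar>birkhoff_sum T l (f i) ((T ^^ M j) z) - real l * a (Suc k)\<bar> \<le> 2 * real l" by (rule triv)
    also have "\<dots> \<le> 2 * real n / real (Suc k)"
    proof -
      have "(k + 1) * l \<le> (k + 1) * N j" using rest[of n] by (intro mult_le_mono) (auto simp: l_def j_def)
      then have "(k + 1) * l \<le> n" using st(3) nl(2) by linarith
      then have "real (k + 1) * real l \<le> real n" unfolding of_nat_mult[symmetric] of_nat_le_iff .
      then show ?thesis by (simp add: field_simps)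
    qed
    finally have A3: "\<bar>birkhoff_sum T l (f i) ((T ^^ M j) z) - real l * a (Suc k)\<bar> \<le> 2 * real n / real (Suc k)" .
    have "\<bar>birkhoff_sum T n (f i) z - real n * a (Suc k)\<bar> \<le> 2 * real n / real (Suc k) + real n * (2 / real (Suc k) + \<tau>) + 2 * real n / real (Suc k)"
      unfolding eq using A1 A2 A3 by linarith
    also have "2 * x / y + x * (2 / y + t) + 2 * x / y = x * (6 / y + t)" for x y t :: real
      by (simp add: divide_inverse algebra_simps)
    finally have fin: "\<bar>birkhoff_sum T n (f i) z - real n * a (Suc k)\<bar> \<le> real n * (6 / real (Suc k) + \<tau>)" .
    have np: "0 < real n" using n by simp
    have "(\<integral>x. f i x \<partial>empirical T n z) - a (Suc k) = (birkhoff_sum T n (f i) z - real n * a (Suc k)) / real n"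
      using integral_empirical_continuous[OF n f_cont] np by (simp add: diff_divide_distrib)
    then have "\<bar>(\<integral>x. f i x \<partial>empirical T n z) - a (Suc k)\<bar> = \<bar>birkhoff_sum T n (f i) z - real n * a (Suc k)\<bar> / real n"
      by (simp add: abs_divide)
    also have "\<dots> \<le> 6 / real (Suc k) + \<tau>" using fin np by (simp add: pos_divide_le_eq mult.commute)
    finally show ?thesis by (simp add: \<sigma>0_def k a_def \<tau>_def)
  qed
  have conv: "(\<lambda>n. (\<integral>x. h x \<partial>empirical T (Suc n) z) - (\<integral>x. h x \<partial>\<nu> (\<sigma> n))) \<longlonglongrightarrow> 0"
    if z: "z \<in> Z" and h: "continuous_on UNIV h" for z and h :: "'a \<Rightarrow> real"
  proof (rule integral_diff_limitI[OF _ \<nu> _ h])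
    show "empirical T (Suc n) z \<in> prob_measures" for n by (rule empirical_prob)
    fix i
    define R where "R K = 6 / real K + \<bar>I (f i) K - I (f i) (K - 1)\<bar>" for K
    have "(\<lambda>k. 6 / real (Suc k) + \<bar>I (f i) (Suc k) - I (f i) k\<bar>) \<longlonglongrightarrow> 0 + \<bar>0\<bar>"
      using slow[OF f_cont[of i]] unfolding I_def
      by (intro tendsto_add tendsto_rabs) (use LIMSEQ_Suc[OF lim_const_over_n[of "6::real"]] in auto)
    then have "(\<lambda>k. R (Suc k)) \<longlonglongrightarrow> 0" by (simp add: R_def)
    then have "R \<longlonglongrightarrow> 0" by (rule LIMSEQ_imp_Suc)
    then have R: "(\<lambda>n. R (\<sigma> n)) \<longlonglongrightarrow> 0" using \<sigma>_top by (rule filterlim_compose)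
    show "(\<lambda>n. (\<integral>x. f i x \<partial>empirical T (Suc n) z) - (\<integral>x. f i x \<partial>\<nu> (\<sigma> n))) \<longlonglongrightarrow> 0"
    proof (rule tendsto_rabs_zero_cancel, rule tendsto_sandwich[OF _ _ tendsto_const R])
      have "\<forall>\<^sub>F n in sequentially. i + 2 \<le> \<sigma> n" using \<sigma>_top by (simp add: filterlim_at_top)
      then show "\<forall>\<^sub>F n in sequentially. \<bar>(\<integral>x. f i x \<partial>empirical T (Suc n) z) - (\<integral>x. f i x \<partial>\<nu> (\<sigma> n))\<bar> \<le> R (\<sigma> n)"
      proof eventually_elim
        case (elim n)
        then show ?case using track[OF z, of "Suc n" i] by (simp add: \<sigma>_def R_def I_def)
      qed
    qed simp
  qed
  show thesis by (rule that[OF r \<sigma>r \<sigma>_top _ press], intro ballI allI impI, rule conv)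
qed

end

section \<open>Accumulation sets\<close>

lemma accumulation_points_iff:
  fixes s :: "nat \<Rightarrow> 'y::metric_space"
  shows "y \<in> accumulation_points s \<longleftrightarrow> (\<forall>e>0. \<forall>N. \<exists>n\<ge>N. dist (s n) y < e)"
proof
  assume "y \<in> accumulation_points s"
  then obtain r where r: "strict_mono r" "(s \<circ> r) \<longlonglongrightarrow> y" by (auto simp: accumulation_points_def)
  show "\<forall>e>0. \<forall>N. \<exists>n\<ge>N. dist (s n) y < e"
  proof (intro allI impI)
    fix e :: real and N assume "0 < e"
    then obtain n0 where n0: "\<And>n. n \<ge> n0 \<Longrightarrow> dist (s (r n)) y < e"
      using r(2) by (auto simp: lim_sequentially)
    show "\<exists>n\<ge>N. dist (s n) y < e"
      using n0[of "max n0 N"] seq_suble[OF r(1), of "max n0 N"] by (intro exI[of _ "r (max n0 N)"]) auto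
  qed
next
  assume near: "\<forall>e>0. \<forall>N. \<exists>n\<ge>N. dist (s n) y < e"
  have ex: "\<exists>n\<ge>N. dist (s n) y < 1 / real (Suc k)" for k N by (rule near[rule_format]) simp
  define p where "p k N = (SOME n. N \<le> n \<and> dist (s n) y < 1 / real (Suc k))" for k N
  have p: "N \<le> p k N" "dist (s (p k N)) y < 1 / real (Suc k)" for k N
    using someI_ex[OF ex[of N k]] by (auto simp: p_def)
  define r where "r = rec_nat (p 0 0) (\<lambda>k v. p (Suc k) (Suc v))"
  have r: "strict_mono r"
    by (rule strict_mono_Suc_iff[THEN iffD2]) (simp add: r_def p(1) Suc_le_lessD)
  have "dist (s (r k)) y < 1 / real (Suc k)" for k by (cases k) (simp_all only: r_def nat.rec p(2))
  then have "(\<lambda>k. dist (s (r k)) y) \<longlonglongrightarrow> 0"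
    by (intro tendsto_sandwich[OF _ _ tendsto_const LIMSEQ_inverse_real_of_nat] always_eventually allI)
      (auto simp: less_imp_le inverse_eq_divide)
  then have "(s \<circ> r) \<longlonglongrightarrow> y" by (simp add: tendsto_dist_iff[of _ y] comp_def)
  then show "y \<in> accumulation_points s" using r by (auto simp: accumulation_points_def)
qed

lemma closed_accumulation_points: "closed (accumulation_points (s :: nat \<Rightarrow> 'y::metric_space))"
  unfolding closure_eq[symmetric]
proof (intro equalityI closure_subset subsetI)
  fix y assume y: "y \<in> closure (accumulation_points s)"
  show "y \<in> accumulation_points s"
    unfolding accumulation_points_iff
  proof (intro allI impI)
    fix e :: real and N assume e: "0 < e"
    then obtain a where a: "a \<in> accumulation_points s" "dist a y < e / 2"
      using y unfolding closure_approachable by (meson half_gt_zero)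
    then obtain n where "n \<ge> N" "dist (s n) a < e / 2"
      using a(1)[unfolded accumulation_points_iff, rule_format, of "e / 2" N] e by auto
    then show "\<exists>n\<ge>N. dist (s n) y < e"
      using dist_triangle_half_r[of a "s n" e y] a(2) by (auto simp: dist_commute intro!: exI[of _ n])
  qed
qed

text \<open>If the accumulation set were split by closed sets \<open>A\<close> and \<open>B\<close>, the slowly moving sequence
  would cross the equidistance set of the two pieces infinitely often and accumulate there.\<close>

lemma connected_accumulation_points:
  fixes s :: "nat \<Rightarrow> 'y::metric_space"
  assumes comp: "\<And>r. strict_mono r \<Longrightarrow> \<exists>q l. strict_mono (q :: nat \<Rightarrow> nat) \<and> (\<lambda>i. s (r (q i))) \<longlonglongrightarrow> l"
    and slow: "(\<lambda>n. dist (s (Suc n)) (s n)) \<longlonglongrightarrow> 0"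
  shows "connected (accumulation_points s)"
  unfolding connected_closed
proof (rule notI, elim exE conjE)
  let ?A = "accumulation_points s"
  fix A B assume AB: "closed A" "closed B" "?A \<subseteq> A \<union> B" "A \<inter> B \<inter> ?A = {}" "A \<inter> ?A \<noteq> {}" "B \<inter> ?A \<noteq> {}"
  \<comment> \<open>Negative on one piece of the accumulation set and positive on the other, so it
    has no zero there.\<close>
  define \<psi> where "\<psi> y = infdist y (A \<inter> ?A) - infdist y (B \<inter> ?A)" for y
  have clA: "closed (A \<inter> ?A)" and clB: "closed (B \<inter> ?A)" using AB closed_accumulation_points by auto
  have neg: "\<psi> y < 0" if y: "y \<in> A" "y \<in> ?A" for y
  proof -
    have "y \<notin> B \<inter> ?A" using AB(4) y by blast
    then have "0 < infdist y (B \<inter> ?A)" using infdist_pos_not_in_closed[OF clB AB(6)] by blast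
    then show ?thesis using y by (simp add: \<psi>_def)
  qed
  have pos: "0 < \<psi> y" if y: "y \<in> B" "y \<in> ?A" for y
  proof -
    have "y \<notin> A \<inter> ?A" using AB(4) y by blast
    then have "0 < infdist y (A \<inter> ?A)" using infdist_pos_not_in_closed[OF clA AB(5)] by blast
    then show ?thesis using y by (simp add: \<psi>_def)
  qed
  have \<psi>_lim: "(\<lambda>i. \<psi> (u i)) \<longlonglongrightarrow> \<psi> y" if "u \<longlonglongrightarrow> y" for u :: "nat \<Rightarrow> 'y" and y
    unfolding \<psi>_def by (intro tendsto_intros that)
  have often: "\<exists>n\<ge>N. P (\<psi> (s n))" if y: "y \<in> ?A" "P (\<psi> y)" "open {v. P v}" for y N and P :: "real \<Rightarrow> bool"
  proof -
    obtain r where r: "strict_mono r" "(s \<circ> r) \<longlonglongrightarrow> y" using y(1) by (auto simp: accumulation_points_def)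
    have "\<forall>\<^sub>F i in sequentially. \<psi> ((s \<circ> r) i) \<in> {v. P v}"
      by (rule topological_tendstoD[OF \<psi>_lim[OF r(2)] y(3)]) (use y(2) in simp)
    then obtain n0 where "\<And>i. i \<ge> n0 \<Longrightarrow> P (\<psi> (s (r i)))" by (auto simp: eventually_sequentially)
    then show ?thesis
      using seq_suble[OF r(1), of "max n0 N"] by (intro exI[of _ "r (max n0 N)"]) auto
  qed
  obtain a b where ab: "a \<in> A" "a \<in> ?A" "b \<in> B" "b \<in> ?A" using AB(5,6) by blast
  \<comment> \<open>Both signs occur arbitrarily late, hence so does a step from negative to
    nonnegative.\<close>
  have "\<exists>n\<ge>N. \<psi> (s n) < 0 \<and> 0 \<le> \<psi> (s (Suc n))" for N
  proof (rule ccontr)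
    assume no: "\<not> ?thesis"
    obtain n where n: "n \<ge> N" "\<psi> (s n) < 0" using often[OF ab(2), of "\<lambda>v. v < 0" N] neg[OF ab(1,2)] by (auto simp: open_Collect_less)
    obtain k where k: "k \<ge> n" "0 < \<psi> (s k)" using often[OF ab(4), of "\<lambda>v. 0 < v" n] pos[OF ab(3,4)] by (auto simp: open_Collect_less)
    have "\<psi> (s k) < 0" using k(1)
    proof (induction k rule: dec_induct)
      case (step m)
      then show ?case using no n(1) by (meson le_trans not_le)
    qed (rule n(2))
    then show False using k(2) by simp
  qed
  then have "infinite {n. \<psi> (s n) < 0 \<and> 0 \<le> \<psi> (s (Suc n))}" by (simp add: infinite_nat_iff_unbounded_le)
  from infinite_enumerate[OF this] obtain r :: "nat \<Rightarrow> nat" where r: "strict_mono r" "\<forall>n. r n \<in> {n. \<psi> (s n) < 0 \<and> 0 \<le> \<psi> (s (Suc n))}"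
    by blast
  obtain q l where q: "strict_mono (q :: nat \<Rightarrow> nat)" "(\<lambda>i. s (r (q i))) \<longlonglongrightarrow> l" using comp[OF r(1)] by blast
  have rq: "strict_mono (\<lambda>i. r (q i))" using strict_mono_o[OF r(1) q(1)] by (simp add: comp_def)
  have l: "l \<in> ?A" using rq q(2) by (auto simp: accumulation_points_def comp_def)
  have "(\<lambda>i. dist (s (Suc (r (q i)))) (s (r (q i)))) \<longlonglongrightarrow> 0"
    using LIMSEQ_subseq_LIMSEQ[OF slow rq] by (simp add: comp_def)
  then have "(\<lambda>i. dist (s (Suc (r (q i)))) (s (r (q i))) + dist (s (r (q i))) l) \<longlonglongrightarrow> 0 + 0"
    by (rule tendsto_add[OF _ q(2)[unfolded tendsto_dist_iff[of _ l]]])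
  then have sum0: "(\<lambda>i. dist (s (Suc (r (q i)))) (s (r (q i))) + dist (s (r (q i))) l) \<longlonglongrightarrow> 0" by simp
  have "(\<lambda>i. dist (s (Suc (r (q i)))) l) \<longlonglongrightarrow> 0"
    by (rule tendsto_sandwich[OF _ _ tendsto_const sum0]) (simp_all add: dist_triangle)
  then have "(\<lambda>i. s (Suc (r (q i)))) \<longlonglongrightarrow> l" unfolding tendsto_dist_iff[of _ l] .
  from \<psi>_lim[OF this] have "0 \<le> \<psi> l" by (rule LIMSEQ_le_const) (use r(2) in auto)
  moreover have "\<psi> l \<le> 0" by (rule LIMSEQ_le_const2[OF \<psi>_lim[OF q(2)]]) (use r(2) in \<open>auto simp: less_imp_le\<close>)
  ultimately show False using neg[of l] pos[of l] l AB(3) by fastforce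
qed

text \<open>Total boundedness of \<open>K\<close>: in every ball of a finite cover of radius
  \<open>1 / Suc n\<close> that meets \<open>S\<close>, one point of \<open>S\<close> is
  selected.\<close>

lemma dense_sequence:
  fixes K S :: "'y::metric_space set"
  assumes "seq_compact K" "S \<subseteq> K" "S \<noteq> {}"
  obtains y :: "nat \<Rightarrow> 'y" where "range y \<subseteq> S" "S \<subseteq> closure (range y)"
proof -
  have "\<exists>k. finite k \<and> k \<subseteq> K \<and> K \<subseteq> (\<Union>x\<in>k. ball x (1 / real (Suc n)))" for n
    using seq_compact_imp_totally_bounded[OF assms(1)] by simp
  then have "\<forall>n. \<exists>k. finite k \<and> K \<subseteq> (\<Union>x\<in>k. ball x (1 / real (Suc n)))" by fast
  from choice[OF this] obtain k where "\<forall>n. finite (k n) \<and> K \<subseteq> (\<Union>x\<in>k n. ball x (1 / real (Suc n)))" ..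
  then have k: "finite (k n)" "K \<subseteq> (\<Union>x\<in>k n. ball x (1 / real (Suc n)))" for n by simp_all
  define p where "p n x = (SOME v. v \<in> S \<inter> ball x (1 / real (Suc n)))" for n x
  define D where "D = (\<Union>n. p n ` {x \<in> k n. S \<inter> ball x (1 / real (Suc n)) \<noteq> {}})"
  have p: "p n x \<in> S \<inter> ball x (1 / real (Suc n))" if "S \<inter> ball x (1 / real (Suc n)) \<noteq> {}" for n x
    unfolding p_def using that by (rule some_in_eq[THEN iffD2])
  have DS: "D \<subseteq> S" using p by (auto simp: D_def)
  have "finite {x \<in> k n. S \<inter> ball x (1 / real (Suc n)) \<noteq> {}}" for n by (rule finite_subset[OF _ k(1)[of n]]) auto
  then have cD: "countable D" unfolding D_def
    by (intro countable_UN[OF countableI_type] countable_image) (rule countable_finite)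
  have dense: "S \<subseteq> closure D"
  proof
    fix v assume v: "v \<in> S"
    show "v \<in> closure D" unfolding closure_approachable
    proof (intro allI impI)
      fix e :: real assume "0 < e"
      then obtain n where n: "1 / real (Suc n) < e / 2" using nat_approx_posE[of "e / 2"] by auto
      obtain x where x: "x \<in> k n" "v \<in> ball x (1 / real (Suc n))" using k(2) v assms(2) by blast
      have ne: "S \<inter> ball x (1 / real (Suc n)) \<noteq> {}" using v x by blast
      have "dist (p n x) v < e"
        using p[OF ne] x(2) n dist_triangle[of "p n x" v x] by (simp add: dist_commute)
      moreover have "p n x \<in> D" using x(1) ne by (auto simp: D_def)
      ultimately show "\<exists>w\<in>D. dist w v < e" by blast
    qed
  qed
  then have "D \<noteq> {}" using assms(3) by auto
  from range_from_nat_into[OF this cD] show thesis using that[of "from_nat_into D"] DS dense by simp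
qed

section \<open>Pressure bounds and the accumulation set of the observed values\<close>

context compact_dynamics
begin

text \<open>Real bounds on both sides suffice, since reals are dense in the extended reals; this
  also covers infinite values of \<open>L\<close>.\<close>

lemma pressure_eqI:
  assumes "\<And>t. L < ereal t \<Longrightarrow> \<forall>\<^sub>F \<epsilon> in at_right 0. pressure_scale d T Z \<phi> \<epsilon> \<le> ereal t"
    and "\<And>s. ereal s < L \<Longrightarrow> \<forall>\<^sub>F \<epsilon> in at_right 0. ereal s \<le> pressure_scale d T Z \<phi> \<epsilon>"
  shows "pressure d T Z \<phi> = L"
  unfolding pressure_def
proof (rule tendsto_Lim)
  show "((\<lambda>\<epsilon>. pressure_scale d T Z \<phi> \<epsilon>) \<longlongrightarrow> L) (at_right 0)"
  proof (rule order_tendstoI)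
    fix a assume "a < L"
    then obtain s where s: "a < ereal s" "ereal s < L" using ereal_dense2 by blast
    from assms(2)[OF s(2)] show "\<forall>\<^sub>F \<epsilon> in at_right 0. a < pressure_scale d T Z \<phi> \<epsilon>"
      by eventually_elim (rule less_le_trans[OF s(1)])
  next
    fix a assume "L < a"
    then obtain t where t: "L < ereal t" "ereal t < a" using ereal_dense2 by blast
    from assms(1)[OF t(1)] show "\<forall>\<^sub>F \<epsilon> in at_right 0. pressure_scale d T Z \<phi> \<epsilon> < a"
      by eventually_elim (rule le_less_trans[OF _ t(2)])
  qed
qed simp

lemma pressure_scale_mono:
  assumes "Z \<subseteq> Z'" shows "pressure_scale d T Z \<phi> \<epsilon> \<le> pressure_scale d T Z' \<phi> \<epsilon>"
  unfolding pressure_scale_def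
proof (intro Inf_superset_mono image_mono subsetI CollectI)
  fix t assume "t \<in> {t. pressure_lim d T Z' t \<phi> \<epsilon> = 0}"
  then show "pressure_lim d T Z t \<phi> \<epsilon> = 0" using pressure_lim_mono[OF assms, of t \<phi> \<epsilon>] by simp
qed

context
  fixes \<Xi> :: "'a measure \<Rightarrow> 'y::{real_vector, metric_space}"
  assumes \<Xi>: "continuous_map weak_star euclidean \<Xi>"
begin

abbreviation observed :: "'a \<Rightarrow> nat \<Rightarrow> 'y" where
  "observed x n \<equiv> \<Xi> (empirical T (Suc n) x)"

lemma observed_subseq:
  assumes r: "strict_mono (r :: nat \<Rightarrow> nat)"
  obtains q \<mu> where "strict_mono q" "\<mu> \<in> invariant_measures T"
    "weak_conv (\<lambda>i. empirical T (Suc (r (q i))) x) \<mu>" "(\<lambda>i. observed x (r (q i))) \<longlonglongrightarrow> \<Xi> \<mu>"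
proof -
  obtain q \<mu> where q: "strict_mono q" "\<mu> \<in> invariant_measures T" "weak_conv (\<lambda>i. empirical T (Suc (r (q i))) x) \<mu>"
    using empirical_subseq_limit[OF r] .
  show thesis
    by (rule that[OF q weak_conv_continuous_map[OF \<Xi> empirical_prob invariantD(1)[OF q(2)] q(3)]])
qed

lemma observed_accumulation:
  assumes "y \<in> accumulation_points (observed x)"
  obtains r \<mu> where "strict_mono r" "\<mu> \<in> invariant_measures T" "weak_conv (\<lambda>i. empirical T (Suc (r i)) x) \<mu>" "\<Xi> \<mu> = y"
proof -
  obtain r where r: "strict_mono r" "(observed x \<circ> r) \<longlonglongrightarrow> y" using assms by (auto simp: accumulation_points_def)
  obtain q \<mu> where q: "strict_mono q" "\<mu> \<in> invariant_measures T"
    "weak_conv (\<lambda>i. empirical T (Suc (r (q i))) x) \<mu>" "(\<lambda>i. observed x (r (q i))) \<longlonglongrightarrow> \<Xi> \<mu>"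
    using observed_subseq[OF r(1)] .
  have "(\<lambda>i. observed x (r (q i))) \<longlonglongrightarrow> y" using LIMSEQ_subseq_LIMSEQ[OF r(2) q(1)] by (simp add: comp_def)
  then have "\<Xi> \<mu> = y" using q(4) LIMSEQ_unique by blast
  then show thesis using that[of "\<lambda>i. r (q i)" \<mu>] strict_mono_o[OF r(1) q(1)] q by (simp add: comp_def)
qed

lemma observed_accumulation_nonempty: "accumulation_points (observed x) \<noteq> {}"
proof -
  obtain q \<mu> where "strict_mono q" "(\<lambda>i. observed x (id (q i))) \<longlonglongrightarrow> \<Xi> \<mu>"
    by (rule observed_subseq[of id x]) (simp add: strict_mono_def, rule that)
  then have "\<Xi> \<mu> \<in> accumulation_points (observed x)" by (auto simp: accumulation_points_def comp_def)
  then show ?thesis by blast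
qed

lemma empirical_step:
  fixes h :: "'a \<Rightarrow> real"
  assumes h: "continuous_on UNIV h"
  shows "(\<lambda>n. (\<integral>y. h y \<partial>empirical T (Suc (Suc n)) x) - (\<integral>y. h y \<partial>empirical T (Suc n) x)) \<longlonglongrightarrow> 0"
proof -
  obtain B where B: "0 < B" "\<And>x. \<bar>h x\<bar> \<le> B" using continuous_bounded[OF h] by blast
  have "\<bar>(\<integral>y. h y \<partial>empirical T (Suc (Suc n)) x) - (\<integral>y. h y \<partial>empirical T (Suc n) x)\<bar> \<le> 2 * B / real (Suc n)" for n
  proof -
    let ?S = "birkhoff_sum T (Suc n) h x" and ?v = "h ((T ^^ Suc n) x)"
    have "(\<integral>y. h y \<partial>empirical T (Suc (Suc n)) x) = (?S + ?v) / real (Suc (Suc n))"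
      using integral_empirical_continuous[OF _ h, of "Suc (Suc n)" x] by (simp add: birkhoff_sum_def)
    moreover have E: "(\<integral>y. h y \<partial>empirical T (Suc n) x) = ?S / real (Suc n)"
      using integral_empirical_continuous[OF _ h, of "Suc n" x] by simp
    moreover have "(a + v) / (b + 1) - a / b = (v - a / b) / (b + 1)" if "0 < b" for a v b :: real
      using that by (simp add: field_simps)
    from this[of "real (Suc n)" ?S ?v] have "(?S + ?v) / real (Suc (Suc n)) - ?S / real (Suc n) = (?v - ?S / real (Suc n)) / real (Suc (Suc n))"
      by (simp add: algebra_simps)
    ultimately have eq: "(\<integral>y. h y \<partial>empirical T (Suc (Suc n)) x) - (\<integral>y. h y \<partial>empirical T (Suc n) x)
       = (?v - (\<integral>y. h y \<partial>empirical T (Suc n) x)) / real (Suc (Suc n))" by simp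
    have "\<bar>?v - (\<integral>y. h y \<partial>empirical T (Suc n) x)\<bar> \<le> 2 * B"
      using integral_abs_le[OF empirical_prob h B(2), of n x] B(2)[of "(T ^^ Suc n) x"] by linarith
    then have "\<bar>?v - (\<integral>y. h y \<partial>empirical T (Suc n) x)\<bar> / real (Suc (Suc n)) \<le> 2 * B / real (Suc n)"
      by (intro frac_le) auto
    then show ?thesis unfolding eq by (simp add: abs_divide)
  qed
  then show ?thesis
    by (intro tendsto_rabs_zero_cancel[OF tendsto_sandwich[OF _ _ tendsto_const LIMSEQ_Suc[OF lim_const_over_n[of "2 * B"]]]] always_eventually allI)
      auto
qed

text \<open>If the increments stayed large along a subsequence, a further subsequence of the
  empirical measures would converge. By \<open>empirical_step\<close> the successors converge to the
  same measure, and continuity of \<Xi> then makes the increments tend to 0 along it.\<close>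

lemma connected_observed: "connected (accumulation_points (observed x))"
proof (rule connected_accumulation_points)
  show "\<exists>q l. strict_mono (q :: nat \<Rightarrow> nat) \<and> (\<lambda>i. observed x (r (q i))) \<longlonglongrightarrow> l" if "strict_mono r" for r :: "nat \<Rightarrow> nat"
    by (rule observed_subseq[OF that]) (rule exI, rule exI, rule conjI)
  show "(\<lambda>n. dist (observed x (Suc n)) (observed x n)) \<longlonglongrightarrow> 0"
  proof (rule ccontr)
    assume "\<not> ?thesis"
    then obtain e where e: "0 < e" "\<forall>N. \<exists>n\<ge>N. e \<le> dist (observed x (Suc n)) (observed x n)"
      by (auto simp: lim_sequentially not_less)
    then have "infinite {n. e \<le> dist (observed x (Suc n)) (observed x n)}" by (simp add: infinite_nat_iff_unbounded_le)
    from infinite_enumerate[OF this] obtain r :: "nat \<Rightarrow> nat" where r: "strict_mono r" "\<forall>n. r n \<in> {n. e \<le> dist (observed x (Suc n)) (observed x n)}"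
      by blast
    obtain q \<mu> where q: "strict_mono q" "\<mu> \<in> invariant_measures T"
      "weak_conv (\<lambda>i. empirical T (Suc (r (q i))) x) \<mu>" "(\<lambda>i. observed x (r (q i))) \<longlonglongrightarrow> \<Xi> \<mu>"
      using observed_subseq[OF r(1)] .
    have rq: "strict_mono (\<lambda>i. r (q i))" using strict_mono_o[OF r(1) q(1)] by (simp add: comp_def)
    have "weak_conv (\<lambda>i. empirical T (Suc (Suc (r (q i)))) x) \<mu>"
      unfolding weak_conv_def
    proof (intro allI impI)
      fix h :: "'a \<Rightarrow> real" assume h: "continuous_on UNIV h"
      have "(\<lambda>i. (\<integral>y. h y \<partial>empirical T (Suc (Suc (r (q i)))) x) - (\<integral>y. h y \<partial>empirical T (Suc (r (q i))) x)) \<longlonglongrightarrow> 0"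
        using LIMSEQ_subseq_LIMSEQ[OF empirical_step[OF h] rq] by (simp add: comp_def)
      from tendsto_add[OF this q(3)[unfolded weak_conv_def, rule_format, OF h]]
      show "(\<lambda>i. \<integral>y. h y \<partial>empirical T (Suc (Suc (r (q i)))) x) \<longlonglongrightarrow> (\<integral>y. h y \<partial>\<mu>)" by simp
    qed
    from weak_conv_continuous_map[OF \<Xi> empirical_prob invariantD(1)[OF q(2)] this]
    have "(\<lambda>i. observed x (Suc (r (q i)))) \<longlonglongrightarrow> \<Xi> \<mu>" .
    from tendsto_dist[OF this q(4)] have "(\<lambda>i. dist (observed x (Suc (r (q i)))) (observed x (r (q i)))) \<longlonglongrightarrow> 0" by simp
    then have "e \<le> 0" by (rule LIMSEQ_le_const) (use r(2) in auto)
    then show False using e(1) by simp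
  qed
qed

lemma le_Lambda_fun:
  assumes "\<mu> \<in> invariant_measures T"
  shows "metric_entropy T \<mu> + ereal (\<integral>x. \<phi> x \<partial>\<mu>) \<le> Lambda_fun T \<Xi> \<phi> (\<Xi> \<mu>)"
  unfolding Lambda_fun_def using assms by (auto intro!: SUP_upper)

lemma less_Lambda_fun:
  assumes "a < Lambda_fun T \<Xi> \<phi> y"
  obtains \<mu> where "\<mu> \<in> invariant_measures T" "\<Xi> \<mu> = y" "a < metric_entropy T \<mu> + ereal (\<integral>x. \<phi> x \<partial>\<mu>)"
  using assms unfolding Lambda_fun_def by (auto simp: less_SUP_iff split: if_splits)

text \<open>The accumulation value \<open>y\<close> is the image of an invariant measure at which
  the empirical measures accumulate, and the entropy plus integral of that measure is at most
  \<open>Lambda_fun\<close> at \<open>y\<close>.\<close>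

lemma pressure_scale_Lambda_upper:
  fixes \<phi> :: "'a \<Rightarrow> real"
  assumes \<phi>: "continuous_on UNIV \<phi>" and L: "L < ereal t"
    and Z: "\<And>x. x \<in> Z \<Longrightarrow> \<exists>y\<in>accumulation_points (observed x). Lambda_fun T \<Xi> \<phi> y \<le> L"
  shows "\<forall>\<^sub>F \<epsilon> in at_right 0. pressure_scale d T Z \<phi> \<epsilon> \<le> ereal t"
proof -
  obtain s where s: "L < ereal s" "ereal s < ereal t" using ereal_dense2[OF L] by blast
  have "s < t" using s(2) by simp
  with \<phi> show ?thesis
  proof (rule pressure_scale_upper)
    fix x assume "x \<in> Z"
    from Z[OF this] obtain y where y: "y \<in> accumulation_points (observed x)" "Lambda_fun T \<Xi> \<phi> y \<le> L" by blast
    obtain r \<mu> where r: "strict_mono r" "\<mu> \<in> invariant_measures T" "weak_conv (\<lambda>i. empirical T (Suc (r i)) x) \<mu>" "\<Xi> \<mu> = y"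
      using observed_accumulation[OF y(1)] .
    have "metric_entropy T \<mu> + ereal (\<integral>x. \<phi> x \<partial>\<mu>) \<le> ereal s"
      using le_Lambda_fun[OF r(2), of \<phi>] y(2) s(1) unfolding r(4) by order
    then show "\<exists>\<mu> r. \<mu> \<in> invariant_measures T \<and> strict_mono (r :: nat \<Rightarrow> nat)
      \<and> weak_conv (\<lambda>i. empirical T (Suc (r i)) x) \<mu> \<and> metric_entropy T \<mu> + ereal (\<integral>x. \<phi> x \<partial>\<mu>) \<le> ereal s"
      using r by blast
  qed
qed

text \<open>Supplies, through \<open>dense_sequence\<close>, the countable dense family of values
  that the path of measures has to visit.\<close>

lemma seq_compact_image_invariant: "seq_compact (\<Xi> ` invariant_measures T)"
  unfolding seq_compact_def
proof (intro allI impI)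
  fix v :: "nat \<Rightarrow> 'y" assume "\<forall>n. v n \<in> \<Xi> ` invariant_measures T"
  then have v: "v n \<in> \<Xi> ` invariant_measures T" for n by blast
  define M where "M n = inv_into (invariant_measures T) \<Xi> (v n)" for n
  have M: "M n \<in> invariant_measures T" "v n = \<Xi> (M n)" for n
    using inv_into_into[OF v] f_inv_into_f[OF v] by (simp_all add: M_def)
  obtain r \<mu> where r: "strict_mono r" "\<mu> \<in> invariant_measures T" "weak_conv (M \<circ> r) \<mu>"
    using invariant_seq_compact[OF M(1)] .
  have "(\<lambda>n. \<Xi> ((M \<circ> r) n)) \<longlonglongrightarrow> \<Xi> \<mu>"
    using invariantD(1)[OF M(1)] by (intro weak_conv_continuous_map[OF \<Xi> _ invariantD(1)[OF r(2)] r(3)]) simp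
  then show "\<exists>l\<in>\<Xi> ` invariant_measures T. \<exists>r. strict_mono r \<and> (v \<circ> r) \<longlonglongrightarrow> l"
    using r by (intro bexI[of _ "\<Xi> \<mu>"] exI[of _ r]) (auto simp: comp_def M(2))
qed

end

end

section \<open>Lower bounds for the pressure\<close>

context almost_product_system
begin

text \<open>The path \<open>\<nu>\<close> runs through affine segments between consecutive elements of a sequence that visits
  every member of a dense family \<open>\<mu> i\<close> infinitely often; the \<open>l\<close>-th segment has \<open>2 * l + 1\<close> steps.\<close>

lemma pressure_scale_lower:
  fixes \<Xi> :: "'a measure \<Rightarrow> 'y::{real_vector, metric_space}" and \<phi> :: "'a \<Rightarrow> real"
  assumes \<Xi>: "continuous_map weak_star euclidean \<Xi>" and affine: "affine_on_measures \<Xi>"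
    and sep: "uniform_separation_property (rho_dist f) T" and \<phi>: "continuous_on UNIV \<phi>"
    and S1: "S1 \<noteq> {}" "S1 \<subseteq> \<Xi> ` invariant_measures T" and S2: "closure (convex hull S1) \<subseteq> S2"
    and L: "ereal s < (INF y\<in>S1. Lambda_fun T \<Xi> \<phi> y)"
  shows "\<forall>\<^sub>F \<epsilon> in at_right 0. ereal s \<le> pressure_scale d T (Delta_set T \<Xi> S1 S2) \<phi> \<epsilon>"
proof -
  obtain s' where s': "ereal s < ereal s'" "ereal s' < (INF y\<in>S1. Lambda_fun T \<Xi> \<phi> y)" using ereal_dense2[OF L] by blast
  \<comment> \<open>One half of the gap is lost between entropies and good rates, the other half is
    the surplus consumed by the Moran construction.\<close>
  define \<eta> where "\<eta> = (s' - s) / 2"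
  have \<eta>: "0 < \<eta>" "s' - \<eta> = s + \<eta>" using s'(1) by (simp_all add: \<eta>_def field_simps)
  obtain y :: "nat \<Rightarrow> 'y" where y: "range y \<subseteq> S1" "S1 \<subseteq> closure (range y)"
    using dense_sequence[OF seq_compact_image_invariant[OF \<Xi>] S1(2,1)] .
  have "\<exists>\<mu>. \<mu> \<in> invariant_measures T \<and> \<Xi> \<mu> = y i \<and> ereal s' < metric_entropy T \<mu> + ereal (\<integral>x. \<phi> x \<partial>\<mu>)" for i
  proof -
    have "(INF y\<in>S1. Lambda_fun T \<Xi> \<phi> y) \<le> Lambda_fun T \<Xi> \<phi> (y i)" by (rule INF_lower) (use y(1) in blast)
    with s'(2) have "ereal s' < Lambda_fun T \<Xi> \<phi> (y i)" by (rule less_le_trans)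
    from less_Lambda_fun[OF \<Xi> this] show ?thesis by blast
  qed
  then have "\<forall>i. \<exists>\<mu>. \<mu> \<in> invariant_measures T \<and> \<Xi> \<mu> = y i \<and> ereal s' < metric_entropy T \<mu> + ereal (\<integral>x. \<phi> x \<partial>\<mu>)" by (rule allI)
  from choice[OF this] obtain \<mu> where "\<forall>i. \<mu> i \<in> invariant_measures T \<and> \<Xi> (\<mu> i) = y i \<and>
    ereal s' < metric_entropy T (\<mu> i) + ereal (\<integral>x. \<phi> x \<partial>\<mu> i)" ..
  then have \<mu>: "\<mu> i \<in> invariant_measures T" "\<Xi> (\<mu> i) = y i" "ereal s' < metric_entropy T (\<mu> i) + ereal (\<integral>x. \<phi> x \<partial>\<mu> i)" for i
    by simp_all
  obtain \<epsilon>0 where \<epsilon>0: "0 < \<epsilon>0" "\<forall>\<mu> c. \<mu> \<in> invariant_measures T \<longrightarrow> ereal (c + \<eta>) < metric_entropy T \<mu> \<longrightarrow> good \<epsilon>0 \<mu> c"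
    using good_invariant[OF sep \<eta>(1)] .
  \<comment> \<open>Each rate complements the integral of \<phi> to the same constant, so the sum of
    rate and integral stays constant along affine segments.\<close>
  define c where "c i = s' - \<eta> - (\<integral>x. \<phi> x \<partial>\<mu> i)" for i
  have good: "good \<epsilon>0 (\<mu> i) (c i)" for i
  proof -
    have "ereal (c i + \<eta>) < metric_entropy T (\<mu> i)"
      using \<mu>(3)[of i] by (cases "metric_entropy T (\<mu> i)") (auto simp: c_def)
    then show ?thesis using \<epsilon>0(2) \<mu>(1) by blast
  qed
  \<comment> \<open>The first component of the inverse pairing function takes every value infinitely
    often.\<close>
  define e where "e l = fst (prod_decode l)" for l
  have "strict_mono (\<lambda>l::nat. l * l)" by (rule strict_mono_Suc_iff[THEN iffD2]) simp
  then obtain q :: "nat \<Rightarrow> nat" where q: "\<forall>n. q n * q n \<le> n \<and> n < Suc (q n) * Suc (q n)"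
    "\<forall>n k. k * k \<le> n \<longrightarrow> n < Suc k * Suc k \<longrightarrow> q n = k" "\<forall>k. q (k * k) = k" "mono q"
    using strict_mono_bracket[of "\<lambda>l. l * l"] by auto
  have q_top: "filterlim q at_top sequentially"
    unfolding filterlim_at_top
  proof
    fix K
    have "\<forall>n\<ge>K * K. K \<le> q n" using monoD[OF q(4)] q(3) by metis
    then show "\<forall>\<^sub>F n in sequentially. K \<le> q n" unfolding eventually_sequentially by blast
  qed
  \<comment> \<open>Segment \<open>l\<close> occupies the indices from the square of
    \<open>l\<close> up to the next square; \<open>u k\<close> is the part of the current segment
    already traversed.\<close>
  define u where "u k = (real k - real (q k * q k)) / real (2 * q k + 1)" for k
  have u: "0 \<le> u k" "u k < 1" for k
  proof -
    have "real (q k * q k) \<le> real k" using q(1) by (simp only: of_nat_le_iff)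
    then show "0 \<le> u k" by (simp add: u_def)
    have "real k < real (Suc (q k) * Suc (q k))" using q(1) by (simp only: of_nat_less_iff)
    then show "u k < 1" by (simp add: u_def field_simps)
  qed
  \<comment> \<open>Nodes are treated apart because \<open>good_mix\<close> concerns proper
    mixtures; at a node the path is the measure \<open>\<mu> (e (q k))\<close> itself.\<close>
  define \<nu> where "\<nu> k = (if u k = 0 then \<mu> (e (q k)) else mix (1 - u k) (\<mu> (e (q k))) (\<mu> (e (Suc (q k)))))" for k
  have \<nu>i: "\<nu> k \<in> invariant_measures T" for k
    using u[of k] by (auto simp: \<nu>_def intro!: \<mu>(1) mix_invariant)
  define C where "C k = (1 - u k) * c (e (q k)) + u k * c (e (Suc (q k)))" for k
  have \<nu>g: "good \<epsilon>0 (\<nu> k) (C k)" for k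
    using good_mix[OF good good invariantD(1)[OF \<mu>(1)] invariantD(1)[OF \<mu>(1)] _ _ \<epsilon>0(1), of "1 - u k" "e (q k)" "e (Suc (q k))"]
      u[of k] good by (auto simp: \<nu>_def C_def)
  have I: "(\<integral>x. h x \<partial>\<nu> k) = (1 - u k) * (\<integral>x. h x \<partial>\<mu> (e (q k))) + u k * (\<integral>x. h x \<partial>\<mu> (e (Suc (q k))))"
    if "continuous_on UNIV h" for h :: "'a \<Rightarrow> real" and k
    using integral_mix_continuous[OF invariantD(1)[OF \<mu>(1)] invariantD(1)[OF \<mu>(1)] _ _ that, of "1 - u k" "e (q k)" "e (Suc (q k))"]
      u[of k] by (auto simp: \<nu>_def)
  have gap: "s + \<eta> \<le> C k + (\<integral>x. \<phi> x \<partial>\<nu> k)" for k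
  proof -
    have "C k + (\<integral>x. \<phi> x \<partial>\<nu> k) = s' - \<eta>" unfolding I[OF \<phi>] C_def c_def by (simp add: algebra_simps)
    then show ?thesis using \<eta>(2) by simp
  qed
  have slow: "(\<lambda>k. (\<integral>x. h x \<partial>\<nu> (Suc k)) - (\<integral>x. h x \<partial>\<nu> k)) \<longlonglongrightarrow> 0" if h: "continuous_on UNIV h" for h :: "'a \<Rightarrow> real"
  proof -
    obtain B where B: "0 < B" "\<And>x. \<bar>h x\<bar> \<le> B" using continuous_bounded[OF h] by blast
    define A where "A l = (\<integral>x. h x \<partial>\<mu> (e l))" for l
    have A: "\<bar>A l\<bar> \<le> B" for l unfolding A_def by (rule integral_abs_le[OF invariantD(1)[OF \<mu>(1)] h B(2)])
    have step: "\<bar>(\<integral>x. h x \<partial>\<nu> (Suc k)) - (\<integral>x. h x \<partial>\<nu> k)\<bar> \<le> 2 * B / real (Suc (q k))" for k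
    proof -
      have Ik: "(\<integral>x. h x \<partial>\<nu> k) = (1 - u k) * A (q k) + u k * A (Suc (q k))" for k using I[OF h] by (simp add: A_def)
      have "(\<integral>x. h x \<partial>\<nu> (Suc k)) - (\<integral>x. h x \<partial>\<nu> k) = (A (Suc (q k)) - A (q k)) / real (2 * q k + 1)"
      proof (cases "Suc k < Suc (q k) * Suc (q k)")
        case True
        have "q k * q k \<le> Suc k" using q(1)[rule_format, of k] by linarith
        then have "q (Suc k) = q k" using q(2) True by blast
        then have "u (Suc k) = u k + 1 / real (2 * q k + 1)" by (simp add: u_def add_divide_distrib[symmetric] algebra_simps)
        then show ?thesis unfolding Ik \<open>q (Suc k) = q k\<close> by (simp add: algebra_simps diff_divide_distrib)
      next
        case False
        \<comment> \<open>The last step of a segment arrives at the next node. It too advances by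
          \<open>1 / (2 * q k + 1)\<close> of the segment.\<close>
        then have k: "Suc k = Suc (q k) * Suc (q k)" using q(1)[rule_format, of k] by linarith
        then have qk: "q (Suc k) = Suc (q k)" using q(3) by metis
        have "u (Suc k) = 0" unfolding u_def qk using k by simp
        moreover have "real k = real (q k * q k) + 2 * real (q k)"
        proof -
          have "k = q k * q k + 2 * q k" using k by simp
          then have "real k = real (q k * q k + 2 * q k)" by (rule arg_cong)
          then show ?thesis by simp
        qed
        then have "1 - u k = 1 / real (2 * q k + 1)" unfolding u_def by (simp add: field_simps)
        then have "u k = 1 - 1 / real (2 * q k + 1)" by linarith
        ultimately show ?thesis unfolding Ik qk by (simp add: left_diff_distrib diff_divide_distrib)
      qed
      then have "\<bar>(\<integral>x. h x \<partial>\<nu> (Suc k)) - (\<integral>x. h x \<partial>\<nu> k)\<bar> = \<bar>A (Suc (q k)) - A (q k)\<bar> / real (2 * q k + 1)" by (simp add: abs_divide)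
      also have "\<dots> \<le> 2 * B / real (Suc (q k))"
        using A[of "Suc (q k)"] A[of "q k"] B(1) by (intro frac_le) auto
      finally show ?thesis .
    qed
    have lim: "(\<lambda>k. 2 * B / real (Suc (q k))) \<longlonglongrightarrow> 0"
      using filterlim_compose[OF LIMSEQ_Suc[OF lim_const_over_n[of "2 * B"]] q_top] by simp
    show ?thesis
      by (rule tendsto_rabs_zero_cancel, rule tendsto_sandwich[OF _ _ tendsto_const lim])
        (simp, rule always_eventually, rule allI, rule step)
  qed
  obtain Z \<sigma> r where r: "strict_mono (r :: nat \<Rightarrow> nat)" "\<forall>k. \<sigma> (r k) = Suc k" "filterlim \<sigma> at_top sequentially"
    and Z: "\<forall>z\<in>Z. \<forall>h :: 'a \<Rightarrow> real. continuous_on UNIV h \<longrightarrow>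
       (\<lambda>n. (\<integral>x. h x \<partial>empirical T (Suc n) z) - (\<integral>x. h x \<partial>\<nu> (\<sigma> n))) \<longlonglongrightarrow> 0"
    and press: "\<forall>\<^sub>F \<epsilon> in at_right 0. ereal s \<le> pressure_scale d T Z \<phi> \<epsilon>"
    by (rule moran_construction[OF \<epsilon>0(1) invariantD(1)[OF \<nu>i] \<nu>g \<phi> \<eta>(1) gap slow]) (assumption, rule that)
  have hull: "\<Xi> (\<nu> k) \<in> convex hull S1" for k
  proof -
    have yS: "y i \<in> convex hull S1" for i using y(1) by (intro hull_inc) blast
    have "\<Xi> (mix (1 - u k) (\<mu> a) (\<mu> b)) = (1 - u k) *\<^sub>R y a + (1 - (1 - u k)) *\<^sub>R y b" for a b
      using affine[unfolded affine_on_measures_def, rule_format, OF invariantD(1)[OF \<mu>(1)] invariantD(1)[OF \<mu>(1)], of "1 - u k" a b]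
        u[of k] by (simp only: \<mu>(2)) auto
    then show ?thesis
      using u[of k] yS convexD[OF convex_convex_hull yS yS, of "1 - u k" "u k"] by (auto simp: \<nu>_def \<mu>(2))
  qed
  have "Z \<subseteq> Delta_set T \<Xi> S1 S2"
  proof
    fix z assume z: "z \<in> Z"
    let ?A = "accumulation_points (\<lambda>n. \<Xi> (empirical T (Suc n) z))"
    note conv = Z[rule_format, OF z]
    have "y i \<in> ?A" for i
    proof -
      \<comment> \<open>Numbers of segments that start at \<open>\<mu> i\<close>; they tend to
        infinity with \<open>t\<close>.\<close>
      define p where "p t = prod_encode (i, Suc t)" for t
      have p: "Suc t \<le> p t" for t unfolding p_def by (rule le_prod_encode_2)
      \<comment> \<open>At this index \<sigma> equals the square of \<open>p t\<close>, a node of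
        the path. The subtraction of 1 matches \<open>\<sigma> (r k) = Suc k\<close>.\<close>
      define n where "n t = r (p t * p t - 1)" for t
      have nt: "t \<le> n t" for t
      proof -
        have "p t * 1 \<le> p t * p t" using p[of t] by (intro mult_le_mono) auto
        then have "t \<le> p t * p t - 1" using p[of t] by linarith
        also have "\<dots> \<le> n t" unfolding n_def by (rule seq_suble[OF r(1)])
        finally show ?thesis .
      qed
      have n_top: "filterlim n at_top sequentially"
        by (rule filterlim_at_top_mono[OF filterlim_ident]) (simp add: nt)
      have \<nu>n: "\<nu> (\<sigma> (n t)) = \<mu> i" for t
      proof -
        have "0 < p t * p t" using p[of t] by simp
        then have "\<sigma> (n t) = p t * p t" using r(2) by (simp add: n_def)
        moreover have "u (p t * p t) = 0" using q(3) by (simp add: u_def)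
        ultimately show ?thesis using q(3) by (simp add: \<nu>_def e_def p_def)
      qed
      have "weak_conv (\<lambda>t. empirical T (Suc (n t)) z) (\<mu> i)"
        unfolding weak_conv_def
      proof (intro allI impI)
        fix h :: "'a \<Rightarrow> real" assume h: "continuous_on UNIV h"
        from filterlim_compose[OF conv[OF h] n_top]
        have "(\<lambda>t. (\<integral>x. h x \<partial>empirical T (Suc (n t)) z) - (\<integral>x. h x \<partial>\<mu> i)) \<longlonglongrightarrow> 0" by (simp only: \<nu>n)
        then show "(\<lambda>t. \<integral>x. h x \<partial>empirical T (Suc (n t)) z) \<longlonglongrightarrow> (\<integral>x. h x \<partial>\<mu> i)" by (rule LIM_zero_cancel)
      qed
      from weak_conv_continuous_map[OF \<Xi> empirical_prob invariantD(1)[OF \<mu>(1)] this]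
      have lim: "(\<lambda>t. \<Xi> (empirical T (Suc (n t)) z)) \<longlonglongrightarrow> y i" by (simp add: \<mu>(2))
      show ?thesis unfolding accumulation_points_iff
      proof (intro allI impI)
        fix \<delta> :: real and N assume "0 < \<delta>"
        then obtain t0 where t0: "\<And>t. t \<ge> t0 \<Longrightarrow> dist (\<Xi> (empirical T (Suc (n t)) z)) (y i) < \<delta>"
          using lim by (auto simp: lim_sequentially)
        have "N \<le> n (max t0 N)" using nt[of "max t0 N"] by simp
        then show "\<exists>n\<ge>N. dist (\<Xi> (empirical T (Suc n) z)) (y i) < \<delta>" using t0[of "max t0 N"] by auto
      qed
    qed
    then have "closure (range y) \<subseteq> ?A" by (intro closure_minimal closed_accumulation_points) auto
    then have 1: "S1 \<subseteq> ?A" using y(2) by blast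
    have 2: "?A \<subseteq> S2"
    proof
      fix v assume "v \<in> ?A"
      then obtain r' \<mu>' where r': "strict_mono r'" "\<mu>' \<in> invariant_measures T"
        "weak_conv (\<lambda>i. empirical T (Suc (r' i)) z) \<mu>'" "\<Xi> \<mu>' = v"
        by (rule observed_accumulation[OF \<Xi>]) (rule that)
      have "weak_conv (\<lambda>i. \<nu> (\<sigma> (r' i))) \<mu>'"
        unfolding weak_conv_def
      proof (intro allI impI)
        fix h :: "'a \<Rightarrow> real" assume h: "continuous_on UNIV h"
        have "(\<lambda>i. (\<integral>x. h x \<partial>empirical T (Suc (r' i)) z) - (\<integral>x. h x \<partial>\<nu> (\<sigma> (r' i)))) \<longlonglongrightarrow> 0"
          using LIMSEQ_subseq_LIMSEQ[OF conv[OF h] r'(1)] by (simp add: comp_def)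
        from tendsto_diff[OF r'(3)[unfolded weak_conv_def, rule_format, OF h] this]
        show "(\<lambda>i. \<integral>x. h x \<partial>\<nu> (\<sigma> (r' i))) \<longlonglongrightarrow> (\<integral>x. h x \<partial>\<mu>')" by simp
      qed
      from weak_conv_continuous_map[OF \<Xi> invariantD(1)[OF \<nu>i] invariantD(1)[OF r'(2)] this]
      have "(\<lambda>i. \<Xi> (\<nu> (\<sigma> (r' i)))) \<longlonglongrightarrow> v" by (simp add: r'(4))
      then have "v \<in> closure (convex hull S1)"
        unfolding closure_sequential by (intro exI[of _ "\<lambda>i. \<Xi> (\<nu> (\<sigma> (r' i)))"] conjI allI hull)
      then show "v \<in> S2" using S2 by blast
    qed
    from 1 2 show "z \<in> Delta_set T \<Xi> S1 S2" by (simp add: Delta_set_def)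
  qed
  from pressure_scale_mono[OF this] press show ?thesis
    by (elim eventually_mono) (rule order_trans)
qed

end

section \<open>Assembly of the three claims\<close>

theorem theorem1p4:
  fixes T :: "'a::metric_space \<Rightarrow> 'a"
    and f :: "nat \<Rightarrow> ('a \<Rightarrow>\<^sub>C real)"
    and g :: "nat \<Rightarrow> nat"
    and \<Xi> :: "'a measure \<Rightarrow> 'y::{real_vector, metric_space}"
    and \<phi> :: "'a \<Rightarrow> real"
    and S1 S2 :: "'y set"
  assumes "compact (UNIV :: 'a set)"
    and "continuous_on UNIV T"
    and "dense_in_C01 f"
    and "linearly_compatible TYPE('y)"
    and "continuous_map weak_star euclidean \<Xi>"
    and "affine_on_measures \<Xi>"
    and "blowup_function g"
    and "almost_product_property (rho_dist f) T g"
    and "uniform_separation_property (rho_dist f) T"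
    and "continuous_on UNIV \<phi>"
    and "S1 \<subseteq> \<Xi> ` invariant_measures T"
  shows "(S1 = {} \<longrightarrow>
            pressure (rho_dist f) T (Delta_set T \<Xi> S1 S2) \<phi> = (SUP y\<in>S2. Lambda_fun T \<Xi> \<phi> y)) \<and>
         (S1 \<noteq> {} \<and> (\<exists>C\<in>components S2. closure (convex hull S1) \<subseteq> C) \<longrightarrow>
            pressure (rho_dist f) T (Delta_set T \<Xi> S1 S2) \<phi> = (INF y\<in>S1. Lambda_fun T \<Xi> \<phi> y)) \<and>
         (S1 \<noteq> {} \<and> \<not> (\<exists>C\<in>components S2. S1 \<subseteq> C) \<longrightarrow> Delta_set T \<Xi> S1 S2 = {})"
proof -
  interpret almost_product_system T f g
    by unfold_locales (fact assms)+
  note \<Xi> = assms(5) and \<phi> = assms(10)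
  show ?thesis
    unfolding d_def[symmetric]
  proof (intro conjI impI; (elim conjE bexE)?)
    assume S1: "S1 = {}"
    show "pressure d T (Delta_set T \<Xi> S1 S2) \<phi> = (SUP y\<in>S2. Lambda_fun T \<Xi> \<phi> y)"
    proof (rule pressure_eqI)
      fix t assume "(SUP y\<in>S2. Lambda_fun T \<Xi> \<phi> y) < ereal t"
      then show "\<forall>\<^sub>F \<epsilon> in at_right 0. pressure_scale d T (Delta_set T \<Xi> S1 S2) \<phi> \<epsilon> \<le> ereal t"
      proof (rule pressure_scale_Lambda_upper[OF \<Xi> \<phi>])
        fix x assume x: "x \<in> Delta_set T \<Xi> S1 S2"
        obtain y where y: "y \<in> accumulation_points (\<lambda>n. \<Xi> (empirical T (Suc n) x))"
          using observed_accumulation_nonempty[OF \<Xi>, of x] by blast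
        moreover have "y \<in> S2" using x y by (auto simp: Delta_set_def)
        ultimately show "\<exists>y\<in>accumulation_points (\<lambda>n. \<Xi> (empirical T (Suc n) x)). Lambda_fun T \<Xi> \<phi> y \<le> (SUP y\<in>S2. Lambda_fun T \<Xi> \<phi> y)"
          by (blast intro: SUP_upper)
      qed
    next
      \<comment> \<open>A value \<open>y\<close> in \<open>S2\<close> with large
        \<open>Lambda_fun\<close> is prescribed as an accumulation point. This shrinks the set of
        points, and the closed convex hull of a singleton stays inside \<open>S2\<close>.\<close>
      fix s assume "ereal s < (SUP y\<in>S2. Lambda_fun T \<Xi> \<phi> y)"
      then obtain y where y: "y \<in> S2" "ereal s < Lambda_fun T \<Xi> \<phi> y" by (auto simp: less_SUP_iff)
      then have "y \<in> \<Xi> ` invariant_measures T" by (auto simp: Lambda_fun_def split: if_splits)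
      then have "\<forall>\<^sub>F \<epsilon> in at_right 0. ereal s \<le> pressure_scale d T (Delta_set T \<Xi> {y} S2) \<phi> \<epsilon>"
        using y by (intro pressure_scale_lower[OF \<Xi> assms(6,9) \<phi>]) auto
      then show "\<forall>\<^sub>F \<epsilon> in at_right 0. ereal s \<le> pressure_scale d T (Delta_set T \<Xi> S1 S2) \<phi> \<epsilon>"
        by (rule eventually_mono) (erule order_trans, rule pressure_scale_mono, auto simp: S1 Delta_set_def)
    qed
  next
    fix C assume S1: "S1 \<noteq> {}" and C: "C \<in> components S2" "closure (convex hull S1) \<subseteq> C"
    show "pressure d T (Delta_set T \<Xi> S1 S2) \<phi> = (INF y\<in>S1. Lambda_fun T \<Xi> \<phi> y)"
    proof (rule pressure_eqI)
      fix t assume "(INF y\<in>S1. Lambda_fun T \<Xi> \<phi> y) < ereal t"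
      then obtain y where y: "y \<in> S1" "Lambda_fun T \<Xi> \<phi> y < ereal t" by (auto simp: INF_less_iff)
      show "\<forall>\<^sub>F \<epsilon> in at_right 0. pressure_scale d T (Delta_set T \<Xi> S1 S2) \<phi> \<epsilon> \<le> ereal t"
        by (rule pressure_scale_Lambda_upper[OF \<Xi> \<phi> y(2)]) (use y(1) in \<open>auto simp: Delta_set_def\<close>)
    next
      fix s assume "ereal s < (INF y\<in>S1. Lambda_fun T \<Xi> \<phi> y)"
      moreover have "closure (convex hull S1) \<subseteq> S2" using C in_components_subset by blast
      ultimately show "\<forall>\<^sub>F \<epsilon> in at_right 0. ereal s \<le> pressure_scale d T (Delta_set T \<Xi> S1 S2) \<phi> \<epsilon>"
        by (intro pressure_scale_lower[OF \<Xi> assms(6,9) \<phi> S1 assms(11)])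
    qed
  next
    assume S1: "S1 \<noteq> {}" and no: "\<not> (\<exists>C\<in>components S2. S1 \<subseteq> C)"
    show "Delta_set T \<Xi> S1 S2 = {}"
    proof (rule equals0I)
      fix x assume "x \<in> Delta_set T \<Xi> S1 S2"
      then have x: "S1 \<subseteq> accumulation_points (\<lambda>n. \<Xi> (empirical T (Suc n) x))"
        "accumulation_points (\<lambda>n. \<Xi> (empirical T (Suc n) x)) \<subseteq> S2" by (auto simp: Delta_set_def)
      have "S2 \<noteq> {}" using S1 x by blast
      \<comment> \<open>The accumulation set is connected and contained in \<open>S2\<close>, so a
        single component contains it together with \<open>S1\<close>.\<close>
      then obtain C where "C \<in> components S2" "accumulation_points (\<lambda>n. \<Xi> (empirical T (Suc n) x)) \<subseteq> C"
        using exists_component_superset[OF x(2) _ connected_observed[OF \<Xi>]] by blast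
      then show False using no x(1) by blast
    qed
  qed
qed

end
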